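(* Let $\mathcal{A}$ be a plus-one generated arrangement of lines in $\mathbb{P}^2=\mathbb{P}^2(\mathbb{C})$ of exponents $(a,b)$ and level $d$ with $d>b$, and let $l_0^{\mathcal{A}}\subset\mathbb{P}^2$ be its distinguished line (defined in the context). (1) Assume $l_0^{\mathcal{A}}\notin\mathcal{A}$. Then the following are equivalent: (a) $\mathcal{A}$ is NT-free; (b) $\mathcal{A}$ is NT-free minus; (c) $d=|\mathcal{A}|-|\mathcal{A}\cap l_0^{\mathcal{A}}|$; (d) $\mathcal{A}\cup\{l_0^{\mathcal{A}}\}$ is free. (2) Assume $l_0^{\mathcal{A}}\in\mathcal{A}$. Then the following are equivalent: (a) $\mathcal{A}$ is NT-free; (b) $\mathcal{A}$ is NT-free plus; (c) $d+1=|\mathcal{A}\cap l_0^{\mathcal{A}}|$; (d) $\mathcal{A}\setminus\{l_0^{\mathcal{A}}\}$ is free.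
   Context: An arrangement $\mathcal{A}$ is a finite set of $n=|\mathcal{A}|$ distinct lines in $\mathbb{P}^2=\mathbb{P}^2(\mathbb{C})$, with defining polynomial $f_{\mathcal{A}}=\prod_{H\in\mathcal{A}}\alpha_H$, where $\alpha_H\in\mathbb{C}[x,y,z]$ is a linear form defining $H$. The vector bundle associated to $\mathcal{A}$ is the rank $2$ vector bundle $\mathcal{T}_{\mathcal{A}}=\ker\big(\nabla f_{\mathcal{A}}:\mathcal{O}_{\mathbb{P}^2}^3\to\mathcal{O}_{\mathbb{P}^2}(n-1)\big)$, where $\nabla f_{\mathcal{A}}=[\partial_x f_{\mathcal{A}}\ \partial_y f_{\mathcal{A}}\ \partial_z f_{\mathcal{A}}]$. $\mathcal{A}$ is free with exponents $(a,b)$, $a,b\in\mathbb{N}$, if $\mathcal{T}_{\mathcal{A}}\cong\mathcal{O}_{\mathbb{P}^2}(-a)\oplus\mathcal{O}_{\mathbb{P}^2}(-b)$. $\mathcal{A}$ is plus-one generated of exponents $(a,b)$ and level $d$, where $a\le b\le d$, if there is an exact sequence $$0\to\mathcal{O}_{\mathbb{P}^2}(-1-d)\to\mathcal{O}_{\mathbb{P}^2}(-d)\oplus\mathcal{O}_{\mathbb{P}^2}(-b)\oplus\mathcal{O}_{\mathbb{P}^2}(-a)\to\mathcal{T}_{\mathcal{A}}\to0.$$ $\mathcal{A}$ is NT-free minus if it is obtained by deleting a line from a free arrangement (i.e. there is a line $H\notin\mathcal{A}$ with $\mathcal{A}\cup\{H\}$ free). $\mathcal{A}$ is NT-free plus if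 it is obtained by adding a line to a free arrangement (i.e. there is $H\in\mathcal{A}$ with $\mathcal{A}\setminus\{H\}$ free). $\mathcal{A}$ is NT-free (next to free) if it is NT-free minus or NT-free plus. For $\mathcal{A}$ plus-one generated of exponents $(a,b)$ and level $d>b$, $l_0^{\mathcal{A}}$ denotes the unique line $l\subset\mathbb{P}^2$ such that $\mathcal{T}_{\mathcal{A}}\otimes\mathcal{O}_l\cong\mathcal{O}_l(-d)\oplus\mathcal{O}_l(d+1-a-b)$; equivalently, it is the line whose equation is the linear form that is the $\mathcal{O}_{\mathbb{P}^2}(-1-d)\to\mathcal{O}_{\mathbb{P}^2}(-d)$ component of the first map in the resolution above. For a line $l$, $|\mathcal{A}\cap l|$ is the number of distinct points of $l$ at which $l$ meets the lines of $\mathcal{A}$ different from $l$. *)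

theory Defs
  imports "HOL-Analysis.Analysis"
begin

text \<open>
  The projective plane is described through its punctured affine cone: a subset of
  \<open>P\<^sup>2(C)\<close> is given by the scaling-invariant set of nonzero vectors of \<open>C\<^sup>3\<close> lying over it, and a
  line of \<open>P\<^sup>2(C)\<close> by the two-dimensional linear subspace of \<open>C\<^sup>3\<close> over it (so it contains \<open>0\<close>,
  which never belongs to an open set).
\<close>

type_synonym vec3 = "complex ^ 3"

text \<open>Homogeneous polynomials are identified with the functions they induce, \<open>C\<close> being infinite.\<close>

definition form :: "nat \<Rightarrow> (vec3 \<Rightarrow> complex) \<Rightarrow> bool" where
  "form k F \<longleftrightarrow> (\<exists>c :: nat \<Rightarrow> nat \<Rightarrow> complex. \<forall>v.
     F v = (\<Sum>i\<le>k. \<Sum>j\<le>k - i. c i j * (v $ 1) ^ i * (v $ 2) ^ j * (v $ 3) ^ (k - i - j)))"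

definition zopen :: "vec3 set \<Rightarrow> bool" where
  "zopen U \<longleftrightarrow> (\<exists>\<F>. (\<forall>F\<in>\<F>. \<exists>k. form k F) \<and> U = {v. v \<noteq> 0 \<and> (\<exists>F\<in>\<F>. F v \<noteq> 0)})"

definition locally_on :: "vec3 set \<Rightarrow> (vec3 set \<Rightarrow> bool) \<Rightarrow> bool" where
  "locally_on U Q \<longleftrightarrow> (\<forall>p\<in>U. \<exists>V. zopen V \<and> p \<in> V \<and> V \<subseteq> U \<and> Q V)"

text \<open>
  Sections over \<open>U\<close> of the twisting sheaf \<open>O\<^sub>X(k)\<close>, where \<open>X\<close> is a closed subvariety of the plane
  (\<open>X = UNIV\<close> for the plane itself): functions on the cone over \<open>U \<inter> X\<close> which are locally a
  quotient of two forms whose degrees differ by \<open>k\<close>. Sections are extended by \<open>0\<close> outside their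
  domain, so that equality of sections is equality of functions. For \<open>X\<close> a proper subvariety this
  is the direct image of \<open>O\<^sub>X(k)\<close> on the plane.
\<close>

definition regular :: "vec3 set \<Rightarrow> int \<Rightarrow> vec3 set \<Rightarrow> (vec3 \<Rightarrow> complex) set" where
  "regular X k U = {s. (\<forall>v. v \<notin> U \<inter> X \<longrightarrow> s v = 0) \<and>
     locally_on U (\<lambda>V. \<exists>m m' F G. form m F \<and> form m' G \<and> int m = int m' + k \<and>
       (\<forall>v\<in>V \<inter> X. G v \<noteq> 0 \<and> s v = F v / G v))}"

abbreviation structure_sheaf :: "vec3 set \<Rightarrow> (vec3 \<Rightarrow> complex) set" where
  "structure_sheaf \<equiv> regular UNIV 0"

text \<open>
  Every sheaf of modules over the structure sheaf of the plane needed here has vector-valued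
  functions as sections, with the pointwise module structure. The sheaf
  \<open>twist X k\<close> is \<open>O\<^sub>X(k\<^sub>1) \<oplus> \<dots> \<oplus> O\<^sub>X(k\<^sub>n)\<close>.
\<close>

type_synonym 'n msheaf = "vec3 set \<Rightarrow> (vec3 \<Rightarrow> complex ^ 'n) set"

definition twist :: "vec3 set \<Rightarrow> int ^ 'n \<Rightarrow> ('n::finite) msheaf" where
  "twist X k U = {s. \<forall>i. (\<lambda>v. s v $ i) \<in> regular X (k $ i) U}"

definition restr :: "vec3 set \<Rightarrow> (vec3 \<Rightarrow> complex ^ 'n) \<Rightarrow> vec3 \<Rightarrow> complex ^ 'n" where
  "restr V s = (\<lambda>v. if v \<in> V then s v else 0)"

type_synonym ('m, 'n) smap =
  "vec3 set \<Rightarrow> (vec3 \<Rightarrow> complex ^ 'm) \<Rightarrow> (vec3 \<Rightarrow> complex ^ 'n)"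

definition sheaf_morphism :: "('m::finite) msheaf \<Rightarrow> ('n::finite) msheaf \<Rightarrow> ('m, 'n) smap \<Rightarrow> bool" where
  "sheaf_morphism \<E> \<G> \<phi> \<longleftrightarrow> (\<forall>U. zopen U \<longrightarrow>
     (\<forall>s\<in>\<E> U. \<phi> U s \<in> \<G> U) \<and>
     (\<forall>s\<in>\<E> U. \<forall>t\<in>\<E> U. \<phi> U (\<lambda>v. s v + t v) = (\<lambda>v. \<phi> U s v + \<phi> U t v)) \<and>
     (\<forall>g\<in>structure_sheaf U. \<forall>s\<in>\<E> U. \<phi> U (\<lambda>v. g v *s s v) = (\<lambda>v. g v *s \<phi> U s v)) \<and>
     (\<forall>V. zopen V \<and> V \<subseteq> U \<longrightarrow> (\<forall>s\<in>\<E> U. \<phi> V (restr V s) = restr V (\<phi> U s))))"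

definition sheaf_isomorphic :: "('m::finite) msheaf \<Rightarrow> ('n::finite) msheaf \<Rightarrow> bool" where
  "sheaf_isomorphic \<E> \<G> \<longleftrightarrow> (\<exists>\<phi>. sheaf_morphism \<E> \<G> \<phi> \<and>
     (\<forall>U. zopen U \<longrightarrow> bij_betw (\<phi> U) (\<E> U) (\<G> U)))"

definition sheaf_image :: "('m::finite) msheaf \<Rightarrow> ('m, 'n::finite) smap \<Rightarrow> vec3 set \<Rightarrow>
    (vec3 \<Rightarrow> complex ^ 'n) \<Rightarrow> bool" where
  "sheaf_image \<E> \<phi> U t \<longleftrightarrow> locally_on U (\<lambda>V. \<exists>s\<in>\<E> V. \<phi> V s = restr V t)"

definition sheaf_surjective :: "('m::finite) msheaf \<Rightarrow> ('n::finite) msheaf \<Rightarrow> ('m, 'n) smap \<Rightarrow> bool" where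
  "sheaf_surjective \<E> \<G> \<phi> \<longleftrightarrow> (\<forall>U. zopen U \<longrightarrow> (\<forall>t\<in>\<G> U. sheaf_image \<E> \<phi> U t))"

definition short_exact ::
  "('k::finite) msheaf \<Rightarrow> ('k, 'm) smap \<Rightarrow> ('m::finite) msheaf \<Rightarrow> ('m, 'n) smap \<Rightarrow>
     ('n::finite) msheaf \<Rightarrow> bool" where
  "short_exact \<E> \<phi> \<F> \<psi> \<G> \<longleftrightarrow>
     sheaf_morphism \<E> \<F> \<phi> \<and> sheaf_morphism \<F> \<G> \<psi> \<and>
     (\<forall>U. zopen U \<longrightarrow> inj_on (\<phi> U) (\<E> U)) \<and>
     (\<forall>U. zopen U \<longrightarrow> (\<forall>t\<in>\<F> U. \<psi> U t = (\<lambda>v. 0) \<longleftrightarrow> sheaf_image \<E> \<phi> U t)) \<and>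
     sheaf_surjective \<F> \<G> \<psi>"

definition is_line :: "vec3 set \<Rightarrow> bool" where
  "is_line H \<longleftrightarrow> (\<exists>\<alpha>::vec3. \<alpha> \<noteq> 0 \<and> H = {v. (\<Sum>i\<in>UNIV. \<alpha> $ i * v $ i) = 0})"

definition arrangement :: "vec3 set set \<Rightarrow> bool" where
  "arrangement A \<longleftrightarrow> finite A \<and> (\<forall>H\<in>A. is_line H)"

text \<open>
  The coefficient vector of a line is determined up to a nonzero scalar only; the choice changes
  the defining polynomial by a nonzero constant and does not affect the sheaf \<open>derivation_bundle\<close>.
\<close>

definition line_coeffs :: "vec3 set \<Rightarrow> vec3" where
  "line_coeffs H = (SOME \<alpha>. \<alpha> \<noteq> 0 \<and> H = {v. (\<Sum>i\<in>UNIV. \<alpha> $ i * v $ i) = 0})"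

definition defining_poly :: "vec3 set set \<Rightarrow> vec3 \<Rightarrow> complex" where
  "defining_poly A v = (\<Prod>H\<in>A. \<Sum>i\<in>UNIV. line_coeffs H $ i * v $ i)"

definition partial_deriv :: "3 \<Rightarrow> (vec3 \<Rightarrow> complex) \<Rightarrow> vec3 \<Rightarrow> complex" where
  "partial_deriv i f v = deriv (\<lambda>t. f (\<chi> j. if j = i then t else v $ j)) (v $ i)"

definition derivation_bundle :: "vec3 set set \<Rightarrow> 3 msheaf" where
  "derivation_bundle A U = {s \<in> twist UNIV 0 U.
     \<forall>v. (\<Sum>i\<in>UNIV. partial_deriv i (defining_poly A) v * s v $ i) = 0}"

definition free_with_exponents :: "vec3 set set \<Rightarrow> nat \<Rightarrow> nat \<Rightarrow> bool" where
  "free_with_exponents A a b \<longleftrightarrow> sheaf_isomorphic (derivation_bundle A)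
     (twist UNIV (vector [- int a, - int b] :: int ^ 2))"

definition free_arrangement :: "vec3 set set \<Rightarrow> bool" where
  "free_arrangement A \<longleftrightarrow> (\<exists>a b. free_with_exponents A a b)"

definition plus_one_generated :: "vec3 set set \<Rightarrow> nat \<Rightarrow> nat \<Rightarrow> nat \<Rightarrow> bool" where
  "plus_one_generated A a b d \<longleftrightarrow> a \<le> b \<and> b \<le> d \<and>
     (\<exists>\<phi> \<psi>. short_exact
        (twist UNIV (vector [- 1 - int d] :: int ^ 1)) \<phi>
        (twist UNIV (vector [- int d, - int b, - int a] :: int ^ 3)) \<psi>
        (derivation_bundle A))"

definition nt_free_minus :: "vec3 set set \<Rightarrow> bool" where
  "nt_free_minus A \<longleftrightarrow> (\<exists>H. is_line H \<and> H \<notin> A \<and> free_arrangement (A \<union> {H}))"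

definition nt_free_plus :: "vec3 set set \<Rightarrow> bool" where
  "nt_free_plus A \<longleftrightarrow> (\<exists>H\<in>A. free_arrangement (A - {H}))"

definition nt_free :: "vec3 set set \<Rightarrow> bool" where
  "nt_free A \<longleftrightarrow> nt_free_minus A \<or> nt_free_plus A"

text \<open>
  The presheaf whose sections over \<open>V\<close> are the elements of \<open>I\<^sub>l(V) \<cdot> \<E>(V)\<close>, with \<open>I\<^sub>l\<close> the ideal
  sheaf of the line \<open>l\<close>.
\<close>

definition ideal_product :: "vec3 set \<Rightarrow> ('n::finite) msheaf \<Rightarrow> 'n msheaf" where
  "ideal_product l \<E> V = {s. \<exists>(m::nat) g t.
     (\<forall>j<m. g j \<in> structure_sheaf V \<and> (\<forall>v\<in>l. g j v = 0) \<and> t j \<in> \<E> V) \<and>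
     s = (\<lambda>v. \<Sum>j<m. g j v *s t j v)}"

text \<open>
  \<open>\<E> \<otimes> O\<^sub>l \<cong> O\<^sub>l(k\<^sub>1) \<oplus> \<dots> \<oplus> O\<^sub>l(k\<^sub>n)\<close>. The tensor product is the quotient sheaf \<open>\<E> / I\<^sub>l\<E>\<close>, so an
  isomorphism amounts to a surjective morphism of sheaves from \<open>\<E>\<close> whose kernel is the sheaf
  \<open>I\<^sub>l\<E>\<close>.
\<close>

definition restricts_to :: "('m::finite) msheaf \<Rightarrow> vec3 set \<Rightarrow> int ^ ('n::finite) \<Rightarrow> bool" where
  "restricts_to \<E> l k \<longleftrightarrow> (\<exists>\<phi>. sheaf_morphism \<E> (twist l k) \<phi> \<and>
     sheaf_surjective \<E> (twist l k) \<phi> \<and>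
     (\<forall>U. zopen U \<longrightarrow> (\<forall>s\<in>\<E> U. \<phi> U s = (\<lambda>v. 0) \<longleftrightarrow>
        locally_on U (\<lambda>V. restr V s \<in> ideal_product l \<E> V))))"

definition distinguished_line :: "vec3 set set \<Rightarrow> nat \<Rightarrow> nat \<Rightarrow> nat \<Rightarrow> vec3 set \<Rightarrow> bool" where
  "distinguished_line A a b d l \<longleftrightarrow> is_line l \<and>
     restricts_to (derivation_bundle A) l
       (vector [- int d, int d + 1 - int a - int b] :: int ^ 2)"

text \<open>Points of the plane appear as the one-dimensional subspaces in which distinct lines meet.\<close>

definition points_on :: "vec3 set set \<Rightarrow> vec3 set \<Rightarrow> vec3 set set" where
  "points_on A l = {H \<inter> l | H. H \<in> A \<and> H \<noteq> l}"

end

theory Submission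
  imports Defs "HOL-Computational_Algebra.Field_as_Ring" "HOL-Computational_Algebra.Fundamental_Theorem_Algebra"
    "Subresultants.Subresultant_Gcd"
begin

text \<open>
  Everything is done with homogeneous vector fields on the cone \<open>C\<^sup>3\<close>. Let \<open>f\<close> be the defining
  polynomial of the arrangement \<open>A\<close> of \<open>n\<close> lines. A field killed by the gradient of \<open>f\<close> is tangent to
  all lines of \<open>A\<close> (it is logarithmic), and conversely every logarithmic field becomes one after a
  multiple of the Euler field \<open>v\<close> is subtracted. On logarithmic fields the determinant
  \<open>det3 v (\<theta> v) (\<psi> v)\<close> is an alternating pairing that ignores the Euler field and is divisible by \<open>f\<close>.
  By Saito's criterion \<open>A\<close> is free if and only if two logarithmic fields have a pairing \<open>c * f\<close> with a
  nonzero constant \<open>c\<close> (\<open>free_if_log_pairing\<close>, \<open>free_imp_log_pairing\<close>).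

  For a plus-one generated arrangement the exact sequence gives fields \<open>td\<close>, \<open>tb\<close>, \<open>ta\<close> of degrees
  \<open>d\<close>, \<open>b\<close>, \<open>a\<close> with one relation \<open>\<alpha> td + \<beta> tb + \<gamma> ta = 0\<close>. The splitting of the bundle on the
  distinguished line says that \<open>\<alpha>\<close> vanishes on that line and that \<open>\<beta>\<close> and \<open>\<gamma>\<close> have no common zero
  on it. Cramer's rule makes the pairings \<open>[tb, ta]\<close>, \<open>[ta, td]\<close>, \<open>[td, tb]\<close> proportional to
  \<open>\<alpha>\<close>, \<open>\<beta>\<close>, \<open>\<gamma>\<close>; since two plane curves always meet, \<open>\<alpha>\<close> is the equation \<open>L\<close> of the distinguished
  line up to a constant, and the pairing of \<open>tb\<close> and \<open>ta\<close> is a constant multiple of \<open>L * f\<close>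
  (\<open>pairings_proportional\<close>). Moreover every logarithmic field is a combination of the three
  generators modulo the Euler field (\<open>generation_mod_euler\<close>). As \<open>d\<close> exceeds \<open>a\<close> and \<open>b\<close>, two
  logarithmic fields whose pairing is \<open>f\<close> times a form of degree at most one can involve \<open>tb\<close> and
  \<open>ta\<close> only, and the form is a multiple of \<open>L\<close> (\<open>small_pairing\<close>).

  This settles which lines can be added or deleted. If \<open>A \<union> {H}\<close> is free, its generators are
  logarithmic for \<open>A\<close> with pairing \<open>c * L\<^sub>H * f\<close>; if \<open>A - {H}\<close> is free, its generators multiplied by
  \<open>L\<^sub>H\<close> are. In both cases \<open>H\<close> is the distinguished line \<open>l\<close>, and \<open>ta\<close> and \<open>tb\<close> inherit from these
  generators that they are tangent to \<open>l\<close> in the first case and radial along \<open>l\<close> in the second.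
  Conversely, tangency makes the pairing \<open>c * L * f\<close> of \<open>tb\<close> and \<open>ta\<close> that of a free arrangement
  \<open>A \<union> {l}\<close>, and radial fields can be divided by \<open>L\<close> modulo the Euler field, which gives the pairing
  of a free arrangement \<open>A - {l}\<close>.

  It remains to read off tangency and radiality from the number \<open>h\<close> of points of \<open>A\<close> on \<open>l\<close>. If
  \<open>l\<close> is not in \<open>A\<close>, the component of a logarithmic field normal to \<open>l\<close> vanishes to order \<open>m - 1\<close> at a
  point of multiplicity \<open>m\<close>, altogether \<open>n - h\<close> times. So fields of degree less than \<open>n - h\<close> are tangent
  to \<open>l\<close>; and if \<open>ta\<close> and \<open>tb\<close> are tangent, all normal components are multiples of that of \<open>td\<close>, and
  explicit fields show that the latter has no other zeros, so that \<open>d = n - h\<close>. If \<open>l\<close> is in \<open>A\<close>, the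
  same argument applies to the determinant of \<open>\<theta>\<close> and the Euler field along \<open>l\<close>, a form of degree one
  more than \<open>\<theta>\<close> with a zero at each of the \<open>h\<close> points; it leads to \<open>d + 1 = h\<close>.
\<close>

(* The matrices of the resultant library come with their own indexing and determinants. *)
no_notation vec_index (infixl "$" 100)
hide_const (open) Matrix.vec Determinant.det module.smult

section \<open>Homogeneous polynomials as functions that are polynomial on lines\<close>

text \<open>Polynomiality is expressed through restrictions to affine lines, because the arguments below restrict
  to one line at a time. For homogeneous functions nothing is lost, see \<open>form_iff_homog\<close>.\<close>

definition poly_on_lines :: "(vec3 \<Rightarrow> complex) \<Rightarrow> bool" where
  "poly_on_lines F \<longleftrightarrow> (\<forall>u w. \<exists>P. \<forall>t. F (u + t *s w) = poly P t)"

text \<open>The degree is an integer, so that the degrees of quotients and pairings need no case distinction; in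
  negative degree only the zero function remains.\<close>

definition homog :: "int \<Rightarrow> (vec3 \<Rightarrow> complex) \<Rightarrow> bool" where
  "homog k F \<longleftrightarrow> poly_on_lines F \<and> (\<forall>c v. c \<noteq> 0 \<longrightarrow> F (c *s v) = c powi k * F v)"

definition lin :: "vec3 \<Rightarrow> vec3 \<Rightarrow> complex" where
  "lin \<alpha> v = (\<Sum>i\<in>UNIV. \<alpha> $ i * v $ i)"

lemma lin_add: "lin \<alpha> (u + v) = lin \<alpha> u + lin \<alpha> v"
  by (simp add: lin_def sum.distrib algebra_simps)

lemma lin_diff: "lin \<alpha> (u - v) = lin \<alpha> u - lin \<alpha> v"
  by (simp add: lin_def sum_subtractf algebra_simps)

lemma lin_scale: "lin \<alpha> (c *s v) = c * lin \<alpha> v"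
  by (simp add: lin_def sum_distrib_left algebra_simps)

lemma lin_zero [simp]: "lin \<alpha> 0 = 0"
  by (simp add: lin_def)

lemmas lin_simps = lin_add lin_diff lin_scale

lemma lin_axis: "lin (axis i 1) v = v $ i"
proof -
  have "lin (axis i 1) v = (\<Sum>j\<in>UNIV. if i = j then v $ j else 0)"
    unfolding lin_def by (rule sum.cong) (auto simp: axis_def)
  then show ?thesis by simp
qed

lemma poly_on_linesE:
  assumes "poly_on_lines F"
  obtains P where "\<And>t. F (u + t *s w) = poly P t"
  using assms unfolding poly_on_lines_def by blast

lemma poly_on_lines_const: "poly_on_lines (\<lambda>v. c)"
  unfolding poly_on_lines_def by (intro allI exI[of _ "[:c:]"]) simp

lemma poly_on_lines_add:
  assumes "poly_on_lines F" "poly_on_lines G"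
  shows "poly_on_lines (\<lambda>v. F v + G v)"
  unfolding poly_on_lines_def
proof (intro allI)
  fix u w
  from assms(1) obtain P where "\<And>t. F (u + t *s w) = poly P t" by (rule poly_on_linesE) blast
  moreover from assms(2) obtain Q where "\<And>t. G (u + t *s w) = poly Q t" by (rule poly_on_linesE) blast
  ultimately show "\<exists>P. \<forall>t. F (u + t *s w) + G (u + t *s w) = poly P t"
    by (intro exI[of _ "P + Q"]) simp
qed

lemma poly_on_lines_mult:
  assumes "poly_on_lines F" "poly_on_lines G"
  shows "poly_on_lines (\<lambda>v. F v * G v)"
  unfolding poly_on_lines_def
proof (intro allI)
  fix u w
  from assms(1) obtain P where "\<And>t. F (u + t *s w) = poly P t" by (rule poly_on_linesE) blast
  moreover from assms(2) obtain Q where "\<And>t. G (u + t *s w) = poly Q t" by (rule poly_on_linesE) blast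
  ultimately show "\<exists>P. \<forall>t. F (u + t *s w) * G (u + t *s w) = poly P t"
    by (intro exI[of _ "P * Q"]) simp
qed

lemma poly_on_lines_lin: "poly_on_lines (lin \<alpha>)"
  unfolding poly_on_lines_def
proof (intro allI)
  fix u w
  show "\<exists>P. \<forall>t. lin \<alpha> (u + t *s w) = poly P t"
    by (intro exI[of _ "[:lin \<alpha> u, lin \<alpha> w:]"]) (simp add: lin_simps)
qed

lemma homog_poly_on_lines: "homog k F \<Longrightarrow> poly_on_lines F"
  by (simp add: homog_def)

lemma homog_scale: "homog k F \<Longrightarrow> c \<noteq> 0 \<Longrightarrow> F (c *s v) = c powi k * F v"
  by (simp add: homog_def)

lemma homog_zero [simp]: "homog k (\<lambda>v. 0)"
  by (simp add: homog_def poly_on_lines_const)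

lemma homog_const: "homog 0 (\<lambda>v. c)"
  by (simp add: homog_def poly_on_lines_const)

lemma homog_lin: "homog 1 (lin \<alpha>)"
  by (simp add: homog_def poly_on_lines_lin lin_scale)

lemma homog_coord: "homog 1 (\<lambda>v. v $ i)"
  using homog_lin[of "axis i 1"] by (simp add: lin_axis[abs_def])

lemma homog_add: "homog k F \<Longrightarrow> homog k G \<Longrightarrow> homog k (\<lambda>v. F v + G v)"
  by (simp add: homog_def poly_on_lines_add algebra_simps)

lemma homog_mult: "homog k F \<Longrightarrow> homog l G \<Longrightarrow> homog (k + l) (\<lambda>v. F v * G v)"
  by (simp add: homog_def poly_on_lines_mult power_int_add)

lemma homog_mult': "homog k F \<Longrightarrow> homog l G \<Longrightarrow> m = k + l \<Longrightarrow> homog m (\<lambda>v. F v * G v)"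
  using homog_mult by blast

lemma homog_cmult: "homog k F \<Longrightarrow> homog k (\<lambda>v. c * F v)"
  using homog_mult[OF homog_const] by fastforce

lemma homog_minus: "homog k F \<Longrightarrow> homog k (\<lambda>v. - F v)"
  using homog_cmult[of k F "-1"] by simp

lemma homog_diff: "homog k F \<Longrightarrow> homog k G \<Longrightarrow> homog k (\<lambda>v. F v - G v)"
  using homog_add[OF _ homog_minus, of k F G] by simp

lemma homog_sum: "(\<And>i. i \<in> I \<Longrightarrow> homog k (F i)) \<Longrightarrow> homog k (\<lambda>v. \<Sum>i\<in>I. F i v)"
  by (induction I rule: infinite_finite_induct) (auto intro: homog_add)

lemma homog_prod: "(\<And>i. i \<in> I \<Longrightarrow> homog (k i) (F i)) \<Longrightarrow> homog (\<Sum>i\<in>I. k i) (\<lambda>v. \<Prod>i\<in>I. F i v)"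
  by (induction I rule: infinite_finite_induct) (auto intro: homog_mult homog_const)

lemma homog_power: "homog k F \<Longrightarrow> homog (int n * k) (\<lambda>v. F v ^ n)"
  by (induction n) (auto intro!: homog_const homog_mult' simp: algebra_simps)

lemma homog_linear_comp:
  assumes "homog k F" "\<And>u v. L (u + v) = L u + L v" "\<And>c v. L (c *s v) = c *s L v"
  shows "homog k (\<lambda>v. F (L v))"
  using assms unfolding homog_def poly_on_lines_def by simp

lemma poly_eq_if_cofinitely_equal:
  fixes P Q :: "complex poly"
  assumes "finite S" "\<And>t. t \<notin> S \<Longrightarrow> poly P t = poly Q t"
  shows "P = Q"
proof (rule ccontr)
  assume "P \<noteq> Q"
  then have "finite {t. poly (P - Q) t = 0}" by (intro poly_roots_finite) simp
  moreover have "UNIV - S \<subseteq> {t. poly (P - Q) t = 0}" using assms by auto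
  ultimately have "finite (UNIV - S)" using finite_subset by blast
  then show False using assms(1) infinite_UNIV_char_0[where 'a = complex] by simp
qed

text \<open>Polynomial functions on a set that contains the line through any two of its points have no zero
  divisors: if \<open>F u\<close> and \<open>G w\<close> were nonzero, the product would not vanish on the line through \<open>u\<close> and
  \<open>w\<close>.\<close>

lemma poly_on_lines_mult_eq_zero:
  assumes F: "poly_on_lines F" and G: "poly_on_lines G"
    and S: "\<And>u v t. u \<in> S \<Longrightarrow> v \<in> S \<Longrightarrow> u + t *s (v - u) \<in> S"
    and FG: "\<And>v. v \<in> S \<Longrightarrow> F v * G v = 0" and u: "u \<in> S" "F u \<noteq> 0" and w: "w \<in> S"
  shows "G w = 0"
proof (rule ccontr)
  assume Gw: "G w \<noteq> 0"
  from F obtain P where P: "\<And>t. F (u + t *s (w - u)) = poly P t" by (rule poly_on_linesE) blast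
  from G obtain Q where Q: "\<And>t. G (u + t *s (w - u)) = poly Q t" by (rule poly_on_linesE) blast
  have "poly (P * Q) t = 0" for t
    using FG[OF S[OF u(1) w, of t]] P Q by simp
  then have "P * Q = 0" by (metis poly_all_0_iff_0)
  moreover have "P \<noteq> 0" using P[of 0] u by auto
  moreover have "Q \<noteq> 0" using Q[of 1] Gw by auto
  ultimately show False by simp
qed

text \<open>A polynomial agreeing with \<open>t \<mapsto> t\<^sup>k Q(1/t)\<close> has degree at most \<open>k\<close>; its coefficient
  at \<open>k\<close> is the value of \<open>Q\<close> at \<open>0\<close>, the point at infinity.\<close>

lemma poly_degree_from_infinity:
  fixes P Q :: "complex poly" and k :: int
  assumes "\<And>t. t \<noteq> 0 \<Longrightarrow> poly P t = t powi k * poly Q (1 / t)"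
  shows "k \<ge> 0 \<Longrightarrow> degree P \<le> nat k \<and> coeff P (nat k) = poly Q 0" and "k < 0 \<Longrightarrow> P = 0"
proof -
  have reflect: "poly (reflect_poly P) s = s ^ degree P * poly P (1 / s)" if "s \<noteq> 0" for s :: complex
    using poly_reflect_poly_nz[OF that, of P] by (simp add: inverse_eq_divide)
  have eq: "poly (reflect_poly P) s * s powi k = s ^ degree P * poly Q s" if "s \<noteq> 0" for s
    using reflect[OF that] assms[of "1 / s"] that
    by (simp add: power_int_divide_distrib power_int_minus field_simps)
  { assume "k < 0 \<or> degree P > nat k"
    define m where "m = nat (int (degree P) - k)"
    have m: "int m = int (degree P) - k" "m > 0" using \<open>k < 0 \<or> degree P > nat k\<close>
      unfolding m_def by auto
    have "poly (reflect_poly P) s = poly (monom 1 m * Q) s" if "s \<notin> {0}" for s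
    proof -
      from that have s: "s \<noteq> 0" by simp
      have "s ^ m * s powi k = s powi (int m + k)" using s by (simp add: power_int_add)
      also have "\<dots> = s ^ degree P" using m by simp
      finally have "s ^ m * poly Q s * s powi k = poly (reflect_poly P) s * s powi k"
        using eq[OF s] by (simp add: algebra_simps)
      then show ?thesis using s by (simp add: poly_monom)
    qed
    then have "reflect_poly P = monom 1 m * Q" by (intro poly_eq_if_cofinitely_equal[of "{0}"]) auto
    then have "coeff (reflect_poly P) 0 = 0" using m by (simp add: coeff_monom_mult)
    then have "P = 0" by simp }
  note zero = this
  show "P = 0" if "k < 0" using zero that by blast
  show "degree P \<le> nat k \<and> coeff P (nat k) = poly Q 0" if k: "k \<ge> 0"
  proof
    show deg: "degree P \<le> nat k" using zero by (metis degree_0 leI le0)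
    define m where "m = nat k - degree P"
    have m: "int m + int (degree P) = k" using deg k unfolding m_def by auto
    have "poly (monom 1 m * reflect_poly P) s = poly Q s" if "s \<notin> {0}" for s
    proof -
      from that have s: "s \<noteq> 0" by simp
      have "s powi k = s ^ m * s ^ degree P"
        using s m by (metis power_add power_int_of_nat of_nat_add)
      then show ?thesis using eq[OF s] s by (simp add: poly_monom algebra_simps)
    qed
    then have Q: "Q = monom 1 m * reflect_poly P" by (intro poly_eq_if_cofinitely_equal[of "{0}", symmetric]) auto
    show "coeff P (nat k) = poly Q 0"
    proof (cases "m = 0")
      case True
      then have "nat k = degree P" using deg m by simp
      then show ?thesis unfolding Q using True by (simp add: reflect_poly_at_0_eq_0_iff poly_0_coeff_0)
    next
      case False
      then have "degree P < nat k" using m by auto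
      then show ?thesis unfolding Q using False by (simp add: poly_monom coeff_eq_0)
    qed
  qed
qed

section \<open>Homogeneous polynomials are forms\<close>

definition indep2 :: "vec3 \<Rightarrow> vec3 \<Rightarrow> bool" where
  "indep2 u w \<longleftrightarrow> (\<forall>c d. c *s u + d *s w = 0 \<longrightarrow> c = 0 \<and> d = 0)"

lemma indep2_sym: "indep2 u w \<Longrightarrow> indep2 w u"
  unfolding indep2_def
proof (intro allI impI)
  fix c d assume "\<forall>c d. c *s u + d *s w = 0 \<longrightarrow> c = 0 \<and> d = 0" "c *s w + d *s u = 0"
  then have "d *s u + c *s w = 0" by (simp add: add.commute)
  then show "c = 0 \<and> d = 0" using \<open>\<forall>c d. _\<close> by blast
qed

lemma indep2_line_nonzero: "indep2 u w \<Longrightarrow> u + t *s w \<noteq> 0"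
  unfolding indep2_def by (drule spec[of _ 1], drule spec[of _ t]) auto

lemma poly_eqI_all: "(\<And>t. poly P t = poly Q t) \<Longrightarrow> P = (Q :: complex poly)"
  by (rule poly_eq_if_cofinitely_equal[of "{}"]) auto

lemma form_imp_homog:
  assumes "form n F" shows "homog (int n) F"
proof -
  from assms obtain c where F: "\<And>v. F v = (\<Sum>i\<le>n. \<Sum>j\<le>n - i. c i j * (v $ 1) ^ i * (v $ 2) ^ j * (v $ 3) ^ (n - i - j))"
    unfolding form_def by blast
  have "homog (int n) (\<lambda>v. \<Sum>i\<le>n. \<Sum>j\<le>n - i. c i j * (v $ 1) ^ i * (v $ 2) ^ j * (v $ 3) ^ (n - i - j))"
  proof (intro homog_sum)
    fix i j assume "i \<in> {..n}" "j \<in> {..n - i}"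
    then show "homog (int n) (\<lambda>v. c i j * (v $ 1) ^ i * (v $ 2) ^ j * (v $ 3) ^ (n - i - j))"
      by (intro homog_mult'[OF homog_mult[OF homog_mult[OF homog_const homog_power[OF homog_coord]]
            homog_power[OF homog_coord]] homog_power[OF homog_coord]]) auto
  qed
  then show ?thesis by (simp add: F[abs_def])
qed

text \<open>Interpolation at \<open>0, \<dots>, n\<close>: the basis does not depend on the interpolated polynomial, which is what
  allows to interpolate in one variable with the other one as a parameter.\<close>

lemma lagrange_basis:
  fixes n :: nat
  shows "\<exists>L :: nat \<Rightarrow> complex poly. \<forall>P. degree P \<le> n \<longrightarrow> P = (\<Sum>i\<le>n. smult (poly P (of_nat i)) (L i))"
proof -
  define L :: "nat \<Rightarrow> complex poly" where
    "L i = (\<Prod>j\<in>{..n} - {i}. smult (1 / (of_nat i - of_nat j)) [:- of_nat j, 1:])" for i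
  have val: "poly (L i) (of_nat j) = (if i = j then 1 else 0)" if "i \<le> n" "j \<le> n" for i j
  proof (cases "i = j")
    case True
    have "poly (L i) (of_nat j) = (\<Prod>j\<in>{..n} - {i}. 1)"
      unfolding L_def poly_prod True by (rule prod.cong) (auto simp: divide_simps)
    then show ?thesis using True by simp
  next
    case False
    have "j \<in> {..n} - {i}" using that False by auto
    moreover have "poly (smult (1 / (of_nat i - of_nat j)) [:- of_nat j, 1 :: complex:]) (of_nat j) = 0" by simp
    ultimately have "poly (L i) (of_nat j) = 0"
      unfolding L_def poly_prod by (intro prod_zero) auto
    then show ?thesis using False by simp
  qed
  have deg: "degree (L i) \<le> n" if "i \<le> n" for i
  proof -
    have "degree (L i) \<le> (\<Sum>j\<in>{..n} - {i}. 1)"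
      unfolding L_def by (rule order.trans[OF degree_prod_sum_le]) (auto intro!: sum_mono)
    then show ?thesis using that by simp
  qed
  show ?thesis
  proof (intro exI[of _ L] allI impI)
    fix P :: "complex poly" assume P: "degree P \<le> n"
    let ?Q = "\<Sum>i\<le>n. smult (poly P (of_nat i)) (L i)"
    have "degree ?Q \<le> n"
      by (rule degree_sum_le) (simp, rule order.trans[OF degree_smult_le deg], simp)
    then have d: "degree (P - ?Q) \<le> n" using P degree_diff_le by blast
    have "poly (P - ?Q) (of_nat j) = 0" if "j \<le> n" for j
    proof -
      have "poly ?Q (of_nat j) = (\<Sum>i\<le>n. if i = j then poly P (of_nat i) else 0)"
        unfolding poly_sum poly_smult by (rule sum.cong) (auto simp: val that)
      then show ?thesis using that by simp
    qed
    then have sub: "of_nat ` {..n} \<subseteq> {x. poly (P - ?Q) x = 0}" by auto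
    have "P - ?Q = 0"
    proof (rule ccontr)
      assume nz: "P - ?Q \<noteq> 0"
      have "card (of_nat ` {..n} :: complex set) \<le> card {x. poly (P - ?Q) x = 0}"
        by (rule card_mono[OF poly_roots_finite[OF nz] sub])
      also have "\<dots> \<le> degree (P - ?Q)" by (rule poly_roots_degree[OF nz])
      finally show False using d by (simp add: card_image inj_on_def)
    qed
    then show "P = ?Q" by simp
  qed
qed

text \<open>Interpolating in \<open>x\<close> expresses \<open>g\<close> by its restrictions to finitely many values of \<open>x\<close>, which are
  polynomials in \<open>y\<close>.\<close>

lemma bivariate_polynomial:
  fixes g :: "complex \<Rightarrow> complex \<Rightarrow> complex"
  assumes x: "\<And>y. \<exists>P. degree P \<le> n \<and> (\<forall>x. g x y = poly P x)"
    and y: "\<And>x. \<exists>P. degree P \<le> n \<and> (\<forall>y. g x y = poly P y)"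
  shows "\<exists>c. \<forall>x y. g x y = (\<Sum>i\<le>n. \<Sum>j\<le>n. c i j * x ^ i * y ^ j)"
proof -
  obtain L :: "nat \<Rightarrow> complex poly" where
    L: "\<And>P. degree P \<le> n \<Longrightarrow> P = (\<Sum>i\<le>n. smult (poly P (of_nat i)) (L i))"
    using lagrange_basis[of n] by metis
  have gx: "g x y = (\<Sum>i\<le>n. g (of_nat i) y * poly (L i) x)" for x y
  proof -
    obtain P where P: "degree P \<le> n" "\<And>x. g x y = poly P x" using x by blast
    have "poly P x = (\<Sum>i\<le>n. poly P (of_nat i) * poly (L i) x)"
      by (subst L[OF P(1)]) (simp add: poly_sum)
    then show ?thesis by (simp add: P(2))
  qed
  have "\<forall>i. \<exists>P. degree P \<le> n \<and> (\<forall>y. g (of_nat i) y = poly P y)" using y by blast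
  then obtain R where R: "\<And>i. degree (R i) \<le> n" "\<And>i y. g (of_nat i) y = poly (R i) y" by metis
  define K where "K i = (\<Sum>m\<le>n. smult (coeff (L m) i) (R m))" for i
  have degK: "degree (K i) \<le> n" for i
    unfolding K_def by (rule degree_sum_le) (simp, rule order.trans[OF degree_smult_le R(1)])
  define M where "M = (\<Sum>m\<le>n. degree (L m))"
  have M: "degree (L m) \<le> M" if "m \<le> n" for m
    unfolding M_def by (rule member_le_sum) (use that in auto)
  define N where "N = max M n"
  have LN: "poly (L m) x = (\<Sum>i\<le>N. coeff (L m) i * x ^ i)" if "m \<le> n" for m x
    using M[OF that] by (intro poly_as_sum_of_monoms'[symmetric, THEN arg_cong[of _ _ "\<lambda>p. poly p x"], simplified poly_sum poly_monom]) (simp add: N_def)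
  have g1: "g x y = (\<Sum>i\<le>N. poly (K i) y * x ^ i)" for x y
  proof -
    have "g x y = (\<Sum>m\<le>n. poly (R m) y * (\<Sum>i\<le>N. coeff (L m) i * x ^ i))"
      unfolding gx[of x y] by (rule sum.cong) (auto simp: R LN)
    also have "\<dots> = (\<Sum>m\<le>n. \<Sum>i\<le>N. poly (R m) y * (coeff (L m) i * x ^ i))"
      by (simp add: sum_distrib_left)
    also have "\<dots> = (\<Sum>i\<le>N. \<Sum>m\<le>n. poly (R m) y * (coeff (L m) i * x ^ i))"
      by (rule sum.swap)
    also have "\<dots> = (\<Sum>i\<le>N. poly (K i) y * x ^ i)"
      by (rule sum.cong) (auto simp: K_def poly_sum sum_distrib_right sum_distrib_left algebra_simps)
    finally show ?thesis .
  qed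
  have g2: "poly (K i) y = 0" if "i > n" for i y
  proof (cases "i \<le> N")
    case True
    obtain P where P: "degree P \<le> n" "\<And>x. g x y = poly P x" using x by blast
    have "poly P t = poly (\<Sum>i\<le>N. monom (poly (K i) y) i) t" for t
      using P(2)[of t] g1[of t y] by (simp add: poly_sum poly_monom)
    then have "P = (\<Sum>i\<le>N. monom (poly (K i) y) i)" by (intro poly_eqI_all) simp
    then have "coeff P i = poly (K i) y" using True by (simp add: coeff_sum)
    then show ?thesis using P(1) that by (simp add: coeff_eq_0)
  next
    case False
    then have "coeff (L m) i = 0" if "m \<le> n" for m
      using M[OF that] by (intro coeff_eq_0) (simp add: N_def)
    then have "K i = 0" unfolding K_def by (intro sum.neutral) auto
    then show ?thesis by simp
  qed
  have "g x y = (\<Sum>i\<le>n. \<Sum>j\<le>n. coeff (K i) j * x ^ i * y ^ j)" for x y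
  proof -
    have "g x y = (\<Sum>i\<le>n. poly (K i) y * x ^ i)"
      unfolding g1[of x y] by (rule sum.mono_neutral_right) (auto simp: N_def g2)
    also have "\<dots> = (\<Sum>i\<le>n. \<Sum>j\<le>n. coeff (K i) j * x ^ i * y ^ j)"
    proof (rule sum.cong[OF refl])
      fix i
      have "poly (K i) y = (\<Sum>j\<le>n. coeff (K i) j * y ^ j)"
        using poly_as_sum_of_monoms'[OF degK[of i], THEN arg_cong[of _ _ "\<lambda>p. poly p y"]]
        by (simp add: poly_sum poly_monom)
      then show "poly (K i) y * x ^ i = (\<Sum>j\<le>n. coeff (K i) j * x ^ i * y ^ j)"
        by (simp add: sum_distrib_right sum_distrib_left algebra_simps)
    qed
    finally show ?thesis .
  qed
  then show ?thesis by (intro exI[of _ "\<lambda>i j. coeff (K i) j"]) simp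
qed

text \<open>The total degree is bounded by looking at the lines through the origin.\<close>

lemma triangular_polynomial:
  fixes g :: "complex \<Rightarrow> complex \<Rightarrow> complex"
  assumes x: "\<And>y. \<exists>P. degree P \<le> n \<and> (\<forall>x. g x y = poly P x)"
    and y: "\<And>x. \<exists>P. degree P \<le> n \<and> (\<forall>y. g x y = poly P y)"
    and r: "\<And>x y. \<exists>P. degree P \<le> n \<and> (\<forall>t. g (t * x) (t * y) = poly P t)"
  shows "\<exists>c. \<forall>x y. g x y = (\<Sum>i\<le>n. \<Sum>j\<le>n - i. c i j * x ^ i * y ^ j)"
proof -
  from bivariate_polynomial[OF x y] obtain c where
    c: "\<And>x y. g x y = (\<Sum>i\<le>n. \<Sum>j\<le>n. c i j * x ^ i * y ^ j)" by blast
  have "g x y = (\<Sum>i\<le>n. \<Sum>j\<le>n - i. c i j * x ^ i * y ^ j)" for x y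
  proof -
    obtain P where P: "degree P \<le> n" "\<And>t. g (t * x) (t * y) = poly P t" using r by blast
    have "poly P t = poly (\<Sum>i\<le>n. \<Sum>j\<le>n. monom (c i j * x ^ i * y ^ j) (i + j)) t" for t
      using P(2)[of t] c[of "t * x" "t * y"]
      by (simp add: poly_sum poly_monom power_mult_distrib power_add algebra_simps)
    then have Peq: "P = (\<Sum>i\<le>n. \<Sum>j\<le>n. monom (c i j * x ^ i * y ^ j) (i + j))" by (intro poly_eqI_all) simp
    have "g x y = poly P 1" using P(2)[of 1] by simp
    also have "\<dots> = (\<Sum>m\<le>n. coeff P m)"
      using poly_as_sum_of_monoms'[OF P(1), THEN arg_cong[of _ _ "\<lambda>p. poly p 1"]]
      by (simp add: poly_sum poly_monom)
    also have "\<dots> = (\<Sum>m\<le>n. \<Sum>i\<le>n. \<Sum>j\<le>n. if i + j = m then c i j * x ^ i * y ^ j else 0)"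
      unfolding Peq by (simp add: coeff_sum)
    also have "\<dots> = (\<Sum>i\<le>n. \<Sum>m\<le>n. \<Sum>j\<le>n. if i + j = m then c i j * x ^ i * y ^ j else 0)"
      by (rule sum.swap)
    also have "\<dots> = (\<Sum>i\<le>n. \<Sum>j\<le>n. \<Sum>m\<le>n. if i + j = m then c i j * x ^ i * y ^ j else 0)"
      by (rule sum.cong[OF refl], rule sum.swap)
    also have "\<dots> = (\<Sum>i\<le>n. \<Sum>j\<le>n. if i + j \<le> n then c i j * x ^ i * y ^ j else 0)"
      by (simp add: sum.delta)
    also have "\<dots> = (\<Sum>i\<le>n. \<Sum>j\<le>n - i. c i j * x ^ i * y ^ j)"
      by (intro sum.cong[OF refl] sum.mono_neutral_cong_right) auto
    finally show ?thesis .
  qed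
  then show ?thesis by blast
qed

definition pt :: "complex \<Rightarrow> complex \<Rightarrow> complex \<Rightarrow> vec3" where
  "pt x y z = vector [x, y, z]"

lemma pt_nth [simp]: "pt x y z $ 1 = x" "pt x y z $ 2 = y" "pt x y z $ 3 = z"
  by (simp_all add: pt_def)

lemma vec3_eq_iff: "(u :: vec3) = v \<longleftrightarrow> u $ 1 = v $ 1 \<and> u $ 2 = v $ 2 \<and> u $ 3 = v $ 3"
  by (auto simp: Finite_Cartesian_Product.vec_eq_iff forall_3)

lemma ex_indep2: "v \<noteq> 0 \<Longrightarrow> \<exists>w. indep2 v w"
proof -
  assume "v \<noteq> 0"
  then consider "v $ 1 \<noteq> 0" | "v $ 2 \<noteq> 0" | "v $ 3 \<noteq> 0" by (auto simp: vec3_eq_iff)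
  then show ?thesis
  proof cases
    case 1 then show ?thesis by (intro exI[of _ "pt 0 1 0"]) (auto simp: indep2_def vec3_eq_iff)
  next
    case 2 then show ?thesis by (intro exI[of _ "pt 1 0 0"]) (auto simp: indep2_def vec3_eq_iff)
  next
    case 3 then show ?thesis by (intro exI[of _ "pt 1 0 0"]) (auto simp: indep2_def vec3_eq_iff)
  qed
qed

text \<open>On a line not through the origin, homogeneity relates the values at \<open>t\<close> to those at \<open>1 / t\<close> on the
  line with the two ends exchanged, which bounds the degree by \<open>k\<close>. Hence \<open>s\<close> is a polynomial of degree
  at most \<open>k\<close> in the chart \<open>z = 1\<close>; its homogenisation agrees with \<open>s\<close> also on \<open>z = 0\<close>, by
  continuation along lines.\<close>

lemma homog_extension:
  fixes s :: "vec3 \<Rightarrow> complex" and k :: int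
  assumes scale: "\<And>c v. c \<noteq> 0 \<Longrightarrow> v \<noteq> 0 \<Longrightarrow> s (c *s v) = c powi k * s v"
    and lines: "\<And>u w. indep2 u w \<Longrightarrow> \<exists>P. \<forall>t. s (u + t *s w) = poly P t"
  shows "\<exists>F. homog k F \<and> (k \<ge> 0 \<longrightarrow> form (nat k) F) \<and> (k < 0 \<longrightarrow> F = (\<lambda>v. 0)) \<and> (\<forall>v. v \<noteq> 0 \<longrightarrow> F v = s v)"
proof -
  have deg: "\<exists>P. (k \<ge> 0 \<longrightarrow> degree P \<le> nat k) \<and> (k < 0 \<longrightarrow> P = 0) \<and> (\<forall>t. s (u + t *s w) = poly P t)"
    if uw: "indep2 u w" for u w
  proof -
    from lines[OF uw] obtain P where P: "\<And>t. s (u + t *s w) = poly P t" by blast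
    from lines[OF indep2_sym[OF uw]] obtain Q where Q: "\<And>t. s (w + t *s u) = poly Q t" by blast
    have "poly P t = t powi k * poly Q (1 / t)" if t: "t \<noteq> 0" for t
    proof -
      have "u + t *s w = t *s (w + (1 / t) *s u)" using t by (simp add: Finite_Cartesian_Product.vec_eq_iff field_simps)
      then have "s (u + t *s w) = s (t *s (w + (1 / t) *s u))" by (rule arg_cong)
      also have "\<dots> = t powi k * s (w + (1 / t) *s u)"
        by (rule scale[OF t indep2_line_nonzero[OF indep2_sym[OF uw]]])
      finally have "s (u + t *s w) = t powi k * s (w + (1 / t) *s u)" .
      then show ?thesis by (simp add: P Q)
    qed
    from poly_degree_from_infinity[of P k Q, OF this] P show ?thesis by (intro exI[of _ P]) auto
  qed
  show ?thesis
  proof (cases "k < 0")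
    case True
    have "s v = 0" if "v \<noteq> 0" for v
    proof -
      from ex_indep2[OF that] obtain w where "indep2 v w" by blast
      from deg[OF this] True obtain P where "P = 0" "\<forall>t. s (v + t *s w) = poly P t" by auto
      then have "s (v + 0 *s w) = 0" by (metis poly_0)
      then show ?thesis by simp
    qed
    then show ?thesis using True by (intro exI[of _ "\<lambda>v. 0"]) auto
  next
    case False
    define n where "n = nat k"
    have k: "k = int n" using False by (simp add: n_def)
    have pw: "c powi k = c ^ n" for c :: complex by (simp add: k)
    have deg': "\<exists>P. degree P \<le> n \<and> (\<forall>t. s (u + t *s w) = poly P t)" if "indep2 u w" for u w
      using deg[OF that] False by (auto simp: n_def)
    define g where "g x y = s (pt x y 1)" for x y
    have "\<exists>P. degree P \<le> n \<and> (\<forall>x. g x y = poly P x)" for y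
    proof -
      have "indep2 (pt 0 y 1) (pt 1 0 0)" by (auto simp: indep2_def vec3_eq_iff)
      moreover have "pt 0 y 1 + x *s pt 1 0 0 = pt x y 1" for x by (simp add: vec3_eq_iff)
      ultimately show ?thesis using deg'[of "pt 0 y 1" "pt 1 0 0"] by (simp add: g_def)
    qed
    moreover have "\<exists>P. degree P \<le> n \<and> (\<forall>y. g x y = poly P y)" for x
    proof -
      have "indep2 (pt x 0 1) (pt 0 1 0)" by (auto simp: indep2_def vec3_eq_iff)
      moreover have "pt x 0 1 + y *s pt 0 1 0 = pt x y 1" for y by (simp add: vec3_eq_iff)
      ultimately show ?thesis using deg'[of "pt x 0 1" "pt 0 1 0"] by (simp add: g_def)
    qed
    moreover have "\<exists>P. degree P \<le> n \<and> (\<forall>t. g (t * x) (t * y) = poly P t)" for x y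
    proof (cases "x = 0 \<and> y = 0")
      case True
      then show ?thesis by (intro exI[of _ "[:g 0 0:]"]) simp
    next
      case False
      then have "indep2 (pt 0 0 1) (pt x y 0)" by (auto simp: indep2_def vec3_eq_iff)
      moreover have "pt 0 0 1 + t *s pt x y 0 = pt (t * x) (t * y) 1" for t by (simp add: vec3_eq_iff)
      ultimately show ?thesis using deg'[of "pt 0 0 1" "pt x y 0"] by (simp add: g_def)
    qed
    ultimately obtain c where c: "\<And>x y. g x y = (\<Sum>i\<le>n. \<Sum>j\<le>n - i. c i j * x ^ i * y ^ j)"
      using triangular_polynomial[of n g] by blast
    define F where "F v = (\<Sum>i\<le>n. \<Sum>j\<le>n - i. c i j * (v $ 1) ^ i * (v $ 2) ^ j * (v $ 3) ^ (n - i - j))" for v :: vec3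
    have form: "form n F" unfolding form_def F_def by blast
    have hom: "homog k F" using form_imp_homog[OF form] k by simp
    have F1: "F (pt x y 1) = s (pt x y 1)" for x y
      using c[of x y] by (simp add: F_def g_def)
    have F3: "F v = s v" if "v $ 3 \<noteq> 0" for v
    proof -
      let ?w = "pt (v $ 1 / v $ 3) (v $ 2 / v $ 3) 1"
      have v: "v = v $ 3 *s ?w" using that by (simp add: vec3_eq_iff)
      have "?w \<noteq> 0" by (simp add: vec3_eq_iff)
      then have "s v = (v $ 3) powi k * s ?w" using scale[OF that] v by metis
      also have "\<dots> = (v $ 3) powi k * F ?w" by (simp add: F1)
      also have "\<dots> = F v" using homog_scale[OF hom that] v by metis
      finally show ?thesis by simp
    qed
    have "F v = s v" if v: "v \<noteq> 0" for v
    proof (cases "v $ 3 = 0")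
      case True
      then have "indep2 v (pt 0 0 1)" using v by (auto simp: indep2_def vec3_eq_iff)
      from lines[OF this] obtain P where P: "\<And>t. s (v + t *s pt 0 0 1) = poly P t" by blast
      from homog_poly_on_lines[OF hom] obtain Q where Q: "\<And>t. F (v + t *s pt 0 0 1) = poly Q t"
        by (rule poly_on_linesE) blast
      have "poly P t = poly Q t" if "t \<notin> {0}" for t
        using F3[of "v + t *s pt 0 0 1"] True that by (simp flip: P Q)
      then have "P = Q" by (intro poly_eq_if_cofinitely_equal[of "{0}"]) auto
      then show ?thesis using P[of 0] Q[of 0] by simp
    qed (use F3 in simp)
    then show ?thesis using form hom False by (intro exI[of _ F]) (auto simp: n_def)
  qed
qed

lemma homog_eqI:
  assumes "homog k F" "homog l G" "\<And>v. v \<noteq> 0 \<Longrightarrow> F v = G v"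
  shows "F = G"
proof
  fix v
  show "F v = G v"
  proof (cases "v = 0")
    case True
    from homog_poly_on_lines[OF assms(1)] obtain P where P: "\<And>t. F (0 + t *s pt 1 0 0) = poly P t"
      by (rule poly_on_linesE) blast
    from homog_poly_on_lines[OF assms(2)] obtain Q where Q: "\<And>t. G (0 + t *s pt 1 0 0) = poly Q t"
      by (rule poly_on_linesE) blast
    have "poly P t = poly Q t" if "t \<notin> {0}" for t
      using assms(3)[of "0 + t *s pt 1 0 0"] that by (simp add: vec3_eq_iff flip: P Q)
    then have "P = Q" by (intro poly_eq_if_cofinitely_equal[of "{0}"]) auto
    then show ?thesis using P[of 0] Q[of 0] True by simp
  qed (use assms(3) in simp)
qed

lemma homog_cases:
  assumes "homog k F"
  shows "k \<ge> 0 \<Longrightarrow> form (nat k) F" and "k < 0 \<Longrightarrow> F = (\<lambda>v. 0)"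
proof -
  have "\<exists>G. homog k G \<and> (k \<ge> 0 \<longrightarrow> form (nat k) G) \<and> (k < 0 \<longrightarrow> G = (\<lambda>v. 0)) \<and> (\<forall>v. v \<noteq> 0 \<longrightarrow> G v = F v)"
  proof (rule homog_extension)
    show "F (c *s v) = c powi k * F v" if "c \<noteq> 0" for c v by (rule homog_scale[OF assms that])
    show "\<exists>P. \<forall>t. F (u + t *s w) = poly P t" for u w
      using assms by (simp add: homog_def poly_on_lines_def)
  qed
  then obtain G where
    G: "homog k G" "k \<ge> 0 \<longrightarrow> form (nat k) G" "k < 0 \<longrightarrow> G = (\<lambda>v. 0)" "\<forall>v. v \<noteq> 0 \<longrightarrow> G v = F v" by blast
  have "F = G" by (rule homog_eqI[OF assms G(1)]) (use G(4) in simp)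
  then show "k \<ge> 0 \<Longrightarrow> form (nat k) F" and "k < 0 \<Longrightarrow> F = (\<lambda>v. 0)" using G by auto
qed

lemma form_iff_homog: "form n F \<longleftrightarrow> homog (int n) F"
  using form_imp_homog homog_cases(1)[of "int n" F] by auto

text \<open>The coefficient in degree \<open>k\<close> is the value at the point at infinity of the line. Hence the zeros of a
  form on a projective line can be counted with a polynomial in one variable.\<close>

lemma homog_line_poly:
  assumes "homog k F" "k \<ge> 0"
  obtains P where "\<And>t. F (u + t *s w) = poly P t" "degree P \<le> nat k" "coeff P (nat k) = F w"
proof -
  from homog_poly_on_lines[OF assms(1)] obtain P where P: "\<And>t. F (u + t *s w) = poly P t"
    by (rule poly_on_linesE) blast
  from homog_poly_on_lines[OF assms(1)] obtain Q where Q: "\<And>t. F (w + t *s u) = poly Q t"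
    by (rule poly_on_linesE) blast
  have "poly P t = t powi k * poly Q (1 / t)" if t: "t \<noteq> 0" for t
  proof -
    have "u + t *s w = t *s (w + (1 / t) *s u)" using t by (simp add: Finite_Cartesian_Product.vec_eq_iff field_simps)
    then have "F (u + t *s w) = F (t *s (w + (1 / t) *s u))" by (rule arg_cong)
    also have "\<dots> = t powi k * F (w + (1 / t) *s u)" by (rule homog_scale[OF assms(1) t])
    finally have "F (u + t *s w) = t powi k * F (w + (1 / t) *s u)" .
    then show ?thesis by (simp add: P Q)
  qed
  from poly_degree_from_infinity(1)[of P k Q, OF this assms(2)] Q[of 0] P that show ?thesis by simp
qed

lemma homog_0_const: "homog 0 F \<Longrightarrow> F v = F 0"
proof -
  assume F: "homog 0 F"
  from homog_line_poly[OF F, of 0 v] obtain P where P: "\<And>t. F (0 + t *s v) = poly P t" "degree P = 0"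
    by auto
  from degree_eq_zeroE[OF P(2)] obtain a where "P = [:a:]" by blast
  then show ?thesis using P(1)[of 0] P(1)[of 1] by simp
qed

section \<open>Planes in the cone and restriction to them\<close>

lemma lin_commute: "lin u v = lin v u"
  by (simp add: lin_def mult.commute)

lemma lin_vec3: "lin \<alpha> v = \<alpha> $ 1 * v $ 1 + \<alpha> $ 2 * v $ 2 + \<alpha> $ 3 * v $ 3"
  by (simp add: lin_def sum_3)

text \<open>A basis \<open>\<nu>, p, q\<close> with dual basis \<open>\<alpha>, x, y\<close>. The projective line \<open>\<alpha> = 0\<close> consists of the points
  \<open>p + t *s q\<close> and the point at infinity \<open>q\<close>.\<close>

definition frame :: "vec3 \<Rightarrow> vec3 \<Rightarrow> vec3 \<Rightarrow> vec3 \<Rightarrow> vec3 \<Rightarrow> vec3 \<Rightarrow> bool" where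
  "frame \<alpha> \<nu> p q x y \<longleftrightarrow>
     lin \<alpha> \<nu> = 1 \<and> lin \<alpha> p = 0 \<and> lin \<alpha> q = 0 \<and>
     lin x \<nu> = 0 \<and> lin x p = 1 \<and> lin x q = 0 \<and>
     lin y \<nu> = 0 \<and> lin y p = 0 \<and> lin y q = 1 \<and>
     (\<forall>v. lin \<alpha> v *s \<nu> + lin x v *s p + lin y v *s q = v)"

lemma frame_exists_some: "\<alpha> \<noteq> 0 \<Longrightarrow> \<exists>\<nu> p q x y. frame \<alpha> \<nu> p q x y"
proof -
  assume "\<alpha> \<noteq> 0"
  then consider "\<alpha> $ 1 \<noteq> 0" | "\<alpha> $ 2 \<noteq> 0" | "\<alpha> $ 3 \<noteq> 0" by (auto simp: vec3_eq_iff)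
  then show ?thesis
  proof cases
    case 1
    have "frame \<alpha> (pt (1 / \<alpha> $ 1) 0 0) (pt (- \<alpha> $ 2 / \<alpha> $ 1) 1 0) (pt (- \<alpha> $ 3 / \<alpha> $ 1) 0 1) (pt 0 1 0) (pt 0 0 1)"
      unfolding frame_def by (intro conjI allI) (use 1 in \<open>simp_all add: lin_vec3 vec3_eq_iff\<close>)
    then show ?thesis by blast
  next
    case 2
    have "frame \<alpha> (pt 0 (1 / \<alpha> $ 2) 0) (pt 1 (- \<alpha> $ 1 / \<alpha> $ 2) 0) (pt 0 (- \<alpha> $ 3 / \<alpha> $ 2) 1) (pt 1 0 0) (pt 0 0 1)"
      unfolding frame_def by (intro conjI allI) (use 2 in \<open>simp_all add: lin_vec3 vec3_eq_iff\<close>)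
    then show ?thesis by blast
  next
    case 3
    have "frame \<alpha> (pt 0 0 (1 / \<alpha> $ 3)) (pt 1 0 (- \<alpha> $ 1 / \<alpha> $ 3)) (pt 0 1 (- \<alpha> $ 2 / \<alpha> $ 3)) (pt 1 0 0) (pt 0 1 0)"
      unfolding frame_def by (intro conjI allI) (use 3 in \<open>simp_all add: lin_vec3 vec3_eq_iff\<close>)
    then show ?thesis by blast
  qed
qed

lemma frame_nth: "A *s \<nu> + B *s p + C *s q = v \<Longrightarrow> v $ i = A * \<nu> $ i + B * p $ i + C * q $ i"
  by auto

lemma frame_vecI: "(\<And>i. v $ i = A * \<nu> $ i + B * p $ i + C * q $ i) \<Longrightarrow> A *s \<nu> + B *s p + C *s q = v"
  by (simp add: Finite_Cartesian_Product.vec_eq_iff)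

lemma change_basis_coeffs:
  fixes a :: complex
  shows "a \<noteq> 0 \<Longrightarrow> (1 * Y + (- b / a) * X) * Q + (1 / a * X + 0 * Y) * (a * P + b * Q) = X * P + Y * Q"
  by (simp add: ring_distribs)

lemma lin_lincomb: "lin (a *s u + b *s w) v = a * lin u v + b * lin w v"
  by (simp add: lin_commute[of _ v] lin_simps)

text \<open>The point at infinity may be prescribed; it will be chosen off the zeros of the form at hand.\<close>

lemma frame_exists:
  assumes "\<alpha> \<noteq> 0" "lin \<alpha> q = 0" "q \<noteq> 0"
  obtains \<nu> p x y where "frame \<alpha> \<nu> p q x y"
proof -
  obtain \<nu> p0 q0 x0 y0 where f: "frame \<alpha> \<nu> p0 q0 x0 y0" using frame_exists_some[OF assms(1)] by blast
  define a b where "a = lin x0 q" and "b = lin y0 q"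
  have v: "lin \<alpha> v *s \<nu> + lin x0 v *s p0 + lin y0 v *s q0 = v" for v using f by (simp add: frame_def)
  have q: "q = a *s p0 + b *s q0" using v[of q] assms(2) unfolding a_def b_def by simp
  have nth: "v $ i = lin \<alpha> v * \<nu> $ i + lin x0 v * p0 $ i + lin y0 v * q0 $ i" for v i
    by (rule frame_nth[OF v])
  note fr = f[unfolded frame_def]
  have qnth: "q $ i = a * p0 $ i + b * q0 $ i" for i using arg_cong[OF q, of "\<lambda>x. x $ i"] by simp
  have "a \<noteq> 0 \<or> b \<noteq> 0"
  proof (rule ccontr)
    assume "\<not> ?thesis"
    then show False using assms(3) q by simp
  qed
  then show ?thesis
  proof
    assume a: "a \<noteq> 0"
    let ?x = "1 *s y0 + (- b / a) *s x0" and ?y = "(1 / a) *s x0 + 0 *s y0"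
    have nth': "v $ i = lin \<alpha> v * \<nu> $ i + lin ?x v * q0 $ i + lin ?y v * q $ i" for v i
      unfolding lin_lincomb qnth nth[of v i]
      using change_basis_coeffs[OF a, of "lin y0 v" b "lin x0 v" "q0 $ i" "p0 $ i"] by (simp only: add.assoc)
    have "lin \<alpha> v *s \<nu> + lin ?x v *s q0 + lin ?y v *s q = v" for v
      by (rule frame_vecI[OF nth'])
    moreover have "lin ?x q = 0" "lin ?y q = 1"
      unfolding lin_lincomb using a by (simp_all flip: a_def b_def)
    ultimately have "frame \<alpha> \<nu> q0 q ?x ?y"
      using fr assms(2) unfolding frame_def lin_lincomb by simp
    then show ?thesis by (rule that)
  next
    assume b: "b \<noteq> 0"
    let ?x = "1 *s x0 + (- a / b) *s y0" and ?y = "(1 / b) *s y0 + 0 *s x0"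
    have nth': "v $ i = lin \<alpha> v * \<nu> $ i + lin ?x v * p0 $ i + lin ?y v * q $ i" for v i
      unfolding lin_lincomb qnth nth[of v i]
      using change_basis_coeffs[OF b, of "lin x0 v" a "lin y0 v" "p0 $ i" "q0 $ i"]
      by (simp only: add.assoc add.commute[of "a * _"] add.commute[of "_ * p0 $ i"])
    have "lin \<alpha> v *s \<nu> + lin ?x v *s p0 + lin ?y v *s q = v" for v
      by (rule frame_vecI[OF nth'])
    moreover have "lin ?x q = 0" "lin ?y q = 1"
      unfolding lin_lincomb using b by (simp_all flip: a_def b_def)
    ultimately have "frame \<alpha> \<nu> p0 q ?x ?y"
      using fr assms(2) unfolding frame_def lin_lincomb by simp
    then show ?thesis by (rule that)
  qed
qed

lemma frame_plane:
  assumes "frame \<alpha> \<nu> p q x y" "lin \<alpha> v = 0"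
  shows "v = lin x v *s p + lin y v *s q"
proof -
  have "lin \<alpha> v *s \<nu> + lin x v *s p + lin y v *s q = v" using assms(1) by (simp add: frame_def)
  then show ?thesis using assms(2) by simp
qed

lemma frame_line: "frame \<alpha> \<nu> p q x y \<Longrightarrow> lin \<alpha> (p + t *s q) = 0"
  by (simp add: frame_def lin_simps)

lemma frame_line_nz: "frame \<alpha> \<nu> p q x y \<Longrightarrow> p + t *s q \<noteq> 0"
proof
  assume f: "frame \<alpha> \<nu> p q x y" and "p + t *s q = 0"
  then have "lin x (p + t *s q) = 0" by simp
  then show False using f by (simp add: frame_def lin_simps)
qed

lemma frame_q_nz: "frame \<alpha> \<nu> p q x y \<Longrightarrow> q \<noteq> 0"
  by (auto simp: frame_def)

lemma homog_line_poly_int: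
  assumes "homog k F"
  shows "\<exists>P. (\<forall>t. F (u + t *s w) = poly P t) \<and> (k \<ge> 0 \<longrightarrow> degree P \<le> nat k \<and> coeff P (nat k) = F w) \<and>
           (k < 0 \<longrightarrow> P = 0)"
proof (cases "k \<ge> 0")
  case True
  from homog_line_poly[OF assms True, of u w] obtain P where
    "\<And>t. F (u + t *s w) = poly P t" "degree P \<le> nat k" "coeff P (nat k) = F w" by blast
  then show ?thesis by (intro exI[of _ P]) (use True in auto)
next
  case False
  show ?thesis by (intro exI[of _ 0]) (use False homog_cases(2)[OF assms] in auto)
qed

lemma homog_at_zero:
  assumes "homog k F" "\<And>t. t \<noteq> 0 \<Longrightarrow> F (t *s v) = 0"
  shows "F 0 = 0"
proof -
  from homog_poly_on_lines[OF assms(1)] obtain P where P: "\<And>t. F (0 + t *s v) = poly P t"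
    by (rule poly_on_linesE) blast
  have "P = 0" by (rule poly_eq_if_cofinitely_equal[of "{0}"]) (use assms(2) P in auto)
  then show ?thesis using P[of 0] by simp
qed

lemma homog_zero_on_plane:
  assumes f: "frame \<alpha> \<nu> p q x y" and F: "homog k F" and z: "\<And>t. F (p + t *s q) = 0" and v: "lin \<alpha> v = 0"
  shows "F v = 0"
proof (cases "k < 0")
  case True
  then show ?thesis using homog_cases(2)[OF F] by simp
next
  case False
  obtain P where P: "\<And>t. F (p + t *s q) = poly P t" "coeff P (nat k) = F q"
    using homog_line_poly_int[OF F, of p q] False by auto
  have "P = 0" by (rule poly_eqI_all) (use z P in auto)
  then have Fq: "F q = 0" using P(2) by simp
  have F0: "F 0 = 0" by (rule homog_at_zero[OF F, of q]) (simp add: homog_scale[OF F] Fq)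
  have v': "v = lin x v *s p + lin y v *s q" by (rule frame_plane[OF f v])
  show ?thesis
  proof (cases "lin x v = 0")
    case True
    show ?thesis
    proof (cases "lin y v = 0")
      case True
      then show ?thesis using v' \<open>lin x v = 0\<close> F0 by simp
    next
      case False
      then have "F (lin y v *s q) = 0" using homog_scale[OF F] Fq by simp
      then show ?thesis using v' True by simp
    qed
  next
    case False
    have "v = lin x v *s (p + (lin y v / lin x v) *s q)"
      using v' False by (simp add: Finite_Cartesian_Product.vec_eq_iff algebra_simps)
    then have "F v = F (lin x v *s (p + (lin y v / lin x v) *s q))" by (rule arg_cong)
    also have "\<dots> = 0" by (subst homog_scale[OF F False]) (simp add: z)
    finally show ?thesis .
  qed
qed

lemma homog_eq_on_plane:
  assumes "frame \<alpha> \<nu> p q x y" "homog k F" "homog k G" "\<And>t. F (p + t *s q) = G (p + t *s q)" "lin \<alpha> v = 0"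
  shows "F v = G v"
  using homog_zero_on_plane[OF assms(1) homog_diff[OF assms(2,3)] _ assms(5)] assms(4) by simp

lemma nonvanishing_direction:
  assumes "homog k F" "\<alpha> \<noteq> 0" "lin \<alpha> v = 0" "F v \<noteq> 0"
  obtains q where "q \<noteq> 0" "lin \<alpha> q = 0" "F q \<noteq> 0"
proof (cases "v = 0")
  case True
  obtain \<nu> p q x y where f: "frame \<alpha> \<nu> p q x y" using frame_exists_some[OF assms(2)] by blast
  have "F q \<noteq> 0"
  proof
    assume "F q = 0"
    then have "F 0 = 0" by (intro homog_at_zero[OF assms(1), of q]) (simp add: homog_scale[OF assms(1)])
    then show False using assms(4) True by simp
  qed
  then show ?thesis using that f frame_q_nz[OF f] by (auto simp: frame_def)
qed (use assms that in blast)

lemma homog_has_zero_on_plane: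
  assumes F: "homog k F" and k: "k > 0" and \<alpha>: "\<alpha> \<noteq> 0"
  obtains v where "v \<noteq> 0" "lin \<alpha> v = 0" "F v = 0"
proof -
  obtain \<nu> p q x y where f: "frame \<alpha> \<nu> p q x y" using frame_exists_some[OF \<alpha>] by blast
  show ?thesis
  proof (cases "F q = 0")
    case True
    then show ?thesis using that f frame_q_nz[OF f] by (auto simp: frame_def)
  next
    case False
    obtain P where P: "\<And>t. F (p + t *s q) = poly P t" "coeff P (nat k) = F q"
      using homog_line_poly_int[OF F, of p q] k by auto
    have "degree P \<ge> nat k" by (rule le_degree) (simp add: P False)
    then have "degree P \<noteq> 0" using k by linarith
    then have "\<not> constant (poly P)" by (simp add: constant_degree)
    then obtain t where "poly P t = 0" using fundamental_theorem_of_algebra by blast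
    then show ?thesis using that[of "p + t *s q"] P(1) frame_line[OF f] frame_line_nz[OF f] by simp
  qed
qed

lemma nonvanishing_on_plane_degree:
  assumes "homog k F" "\<alpha> \<noteq> 0" "\<And>v. v \<noteq> 0 \<Longrightarrow> lin \<alpha> v = 0 \<Longrightarrow> F v \<noteq> 0"
  shows "k = 0"
proof -
  obtain \<nu> p q x y where f: "frame \<alpha> \<nu> p q x y" using frame_exists_some[OF assms(2)] by blast
  have "F q \<noteq> 0" using assms(3) frame_q_nz[OF f] f by (auto simp: frame_def)
  then have "\<not> k < 0" using homog_cases(2)[OF assms(1)] by auto
  moreover have "\<not> k > 0" using homog_has_zero_on_plane[OF assms(1) _ assms(2)] assms(3) by metis
  ultimately show ?thesis by simp
qed

lemma nonvanishing_constant: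
  assumes F: "homog k F" and nz: "\<And>v. v \<noteq> 0 \<Longrightarrow> F v \<noteq> 0"
  shows "k = 0 \<and> (\<exists>c. c \<noteq> 0 \<and> (\<forall>v. F v = c))"
proof -
  have "pt 1 0 0 \<noteq> 0" by (simp add: vec3_eq_iff)
  then have k: "k = 0" using nonvanishing_on_plane_degree[OF F, of "pt 1 0 0"] nz by blast
  then have "F v = F 0" for v using F homog_0_const by blast
  moreover from this[of "pt 1 0 0"] have "F 0 \<noteq> 0" using nz[OF \<open>pt 1 0 0 \<noteq> 0\<close>] by simp
  ultimately show ?thesis using k by blast
qed

text \<open>In coordinates in which the linear form is the first coordinate, the terms free of that coordinate
  vanish.\<close>

lemma linear_form_division:
  assumes \<alpha>: "\<alpha> \<noteq> 0" and F: "homog k F" and z: "\<And>v. lin \<alpha> v = 0 \<Longrightarrow> F v = 0"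
  obtains G where "homog (k - 1) G" "\<And>v. F v = lin \<alpha> v * G v"
proof (cases "k < 0")
  case True
  then show ?thesis using homog_cases(2)[OF F] that[of "\<lambda>v. 0"] by simp
next
  case False
  obtain \<nu> p q x y where f: "frame \<alpha> \<nu> p q x y" using frame_exists_some[OF \<alpha>] by blast
  define M :: "vec3 \<Rightarrow> vec3" where "M v = v $ 1 *s \<nu> + v $ 2 *s p + v $ 3 *s q" for v
  have FM: "homog k (\<lambda>v. F (M v))"
    by (rule homog_linear_comp[OF F]) (auto simp: M_def Finite_Cartesian_Product.vec_eq_iff algebra_simps)
  have linM: "lin \<alpha> (M v) = v $ 1" for v using f by (simp add: M_def frame_def lin_simps)
  from homog_cases(1)[OF FM] False obtain c where
    c: "\<And>v. F (M v) = (\<Sum>i\<le>nat k. \<Sum>j\<le>nat k - i. c i j * (v $ 1) ^ i * (v $ 2) ^ j * (v $ 3) ^ (nat k - i - j))"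
    unfolding form_def by auto
  have inv: "M (pt (lin \<alpha> v) (lin x v) (lin y v)) = v" for v
    using f by (simp add: M_def frame_def)
  show ?thesis
  proof (cases "nat k")
    case 0
    have "F v = 0" for v
    proof -
      have "F (M w) = c 0 0" for w using c[of w] 0 by simp
      moreover have "F (M 0) = 0" using z by (simp add: linM)
      ultimately show ?thesis by (metis inv)
    qed
    then show ?thesis using that[of "\<lambda>v. 0"] by simp
  next
    case (Suc m)
    define G' where "G' v = (\<Sum>i\<le>m. \<Sum>j\<le>m - i. c (Suc i) j * (v $ 1) ^ i * (v $ 2) ^ j * (v $ 3) ^ (m - i - j))" for v :: vec3
    have "form m G'" unfolding form_def G'_def by (rule exI[of _ "\<lambda>i. c (Suc i)"]) simp
    then have G': "homog (k - 1) G'" using Suc False by (simp add: form_iff_homog)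
       (metis (no_types, opaque_lifting) add_diff_cancel_left' int_nat_eq leI of_nat_Suc)
    have eq: "F (M v) = v $ 1 * G' v" for v
    proof -
      let ?t = "\<lambda>v i. \<Sum>j\<le>Suc m - i. c i j * (v $ 1) ^ i * (v $ 2) ^ j * (v $ 3) ^ (Suc m - i - j)"
      have split: "F (M v) = ?t v 0 + v $ 1 * G' v" for v :: vec3
      proof -
        have "F (M v) = ?t v 0 + (\<Sum>i\<le>m. ?t v (Suc i))"
          using c[of v] unfolding Suc by (subst sum.atMost_Suc_shift[symmetric]) simp
        also have "(\<Sum>i\<le>m. ?t v (Suc i)) = v $ 1 * G' v"
          unfolding G'_def sum_distrib_left by (intro sum.cong) (auto simp: algebra_simps)
        finally show ?thesis .
      qed
      have "F (M (pt 0 (v $ 2) (v $ 3))) = 0" using z by (simp add: linM)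
      then have "?t v 0 = 0" using split[of "pt 0 (v $ 2) (v $ 3)"] by simp
      then show ?thesis using split[of v] by simp
    qed
    define G where "G v = G' (pt (lin \<alpha> v) (lin x v) (lin y v))" for v
    have "homog (k - 1) G" unfolding G_def
      by (rule homog_linear_comp[OF G']) (auto simp: vec3_eq_iff lin_simps)
    moreover have "F v = lin \<alpha> v * G v" for v
      using eq[of "pt (lin \<alpha> v) (lin x v) (lin y v)"] by (simp add: inv G_def)
    ultimately show ?thesis by (rule that)
  qed
qed

lemma binary_form_lift:
  assumes f: "frame \<alpha> \<nu> p q x y" and U: "degree U \<le> k"
  obtains u where "homog (int k) u" "\<And>t. u (p + t *s q) = poly U t"
proof -
  define u where "u v = (\<Sum>i\<le>k. coeff U i * lin x v ^ (k - i) * lin y v ^ i)" for v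
  have "homog (int k) u" unfolding u_def
  proof (intro homog_sum)
    fix i assume "i \<in> {..k}"
    then show "homog (int k) (\<lambda>v. coeff U i * lin x v ^ (k - i) * lin y v ^ i)"
      by (intro homog_mult'[OF homog_mult[OF homog_const homog_power[OF homog_lin]] homog_power[OF homog_lin]]) auto
  qed
  moreover have "u (p + t *s q) = poly U t" for t
  proof -
    have "poly U t = (\<Sum>i\<le>k. coeff U i * t ^ i)"
      using poly_as_sum_of_monoms'[OF U, THEN arg_cong[of _ _ "\<lambda>p. poly p t"]]
      by (simp add: poly_sum poly_monom)
    then show ?thesis using f by (simp add: u_def frame_def lin_simps)
  qed
  ultimately show ?thesis by (rule that)
qed

lemma coprime_polyI:
  fixes B G :: "complex poly"
  assumes "B \<noteq> 0" "\<And>t. poly B t = 0 \<Longrightarrow> poly G t \<noteq> 0"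
  shows "coprime B G"
proof (rule coprimeI)
  fix d assume d: "d dvd B" "d dvd G"
  then have "d \<noteq> 0" using assms(1) by auto
  have "degree d = 0"
  proof (rule ccontr)
    assume "degree d \<noteq> 0"
    then have "\<not> constant (poly d)" by (simp add: constant_degree)
    then obtain t where "poly d t = 0" using fundamental_theorem_of_algebra by blast
    then have "poly B t = 0" "poly G t = 0" using d by (auto elim!: dvdE)
    then show False using assms(2) by blast
  qed
  then show "is_unit d" using \<open>d \<noteq> 0\<close> by (simp add: is_unit_iff_degree)
qed

text \<open>On the projective line \<open>\<alpha> = 0\<close> a syzygy of two forms without common zero is a multiple of the trivial
  one. With a point at infinity where \<open>\<beta>\<close> does not vanish this is division by a coprime polynomial in
  one variable, and the degree of the restriction of \<open>\<beta>\<close> is exactly \<open>m\<close>, so that the quotient has the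
  right degree.\<close>

lemma coprime_division_on_plane:
  assumes \<alpha>: "\<alpha> \<noteq> 0" and \<beta>: "homog m \<beta>" and \<gamma>: "homog m' \<gamma>" and P: "homog e P" and Q: "homog e' Q"
    and deg: "e + m' = e' + m"
    and ncz: "\<And>v. v \<noteq> 0 \<Longrightarrow> lin \<alpha> v = 0 \<Longrightarrow> \<beta> v \<noteq> 0 \<or> \<gamma> v \<noteq> 0"
    and rel: "\<And>v. lin \<alpha> v = 0 \<Longrightarrow> \<beta> v * Q v + \<gamma> v * P v = 0"
  obtains u where "homog (e - m) u" "\<And>v. lin \<alpha> v = 0 \<Longrightarrow> P v = \<beta> v * u v"
    "\<And>v. lin \<alpha> v = 0 \<Longrightarrow> Q v = - \<gamma> v * u v"
proof (cases "\<forall>v. lin \<alpha> v = 0 \<longrightarrow> \<beta> v = 0")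
  case True
  then have nz: "v \<noteq> 0 \<Longrightarrow> lin \<alpha> v = 0 \<Longrightarrow> \<gamma> v \<noteq> 0" for v using ncz by blast
  then have m': "m' = 0" by (rule nonvanishing_on_plane_degree[OF \<gamma> \<alpha>])
  then have c: "\<gamma> v = \<gamma> 0" for v using homog_0_const \<gamma> by blast
  obtain \<nu> p q x y where "frame \<alpha> \<nu> p q x y" using frame_exists_some[OF \<alpha>] by blast
  then have "\<gamma> q \<noteq> 0" using nz frame_q_nz by (auto simp: frame_def)
  then have c0: "\<gamma> 0 \<noteq> 0" using c[of q] by simp
  have "e - m = e'" using deg m' by simp
  then have "homog (e - m) (\<lambda>v. - (1 / \<gamma> 0) * Q v)" using homog_cmult[OF Q] by presburger
  then show ?thesis
  proof (rule that)
    fix v assume v: "lin \<alpha> v = 0"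
    have "\<beta> v = 0" using True v by blast
    then have "P v = 0" using rel[OF v] c[of v] c0 by simp
    then show "P v = \<beta> v * (- (1 / \<gamma> 0) * Q v)" using \<open>\<beta> v = 0\<close> by simp
    show "Q v = - \<gamma> v * (- (1 / \<gamma> 0) * Q v)" using c[of v] c0 by simp
  qed
next
  case False
  then obtain v where "lin \<alpha> v = 0" "\<beta> v \<noteq> 0" by blast
  from nonvanishing_direction[OF \<beta> \<alpha> this] obtain q where
    q: "q \<noteq> 0" "lin \<alpha> q = 0" "\<beta> q \<noteq> 0" by blast
  from frame_exists[OF \<alpha> q(2,1)] obtain \<nu> p x y where f: "frame \<alpha> \<nu> p q x y" .
  have m: "m \<ge> 0" using homog_cases(2)[OF \<beta>] q(3) by (metis leI)
  obtain B where B: "\<And>t. \<beta> (p + t *s q) = poly B t" "degree B \<le> nat m" "coeff B (nat m) = \<beta> q"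
    using homog_line_poly_int[OF \<beta>, of p q] m by blast
  obtain G where G: "\<And>t. \<gamma> (p + t *s q) = poly G t"
    using homog_line_poly_int[OF \<gamma>, of p q] by blast
  obtain P' where
    P': "\<And>t. P (p + t *s q) = poly P' t" "e \<ge> 0 \<Longrightarrow> degree P' \<le> nat e" "e < 0 \<Longrightarrow> P' = 0"
    using homog_line_poly_int[OF P, of p q] by blast
  obtain Q' where Q': "\<And>t. Q (p + t *s q) = poly Q' t"
    using homog_line_poly_int[OF Q, of p q] by blast
  have B0: "B \<noteq> 0" using B(3) q(3) by auto
  have dB: "degree B = nat m" using B(2,3) q(3) le_degree[of B "nat m"] by auto
  have cop: "coprime B G"
    by (rule coprime_polyI[OF B0])
       (use ncz[OF frame_line_nz[OF f] frame_line[OF f]] in \<open>auto simp: B(1) G\<close>)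
  have rel': "B * Q' + G * P' = 0"
    by (rule poly_eqI_all) (use rel[OF frame_line[OF f]] B(1) G P'(1) Q' in simp)
  then have "G * P' = B * (- Q')" by (simp add: add_eq_0_iff)
  then have "B dvd G * P'" by simp
  then have "B dvd P'" using cop by (simp add: coprime_dvd_mult_right_iff)
  then obtain U where U: "P' = B * U" by (elim dvdE)
  have "B * (Q' + G * U) = 0" using rel' unfolding U by (simp add: algebra_simps)
  then have Q'': "Q' = - (G * U)" using B0 by (simp add: add_eq_0_iff2)
  obtain u where u: "homog (e - m) u" "\<And>t. u (p + t *s q) = poly U t"
  proof (cases "U = 0")
    case True
    then show ?thesis using that[of "\<lambda>v. 0"] by simp
  next
    case False
    then have "P' \<noteq> 0" using U B0 by simp
    then have e: "e \<ge> 0" using P'(3) by (metis leI)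
    have "degree P' = nat m + degree U" unfolding U using B0 False by (simp add: degree_mult_eq dB)
    then have *: "nat m + degree U \<le> nat e" using P'(2)[OF e] by simp
    then have "degree U \<le> nat (e - m)" using m e by linarith
    moreover have "int (nat (e - m)) = e - m" using * m e by linarith
    ultimately show ?thesis using binary_form_lift[OF f, of U "nat (e - m)"] that by metis
  qed
  show ?thesis
  proof (rule that[OF u(1)])
    fix v assume v: "lin \<alpha> v = 0"
    show "P v = \<beta> v * u v"
      by (rule homog_eq_on_plane[OF f P homog_mult'[OF \<beta> u(1)] _ v]) (auto simp: P' U B(1) u(2))
    show "Q v = - \<gamma> v * u v"
      by (rule homog_eq_on_plane[OF f Q homog_mult'[OF homog_minus[OF \<gamma>] u(1)] _ v])
         (use deg in \<open>auto simp: Q' Q'' G u(2)\<close>)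
  qed
qed

section \<open>Arrangements and their defining polynomials\<close>

lemma line_coeffs_props:
  assumes "is_line H"
  shows "line_coeffs H \<noteq> 0" and "v \<in> H \<longleftrightarrow> lin (line_coeffs H) v = 0"
proof -
  have "line_coeffs H \<noteq> 0 \<and> H = {v. (\<Sum>i\<in>UNIV. line_coeffs H $ i * v $ i) = 0}"
    using assms unfolding is_line_def line_coeffs_def by (rule someI_ex)
  then show "line_coeffs H \<noteq> 0" "v \<in> H \<longleftrightarrow> lin (line_coeffs H) v = 0"
    unfolding lin_def by auto
qed

lemma line_form_nonzero:
  assumes "is_line H" shows "\<exists>w. lin (line_coeffs H) w \<noteq> 0"
proof -
  obtain \<nu> p q x y where "frame (line_coeffs H) \<nu> p q x y"
    using frame_exists_some[OF line_coeffs_props(1)[OF assms]] by blast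
  then have "lin (line_coeffs H) \<nu> \<noteq> 0" by (simp add: frame_def)
  then show ?thesis by blast
qed

lemma defining_poly_lin: "defining_poly A v = (\<Prod>H\<in>A. lin (line_coeffs H) v)"
  by (simp add: defining_poly_def lin_def)

lemma homog_defining_poly: "homog (int (card A)) (defining_poly A)"
  using homog_prod[of A "\<lambda>_. 1" "\<lambda>H. lin (line_coeffs H)", OF homog_lin]
  by (simp add: defining_poly_lin[abs_def])

lemma defining_poly_insert:
  "finite A \<Longrightarrow> H \<notin> A \<Longrightarrow> defining_poly (insert H A) v = lin (line_coeffs H) v * defining_poly A v"
  by (simp add: defining_poly_lin)

lemma line_closed:
  assumes "is_line H" "u \<in> H" "v \<in> H"
  shows "u + t *s (v - u) \<in> H" "u + v \<in> H" "u - v \<in> H" "c *s u \<in> H"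
  using assms by (simp_all add: line_coeffs_props lin_simps)

lemma lines_eq_if_subset:
  assumes "is_line H" "is_line K" "H \<subseteq> K"
  shows "H = K"
proof -
  obtain \<nu> p q x y where f: "frame (line_coeffs H) \<nu> p q x y"
    using frame_exists_some line_coeffs_props(1)[OF assms(1)] by blast
  have pq: "lin (line_coeffs K) p = 0" "lin (line_coeffs K) q = 0"
    using f assms(3) line_coeffs_props(2)[OF assms(1)] line_coeffs_props(2)[OF assms(2)]
    by (auto simp: frame_def)
  have K: "lin (line_coeffs K) v = lin (line_coeffs H) v * lin (line_coeffs K) \<nu>" for v
  proof -
    have "v = lin (line_coeffs H) v *s \<nu> + lin x v *s p + lin y v *s q" using f unfolding frame_def by simp
    then have "lin (line_coeffs K) v = lin (line_coeffs K) (lin (line_coeffs H) v *s \<nu> + lin x v *s p + lin y v *s q)"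
      by (rule arg_cong)
    then show ?thesis by (simp add: lin_simps pq)
  qed
  have "lin (line_coeffs K) \<nu> \<noteq> 0"
  proof
    assume "lin (line_coeffs K) \<nu> = 0"
    then have "lin (axis i 1) (line_coeffs K) = 0" for i using K by (metis lin_commute mult_zero_right)
    then show False using line_coeffs_props(1)[OF assms(2)]
      by (auto simp: lin_axis Finite_Cartesian_Product.vec_eq_iff)
  qed
  then have "v \<in> H \<longleftrightarrow> v \<in> K" for v
    using K[of v] unfolding line_coeffs_props(2)[OF assms(1)] line_coeffs_props(2)[OF assms(2)] by (metis mult_eq_0_iff)
  then show ?thesis by blast
qed

lemma defining_poly_nonzero_on_line:
  assumes "finite A" "\<And>K. K \<in> A \<Longrightarrow> is_line K" "is_line H" "H \<notin> A"
  shows "\<exists>v\<in>H. defining_poly A v \<noteq> 0"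
  using assms
proof (induction A rule: finite_induct)
  case empty
  have "0 \<in> H" using empty by (simp add: line_coeffs_props)
  then show ?case by (auto simp: defining_poly_lin)
next
  case (insert K A)
  then obtain v where v: "v \<in> H" "defining_poly A v \<noteq> 0" by blast
  obtain w where w: "w \<in> H" "w \<notin> K"
    using lines_eq_if_subset[of H K] insert by blast
  show ?case
  proof (rule ccontr)
    assume "\<not> ?case"
    then have z: "defining_poly A v * lin (line_coeffs K) v = 0" if "v \<in> H" for v
      using that insert by (auto simp: defining_poly_insert)
    have "lin (line_coeffs K) w = 0"
      by (rule poly_on_lines_mult_eq_zero[OF homog_poly_on_lines[OF homog_defining_poly[of A]]
            poly_on_lines_lin, of H, OF line_closed(1)[OF \<open>is_line H\<close>] z v w(1)])
    then show False using w insert by (simp add: line_coeffs_props)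
  qed
qed

text \<open>A line is irreducible and not covered by finitely many other lines.\<close>

lemma zero_on_line_cancel:
  assumes "finite A" "\<And>K. K \<in> A \<Longrightarrow> is_line K" "is_line H" "H \<notin> A" "poly_on_lines G"
    and "\<And>v. v \<in> H \<Longrightarrow> defining_poly A v * G v = 0" "v \<in> H"
  shows "G v = 0"
proof -
  obtain u where u: "u \<in> H" "defining_poly A u \<noteq> 0"
    using defining_poly_nonzero_on_line[OF assms(1-4)] by blast
  show ?thesis
    by (rule poly_on_lines_mult_eq_zero[OF homog_poly_on_lines[OF homog_defining_poly[of A]] assms(5), of H,
          OF line_closed(1)[OF assms(3)] assms(6) u assms(7)])
qed

lemma defining_poly_nonzero:
  assumes "arrangement A"
  shows "\<exists>v. defining_poly A v \<noteq> 0"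
proof -
  have fin: "finite A" and li: "\<And>H. H \<in> A \<Longrightarrow> is_line H" using assms by (auto simp: arrangement_def)
  from fin li show ?thesis
  proof (induction A rule: finite_induct)
    case empty then show ?case by (simp add: defining_poly_lin)
  next
    case (insert K A)
    then obtain v where v: "defining_poly A v \<noteq> 0" by blast
    have "\<exists>w. lin (line_coeffs K) w \<noteq> 0"
    proof (rule ccontr)
      assume "\<not> ?thesis"
      then have "lin (axis i 1) (line_coeffs K) = 0" for i by (metis lin_commute)
      then show False using line_coeffs_props(1)[of K] insert
        by (auto simp: lin_axis Finite_Cartesian_Product.vec_eq_iff)
    qed
    then obtain w where w: "lin (line_coeffs K) w \<noteq> 0" by blast
    show ?case
    proof (rule ccontr)
      assume "\<not> ?case"
      then have z: "defining_poly A v * lin (line_coeffs K) v = 0" if "v \<in> UNIV" for v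
        using insert by (auto simp: defining_poly_insert)
      have "lin (line_coeffs K) w = 0"
        by (rule poly_on_lines_mult_eq_zero[OF homog_poly_on_lines[OF homog_defining_poly[of A]]
              poly_on_lines_lin, where S = UNIV and u = v]) (use z v in auto)
      then show False using w by simp
    qed
  qed
qed

lemma poly_on_lines_cancel:
  assumes "arrangement A" "poly_on_lines G" "\<And>v. defining_poly A v * G v = 0"
  shows "G v = 0"
proof -
  obtain u where u: "defining_poly A u \<noteq> 0" using defining_poly_nonzero[OF assms(1)] by blast
  show ?thesis
    by (rule poly_on_lines_mult_eq_zero[OF homog_poly_on_lines[OF homog_defining_poly[of A]] assms(2), where S = UNIV and u = u])
       (use assms(3) u in auto)
qed

text \<open>The linear forms can be divided out one after the other, as none of them vanishes on another line.\<close>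

lemma defining_poly_dvd:
  assumes "arrangement A" "homog k F" "\<And>H v. H \<in> A \<Longrightarrow> v \<in> H \<Longrightarrow> F v = 0"
  obtains G where "homog (k - int (card A)) G" "\<And>v. F v = defining_poly A v * G v"
proof -
  have fin: "finite A" and li: "\<And>H. H \<in> A \<Longrightarrow> is_line H" using assms(1) by (auto simp: arrangement_def)
  from fin li assms(3) have "\<exists>G. homog (k - int (card A)) G \<and> (\<forall>v. F v = defining_poly A v * G v)"
  proof (induction A rule: finite_induct)
    case empty
    then show ?case using assms(2) by (intro exI[of _ F]) (simp add: defining_poly_lin)
  next
    case (insert H A)
    then obtain G where G: "homog (k - int (card A)) G" "\<And>v. F v = defining_poly A v * G v" by blast
    have H: "is_line H" using insert by simp
    have z: "G v = 0" if "lin (line_coeffs H) v = 0" for v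
      by (rule zero_on_line_cancel[of A H G v])
         (use insert that H G homog_poly_on_lines[OF G(1)] in \<open>auto simp: line_coeffs_props\<close>)
    from linear_form_division[OF line_coeffs_props(1)[OF H] G(1) z] obtain G' where
      G': "homog (k - int (card A) - 1) G'" "\<And>v. G v = lin (line_coeffs H) v * G' v" by blast
    show ?case using G' G insert by (intro exI[of _ G']) (auto simp: defining_poly_insert algebra_simps)
  qed
  then show ?thesis using that by blast
qed

section \<open>Logarithmic vector fields\<close>

text \<open>With the Euler field \<open>v\<close> as first argument and two vector fields as the others, this is the pairing on
  which the whole argument rests.\<close>

definition det3 :: "vec3 \<Rightarrow> vec3 \<Rightarrow> vec3 \<Rightarrow> complex" where
  "det3 u v w = u $ 1 * (v $ 2 * w $ 3 - v $ 3 * w $ 2) - u $ 2 * (v $ 1 * w $ 3 - v $ 3 * w $ 1)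
     + u $ 3 * (v $ 1 * w $ 2 - v $ 2 * w $ 1)"

lemma det3_gram:
  "det3 a b c * det3 u v w =
     lin a u * (lin b v * lin c w - lin b w * lin c v) - lin a v * (lin b u * lin c w - lin b w * lin c u)
     + lin a w * (lin b u * lin c v - lin b v * lin c u)"
  unfolding det3_def lin_vec3 by (simp add: algebra_simps)

lemma det3_lincomb:
  "det3 v (a *s u + b *s w) z = a * det3 v u z + b * det3 v w z"
  "det3 v z (a *s u + b *s w) = a * det3 v z u + b * det3 v z w"
  "det3 (a *s u + b *s w) v z = a * det3 u v z + b * det3 w v z"
  by (simp_all add: det3_def algebra_simps)

lemma det3_scale [simp]:
  "det3 (a *s v) u w = a * det3 v u w" "det3 v (a *s u) w = a * det3 v u w" "det3 v u (a *s w) = a * det3 v u w"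
  by (simp_all add: det3_def algebra_simps)

lemma det3_add:
  "det3 (u + u') v w = det3 u v w + det3 u' v w" "det3 v (u + u') w = det3 v u w + det3 v u' w"
  "det3 v w (u + u') = det3 v w u + det3 v w u'"
  by (simp_all add: det3_def algebra_simps)

lemma det3_repeat [simp]: "det3 v v w = 0" "det3 v w v = 0" "det3 w v v = 0" "det3 0 v w = 0" "det3 v 0 w = 0" "det3 v w 0 = 0"
  by (simp_all add: det3_def algebra_simps)

lemma det3_swap: "det3 v w u = - det3 v u w" "det3 u v w = - det3 v u w"
  by (simp_all add: det3_def algebra_simps)

lemma frame_det3:
  assumes "frame \<alpha> \<nu> p q x y" shows "det3 \<nu> p q \<noteq> 0"
proof -
  have "det3 \<alpha> x y * det3 \<nu> p q = 1" unfolding det3_gram using assms by (simp add: frame_def)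
  then show ?thesis by auto
qed

lemma frame_det3_plane:
  assumes f: "frame \<alpha> \<nu> p q x y" and v: "lin \<alpha> v = 0" and w: "lin \<alpha> w = 0"
  shows "det3 u v w = lin \<alpha> u * (lin x v * lin y w - lin y v * lin x w) * det3 \<nu> p q"
proof -
  define a b c d where "a = lin x v" and "b = lin y v" and "c = lin x w" and "d = lin y w"
  define r s m where "r = lin \<alpha> u" and "s = lin x u" and "m = lin y u"
  have "v = a *s p + b *s q" "w = c *s p + d *s q"
    using frame_plane[OF f v] frame_plane[OF f w] unfolding a_def b_def c_def d_def by simp_all
  moreover have "u = r *s \<nu> + s *s p + m *s q" using f unfolding frame_def r_def s_def m_def by simp
  ultimately have "det3 u v w = r * (a * d - b * c) * det3 \<nu> p q"
    by (simp add: det3_def algebra_simps)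
  then show ?thesis unfolding a_def b_def c_def d_def r_def by simp
qed

lemma det3_plane_zero:
  assumes "\<alpha> \<noteq> 0" "lin \<alpha> u = 0" "lin \<alpha> v = 0" "lin \<alpha> w = 0"
  shows "det3 u v w = 0"
proof -
  obtain \<nu> p q x y where f: "frame \<alpha> \<nu> p q x y" using frame_exists_some[OF assms(1)] by blast
  show ?thesis using frame_det3_plane[OF f assms(3,4), of u] assms(2) by simp
qed

definition vform :: "int \<Rightarrow> (vec3 \<Rightarrow> vec3) \<Rightarrow> bool" where
  "vform k \<theta> \<longleftrightarrow> (\<forall>i. homog k (\<lambda>v. \<theta> v $ i))"

lemma vform_add: "vform k \<theta> \<Longrightarrow> vform k \<psi> \<Longrightarrow> vform k (\<lambda>v. \<theta> v + \<psi> v)"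
  by (simp add: vform_def homog_add)

lemma vform_diff: "vform k \<theta> \<Longrightarrow> vform k \<psi> \<Longrightarrow> vform k (\<lambda>v. \<theta> v - \<psi> v)"
  by (simp add: vform_def homog_diff)

lemma vform_mult: "homog k g \<Longrightarrow> vform l \<theta> \<Longrightarrow> m = k + l \<Longrightarrow> vform m (\<lambda>v. g v *s \<theta> v)"
  by (simp add: vform_def homog_mult)

lemma vform_id: "vform 1 (\<lambda>v. v)"
  by (simp add: vform_def homog_coord)

lemma vform_const: "vform 0 (\<lambda>v. u)"
  by (simp add: vform_def homog_const)

lemma homog_lin_vform: "vform k \<theta> \<Longrightarrow> homog k (\<lambda>v. lin \<alpha> (\<theta> v))"
  unfolding lin_def by (intro homog_sum) (simp add: vform_def homog_cmult)

lemma homog_det3_aux: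
  assumes "homog a F" "homog b G" "homog c H" "homog b G'" "homog c H'"
  shows "homog (a + b + c) (\<lambda>v. F v * (G v * H v - G' v * H' v))"
  using homog_mult[OF assms(1) homog_diff[OF homog_mult[OF assms(2,3)] homog_mult[OF assms(4,5)]]]
  by (simp add: add.assoc)

lemma homog_det3:
  assumes "vform a \<xi>" "vform b \<theta>" "vform c \<psi>"
  shows "homog (a + b + c) (\<lambda>v. det3 (\<xi> v) (\<theta> v) (\<psi> v))"
  unfolding det3_def using assms unfolding vform_def
  by (intro homog_add homog_diff homog_det3_aux) auto

text \<open>The homogeneous vector fields of degree \<open>k\<close> that are tangent to all lines of \<open>A\<close>.\<close>

definition log_field :: "vec3 set set \<Rightarrow> int \<Rightarrow> (vec3 \<Rightarrow> vec3) \<Rightarrow> bool" where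
  "log_field A k \<theta> \<longleftrightarrow> vform k \<theta> \<and> (\<forall>H\<in>A. \<forall>v\<in>H. \<theta> v \<in> H)"

definition grad_pairing :: "vec3 set set \<Rightarrow> vec3 \<Rightarrow> vec3 \<Rightarrow> complex" where
  "grad_pairing A v s = (\<Sum>i\<in>UNIV. partial_deriv i (defining_poly A) v * s $ i)"

lemma arrangementD: "arrangement A \<Longrightarrow> finite A" "arrangement A \<Longrightarrow> H \<in> A \<Longrightarrow> is_line H"
  by (auto simp: arrangement_def)

lemma lin_update: "lin \<alpha> (\<chi> j. if j = i then t else v $ j) = lin \<alpha> v + \<alpha> $ i * (t - v $ i)"
proof -
  have "lin \<alpha> (\<chi> j. if j = i then t else v $ j) = (\<Sum>j\<in>UNIV. \<alpha> $ j * v $ j + (if j = i then \<alpha> $ i * (t - v $ i) else 0))"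
    unfolding lin_def by (rule sum.cong) (auto simp: algebra_simps)
  then show ?thesis by (simp add: sum.distrib lin_def)
qed

lemma partial_deriv_defining_poly:
  assumes "finite A"
  shows "partial_deriv i (defining_poly A) v = (\<Sum>H\<in>A. line_coeffs H $ i * defining_poly (A - {H}) v)"
proof -
  let ?u = "\<lambda>t. \<chi> j. if j = i then t else v $ j"
  have v: "?u (v $ i) = v" by (simp add: Finite_Cartesian_Product.vec_eq_iff)
  have "((\<lambda>t. \<Prod>H\<in>A. lin (line_coeffs H) (?u t)) has_field_derivative
      (\<Sum>H\<in>A. line_coeffs H $ i * (\<Prod>K\<in>A - {H}. lin (line_coeffs K) (?u (v $ i))))) (at (v $ i))"
  proof (rule has_field_derivative_prod)
    fix H assume "H \<in> A"
    show "((\<lambda>t. lin (line_coeffs H) (?u t)) has_field_derivative line_coeffs H $ i) (at (v $ i))"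
      unfolding lin_update by (auto intro!: derivative_eq_intros)
  qed
  then have "((\<lambda>t. defining_poly A (?u t)) has_field_derivative
      (\<Sum>H\<in>A. line_coeffs H $ i * defining_poly (A - {H}) v)) (at (v $ i))"
    unfolding defining_poly_lin v .
  then show ?thesis unfolding partial_deriv_def by (rule DERIV_imp_deriv)
qed

lemma grad_pairing_eq:
  assumes "finite A"
  shows "grad_pairing A v s = (\<Sum>H\<in>A. lin (line_coeffs H) s * defining_poly (A - {H}) v)"
proof -
  have "grad_pairing A v s = (\<Sum>i\<in>UNIV. \<Sum>H\<in>A. line_coeffs H $ i * s $ i * defining_poly (A - {H}) v)"
    unfolding grad_pairing_def partial_deriv_defining_poly[OF assms] sum_distrib_right
    by (intro sum.cong) (auto simp: algebra_simps)
  also have "\<dots> = (\<Sum>H\<in>A. \<Sum>i\<in>UNIV. line_coeffs H $ i * s $ i * defining_poly (A - {H}) v)"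
    by (rule sum.swap)
  finally show ?thesis by (simp add: lin_def sum_distrib_right)
qed

lemma grad_pairing_lincomb:
  "grad_pairing A v (a *s s + b *s t) = a * grad_pairing A v s + b * grad_pairing A v t"
  unfolding grad_pairing_def by (simp add: sum.distrib sum_distrib_left algebra_simps)

lemma grad_pairing_scale: "grad_pairing A v (a *s s) = a * grad_pairing A v s"
  using grad_pairing_lincomb[of A v a s 0 0] by simp

lemma grad_pairing_add: "grad_pairing A v (s + t) = grad_pairing A v s + grad_pairing A v t"
  using grad_pairing_lincomb[of A v 1 s 1 t] by simp

lemma defining_poly_remove:
  assumes "finite A" "H \<in> A"
  shows "defining_poly A v = lin (line_coeffs H) v * defining_poly (A - {H}) v"
  using assms by (simp add: defining_poly_lin prod.remove)

lemma euler_identity: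
  assumes "finite A" shows "grad_pairing A v v = of_nat (card A) * defining_poly A v"
proof -
  have "grad_pairing A v v = (\<Sum>H\<in>A. defining_poly A v)"
    unfolding grad_pairing_eq[OF assms]
    by (rule sum.cong[OF refl], rule defining_poly_remove[OF assms, symmetric])
  then show ?thesis by simp
qed

lemma defining_poly_zero_on:
  assumes "arrangement A" "H \<in> A" "v \<in> H" shows "defining_poly A v = 0"
  using defining_poly_remove[OF arrangementD(1)[OF assms(1)] assms(2)] assms
    line_coeffs_props(2)[OF arrangementD(2)[OF assms(1,2)]] by simp

text \<open>On a line \<open>H\<close> of the arrangement only the term of \<open>H\<close> survives in the gradient, so a field
  killing the defining polynomial is tangent to \<open>H\<close>.\<close>

lemma grad_kernel_log_field:
  assumes A: "arrangement A" and \<theta>: "vform k \<theta>" and z: "\<And>v. grad_pairing A v (\<theta> v) = 0"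
  shows "log_field A k \<theta>"
  unfolding log_field_def
proof (intro conjI ballI \<theta>)
  fix H v assume H: "H \<in> A" and v: "v \<in> H"
  note fin = arrangementD(1)[OF A] and li = arrangementD(2)[OF A]
  have "lin (line_coeffs H) (\<theta> v) = 0"
  proof (rule zero_on_line_cancel[of "A - {H}" H _ v])
    show "poly_on_lines (\<lambda>v. lin (line_coeffs H) (\<theta> v))"
      by (rule homog_poly_on_lines[OF homog_lin_vform[OF \<theta>]])
    fix w assume w: "w \<in> H"
    have "defining_poly (A - {K}) w = 0" if "K \<in> A" "K \<noteq> H" for K
      by (rule defining_poly_zero_on[of _ H]) (use A H w that in \<open>auto simp: arrangement_def\<close>)
    then have "(\<Sum>K\<in>A. lin (line_coeffs K) (\<theta> w) * defining_poly (A - {K}) w) =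
      lin (line_coeffs H) (\<theta> w) * defining_poly (A - {H}) w"
      using fin H by (subst sum.remove[of A H]) auto
    then have "lin (line_coeffs H) (\<theta> w) * defining_poly (A - {H}) w = 0"
      using z[of w] unfolding grad_pairing_eq[OF fin] by metis
    then show "defining_poly (A - {H}) w * lin (line_coeffs H) (\<theta> w) = 0"
      by (simp only: mult.commute)
  qed (use fin li H v in auto)
  then show "\<theta> v \<in> H" using line_coeffs_props(2)[OF li[OF H]] by simp
qed

text \<open>Conversely, subtracting a multiple of the Euler field from a logarithmic field kills the defining
  polynomial.\<close>

lemma log_field_mod_euler:
  assumes A: "arrangement A" and ne: "A \<noteq> {}" and \<theta>: "log_field A k \<theta>"
  obtains \<mu> where "homog (k - 1) \<mu>" "\<And>v. grad_pairing A v (\<theta> v + \<mu> v *s v) = 0"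
proof -
  note fin = arrangementD(1)[OF A] and li = arrangementD(2)[OF A]
  have "\<exists>g. homog (k - 1) g \<and> (\<forall>v. lin (line_coeffs H) (\<theta> v) = lin (line_coeffs H) v * g v)" if H: "H \<in> A" for H
  proof -
    have "lin (line_coeffs H) (\<theta> v) = 0" if "lin (line_coeffs H) v = 0" for v
      using \<theta> H that line_coeffs_props(2)[OF li[OF H]] by (auto simp: log_field_def)
    then show ?thesis
      using linear_form_division[OF line_coeffs_props(1)[OF li[OF H]] homog_lin_vform, of k \<theta>] \<theta>
      unfolding log_field_def by metis
  qed
  then obtain g where g: "\<And>H. H \<in> A \<Longrightarrow> homog (k - 1) (g H)"
    "\<And>H v. H \<in> A \<Longrightarrow> lin (line_coeffs H) (\<theta> v) = lin (line_coeffs H) v * g H v" by metis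
  define \<mu> where "\<mu> v = (- 1 / of_nat (card A)) * (\<Sum>H\<in>A. g H v)" for v
  show ?thesis
  proof (rule that)
    show "homog (k - 1) \<mu>" unfolding \<mu>_def by (intro homog_cmult homog_sum g)
    fix v
    have "grad_pairing A v (\<theta> v) = (\<Sum>H\<in>A. defining_poly A v * g H v)"
      unfolding grad_pairing_eq[OF fin]
      by (rule sum.cong) (auto simp: g(2) defining_poly_remove[OF fin, of _ v])
    moreover have "card A \<noteq> 0" using fin ne by simp
    ultimately show "grad_pairing A v (\<theta> v + \<mu> v *s v) = 0"
      unfolding grad_pairing_add grad_pairing_scale euler_identity[OF fin] \<mu>_def
      by (simp add: sum_distrib_left[symmetric])
  qed
qed

text \<open>On a line of the arrangement the three vectors lie in a common plane, so the determinant vanishes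
  there.\<close>

lemma log_pairing:
  assumes A: "arrangement A" and \<theta>: "log_field A k \<theta>" and \<psi>: "log_field A l \<psi>"
  obtains G where "homog (k + l + 1 - int (card A)) G" "\<And>v. det3 v (\<theta> v) (\<psi> v) = defining_poly A v * G v"
proof -
  have "homog (1 + k + l) (\<lambda>v. det3 v (\<theta> v) (\<psi> v))"
    using homog_det3[OF vform_id] \<theta> \<psi> by (simp add: log_field_def)
  then have h: "homog (k + l + 1) (\<lambda>v. det3 v (\<theta> v) (\<psi> v))" by (simp add: add.commute add.left_commute)
  have z: "det3 v (\<theta> v) (\<psi> v) = 0" if "H \<in> A" "v \<in> H" for H v
  proof (rule det3_plane_zero)
    note H = line_coeffs_props[OF arrangementD(2)[OF A that(1)]]
    show "line_coeffs H \<noteq> 0" by (rule H(1))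
    show "lin (line_coeffs H) v = 0" "lin (line_coeffs H) (\<theta> v) = 0" "lin (line_coeffs H) (\<psi> v) = 0"
      using \<theta> \<psi> that unfolding log_field_def H(2)[symmetric] by auto
  qed
  show ?thesis
  proof (rule defining_poly_dvd[OF A h])
    show "det3 v (\<theta> v) (\<psi> v) = 0" if "H \<in> A" "v \<in> H" for H v by (rule z[OF that])
    fix G assume "homog (k + l + 1 - int (card A)) G" "\<And>v. det3 v (\<theta> v) (\<psi> v) = defining_poly A v * G v"
    then show thesis by (rule that)
  qed
qed

text \<open>A constant field along \<open>H\<close> becomes tangent to the other lines when it is multiplied by their
  equations.\<close>

lemma log_field_translate:
  assumes A: "arrangement A" and H: "H \<in> A" and u: "u \<in> H"
  shows "log_field A (int (card A) - 1) (\<lambda>v. defining_poly (A - {H}) v *s u)"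
  unfolding log_field_def
proof (intro conjI ballI)
  have "card A \<ge> 1" using A H by (auto simp: arrangement_def Suc_le_eq card_gt_0_iff)
  then show "vform (int (card A) - 1) (\<lambda>v. defining_poly (A - {H}) v *s u)"
    by (intro vform_mult[OF homog_defining_poly vform_const])
       (use arrangementD(1)[OF A] H in \<open>simp add: card_Diff_singleton of_nat_diff\<close>)
  fix K v assume K: "K \<in> A" and v: "v \<in> K"
  show "defining_poly (A - {H}) v *s u \<in> K"
  proof (cases "K = H")
    case True
    then show ?thesis using line_closed(4)[OF arrangementD(2)[OF A H]] u by blast
  next
    case False
    then have "defining_poly (A - {H}) v = 0"
      by (intro defining_poly_zero_on[of _ K]) (use A K v in \<open>auto simp: arrangement_def\<close>)
    then show ?thesis using line_coeffs_props(2)[OF arrangementD(2)[OF A K]] by simp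
  qed
qed

text \<open>A constant field \<open>p\<close> is tangent to the lines through the point \<open>p\<close>, so only the equations of the
  others are needed.\<close>

lemma log_field_point:
  assumes A: "arrangement A"
  shows "log_field A (int (card {H\<in>A. p \<notin> H})) (\<lambda>v. defining_poly {H\<in>A. p \<notin> H} v *s p)"
  unfolding log_field_def
proof (intro conjI ballI)
  show "vform (int (card {H\<in>A. p \<notin> H})) (\<lambda>v. defining_poly {H\<in>A. p \<notin> H} v *s p)"
    by (intro vform_mult[OF homog_defining_poly vform_const]) simp
  fix K v assume K: "K \<in> A" and v: "v \<in> K"
  show "defining_poly {H\<in>A. p \<notin> H} v *s p \<in> K"
  proof (cases "p \<in> K")
    case True
    then show ?thesis using line_closed(4)[OF arrangementD(2)[OF A K]] by blast
  next
    case False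
    then have "defining_poly {H\<in>A. p \<notin> H} v = 0"
      by (intro defining_poly_zero_on[of _ K]) (use A K v in \<open>auto simp: arrangement_def\<close>)
    then show ?thesis using line_coeffs_props(2)[OF arrangementD(2)[OF A K]] by simp
  qed
qed

lemma defining_poly_nonzero_at:
  assumes "arrangement A" "\<And>H. H \<in> A \<Longrightarrow> p \<notin> H" shows "defining_poly A p \<noteq> 0"
  using assms line_coeffs_props(2)[OF arrangementD(2)[OF assms(1)]]
  by (auto simp: defining_poly_lin arrangement_def)

text \<open>Local freeness at \<open>p\<close>: if \<open>p\<close> lies on the line \<open>H\<close>, spanned by \<open>p\<close> and \<open>u\<close>, the constant
  fields \<open>p\<close> and \<open>u\<close>, multiplied by the factors of the defining polynomial to which they are not
  tangent, do it.\<close>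

lemma log_fields_independent_at:
  assumes A: "arrangement A" and p: "p \<noteq> 0"
  obtains k l m \<delta> \<epsilon> G where "log_field A k \<delta>" "log_field A l \<epsilon>" "homog m G"
    "\<And>v. det3 v (\<delta> v) (\<epsilon> v) = defining_poly A v * G v" "G p \<noteq> 0"
proof (cases "defining_poly A p = 0")
  case False
  obtain u w where uw: "det3 p u w \<noteq> 0"
  proof -
    from p consider "p $ 1 \<noteq> 0" | "p $ 2 \<noteq> 0" | "p $ 3 \<noteq> 0" by (auto simp: vec3_eq_iff)
    then show ?thesis
    proof cases
      case 1 then show ?thesis by (intro that[of "pt 0 1 0" "pt 0 0 1"]) (simp add: det3_def)
    next
      case 2 then show ?thesis by (intro that[of "pt 1 0 0" "pt 0 0 1"]) (simp add: det3_def)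
    next
      case 3 then show ?thesis by (intro that[of "pt 1 0 0" "pt 0 1 0"]) (simp add: det3_def)
    qed
  qed
  let ?n = "int (card A)" and ?f = "defining_poly A"
  have log: "log_field A ?n (\<lambda>v. ?f v *s u)" for u
    unfolding log_field_def
    using vform_mult[OF homog_defining_poly[of A] vform_const[of u]] defining_poly_zero_on[OF A]
      line_coeffs_props(2)[OF arrangementD(2)[OF A]] by simp
  show ?thesis
  proof (rule that[OF log[of u] log[of w]])
    show "homog (?n + (1 + 0 + 0)) (\<lambda>v. ?f v * det3 v u w)"
      by (rule homog_mult[OF homog_defining_poly homog_det3[OF vform_id vform_const vform_const]])
    show "det3 v (?f v *s u) (?f v *s w) = ?f v * (?f v * det3 v u w)" for v by simp
    show "?f p * det3 p u w \<noteq> 0" using uw False by simp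
  qed
next
  case True
  then obtain H where H: "H \<in> A" "p \<in> H" using defining_poly_nonzero_at[OF A] by blast
  note li = line_coeffs_props[OF arrangementD(2)[OF A H(1)]]
  obtain \<nu> u x y where f: "frame (line_coeffs H) \<nu> u p x y"
    using frame_exists[OF li(1) _ p] li(2) H(2) by metis
  have u: "u \<in> H" using f li(2) by (simp add: frame_def)
  let ?B = "{H\<in>A. p \<notin> H}" and ?c = "- det3 \<nu> u p"
  have d: "det3 v p u = lin (line_coeffs H) v * ?c" for v
    using frame_det3_plane[OF f, of p u v] f by (simp add: frame_def)
  show ?thesis
  proof (rule that[OF log_field_point[OF A, of p] log_field_translate[OF A H(1) u]])
    show "homog (int (card ?B)) (\<lambda>v. ?c * defining_poly ?B v)"
      by (rule homog_cmult[OF homog_defining_poly])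
    show "det3 v (defining_poly ?B v *s p) (defining_poly (A - {H}) v *s u) =
        defining_poly A v * (?c * defining_poly ?B v)" for v
      using d[of v] defining_poly_remove[OF arrangementD(1)[OF A] H(1), of v] by simp
    have "arrangement ?B" using A by (simp add: arrangement_def)
    then have "defining_poly ?B p \<noteq> 0" by (rule defining_poly_nonzero_at) simp
    then show "?c * defining_poly ?B p \<noteq> 0" using frame_det3[OF f] by simp
  qed
qed

section \<open>Sections of twisting sheaves as local quotients of forms\<close>

lemma zopen_principal:
  assumes "homog k G" shows "zopen {v. v \<noteq> 0 \<and> G v \<noteq> 0}"
proof (cases "k \<ge> 0")
  case True
  then show ?thesis unfolding zopen_def
    by (intro exI[of _ "{G}"]) (use homog_cases(1)[OF assms] in auto)
next
  case False
  then show ?thesis unfolding zopen_def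
    by (intro exI[of _ "{}"]) (use homog_cases(2)[OF assms] in auto)
qed

lemma zopen_nonzero: "zopen U \<Longrightarrow> v \<in> U \<Longrightarrow> v \<noteq> 0"
  unfolding zopen_def by auto

lemma zopen_basic:
  assumes "zopen U" "p \<in> U"
  obtains k G where "homog (int k) G" "G p \<noteq> 0" "\<And>v. v \<noteq> 0 \<Longrightarrow> G v \<noteq> 0 \<Longrightarrow> v \<in> U"
proof -
  from assms(1) obtain \<F> where F: "\<And>F. F \<in> \<F> \<Longrightarrow> \<exists>k. form k F" "U = {v. v \<noteq> 0 \<and> (\<exists>F\<in>\<F>. F v \<noteq> 0)}"
    unfolding zopen_def by blast
  from assms(2) F(2) obtain G where G: "G \<in> \<F>" "G p \<noteq> 0" by blast
  from F(1)[OF G(1)] obtain k where "homog (int k) G" by (auto simp: form_iff_homog)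
  then show ?thesis using that G F(2) by blast
qed

lemma zopen_inter:
  assumes "zopen U" "zopen V" shows "zopen (U \<inter> V)"
proof -
  let ?W = "{F. (\<exists>k. form k F) \<and> (\<forall>v. v \<noteq> 0 \<and> F v \<noteq> 0 \<longrightarrow> v \<in> U \<inter> V)}"
  have "U \<inter> V = {v. v \<noteq> 0 \<and> (\<exists>F\<in>?W. F v \<noteq> 0)}"
  proof (intro equalityI subsetI)
    fix p assume p: "p \<in> U \<inter> V"
    from zopen_basic[OF assms(1)] p obtain k G where
      G: "homog (int k) G" "G p \<noteq> 0" "\<And>v. v \<noteq> 0 \<Longrightarrow> G v \<noteq> 0 \<Longrightarrow> v \<in> U" by blast
    from zopen_basic[OF assms(2)] p obtain l K where
      K: "homog (int l) K" "K p \<noteq> 0" "\<And>v. v \<noteq> 0 \<Longrightarrow> K v \<noteq> 0 \<Longrightarrow> v \<in> V" by blast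
    have "homog (int (k + l)) (\<lambda>v. G v * K v)" using homog_mult[OF G(1) K(1)] by simp
    then have "form (k + l) (\<lambda>v. G v * K v)" by (simp add: form_iff_homog)
    then have "(\<lambda>v. G v * K v) \<in> ?W" using G(3) K(3) by auto
    moreover have "G p * K p \<noteq> 0" using G(2) K(2) by simp
    ultimately show "p \<in> {v. v \<noteq> 0 \<and> (\<exists>F\<in>?W. F v \<noteq> 0)}"
      using zopen_nonzero[OF assms(1)] p by (intro CollectI conjI bexI[of _ "\<lambda>v. G v * K v"]) auto
  next
    fix p assume "p \<in> {v. v \<noteq> 0 \<and> (\<exists>F\<in>?W. F v \<noteq> 0)}"
    then show "p \<in> U \<inter> V" by auto
  qed
  then show ?thesis unfolding zopen_def by (intro exI[of _ ?W] conjI) auto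
qed

lemma regular_zero_outside: "s \<in> regular X k U \<Longrightarrow> v \<notin> U \<inter> X \<Longrightarrow> s v = 0"
  unfolding regular_def by blast

text \<open>Multiplying by a form that cuts out a small neighbourhood, one can take the set where the denominator
  does not vanish as the neighbourhood on which the section is a quotient.\<close>

lemma regular_local:
  assumes U: "zopen U" and s: "s \<in> regular X k U" and p: "p \<in> U" "p \<in> X"
  obtains m F G where "homog (m + k) F" "homog m G" "G p \<noteq> 0"
    "\<And>v. v \<noteq> 0 \<Longrightarrow> G v \<noteq> 0 \<Longrightarrow> v \<in> U" "\<And>v. v \<noteq> 0 \<Longrightarrow> G v \<noteq> 0 \<Longrightarrow> v \<in> X \<Longrightarrow> s v * G v = F v"
proof -
  from s p(1) obtain V n n' F G where V: "zopen V" "p \<in> V" "V \<subseteq> U"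
    and FG: "form n F" "form n' G" "int n = int n' + k"
      "\<And>v. v \<in> V \<inter> X \<Longrightarrow> G v \<noteq> 0 \<and> s v = F v / G v"
    unfolding regular_def locally_on_def by blast
  from zopen_basic[OF V(1,2)] obtain l K where
    K: "homog (int l) K" "K p \<noteq> 0" "\<And>v. v \<noteq> 0 \<Longrightarrow> K v \<noteq> 0 \<Longrightarrow> v \<in> V" by blast
  show ?thesis
  proof (rule that)
    show "homog (int n' + int l) (\<lambda>v. G v * K v)"
      using homog_mult[OF _ K(1)] FG(2) by (simp add: form_iff_homog)
    show "homog (int n' + int l + k) (\<lambda>v. F v * K v)"
      using FG(1,3) by (intro homog_mult'[OF _ K(1), of "int n"]) (auto simp: form_iff_homog)
    show "G p * K p \<noteq> 0" using K(2) FG(4)[of p] V(2) p(2) by simp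
    show "v \<in> U" if "v \<noteq> 0" "G v * K v \<noteq> 0" for v using K(3)[of v] that V(3) by auto
    show "s v * (G v * K v) = F v * K v" if "v \<noteq> 0" "G v * K v \<noteq> 0" "v \<in> X" for v
      using K(3)[of v] FG(4)[of v] that by simp
  qed
qed

lemma regular_local_UNIV:
  assumes "zopen U" "s \<in> regular UNIV k U" "p \<in> U"
  shows "\<exists>m F G. homog (m + k) F \<and> homog m G \<and> G p \<noteq> 0 \<and>
    (\<forall>v. v \<noteq> 0 \<longrightarrow> G v \<noteq> 0 \<longrightarrow> v \<in> U \<and> s v * G v = F v)"
proof -
  obtain m F G where "homog (m + k) F" "homog m G" "G p \<noteq> 0"
    "\<And>v. v \<noteq> 0 \<Longrightarrow> G v \<noteq> 0 \<Longrightarrow> v \<in> U" "\<And>v. v \<noteq> 0 \<Longrightarrow> G v \<noteq> 0 \<Longrightarrow> v \<in> UNIV \<Longrightarrow> s v * G v = F v"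
    by (rule regular_local[OF assms UNIV_I]) blast
  then show ?thesis by (intro exI[of _ m] exI[of _ F] exI[of _ G]) auto
qed

lemma ex_coord_nonzero: "(v :: vec3) \<noteq> 0 \<Longrightarrow> \<exists>i. v $ i \<noteq> 0"
  by (auto simp: Finite_Cartesian_Product.vec_eq_iff)

text \<open>The degrees of forms in the definition of a section are natural numbers; a power of a coordinate that
  does not vanish at the point makes both degrees nonnegative.\<close>

lemma regularI:
  assumes U: "zopen U" and out: "\<And>v. v \<notin> U \<Longrightarrow> s v = 0"
    and loc: "\<And>p. p \<in> U \<Longrightarrow> \<exists>m F G. homog (m + k) F \<and> homog m G \<and> G p \<noteq> 0 \<and>
      (\<forall>v. v \<noteq> 0 \<longrightarrow> G v \<noteq> 0 \<longrightarrow> v \<in> U \<and> s v * G v = F v)"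
  shows "s \<in> regular UNIV k U"
  unfolding regular_def locally_on_def
proof (intro CollectI conjI allI impI ballI)
  show "s v = 0" if "v \<notin> U \<inter> UNIV" for v using out that by simp
  fix p assume p: "p \<in> U"
  from loc[OF p] obtain m F G where FG: "homog (m + k) F" "homog m G" "G p \<noteq> 0"
    "\<And>v. v \<noteq> 0 \<Longrightarrow> G v \<noteq> 0 \<Longrightarrow> v \<in> U \<and> s v * G v = F v" by blast
  have p0: "p \<noteq> 0" by (rule zopen_nonzero[OF U p])
  obtain i where i: "p $ i \<noteq> 0" using ex_coord_nonzero[OF p0] by blast
  \<comment> \<open>The exponent makes the degree of the numerator nonnegative.\<close>
  define N where "N = nat (- (m + k))"
  let ?G = "\<lambda>v. G v * (v $ i) ^ N" and ?F = "\<lambda>v. F v * (v $ i) ^ N"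
  have m: "m \<ge> 0" using FG(3) homog_cases(2)[OF FG(2)] by (metis leI)
  have G: "homog (m + int N) ?G" using homog_mult[OF FG(2) homog_power[OF homog_coord]] by simp
  have F: "homog (m + k + int N) ?F" using homog_mult[OF FG(1) homog_power[OF homog_coord]] by simp
  have "m + k + int N \<ge> 0" unfolding N_def by simp
  then have fF: "form (nat (m + k + int N)) ?F" and fG: "form (nat (m + int N)) ?G"
    using homog_cases(1)[OF F] homog_cases(1)[OF G] m by auto
  have *: "v \<in> U \<and> s v = ?F v / ?G v" if "v \<noteq> 0" "?G v \<noteq> 0" for v
    using FG(4)[of v] that by (simp add: field_simps)
  show "\<exists>V. zopen V \<and> p \<in> V \<and> V \<subseteq> U \<and> (\<exists>m m' F G. form m F \<and> form m' G \<and> int m = int m' + k \<and>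
      (\<forall>v\<in>V \<inter> UNIV. G v \<noteq> 0 \<and> s v = F v / G v))"
  proof (intro exI[of _ "{v. v \<noteq> 0 \<and> ?G v \<noteq> 0}"] conjI)
    show "zopen {v. v \<noteq> 0 \<and> ?G v \<noteq> 0}" by (rule zopen_principal[OF G])
    show "p \<in> {v. v \<noteq> 0 \<and> ?G v \<noteq> 0}" using p0 FG(3) i by simp
    show "{v. v \<noteq> 0 \<and> ?G v \<noteq> 0} \<subseteq> U" using * by blast
    show "\<exists>m m' F G. form m F \<and> form m' G \<and> int m = int m' + k \<and>
      (\<forall>v\<in>{v. v \<noteq> 0 \<and> ?G v \<noteq> 0} \<inter> UNIV. G v \<noteq> 0 \<and> s v = F v / G v)"
      by (intro exI[of _ "nat (m + k + int N)"] exI[of _ "nat (m + int N)"] exI[of _ ?F] exI[of _ ?G] conjI fF fG)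
         (use * \<open>m + k + int N \<ge> 0\<close> m in auto)
  qed
qed

lemma regular_quotient:
  assumes U: "zopen U" and F: "homog a F" and G: "homog b G" and nz: "\<And>v. v \<in> U \<Longrightarrow> G v \<noteq> 0"
    and k: "k = a - b"
  shows "(\<lambda>v. if v \<in> U then F v / G v else 0) \<in> regular UNIV k U"
proof (rule regularI[OF U])
  fix p assume p: "p \<in> U"
  from zopen_basic[OF U p] obtain l K where
    K: "homog (int l) K" "K p \<noteq> 0" "\<And>v. v \<noteq> 0 \<Longrightarrow> K v \<noteq> 0 \<Longrightarrow> v \<in> U" by blast
  have "homog (int l + b + k) (\<lambda>v. K v * F v)" by (rule homog_mult'[OF K(1) F]) (simp add: k)
  moreover have "homog (int l + b) (\<lambda>v. K v * G v)" by (rule homog_mult[OF K(1) G])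
  ultimately show "\<exists>m F' G'. homog (m + k) F' \<and> homog m G' \<and> G' p \<noteq> 0 \<and>
      (\<forall>v. v \<noteq> 0 \<longrightarrow> G' v \<noteq> 0 \<longrightarrow> v \<in> U \<and> (if v \<in> U then F v / G v else 0) * G' v = F' v)"
    by (intro exI[of _ "int l + b"] exI[of _ "\<lambda>v. K v * F v"] exI[of _ "\<lambda>v. K v * G v"])
       (use K nz p in auto)
qed auto

lemma regular_zero: "zopen U \<Longrightarrow> (\<lambda>v. 0) \<in> regular UNIV k U"
  using regular_quotient[of U k "\<lambda>v. 0" 0 "\<lambda>v. 1" k] homog_const[of 1] by (simp cong: if_cong)

lemma regular_restrict:
  assumes U: "zopen U" and V: "zopen V" "V \<subseteq> U" and s: "s \<in> regular UNIV k U"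
  shows "(\<lambda>v. if v \<in> V then s v else 0) \<in> regular UNIV k V"
proof (rule regularI[OF V(1)])
  fix p assume p: "p \<in> V"
  have "p \<in> U" using p V(2) by blast
  from regular_local_UNIV[OF U s this] obtain m F G where FG: "homog (m + k) F" "homog m G" "G p \<noteq> 0"
    "\<And>v. v \<noteq> 0 \<Longrightarrow> G v \<noteq> 0 \<Longrightarrow> v \<in> U \<and> s v * G v = F v" by blast
  from zopen_basic[OF V(1) p] obtain l K where
    K: "homog (int l) K" "K p \<noteq> 0" "\<And>v. v \<noteq> 0 \<Longrightarrow> K v \<noteq> 0 \<Longrightarrow> v \<in> V" by blast
  have "homog (int l + m + k) (\<lambda>v. K v * F v)" by (rule homog_mult'[OF K(1) FG(1)]) simp
  moreover have "homog (int l + m) (\<lambda>v. K v * G v)" by (rule homog_mult[OF K(1) FG(2)])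
  ultimately show "\<exists>m F' G'. homog (m + k) F' \<and> homog m G' \<and> G' p \<noteq> 0 \<and>
      (\<forall>v. v \<noteq> 0 \<longrightarrow> G' v \<noteq> 0 \<longrightarrow> v \<in> V \<and> (if v \<in> V then s v else 0) * G' v = F' v)"
    by (intro exI[of _ "int l + m"] exI[of _ "\<lambda>v. K v * F v"] exI[of _ "\<lambda>v. K v * G v"])
       (use K FG in auto)
qed auto

lemma regular_mult:
  assumes U: "zopen U" and s: "s \<in> regular UNIV k U" and t: "t \<in> regular UNIV l U"
  shows "(\<lambda>v. s v * t v) \<in> regular UNIV (k + l) U"
proof (rule regularI[OF U])
  show "s v * t v = 0" if "v \<notin> U" for v using regular_zero_outside[OF s, of v] that by simp
  fix p assume p: "p \<in> U"
  from regular_local_UNIV[OF U s p] obtain m F G where FG: "homog (m + k) F" "homog m G" "G p \<noteq> 0"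
    "\<And>v. v \<noteq> 0 \<Longrightarrow> G v \<noteq> 0 \<Longrightarrow> v \<in> U \<and> s v * G v = F v" by blast
  from regular_local_UNIV[OF U t p] obtain m' F' G' where FG': "homog (m' + l) F'" "homog m' G'" "G' p \<noteq> 0"
    "\<And>v. v \<noteq> 0 \<Longrightarrow> G' v \<noteq> 0 \<Longrightarrow> v \<in> U \<and> t v * G' v = F' v" by blast
  have "homog (m + m' + (k + l)) (\<lambda>v. F v * F' v)" by (rule homog_mult'[OF FG(1) FG'(1)]) simp
  moreover have "homog (m + m') (\<lambda>v. G v * G' v)" by (rule homog_mult[OF FG(2) FG'(2)])
  moreover have "v \<in> U \<and> s v * t v * (G v * G' v) = F v * F' v" if "v \<noteq> 0" "G v * G' v \<noteq> 0" for v
  proof -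
    have "G v \<noteq> 0" "G' v \<noteq> 0" using that(2) by auto
    then have h: "v \<in> U" "s v * G v = F v" "t v * G' v = F' v"
      using FG(4)[OF that(1)] FG'(4)[OF that(1)] by auto
    then show ?thesis by (simp flip: h(2,3))
  qed
  ultimately show "\<exists>m F G. homog (m + (k + l)) F \<and> homog m G \<and> G p \<noteq> 0 \<and>
      (\<forall>v. v \<noteq> 0 \<longrightarrow> G v \<noteq> 0 \<longrightarrow> v \<in> U \<and> s v * t v * G v = F v)"
    using FG(3) FG'(3)
    by (intro exI[of _ "m + m'"] exI[of _ "\<lambda>v. F v * F' v"] exI[of _ "\<lambda>v. G v * G' v"]) auto
qed

lemma regular_add:
  assumes U: "zopen U" and s: "s \<in> regular UNIV k U" and t: "t \<in> regular UNIV k U"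
  shows "(\<lambda>v. s v + t v) \<in> regular UNIV k U"
proof (rule regularI[OF U])
  show "s v + t v = 0" if "v \<notin> U" for v
    using regular_zero_outside[OF s, of v] regular_zero_outside[OF t, of v] that by simp
  fix p assume p: "p \<in> U"
  from regular_local_UNIV[OF U s p] obtain m F G where FG: "homog (m + k) F" "homog m G" "G p \<noteq> 0"
    "\<And>v. v \<noteq> 0 \<Longrightarrow> G v \<noteq> 0 \<Longrightarrow> v \<in> U \<and> s v * G v = F v" by blast
  from regular_local_UNIV[OF U t p] obtain m' F' G' where FG': "homog (m' + k) F'" "homog m' G'" "G' p \<noteq> 0"
    "\<And>v. v \<noteq> 0 \<Longrightarrow> G' v \<noteq> 0 \<Longrightarrow> v \<in> U \<and> t v * G' v = F' v" by blast
  have "homog (m + m' + k) (\<lambda>v. F v * G' v + F' v * G v)"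
    by (intro homog_add homog_mult'[OF FG(1) FG'(2)] homog_mult'[OF FG'(1) FG(2)]) simp_all
  moreover have "homog (m + m') (\<lambda>v. G v * G' v)" by (rule homog_mult[OF FG(2) FG'(2)])
  moreover have "v \<in> U \<and> (s v + t v) * (G v * G' v) = F v * G' v + F' v * G v"
    if "v \<noteq> 0" "G v * G' v \<noteq> 0" for v
  proof -
    have "G v \<noteq> 0" "G' v \<noteq> 0" using that by auto
    then have h: "v \<in> U" "s v * G v = F v" "t v * G' v = F' v"
      using FG(4)[OF that(1)] FG'(4)[OF that(1)] by auto
    then show ?thesis by (simp flip: h(2,3) add: algebra_simps)
  qed
  ultimately show "\<exists>m F G. homog (m + k) F \<and> homog m G \<and> G p \<noteq> 0 \<and>
      (\<forall>v. v \<noteq> 0 \<longrightarrow> G v \<noteq> 0 \<longrightarrow> v \<in> U \<and> (s v + t v) * G v = F v)"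
    using FG(3) FG'(3)
    by (intro exI[of _ "m + m'"] exI[of _ "\<lambda>v. F v * G' v + F' v * G v"] exI[of _ "\<lambda>v. G v * G' v"]) auto
qed

lemma regular_to_subvariety:
  assumes "s \<in> regular UNIV k U"
  shows "(\<lambda>v. if v \<in> X then s v else 0) \<in> regular X k U"
proof -
  from assms have loc: "\<And>p. p \<in> U \<Longrightarrow> \<exists>V. zopen V \<and> p \<in> V \<and> V \<subseteq> U \<and> (\<exists>m m' F G. form m F \<and> form m' G \<and>
      int m = int m' + k \<and> (\<forall>v\<in>V \<inter> UNIV. G v \<noteq> 0 \<and> s v = F v / G v))"
    unfolding regular_def locally_on_def by blast
  show ?thesis unfolding regular_def locally_on_def
  proof (intro CollectI conjI allI impI ballI)
    fix p assume "p \<in> U"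
    from loc[OF this] obtain V m m' F G where "zopen V" "p \<in> V" "V \<subseteq> U" "form m F" "form m' G"
      "int m = int m' + k" "\<And>v. v \<in> V \<Longrightarrow> G v \<noteq> 0 \<and> s v = F v / G v" by blast
    then show "\<exists>V. zopen V \<and> p \<in> V \<and> V \<subseteq> U \<and> (\<exists>m m' F G. form m F \<and> form m' G \<and>
      int m = int m' + k \<and> (\<forall>v\<in>V \<inter> X. G v \<noteq> 0 \<and> (if v \<in> X then s v else 0) = F v / G v))"
      by (intro exI[of _ V] conjI exI[of _ m] exI[of _ m'] exI[of _ F] exI[of _ G]) auto
  qed (use regular_zero_outside[OF assms] in auto)
qed

text \<open>Take a denominator of least degree. If it had a root, comparing with a quotient that is defined at this
  root shows that the root can be cancelled.\<close>

lemma locally_rational_imp_polynomial: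
  fixes f :: "complex \<Rightarrow> complex"
  assumes loc: "\<And>t0. \<exists>A B. poly B t0 \<noteq> 0 \<and> (\<forall>t. poly B t \<noteq> 0 \<longrightarrow> f t * poly B t = poly A t)"
  shows "\<exists>P. \<forall>t. f t = poly P t"
proof -
  define rep where "rep A B \<longleftrightarrow> (\<forall>t. poly B t \<noteq> 0 \<longrightarrow> f t * poly B t = poly A t)" for A B
  have "\<exists>n A B. B \<noteq> 0 \<and> rep A B \<and> degree B = n" using loc[of 0] unfolding rep_def by (metis poly_0)
  define n where "n = (LEAST n. \<exists>A B. B \<noteq> 0 \<and> rep A B \<and> degree B = n)"
  have "\<exists>A B. B \<noteq> 0 \<and> rep A B \<and> degree B = n"
    unfolding n_def by (rule LeastI_ex) fact
  then obtain A B where AB: "B \<noteq> 0" "rep A B" "degree B = n" by blast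
  have min: "n \<le> degree B'" if "B' \<noteq> 0" "rep A' B'" for A' B'
    unfolding n_def by (rule Least_le) (use that in blast)
  have "n = 0"
  proof (rule ccontr)
    assume "n \<noteq> 0"
    then have "\<not> constant (poly B)" using AB(3) by (simp add: constant_degree)
    then obtain t0 where t0: "poly B t0 = 0" using fundamental_theorem_of_algebra by blast
    obtain A' B' where AB': "poly B' t0 \<noteq> 0" "rep A' B'" using loc[of t0] unfolding rep_def by blast
    then have B'0: "B' \<noteq> 0" by auto
    have eq: "A * B' = A' * B"
    proof (rule poly_eq_if_cofinitely_equal)
      show "finite {t. poly (B * B') t = 0}" using AB(1) B'0 by (intro poly_roots_finite) simp
      fix t assume "t \<notin> {t. poly (B * B') t = 0}"
      then have "f t * poly B t = poly A t" "f t * poly B' t = poly A' t"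
        using AB(2) AB'(2) unfolding rep_def by auto
      then show "poly (A * B') t = poly (A' * B) t" by (metis mult.assoc mult.commute poly_mult)
    qed
    have "poly (A * B') t0 = 0" unfolding eq using t0 by simp
    then have "poly A t0 = 0" using AB'(1) by simp
    then obtain A1 where A1: "A = [:- t0, 1:] * A1" by (auto simp: poly_eq_0_iff_dvd)
    from t0 obtain B1 where B1: "B = [:- t0, 1:] * B1" by (auto simp: poly_eq_0_iff_dvd)
    have "[:- t0, 1:] * (A1 * B') = [:- t0, 1:] * (A' * B1)"
      using eq unfolding A1 B1 by (simp only: mult.assoc mult.left_commute)
    then have eq1: "A1 * B' = A' * B1" using mult_left_cancel[of "[:- t0, 1:]"] by (metis pCons_eq_0_iff one_neq_zero)
    have "rep A1 B1" unfolding rep_def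
    proof (intro allI impI)
      fix t assume nz: "poly B1 t \<noteq> 0"
      show "f t * poly B1 t = poly A1 t"
      proof (cases "t = t0")
        case True
        have "poly A1 t * poly B' t = poly A' t * poly B1 t" using eq1 by (metis poly_mult)
        also have "poly A' t = f t * poly B' t" using AB' True unfolding rep_def by simp
        finally show ?thesis using AB'(1) True by simp
      next
        case False
        then have "poly B t \<noteq> 0" using nz unfolding B1 by simp
        then have "f t * poly B t = poly A t" using AB(2) unfolding rep_def by simp
        then have "(t - t0) * (f t * poly B1 t) = (t - t0) * poly A1 t" unfolding A1 B1 by (simp add: algebra_simps)
        then show ?thesis using False by simp
      qed
    qed
    moreover have "B1 \<noteq> 0" using AB(1) B1 by auto
    ultimately have "n \<le> degree B1" using min by blast
    moreover have "degree B = degree [:- t0, 1:] + degree B1"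
      unfolding B1 using \<open>B1 \<noteq> 0\<close> by (intro degree_mult_eq) auto
    ultimately show False using AB(3) by simp
  qed
  then obtain b where b: "B = [:b:]" using AB(3) degree_eq_zeroE by blast
  then have "b \<noteq> 0" using AB(1) by simp
  then have "f t = poly (Polynomial.smult (1 / b) A) t" for t
    using AB(2) unfolding rep_def b by (simp add: field_simps)
  then show ?thesis by blast
qed

text \<open>The global sections of \<open>O\<^sub>X(k)\<close>, without a convention about their values off \<open>X\<close> or at the origin.\<close>

definition locally_quotient :: "vec3 set \<Rightarrow> int \<Rightarrow> (vec3 \<Rightarrow> complex) \<Rightarrow> bool" where
  "locally_quotient X k f \<longleftrightarrow> (\<forall>p\<in>X. p \<noteq> 0 \<longrightarrow> (\<exists>m F G. homog (m + k) F \<and> homog m G \<and> G p \<noteq> 0 \<and>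
      (\<forall>v\<in>X. v \<noteq> 0 \<longrightarrow> G v \<noteq> 0 \<longrightarrow> f v * G v = F v)))"

lemma locally_quotient_scale:
  assumes "locally_quotient X k f" "v \<in> X" "c *s v \<in> X" "v \<noteq> 0" "c \<noteq> 0"
  shows "f (c *s v) = c powi k * f v"
proof -
  from assms obtain m F G where FG: "homog (m + k) F" "homog m G" "G v \<noteq> 0"
    "\<And>v. v \<in> X \<Longrightarrow> v \<noteq> 0 \<Longrightarrow> G v \<noteq> 0 \<Longrightarrow> f v * G v = F v"
    unfolding locally_quotient_def by blast
  have G: "G (c *s v) = c powi m * G v" by (rule homog_scale[OF FG(2) assms(5)])
  have cm: "c powi m \<noteq> 0" using assms(5) by simp
  have "c *s v \<noteq> 0" using assms(4,5) by (auto simp: Finite_Cartesian_Product.vec_eq_iff)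
  then have "f (c *s v) * (c powi m * G v) = F (c *s v)"
    using FG(4)[of "c *s v"] assms G cm FG(3) by simp
  also have "\<dots> = c powi (m + k) * (f v * G v)"
    using homog_scale[OF FG(1) assms(5)] FG(4)[of v] assms FG(3) by simp
  also have "\<dots> = (c powi k * f v) * (c powi m * G v)" using assms(5) by (simp add: power_int_add)
  finally show ?thesis using cm FG(3) assms(5) by simp
qed

lemma locally_quotient_line:
  assumes f: "locally_quotient X k f" and l: "\<And>t. u + t *s w \<in> X" "\<And>t. u + t *s w \<noteq> 0"
  shows "\<exists>P. \<forall>t. f (u + t *s w) = poly P t"
proof (rule locally_rational_imp_polynomial)
  fix t0
  from f l obtain m F G where FG: "homog (m + k) F" "homog m G" "G (u + t0 *s w) \<noteq> 0"
    "\<And>v. v \<in> X \<Longrightarrow> v \<noteq> 0 \<Longrightarrow> G v \<noteq> 0 \<Longrightarrow> f v * G v = F v"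
    unfolding locally_quotient_def by blast
  obtain A where A: "\<And>t. F (u + t *s w) = poly A t"
    using homog_poly_on_lines[OF FG(1)] unfolding poly_on_lines_def by blast
  obtain B where B: "\<And>t. G (u + t *s w) = poly B t"
    using homog_poly_on_lines[OF FG(2)] unfolding poly_on_lines_def by blast
  show "\<exists>A B. poly B t0 \<noteq> 0 \<and> (\<forall>t. poly B t \<noteq> 0 \<longrightarrow> f (u + t *s w) * poly B t = poly A t)"
    by (intro exI[of _ A] exI[of _ B]) (use FG(3,4) l in \<open>auto simp flip: A B\<close>)
qed

text \<open>The global sections of \<open>O(k)\<close> on the plane are the forms of degree \<open>k\<close>.\<close>

lemma locally_quotient_global:
  assumes "locally_quotient UNIV k f"
  obtains F where "homog k F" "\<And>v. v \<noteq> 0 \<Longrightarrow> F v = f v"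
proof -
  have "\<exists>F. homog k F \<and> (k \<ge> 0 \<longrightarrow> form (nat k) F) \<and> (k < 0 \<longrightarrow> F = (\<lambda>v. 0)) \<and> (\<forall>v. v \<noteq> 0 \<longrightarrow> F v = f v)"
  proof (rule homog_extension)
    show "f (c *s v) = c powi k * f v" if "c \<noteq> 0" "v \<noteq> 0" for c v
      by (rule locally_quotient_scale[OF assms]) (use that in auto)
    show "\<exists>P. \<forall>t. f (u + t *s w) = poly P t" if "indep2 u w" for u w
      by (rule locally_quotient_line[OF assms]) (use indep2_line_nonzero[OF that] in auto)
  qed
  then show ?thesis using that by blast
qed

text \<open>The same on a line: in the two standard charts the section is a polynomial in \<open>t\<close> and in \<open>1 / t\<close>, and
  the gluing condition bounds the degree.\<close>

lemma locally_quotient_global_on_plane: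
  assumes \<alpha>: "\<alpha> \<noteq> 0" and f: "locally_quotient {v. lin \<alpha> v = 0} k f"
  obtains F where "homog k F" "\<And>v. v \<noteq> 0 \<Longrightarrow> lin \<alpha> v = 0 \<Longrightarrow> F v = f v"
proof -
  let ?X = "{v. lin \<alpha> v = 0}"
  obtain \<nu> p q x y where fr: "frame \<alpha> \<nu> p q x y" using frame_exists_some[OF \<alpha>] by blast
  have pq: "lin \<alpha> p = 0" "lin \<alpha> q = 0" using fr by (auto simp: frame_def)
  have nz: "p + t *s q \<noteq> 0" "q + t *s p \<noteq> 0" for t
  proof -
    show "p + t *s q \<noteq> 0" by (rule frame_line_nz[OF fr])
    have "lin y (q + t *s p) = 1" using fr by (simp add: frame_def lin_simps)
    then show "q + t *s p \<noteq> 0" by auto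
  qed
  obtain P where P: "\<And>t. f (p + t *s q) = poly P t"
    using locally_quotient_line[OF f, of p q] nz pq by (auto simp: lin_simps)
  obtain Q where Q: "\<And>t. f (q + t *s p) = poly Q t"
    using locally_quotient_line[OF f, of q p] nz pq by (auto simp: lin_simps)
  have sw: "poly P t = t powi k * poly Q (1 / t)" if t: "t \<noteq> 0" for t
  proof -
    have "p + t *s q = t *s (q + (1 / t) *s p)"
      using t by (simp add: Finite_Cartesian_Product.vec_eq_iff field_simps)
    then have "f (p + t *s q) = f (t *s (q + (1 / t) *s p))" by (rule arg_cong)
    also have "\<dots> = t powi k * f (q + (1 / t) *s p)"
      by (rule locally_quotient_scale[OF f]) (use t nz pq in \<open>auto simp: lin_simps\<close>)
    finally show ?thesis by (simp add: P Q)
  qed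
  have val: "f v = F v" if F: "homog k F" "\<And>t. F (p + t *s q) = poly P t" "F q = poly Q 0"
    and v: "v \<noteq> 0" "lin \<alpha> v = 0" for F v
  proof (cases "lin x v = 0")
    case True
    then have v': "v = lin y v *s q" using frame_plane[OF fr v(2)] by simp
    then have y: "lin y v \<noteq> 0" using v(1) by auto
    have "f (lin y v *s q) = lin y v powi k * f q"
      by (rule locally_quotient_scale[OF f]) (use y pq frame_q_nz[OF fr] in \<open>auto simp: lin_simps\<close>)
    also have "\<dots> = F (lin y v *s q)" using homog_scale[OF F(1) y] F(3) Q[of 0] by simp
    finally show ?thesis using v' by simp
  next
    case False
    have v': "v = lin x v *s (p + (lin y v / lin x v) *s q)"
    proof -
      have "lin x v *s (p + (lin y v / lin x v) *s q) = lin x v *s p + lin y v *s q"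
        using False by (simp add: Finite_Cartesian_Product.vec_eq_iff algebra_simps)
      then show ?thesis using frame_plane[OF fr v(2)] by simp
    qed
    have "f (lin x v *s (p + (lin y v / lin x v) *s q)) = lin x v powi k * f (p + (lin y v / lin x v) *s q)"
      by (rule locally_quotient_scale[OF f]) (use False pq nz in \<open>auto simp: lin_simps\<close>)
    also have "\<dots> = F (lin x v *s (p + (lin y v / lin x v) *s q))"
      by (subst homog_scale[OF F(1) False]) (simp only: F(2) P)
    finally show ?thesis by (simp only: v'[symmetric])
  qed
  show ?thesis
  proof (cases "k \<ge> 0")
    case True
    note deg = poly_degree_from_infinity(1)[of P k Q, OF sw True]
    then obtain F where F: "homog (int (nat k)) F" "\<And>t. F (p + t *s q) = poly P t"
      using binary_form_lift[OF fr, of P "nat k"] by blast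
    then have Fk: "homog k F" using True by simp
    obtain P' where P': "\<And>t. F (p + t *s q) = poly P' t" "coeff P' (nat k) = F q"
      using homog_line_poly_int[OF Fk, of p q] True by blast
    have "P' = P" by (rule poly_eqI_all) (use P' F in metis)
    then have "F q = poly Q 0" using P'(2) deg by simp
    then show ?thesis using that[OF Fk] val[OF Fk F(2)] by metis
  next
    case False
    then have "P = 0" using poly_degree_from_infinity(2)[of P k Q, OF sw] by simp
    have "poly Q t = poly 0 t" if "t \<notin> {0}" for t
      using sw[of "1 / t"] that \<open>P = 0\<close> by simp
    then have "Q = 0" by (intro poly_eq_if_cofinitely_equal[of "{0}"]) auto
    then show ?thesis using that[of "\<lambda>v. 0"] val[of "\<lambda>v. 0"] \<open>P = 0\<close> by simp
  qed
qed

section \<open>Morphisms of sheaves in terms of homogeneous vector fields\<close>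

lemma common_denominator:
  fixes s :: "vec3 \<Rightarrow> complex ^ ('n::finite)"
  assumes V: "zopen V" and s: "s \<in> twist UNIV \<kappa> V" and p: "p \<in> V"
  shows "\<exists>M G N. homog M G \<and> G p \<noteq> 0 \<and> (\<forall>j. homog (M + \<kappa> $ j) (N j)) \<and>
    (\<forall>v. v \<noteq> 0 \<longrightarrow> G v \<noteq> 0 \<longrightarrow> v \<in> V \<and> (\<forall>j. s v $ j * G v = N j v))"
proof -
  have "\<forall>j. \<exists>m F G. homog (m + \<kappa> $ j) F \<and> homog m G \<and> G p \<noteq> 0 \<and>
    (\<forall>v. v \<noteq> 0 \<longrightarrow> G v \<noteq> 0 \<longrightarrow> v \<in> V \<and> s v $ j * G v = F v)"
    using s regular_local_UNIV[OF V _ p] unfolding twist_def by blast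
  then obtain m F G where FG: "\<And>j. homog (m j + \<kappa> $ j) (F j)" "\<And>j. homog (m j) (G j)" "\<And>j. G j p \<noteq> 0"
    "\<And>j v. v \<noteq> 0 \<Longrightarrow> G j v \<noteq> 0 \<Longrightarrow> v \<in> V \<and> s v $ j * G j v = F j v" by metis
  let ?M = "\<Sum>j\<in>UNIV. m j" and ?G = "\<lambda>v. \<Prod>j\<in>UNIV. G j v"
  let ?N = "\<lambda>j v. F j v * (\<Prod>l\<in>UNIV - {j}. G l v)"
  show ?thesis
  proof (intro exI[of _ ?M] exI[of _ ?G] exI[of _ ?N] conjI allI impI)
    show "homog ?M ?G" by (rule homog_prod) (rule FG(2))
    show "?G p \<noteq> 0" using FG(3) by simp
    fix j
    show "homog (?M + \<kappa> $ j) (?N j)"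
      by (rule homog_mult'[OF FG(1) homog_prod]) (auto simp: FG(2) sum.remove[of UNIV j m])
    fix v :: vec3 assume v: "v \<noteq> 0" "?G v \<noteq> 0"
    then have nz: "G j v \<noteq> 0" by simp
    then show "v \<in> V" using FG(4) v by blast
    show "s v $ j * ?G v = ?N j v"
      using FG(4)[OF v(1) nz] by (simp add: prod.remove[of UNIV j "\<lambda>j. G j v"] mult.assoc[symmetric])
  qed
qed

lemma poly_on_lines_at_zero:
  assumes F: "poly_on_lines F" and z: "\<And>v. v \<noteq> 0 \<Longrightarrow> F v = 0"
  shows "F v = 0"
proof -
  obtain P where P: "\<And>t. F (0 + t *s pt 1 0 0) = poly P t" using F unfolding poly_on_lines_def by blast
  have "P = 0"
  proof (rule poly_eq_if_cofinitely_equal[of "{0}"])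
    fix t :: complex assume "t \<notin> {0}"
    then have "0 + t *s pt 1 0 0 \<noteq> 0" by (simp add: vec3_eq_iff)
    from z[OF this] show "poly P t = poly 0 t" using P[of t] by simp
  qed simp
  then have "F 0 = 0" using P[of 0] by simp
  then show ?thesis using z[of v] by (cases "v = 0") auto
qed

lemma identity_principle:
  assumes Q: "poly_on_lines Q" "Q p \<noteq> 0" and D: "poly_on_lines D"
    and z: "\<And>v. v \<noteq> 0 \<Longrightarrow> Q v \<noteq> 0 \<Longrightarrow> D v = 0"
  shows "D v = 0"
proof -
  have "Q v * D v = 0" for v
    by (rule poly_on_lines_at_zero[OF poly_on_lines_mult[OF Q(1) D]]) (use z in auto)
  then show ?thesis
    by (intro poly_on_lines_mult_eq_zero[OF Q(1) D, where S = UNIV and u = p]) (use Q(2) in auto)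
qed

lemma homog_grad_pairing:
  assumes A: "arrangement A" and \<theta>: "vform k \<theta>"
  shows "poly_on_lines (\<lambda>v. grad_pairing A v (\<theta> v))"
proof -
  note fin = arrangementD(1)[OF A]
  have "homog (k + (int (card A) - 1)) (\<lambda>v. \<Sum>H\<in>A. lin (line_coeffs H) (\<theta> v) * defining_poly (A - {H}) v)"
  proof (intro homog_sum homog_mult'[OF homog_lin_vform[OF \<theta>] homog_defining_poly])
    fix H assume "H \<in> A"
    moreover from this fin have "card A > 0" by (auto simp: card_gt_0_iff)
    ultimately show "k + (int (card A) - 1) = k + int (card (A - {H}))"
      using fin by (simp add: of_nat_diff)
  qed
  then show ?thesis unfolding grad_pairing_eq[OF fin] by (rule homog_poly_on_lines)
qed

lemma derivation_bundle_iff: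
  "s \<in> derivation_bundle A U \<longleftrightarrow> s \<in> twist UNIV 0 U \<and> (\<forall>v. grad_pairing A v (s v) = 0)"
  by (simp add: derivation_bundle_def grad_pairing_def)

lemma morphismD:
  assumes "sheaf_morphism E F \<Phi>" "zopen U"
  shows "s \<in> E U \<Longrightarrow> \<Phi> U s \<in> F U"
    and "s \<in> E U \<Longrightarrow> t \<in> E U \<Longrightarrow> \<Phi> U (\<lambda>v. s v + t v) = (\<lambda>v. \<Phi> U s v + \<Phi> U t v)"
    and "g \<in> structure_sheaf U \<Longrightarrow> s \<in> E U \<Longrightarrow> \<Phi> U (\<lambda>v. g v *s s v) = (\<lambda>v. g v *s \<Phi> U s v)"
    and "zopen V \<Longrightarrow> V \<subseteq> U \<Longrightarrow> s \<in> E U \<Longrightarrow> \<Phi> V (restr V s) = restr V (\<Phi> U s)"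
  using assms unfolding sheaf_morphism_def by blast+

lemma morphism_zero:
  assumes \<Phi>: "sheaf_morphism E F \<Phi>" and U: "zopen U" and z: "(\<lambda>v. 0) \<in> E U"
  shows "\<Phi> U (\<lambda>v. 0) = (\<lambda>v. 0)"
proof -
  have "\<Phi> U (\<lambda>v. 0) = (\<lambda>v. \<Phi> U (\<lambda>v. 0) v + \<Phi> U (\<lambda>v. 0) v)"
    using morphismD(2)[OF \<Phi> U z z] by simp
  then have "\<Phi> U (\<lambda>v. 0) v = \<Phi> U (\<lambda>v. 0) v + \<Phi> U (\<lambda>v. 0) v" for v by (rule fun_cong)
  then show ?thesis by (intro ext) simp
qed

lemma morphism_sum:
  assumes \<Phi>: "sheaf_morphism E F \<Phi>" and U: "zopen U" and z: "(\<lambda>v. 0) \<in> E U"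
    and add: "\<And>s t. s \<in> E U \<Longrightarrow> t \<in> E U \<Longrightarrow> (\<lambda>v. s v + t v) \<in> E U"
    and s: "\<And>j. j \<in> J \<Longrightarrow> s j \<in> E U"
  shows "\<Phi> U (\<lambda>v. \<Sum>j\<in>J. s j v) = (\<lambda>v. \<Sum>j\<in>J. \<Phi> U (s j) v) \<and> (\<lambda>v. \<Sum>j\<in>J. s j v) \<in> E U"
  using s
proof (induction J rule: infinite_finite_induct)
  case (insert j J)
  then have IH: "\<Phi> U (\<lambda>v. \<Sum>j\<in>J. s j v) = (\<lambda>v. \<Sum>j\<in>J. \<Phi> U (s j) v)" "(\<lambda>v. \<Sum>j\<in>J. s j v) \<in> E U"
    and sj: "s j \<in> E U" by auto
  show ?case using insert(1,2) add[OF sj IH(2)] morphismD(2)[OF \<Phi> U sj IH(2)] IH(1) by simp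
qed (use morphism_zero[OF \<Phi> U z] z in auto)

lemma twist_add:
  "zopen U \<Longrightarrow> s \<in> twist UNIV \<kappa> U \<Longrightarrow> t \<in> twist UNIV \<kappa> U \<Longrightarrow> (\<lambda>v. s v + t v) \<in> twist UNIV \<kappa> U"
  unfolding twist_def by (auto intro: regular_add)

lemma twist_zero: "zopen U \<Longrightarrow> (\<lambda>v. 0) \<in> twist UNIV \<kappa> U"
  unfolding twist_def by (auto intro: regular_zero)

lemma twist_zero_outside: "s \<in> twist X \<kappa> U \<Longrightarrow> v \<notin> U \<inter> X \<Longrightarrow> s v = 0"
  unfolding twist_def using regular_zero_outside by (fastforce simp: Finite_Cartesian_Product.vec_eq_iff)

lemma twist_mult:
  assumes "zopen U" "g \<in> regular UNIV k U" "\<And>j. (\<lambda>v. s v $ j) \<in> regular UNIV (l $ j) U" "\<And>j. \<kappa> $ j = k + l $ j"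
  shows "(\<lambda>v. g v *s s v) \<in> twist UNIV \<kappa> U"
  unfolding twist_def using regular_mult[OF assms(1,2)] assms(3,4) by simp

lemma regular_homog:
  assumes "zopen U" "homog k F" shows "(\<lambda>v. if v \<in> U then F v else 0) \<in> regular UNIV k U"
  using regular_quotient[OF assms homog_const[of 1], of k] by (simp cong: if_cong)

lemma regular_mult_homog:
  assumes U: "zopen U" and g: "g \<in> regular UNIV k U" and F: "homog l F"
  shows "(\<lambda>v. g v * F v) \<in> regular UNIV (k + l) U"
proof -
  have "(\<lambda>v. g v * F v) = (\<lambda>v. g v * (if v \<in> U then F v else 0))"
    using regular_zero_outside[OF g] by auto
  then show ?thesis using regular_mult[OF U g regular_homog[OF U F]] by simp
qed

lemma regular_coord_power:
  assumes U: "zopen U" and nz: "\<And>v. v \<in> U \<Longrightarrow> v $ i \<noteq> 0"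
  shows "(\<lambda>v. if v \<in> U then (v $ i) powi k else 0) \<in> regular UNIV k U"
proof (cases "k \<ge> 0")
  case True
  have "homog k (\<lambda>v. (v $ i) ^ nat k)" using homog_power[OF homog_coord, of "nat k" i] True by simp
  from regular_homog[OF U this] show ?thesis using True by (simp add: power_int_def cong: if_cong)
next
  case False
  have "homog (- k) (\<lambda>v. (v $ i) ^ nat (- k))" using homog_power[OF homog_coord, of "nat (- k)" i] False by simp
  from regular_quotient[OF U homog_const[of 1] this, of k] nz False
  show ?thesis by (simp add: power_int_def divide_inverse power_inverse cong: if_cong)
qed

lemma zopen_coord: "zopen {v. v \<noteq> 0 \<and> v $ i \<noteq> 0}"
  by (rule zopen_principal[OF homog_coord])

text \<open>A vector of functions \<open>\<theta>\<close> that becomes a section after multiplication by sections of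
  \<open>O(k)\<close> is a global section of the twist by \<open>- k\<close>; a morphism carries it to such a vector.\<close>

lemma twisted_section_image:
  fixes E :: "('m::finite) msheaf" and F :: "('n::finite) msheaf"
  assumes \<Phi>: "sheaf_morphism E F \<Phi>" and FX: "\<And>U. zopen U \<Longrightarrow> F U \<subseteq> twist X \<kappa> U"
    and \<theta>: "\<And>U g. zopen U \<Longrightarrow> g \<in> regular UNIV k U \<Longrightarrow> (\<lambda>v. g v *s \<theta> v) \<in> E U"
  shows "\<exists>\<eta>. (\<forall>U g. zopen U \<longrightarrow> g \<in> regular UNIV k U \<longrightarrow> \<Phi> U (\<lambda>v. g v *s \<theta> v) = (\<lambda>v. g v *s \<eta> v)) \<and>
    (\<forall>j. locally_quotient X (\<kappa> $ j - k) (\<lambda>v. \<eta> v $ j))"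
proof -
  define D :: "3 \<Rightarrow> vec3 set" where "D i = {v. v \<noteq> 0 \<and> v $ i \<noteq> 0}" for i
  have D: "zopen (D i)" for i unfolding D_def by (rule zopen_coord)
  define h where "h i = (\<lambda>v. if v \<in> D i then (v $ i) powi k else 0)" for i
  have h: "h i \<in> regular UNIV k (D i)" for i
    unfolding h_def by (rule regular_coord_power[OF D]) (simp add: D_def)
  define s where "s i = \<Phi> (D i) (\<lambda>v. h i v *s \<theta> v)" for i
  have key: "h i v *s \<Phi> U (\<lambda>v. g v *s \<theta> v) v = g v *s s i v"
    if U: "zopen U" and g: "g \<in> regular UNIV k U" and v: "v \<in> U" "v $ i \<noteq> 0" for U g v i
  proof -
    let ?V = "U \<inter> D i"
    have V: "zopen ?V" by (rule zopen_inter[OF U D])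
    have vV: "v \<in> ?V" using v zopen_nonzero[OF U] by (auto simp: D_def)
    have nz: "w \<in> ?V \<Longrightarrow> w $ i \<noteq> 0" for w by (simp add: D_def)
    let ?q = "\<lambda>w. (if w \<in> ?V then g w else 0) * (if w \<in> ?V then (w $ i) powi (- k) else 0)"
    have q: "?q \<in> structure_sheaf ?V"
      using regular_mult[OF V regular_restrict[OF U V _ g] regular_coord_power[OF V nz, where k = "- k"]] by simp
    have hE: "(\<lambda>v. h i v *s \<theta> v) \<in> E (D i)" by (rule \<theta>[OF D h])
    have rE: "restr ?V (\<lambda>v. h i v *s \<theta> v) \<in> E ?V"
    proof -
      have "restr ?V (\<lambda>v. h i v *s \<theta> v) = (\<lambda>v. (if v \<in> ?V then h i v else 0) *s \<theta> v)"
        by (auto simp: restr_def)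
      then show ?thesis using \<theta>[OF V regular_restrict[OF D V _ h]] by simp
    qed
    have eq: "restr ?V (\<lambda>v. g v *s \<theta> v) = (\<lambda>w. ?q w *s restr ?V (\<lambda>v. h i v *s \<theta> v) w)"
    proof
      fix w
      show "restr ?V (\<lambda>v. g v *s \<theta> v) w = ?q w *s restr ?V (\<lambda>v. h i v *s \<theta> v) w"
        using nz[of w] by (auto simp: restr_def h_def power_int_minus vector_smult_assoc)
    qed
    have "restr ?V (\<Phi> U (\<lambda>v. g v *s \<theta> v)) = \<Phi> ?V (restr ?V (\<lambda>v. g v *s \<theta> v))"
      by (rule morphismD(4)[OF \<Phi> U V _ \<theta>[OF U g], symmetric]) simp
    also have "\<dots> = (\<lambda>w. ?q w *s \<Phi> ?V (restr ?V (\<lambda>v. h i v *s \<theta> v)) w)"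
      unfolding eq by (rule morphismD(3)[OF \<Phi> V q rE])
    also have "\<Phi> ?V (restr ?V (\<lambda>v. h i v *s \<theta> v)) = restr ?V (s i)"
      unfolding s_def by (rule morphismD(4)[OF \<Phi> D V _ hE]) simp
    finally have "restr ?V (\<Phi> U (\<lambda>v. g v *s \<theta> v)) v = ?q v *s restr ?V (s i) v" by (rule fun_cong)
    then have "\<Phi> U (\<lambda>v. g v *s \<theta> v) v = (g v * (v $ i) powi (- k)) *s s i v"
      using vV by (simp add: restr_def)
    then show ?thesis using vV v(2) by (simp add: h_def power_int_minus vector_smult_assoc)
  qed
  \<comment> \<open>At each point divide by the power of a coordinate that does not vanish; \<open>key\<close> makes the choice irrelevant.\<close>
  define c where "c v = (SOME i. (v :: vec3) $ i \<noteq> 0)" for v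
  have c: "v $ c v \<noteq> 0" if "v \<noteq> 0" for v unfolding c_def by (rule someI_ex) (rule ex_coord_nonzero[OF that])
  define \<eta> where "\<eta> v = (1 / h (c v) v) *s s (c v) v" for v
  have main: "\<Phi> U (\<lambda>v. g v *s \<theta> v) = (\<lambda>v. g v *s \<eta> v)" if U: "zopen U" and g: "g \<in> regular UNIV k U" for U g
  proof
    fix v
    show "\<Phi> U (\<lambda>v. g v *s \<theta> v) v = g v *s \<eta> v"
    proof (cases "v \<in> U")
      case True
      have v0: "v \<noteq> 0" by (rule zopen_nonzero[OF U True])
      have hn: "h (c v) v \<noteq> 0" using c[OF v0] v0 by (simp add: h_def D_def)
      have "g v *s \<eta> v = (1 / h (c v) v) *s (g v *s s (c v) v)"
        by (simp add: \<eta>_def vector_smult_assoc mult.commute)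
      also have "\<dots> = (1 / h (c v) v) *s (h (c v) v *s \<Phi> U (\<lambda>v. g v *s \<theta> v) v)"
        by (simp only: key[OF U g True c[OF v0]])
      also have "\<dots> = \<Phi> U (\<lambda>v. g v *s \<theta> v) v" using hn by (simp add: vector_smult_assoc)
      finally show ?thesis by simp
    next
      case False
      have "\<Phi> U (\<lambda>v. g v *s \<theta> v) \<in> twist X \<kappa> U"
        using morphismD(1)[OF \<Phi> U \<theta>[OF U g]] FX[OF U] by blast
      then show ?thesis using twist_zero_outside False regular_zero_outside[OF g, of v] by fastforce
    qed
  qed
  have "locally_quotient X (\<kappa> $ j - k) (\<lambda>v. \<eta> v $ j)" for j
    unfolding locally_quotient_def
  proof (intro ballI impI)
    fix p assume p: "p \<in> X" "p \<noteq> 0"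
    define i where "i = c p"
    have pi: "p $ i \<noteq> 0" unfolding i_def by (rule c[OF p(2)])
    have "(\<lambda>v. h i v *s \<eta> v) \<in> twist X \<kappa> (D i)"
      using morphismD(1)[OF \<Phi> D \<theta>[OF D h]] FX[OF D] main[OF D h] by auto
    then have reg: "(\<lambda>v. h i v * \<eta> v $ j) \<in> regular X (\<kappa> $ j) (D i)" unfolding twist_def by simp
    have pD: "p \<in> D i" using p pi by (simp add: D_def)
    obtain m F G where FG: "homog (m + \<kappa> $ j) F" "homog m G" "G p \<noteq> 0"
      "\<And>v. v \<noteq> 0 \<Longrightarrow> G v \<noteq> 0 \<Longrightarrow> v \<in> D i" "\<And>v. v \<noteq> 0 \<Longrightarrow> G v \<noteq> 0 \<Longrightarrow> v \<in> X \<Longrightarrow> h i v * \<eta> v $ j * G v = F v"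
      by (rule regular_local[OF D reg pD p(1)]) blast
    let ?a = "nat k" and ?b = "nat (- k)"
    have "homog (m + int ?a + (\<kappa> $ j - k)) (\<lambda>v. F v * (v $ i) ^ ?b)"
      by (rule homog_mult'[OF FG(1) homog_power[OF homog_coord]]) auto
    moreover have "homog (m + int ?a) (\<lambda>v. G v * (v $ i) ^ ?a)"
      by (rule homog_mult'[OF FG(2) homog_power[OF homog_coord]]) auto
    moreover have "\<eta> v $ j * (G v * (v $ i) ^ ?a) = F v * (v $ i) ^ ?b"
      if "v \<in> X" "v \<noteq> 0" "G v * (v $ i) ^ ?a \<noteq> 0" for v
    proof -
      have "G v \<noteq> 0" using that by auto
      note vD = FG(4)[OF that(2) this] and eq = FG(5)[OF that(2) this that(1)]
      have vi: "v $ i \<noteq> 0" using vD by (simp add: D_def)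
      have "h i v * (v $ i) ^ ?b = (v $ i) ^ ?a"
        using vi vD by (auto simp: h_def power_int_def power_inverse)
      then have "\<eta> v $ j * (G v * (v $ i) ^ ?a) = (h i v * \<eta> v $ j * G v) * (v $ i) ^ ?b"
        by (simp add: mult_ac)
      then show ?thesis by (simp add: eq)
    qed
    ultimately show "\<exists>m F G. homog (m + (\<kappa> $ j - k)) F \<and> homog m G \<and> G p \<noteq> 0 \<and>
      (\<forall>v\<in>X. v \<noteq> 0 \<longrightarrow> G v \<noteq> 0 \<longrightarrow> \<eta> v $ j * G v = F v)"
      by (intro exI[of _ "m + int ?a"] exI[of _ "\<lambda>v. F v * (v $ i) ^ ?b"] exI[of _ "\<lambda>v. G v * (v $ i) ^ ?a"])
         (use FG(3) pi in auto)
  qed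
  then show ?thesis using main by (intro exI[of _ \<eta>]) blast
qed

lemma coord_unit_section:
  fixes p :: vec3
  assumes "p \<noteq> 0"
  obtains U g where "zopen U" "p \<in> U" "g \<in> regular UNIV k U" "\<And>v. v \<in> U \<Longrightarrow> g v \<noteq> 0"
proof -
  obtain i where i: "p $ i \<noteq> 0" using ex_coord_nonzero[OF assms] by blast
  let ?U = "{v. v \<noteq> 0 \<and> v $ i \<noteq> 0}"
  show ?thesis
  proof (rule that)
    show "zopen ?U" by (rule zopen_coord)
    show "(\<lambda>v. if v \<in> ?U then (v $ i) powi k else 0) \<in> regular UNIV k ?U"
      by (rule regular_coord_power[OF zopen_coord]) simp
  qed (use assms i in auto)
qed

section \<open>Presentations of the derivation bundle by vector fields\<close>

lemma regular_axis:
  fixes j :: "'n::finite"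
  assumes U: "zopen U" and g: "g \<in> regular UNIV (\<kappa> $ j) U"
  shows "(\<lambda>v. g v *s axis j 1) \<in> twist UNIV \<kappa> U"
  unfolding twist_def
proof (intro CollectI allI)
  fix i
  show "(\<lambda>v. (g v *s axis j 1) $ i) \<in> regular UNIV (\<kappa> $ i) U"
    using g regular_zero[OF U] by (cases "i = j") (auto simp: axis_def)
qed

lemma vec_axis_sum: "(x :: complex ^ ('n::finite)) = (\<Sum>j\<in>UNIV. x $ j *s axis j 1)"
proof -
  have "(\<Sum>j\<in>UNIV. x $ j *s axis j 1) $ i = x $ i" for i
  proof -
    have "(\<Sum>j\<in>UNIV. x $ j *s axis j 1) $ i = (\<Sum>j\<in>UNIV. x $ j * axis j 1 $ i)" by simp
    also have "\<dots> = (\<Sum>j\<in>UNIV. if i = j then x $ j else 0)"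
      by (rule sum.cong) (auto simp: axis_def)
    finally show ?thesis by simp
  qed
  then show ?thesis unfolding Finite_Cartesian_Product.vec_eq_iff by metis
qed

lemma vform_poly_on_lines: "vform k \<theta> \<Longrightarrow> poly_on_lines (\<lambda>v. \<theta> v $ i)"
  by (simp add: vform_def homog_def)

lemma poly_on_lines_sum: "(\<And>i. i \<in> I \<Longrightarrow> poly_on_lines (F i)) \<Longrightarrow> poly_on_lines (\<lambda>v. \<Sum>i\<in>I. F i v)"
  by (induction I rule: infinite_finite_induct) (auto intro: poly_on_lines_add poly_on_lines_const)

lemma poly_on_lines_diff: "poly_on_lines F \<Longrightarrow> poly_on_lines G \<Longrightarrow> poly_on_lines (\<lambda>v. F v - G v)"
  using poly_on_lines_add[OF _ poly_on_lines_mult[OF poly_on_lines_const[of "-1"]], of F G] by simp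

lemma kernel_field_section:
  assumes A: "arrangement A" and \<theta>: "vform (- k) \<theta>" and z: "\<And>v. grad_pairing A v (\<theta> v) = 0"
    and U: "zopen U" and g: "g \<in> regular UNIV k U"
  shows "(\<lambda>v. g v *s \<theta> v) \<in> derivation_bundle A U"
  unfolding derivation_bundle_iff
proof (intro conjI allI)
  show "(\<lambda>v. g v *s \<theta> v) \<in> twist UNIV 0 U"
    unfolding twist_def using regular_mult_homog[OF U g, of "- k"] \<theta> by (simp add: vform_def)
  show "grad_pairing A v (g v *s \<theta> v) = 0" for v by (simp add: grad_pairing_scale z)
qed

text \<open>Local generation of the derivation bundle in terms of forms: near \<open>p\<close> the factor \<open>Q\<close> is a unit.\<close>

definition generates :: "vec3 set set \<Rightarrow> (('n::finite) \<Rightarrow> vec3 \<Rightarrow> vec3) \<Rightarrow> int ^ 'n \<Rightarrow> bool" where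
  "generates A \<theta> \<kappa> \<longleftrightarrow> (\<forall>\<delta> k p. vform k \<delta> \<longrightarrow> (\<forall>v. grad_pairing A v (\<delta> v) = 0) \<longrightarrow> p \<noteq> 0 \<longrightarrow>
     (\<exists>m Q u. homog m Q \<and> Q p \<noteq> 0 \<and> (\<forall>j. homog (m + k + \<kappa> $ j) (u j)) \<and>
       (\<forall>v. Q v *s \<delta> v = (\<Sum>j\<in>UNIV. u j v *s \<theta> j v))))"

text \<open>A morphism out of a sum of line bundles is determined by the images of the coordinate vectors, which
  are global sections of twists of the target and hence vector fields. Surjectivity turns into local
  generation once denominators are cleared.\<close>

lemma presentation_by_fields:
  fixes \<kappa> :: "int ^ ('n::finite)"
  assumes A: "arrangement A" and \<Psi>: "sheaf_morphism (twist UNIV \<kappa>) (derivation_bundle A) \<Psi>"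
    and surj: "sheaf_surjective (twist UNIV \<kappa>) (derivation_bundle A) \<Psi>"
  shows "\<exists>\<theta>. (\<forall>j. vform (- \<kappa> $ j) (\<theta> j)) \<and> (\<forall>j v. grad_pairing A v (\<theta> j v) = 0) \<and>
    (\<forall>U s. zopen U \<longrightarrow> s \<in> twist UNIV \<kappa> U \<longrightarrow> \<Psi> U s = (\<lambda>v. \<Sum>j\<in>UNIV. s v $ j *s \<theta> j v)) \<and>
    generates A \<theta> \<kappa>"
proof -
  have sub: "derivation_bundle A U \<subseteq> twist UNIV 0 U" for U by (auto simp: derivation_bundle_iff)
  have "\<exists>\<theta>. vform (- \<kappa> $ j) \<theta> \<and> (\<forall>U g. zopen U \<longrightarrow> g \<in> regular UNIV (\<kappa> $ j) U \<longrightarrow>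
     \<Psi> U (\<lambda>v. g v *s axis j 1) = (\<lambda>v. g v *s \<theta> v))" for j
  proof -
    from twisted_section_image[OF \<Psi> sub, of "\<kappa> $ j" "\<lambda>v. axis j 1", OF regular_axis]
    obtain \<eta> where \<eta>: "\<And>U g. zopen U \<Longrightarrow> g \<in> regular UNIV (\<kappa> $ j) U \<Longrightarrow>
        \<Psi> U (\<lambda>v. g v *s axis j 1) = (\<lambda>v. g v *s \<eta> v)"
      "\<And>i. locally_quotient UNIV (0 $ i - \<kappa> $ j) (\<lambda>v. \<eta> v $ i)" by blast
    have "\<exists>F. homog (- \<kappa> $ j) F \<and> (\<forall>v. v \<noteq> 0 \<longrightarrow> F v = \<eta> v $ i)" for i
      using locally_quotient_global[OF \<eta>(2)[of i]] by (metis diff_0 zero_index)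
    then obtain F where F: "\<And>i. homog (- \<kappa> $ j) (F i)" "\<And>i v. v \<noteq> 0 \<Longrightarrow> F i v = \<eta> v $ i" by metis
    show ?thesis
    proof (intro exI[of _ "\<lambda>v. \<chi> i. F i v"] conjI allI impI)
      show "vform (- \<kappa> $ j) (\<lambda>v. \<chi> i. F i v)" by (simp add: vform_def F(1))
      fix U g assume U: "zopen U" and g: "g \<in> regular UNIV (\<kappa> $ j) U"
      have "g v *s \<eta> v = g v *s (\<chi> i. F i v)" for v
      proof (cases "v = 0")
        case True
        then have "v \<notin> U" using zopen_nonzero[OF U] by blast
        then show ?thesis using regular_zero_outside[OF g, of v] by simp
      qed (simp add: F(2))
      then have "(\<lambda>v. g v *s \<eta> v) = (\<lambda>v. g v *s (\<chi> i. F i v))" by (rule ext)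
      then show "\<Psi> U (\<lambda>v. g v *s axis j 1) = (\<lambda>v. g v *s (\<chi> i. F i v))"
        by (simp only: \<eta>(1)[OF U g])
    qed
  qed
  then have "\<forall>j. \<exists>\<theta>. vform (- \<kappa> $ j) \<theta> \<and> (\<forall>U g. zopen U \<longrightarrow> g \<in> regular UNIV (\<kappa> $ j) U \<longrightarrow>
     \<Psi> U (\<lambda>v. g v *s axis j 1) = (\<lambda>v. g v *s \<theta> v))" by (rule allI)
  from choice[OF this] obtain \<theta> where \<theta>: "\<And>j. vform (- \<kappa> $ j) (\<theta> j)"
    "\<And>j U g. zopen U \<Longrightarrow> g \<in> regular UNIV (\<kappa> $ j) U \<Longrightarrow>
       \<Psi> U (\<lambda>v. g v *s axis j 1) = (\<lambda>v. g v *s \<theta> j v)" by blast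
  have kill: "grad_pairing A v (\<theta> j v) = 0" for j v
  proof (rule poly_on_lines_at_zero[OF homog_grad_pairing[OF A \<theta>(1)]])
    fix v :: vec3 assume v: "v \<noteq> 0"
    obtain U g where U: "zopen U" "v \<in> U" and g: "g \<in> regular UNIV (\<kappa> $ j) U" "\<And>v. v \<in> U \<Longrightarrow> g v \<noteq> 0"
      using coord_unit_section[OF v] by metis
    have "(\<lambda>v. g v *s \<theta> j v) \<in> derivation_bundle A U"
      using morphismD(1)[OF \<Psi> U(1) regular_axis[OF U(1) g(1)]] \<theta>(2)[OF U(1) g(1)] by simp
    then have "g v * grad_pairing A v (\<theta> j v) = 0" by (simp add: derivation_bundle_iff grad_pairing_scale)
    then show "grad_pairing A v (\<theta> j v) = 0" using g(2)[OF U(2)] by simp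
  qed
  have expand: "\<Psi> U s = (\<lambda>v. \<Sum>j\<in>UNIV. s v $ j *s \<theta> j v)" if U: "zopen U" and s: "s \<in> twist UNIV \<kappa> U" for U s
  proof -
    have sj: "(\<lambda>v. s v $ j) \<in> regular UNIV (\<kappa> $ j) U" for j using s by (simp add: twist_def)
    have "s = (\<lambda>v. \<Sum>j\<in>UNIV. s v $ j *s axis j 1)" using vec_axis_sum by blast
    then have "\<Psi> U s = \<Psi> U (\<lambda>v. \<Sum>j\<in>UNIV. s v $ j *s axis j 1)" by (rule arg_cong)
    also have "\<dots> = (\<lambda>v. \<Sum>j\<in>UNIV. \<Psi> U (\<lambda>v. s v $ j *s axis j 1) v)"
      by (rule conjunct1[OF morphism_sum[OF \<Psi> U twist_zero[OF U] twist_add[OF U]]])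
         (auto intro: regular_axis[OF U sj])
    finally show ?thesis by (simp add: \<theta>(2)[OF U sj])
  qed
  have "generates A \<theta> \<kappa>" unfolding generates_def
  proof (intro allI impI)
    fix \<delta> k and p :: vec3
    assume \<delta>: "vform k \<delta>" and z: "\<forall>v. grad_pairing A v (\<delta> v) = 0" and p: "p \<noteq> 0"
    show "\<exists>m Q u. homog m Q \<and> Q p \<noteq> 0 \<and> (\<forall>j. homog (m + k + \<kappa> $ j) (u j)) \<and>
       (\<forall>v. Q v *s \<delta> v = (\<Sum>j\<in>UNIV. u j v *s \<theta> j v))"
    proof (cases "k \<ge> 0")
      case False
      then have "\<delta> v = 0" for v
        using \<delta> homog_cases(2)[of k "\<lambda>v. \<delta> v $ i" for i] False
        by (simp add: vform_def Finite_Cartesian_Product.vec_eq_iff fun_eq_iff)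
      then show ?thesis
        by (intro exI[of _ 0] exI[of _ "\<lambda>v. 1"] exI[of _ "\<lambda>j v. 0"]) (simp add: homog_const)
    next
      case True
      obtain i where i: "p $ i \<noteq> 0" using ex_coord_nonzero[OF p] by blast
      let ?U = "{v. v \<noteq> 0 \<and> v $ i \<noteq> 0}"
      let ?h = "\<lambda>v. if v \<in> ?U then (v $ i) powi (- k) else 0"
      have U: "zopen ?U" by (rule zopen_coord)
      have h: "?h \<in> regular UNIV (- k) ?U" by (rule regular_coord_power[OF U]) simp
      have "(\<lambda>v. ?h v *s \<delta> v) \<in> derivation_bundle A ?U"
        by (rule kernel_field_section[OF A _ _ U h]) (use \<delta> z in auto)
      then have "sheaf_image (twist UNIV \<kappa>) \<Psi> ?U (\<lambda>v. ?h v *s \<delta> v)"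
        using surj U unfolding sheaf_surjective_def by blast
      moreover have pU: "p \<in> ?U" using p i by simp
      ultimately obtain V s where V: "zopen V" "p \<in> V" "V \<subseteq> ?U" and s: "s \<in> twist UNIV \<kappa> V"
        "\<Psi> V s = restr V (\<lambda>v. ?h v *s \<delta> v)"
        unfolding sheaf_image_def locally_on_def by blast
      from common_denominator[OF V(1) s(1) V(2)] obtain M G N where
        G: "homog M G" "G p \<noteq> 0" "\<And>j. homog (M + \<kappa> $ j) (N j)" and
        G': "\<forall>v. v \<noteq> 0 \<longrightarrow> G v \<noteq> 0 \<longrightarrow> v \<in> V \<and> (\<forall>j. s v $ j * G v = N j v)" by (elim exE conjE) metis
      have GV: "v \<in> V" and GN: "s v $ j * G v = N j v" if "v \<noteq> 0" "G v \<noteq> 0" for v j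
        using G' that by auto
      let ?u = "\<lambda>j v. (v $ i) ^ nat k * N j v"
      have u: "homog (M + k + \<kappa> $ j) (?u j)" for j
        by (rule homog_mult'[OF homog_power[OF homog_coord] G(3)]) (use True in simp)
      have eq: "G v *s \<delta> v = (\<Sum>j\<in>UNIV. ?u j v *s \<theta> j v)" if v: "v \<noteq> 0" "G v \<noteq> 0" for v
      proof -
        have vV: "v \<in> V" by (rule GV[OF v])
        then have vU: "v \<noteq> 0" "v $ i \<noteq> 0" using V(3) by auto
        have "(\<Sum>j\<in>UNIV. s v $ j *s \<theta> j v) = (v $ i) powi (- k) *s \<delta> v"
          using fun_cong[OF s(2), of v] fun_cong[OF expand[OF V(1) s(1)], of v] vV vU by (simp add: restr_def)
        then have "((v $ i) ^ nat k * G v) *s (\<Sum>j\<in>UNIV. s v $ j *s \<theta> j v) =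
            ((v $ i) ^ nat k * G v * (v $ i) powi (- k)) *s \<delta> v" by (simp add: vector_smult_assoc)
        also have "(v $ i) ^ nat k * G v * (v $ i) powi (- k) = G v"
        proof -
          have "(v $ i) ^ nat k = (v $ i) powi k" using True by (simp add: power_int_def)
          then show ?thesis using vU by (simp add: power_int_minus field_simps)
        qed
        also have "((v $ i) ^ nat k * G v) *s (\<Sum>j\<in>UNIV. s v $ j *s \<theta> j v) =
            (\<Sum>j\<in>UNIV. ((v $ i) ^ nat k * (s v $ j * G v)) *s \<theta> j v)"
          by (simp add: vec.scale_sum_right vector_smult_assoc mult_ac)
        finally show ?thesis by (simp add: GN[OF v])
      qed
      have "G v *s \<delta> v = (\<Sum>j\<in>UNIV. ?u j v *s \<theta> j v)" for v
      proof -
        have "G v * \<delta> v $ l - (\<Sum>j\<in>UNIV. ?u j v * \<theta> j v $ l) = 0" for l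
        proof (rule identity_principle[OF homog_poly_on_lines[OF G(1)] G(2)])
          show "poly_on_lines (\<lambda>v. G v * \<delta> v $ l - (\<Sum>j\<in>UNIV. ?u j v * \<theta> j v $ l))"
            by (intro poly_on_lines_diff poly_on_lines_mult poly_on_lines_sum vform_poly_on_lines[OF \<delta>]
                vform_poly_on_lines[OF \<theta>(1)] homog_poly_on_lines[OF u] homog_poly_on_lines[OF G(1)])
          fix v assume "v \<noteq> 0" "G v \<noteq> 0"
          from arg_cong[OF eq[OF this], of "\<lambda>x. x $ l"]
          show "G v * \<delta> v $ l - (\<Sum>j\<in>UNIV. ?u j v * \<theta> j v $ l) = 0" by simp
        qed
        then show ?thesis by (simp add: Finite_Cartesian_Product.vec_eq_iff)
      qed
      then show ?thesis using G(1,2) u by (intro exI[of _ M] exI[of _ G] exI[of _ ?u]) auto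
    qed
  qed
  then show ?thesis using \<theta>(1) kill expand by (intro exI[of _ \<theta>]) blast
qed

text \<open>After its denominators are cleared, a section near \<open>p\<close> is a field to which local generation applies.\<close>

lemma section_in_generators:
  assumes A: "arrangement A" and gen: "generates A \<theta> \<kappa>" and V: "zopen V"
    and s: "s \<in> derivation_bundle A V" and p: "p \<in> V"
  obtains W r where "zopen W" "p \<in> W" "W \<subseteq> V" "\<And>j. r j \<in> regular UNIV (\<kappa> $ j) W"
    "restr W s = (\<lambda>v. \<Sum>j\<in>UNIV. r j v *s \<theta> j v)"
proof -
  have sT: "s \<in> twist UNIV 0 V" using s by (simp add: derivation_bundle_iff)
  have p0: "p \<noteq> 0" by (rule zopen_nonzero[OF V p])
  from common_denominator[OF V sT p] obtain M G N where
    G: "homog M G" "G p \<noteq> 0" "\<And>j. homog (M + 0 $ j) (N j)" and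
    G': "\<forall>v. v \<noteq> 0 \<longrightarrow> G v \<noteq> 0 \<longrightarrow> v \<in> V \<and> (\<forall>j. s v $ j * G v = N j v)" by (elim exE conjE) metis
  have GV: "v \<in> V" and GN: "s v $ j * G v = N j v" if "v \<noteq> 0" "G v \<noteq> 0" for v j
    using G' that by auto
  define \<delta> where "\<delta> v = (\<chi> j. N j v)" for v
  have \<delta>: "vform M \<delta>" using G(3) by (simp add: vform_def \<delta>_def)
  have Gs: "\<delta> v = G v *s s v" if "v \<noteq> 0" "G v \<noteq> 0" for v
    using GN[OF that] by (simp add: \<delta>_def Finite_Cartesian_Product.vec_eq_iff mult.commute)
  have kill: "grad_pairing A v (\<delta> v) = 0" for v
    by (rule identity_principle[OF homog_poly_on_lines[OF G(1)] G(2) homog_grad_pairing[OF A \<delta>]])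
       (use s in \<open>auto simp: Gs grad_pairing_scale derivation_bundle_iff\<close>)
  from gen[unfolded generates_def, rule_format, OF \<delta> kill p0]
  obtain m Q u where Q: "homog m Q" "Q p \<noteq> 0" "\<And>j. homog (m + M + \<kappa> $ j) (u j)"
    "\<And>v. Q v *s \<delta> v = (\<Sum>j\<in>UNIV. u j v *s \<theta> j v)" by blast
  let ?W = "{v. v \<noteq> 0 \<and> G v * Q v \<noteq> 0}"
  have W: "zopen ?W" by (rule zopen_principal[OF homog_mult[OF G(1) Q(1)]])
  let ?r = "\<lambda>j v. if v \<in> ?W then u j v / (G v * Q v) else 0"
  show ?thesis
  proof (rule that[OF W])
    show "p \<in> ?W" using p0 G(2) Q(2) by simp
    show "?W \<subseteq> V" using GV by auto
    show "?r j \<in> regular UNIV (\<kappa> $ j) ?W" for j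
      by (rule regular_quotient[OF W Q(3) homog_mult[OF G(1) Q(1)]]) auto
    show "restr ?W s = (\<lambda>v. \<Sum>j\<in>UNIV. ?r j v *s \<theta> j v)"
    proof
      fix v
      show "restr ?W s v = (\<Sum>j\<in>UNIV. ?r j v *s \<theta> j v)"
      proof (cases "v \<in> ?W")
        case True
        then have nz: "v \<noteq> 0" "G v \<noteq> 0" "Q v \<noteq> 0" by auto
        have "(\<Sum>j\<in>UNIV. ?r j v *s \<theta> j v) = (1 / (G v * Q v)) *s (\<Sum>j\<in>UNIV. u j v *s \<theta> j v)"
          using True by (simp add: vec.scale_sum_right vector_smult_assoc)
        also have "\<dots> = (1 / (G v * Q v)) *s (Q v *s (G v *s s v))"
          unfolding Q(4)[symmetric] Gs[OF nz(1,2)] ..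
        also have "\<dots> = s v" using nz by (simp add: vector_smult_assoc)
        finally show ?thesis using True by (simp add: restr_def)
      next
        case False
        then show ?thesis by (simp only: restr_def if_not_P if_False) simp
      qed
    qed
  qed
qed

lemma sheaf_isomorphic_inverse:
  fixes E :: "('m::finite) msheaf" and F :: "('n::finite) msheaf"
  assumes \<phi>: "sheaf_morphism E F \<phi>" and bij: "\<And>U. zopen U \<Longrightarrow> bij_betw (\<phi> U) (E U) (F U)"
    and add: "\<And>U s t. zopen U \<Longrightarrow> s \<in> E U \<Longrightarrow> t \<in> E U \<Longrightarrow> (\<lambda>v. s v + t v) \<in> E U"
    and mult: "\<And>U g s. zopen U \<Longrightarrow> g \<in> structure_sheaf U \<Longrightarrow> s \<in> E U \<Longrightarrow> (\<lambda>v. g v *s s v) \<in> E U"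
    and res: "\<And>U V s. zopen U \<Longrightarrow> zopen V \<Longrightarrow> V \<subseteq> U \<Longrightarrow> s \<in> E U \<Longrightarrow> restr V s \<in> E V"
  shows "sheaf_morphism F E (\<lambda>U. inv_into (E U) (\<phi> U))"
  unfolding sheaf_morphism_def
proof (intro allI impI)
  fix U assume U: "zopen U"
  let ?\<chi> = "\<lambda>U. inv_into (E U) (\<phi> U)"
  have inE: "?\<chi> U t \<in> E U" if "zopen U" "t \<in> F U" for U t
    using bij_betw_imp_surj_on[OF bij[OF that(1)]] that(2) by (metis inv_into_into)
  have right: "\<phi> U (?\<chi> U t) = t" if "zopen U" "t \<in> F U" for U t
    using bij_betw_inv_into_right[OF bij[OF that(1)] that(2)] .
  have left: "?\<chi> U (\<phi> U s) = s" if "zopen U" "s \<in> E U" for U s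
    using bij_betw_inv_into_left[OF bij[OF that(1)] that(2)] .
  show "(\<forall>s\<in>F U. ?\<chi> U s \<in> E U) \<and>
     (\<forall>s\<in>F U. \<forall>t\<in>F U. ?\<chi> U (\<lambda>v. s v + t v) = (\<lambda>v. ?\<chi> U s v + ?\<chi> U t v)) \<and>
     (\<forall>g\<in>structure_sheaf U. \<forall>s\<in>F U. ?\<chi> U (\<lambda>v. g v *s s v) = (\<lambda>v. g v *s ?\<chi> U s v)) \<and>
     (\<forall>V. zopen V \<and> V \<subseteq> U \<longrightarrow> (\<forall>s\<in>F U. ?\<chi> V (restr V s) = restr V (?\<chi> U s)))"
  proof (intro conjI ballI allI impI)
    show "?\<chi> U s \<in> E U" if "s \<in> F U" for s by (rule inE[OF U that])
    show "?\<chi> U (\<lambda>v. s v + t v) = (\<lambda>v. ?\<chi> U s v + ?\<chi> U t v)" if s: "s \<in> F U" and t: "t \<in> F U" for s t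
      using left[OF U add[OF U inE[OF U s] inE[OF U t]]] morphismD(2)[OF \<phi> U inE[OF U s] inE[OF U t]]
      by (simp add: right[OF U s] right[OF U t])
    show "?\<chi> U (\<lambda>v. g v *s s v) = (\<lambda>v. g v *s ?\<chi> U s v)" if g: "g \<in> structure_sheaf U" and s: "s \<in> F U" for g s
      using left[OF U mult[OF U g inE[OF U s]]] morphismD(3)[OF \<phi> U g inE[OF U s]]
      by (simp add: right[OF U s])
    show "?\<chi> V (restr V s) = restr V (?\<chi> U s)" if V: "zopen V \<and> V \<subseteq> U" and s: "s \<in> F U" for V s
      using left[OF _ res[OF U _ _ inE[OF U s]], of V] morphismD(4)[OF \<phi> U _ _ inE[OF U s], of V] V
      by (simp add: right[OF U s])
  qed
qed

lemma derivation_bundle_add: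
  assumes "zopen U" "s \<in> derivation_bundle A U" "t \<in> derivation_bundle A U"
  shows "(\<lambda>v. s v + t v) \<in> derivation_bundle A U"
  using assms twist_add[OF assms(1), of s 0 t] by (simp add: derivation_bundle_iff grad_pairing_add)

lemma twist_structure_mult:
  "zopen U \<Longrightarrow> g \<in> structure_sheaf U \<Longrightarrow> s \<in> twist UNIV \<kappa> U \<Longrightarrow> (\<lambda>v. g v *s s v) \<in> twist UNIV \<kappa> U"
  by (rule twist_mult[of U g 0 s \<kappa>]) (auto simp: twist_def)

lemma twist_restrict:
  assumes "zopen U" "zopen V" "V \<subseteq> U" "s \<in> twist UNIV \<kappa> U"
  shows "restr V s \<in> twist UNIV \<kappa> V"
proof -
  have "(\<lambda>v. restr V s v $ j) = (\<lambda>v. if v \<in> V then s v $ j else 0)" for j by (auto simp: restr_def)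
  then show ?thesis using assms regular_restrict[OF assms(1-3)] by (simp add: twist_def)
qed

lemma derivation_bundle_mult:
  "zopen U \<Longrightarrow> g \<in> structure_sheaf U \<Longrightarrow> s \<in> derivation_bundle A U \<Longrightarrow> (\<lambda>v. g v *s s v) \<in> derivation_bundle A U"
  by (simp add: derivation_bundle_iff twist_structure_mult grad_pairing_scale)

lemma grad_pairing_zero [simp]: "grad_pairing A v 0 = 0"
  by (simp add: grad_pairing_def)

lemma derivation_bundle_restrict:
  "zopen U \<Longrightarrow> zopen V \<Longrightarrow> V \<subseteq> U \<Longrightarrow> s \<in> derivation_bundle A U \<Longrightarrow> restr V s \<in> derivation_bundle A V"
  using twist_restrict[of U V s 0] by (simp add: derivation_bundle_iff) (simp add: restr_def)

text \<open>The inverse of the isomorphism is a surjective morphism from a sum of two line bundles.\<close>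

lemma free_generators:
  assumes A: "arrangement A" and free: "free_with_exponents A a b"
  obtains \<theta> :: "2 \<Rightarrow> vec3 \<Rightarrow> vec3" where "vform (int a) (\<theta> 1)" "vform (int b) (\<theta> 2)"
    "\<And>j v. grad_pairing A v (\<theta> j v) = 0" "generates A \<theta> (vector [- int a, - int b])"
proof -
  let ?\<kappa> = "vector [- int a, - int b] :: int ^ 2"
  from free obtain \<phi> where \<phi>: "sheaf_morphism (derivation_bundle A) (twist UNIV ?\<kappa>) \<phi>"
    and bij: "\<And>U. zopen U \<Longrightarrow> bij_betw (\<phi> U) (derivation_bundle A U) (twist UNIV ?\<kappa> U)"
    unfolding free_with_exponents_def sheaf_isomorphic_def by blast
  let ?\<chi> = "\<lambda>U. inv_into (derivation_bundle A U) (\<phi> U)"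
  have \<chi>: "sheaf_morphism (twist UNIV ?\<kappa>) (derivation_bundle A) ?\<chi>"
    by (rule sheaf_isomorphic_inverse[OF \<phi> bij derivation_bundle_add derivation_bundle_mult derivation_bundle_restrict])
  have surj: "sheaf_surjective (twist UNIV ?\<kappa>) (derivation_bundle A) ?\<chi>"
    unfolding sheaf_surjective_def sheaf_image_def locally_on_def
  proof (intro allI impI ballI)
    fix U t p assume U: "zopen U" and t: "t \<in> derivation_bundle A U" and p: "p \<in> U"
    have "\<phi> U t \<in> twist UNIV ?\<kappa> U" by (rule morphismD(1)[OF \<phi> U t])
    moreover have "?\<chi> U (\<phi> U t) = t" by (rule bij_betw_inv_into_left[OF bij[OF U] t])
    moreover have "restr U t = t"
      using t twist_zero_outside[of t UNIV 0 U] by (auto simp: restr_def derivation_bundle_iff)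
    ultimately show "\<exists>V. zopen V \<and> p \<in> V \<and> V \<subseteq> U \<and> (\<exists>s\<in>twist UNIV ?\<kappa> V. ?\<chi> V s = restr V t)"
      using U p by (intro exI[of _ U] conjI bexI[of _ "\<phi> U t"]) auto
  qed
  from presentation_by_fields[OF A \<chi> surj] obtain \<theta> where
    \<theta>: "\<And>j. vform (- ?\<kappa> $ j) (\<theta> j)" "\<And>j v. grad_pairing A v (\<theta> j v) = 0" "generates A \<theta> ?\<kappa>" by blast
  show ?thesis using that[of \<theta>] \<theta>(1)[of 1] \<theta>(1)[of 2] \<theta>(2,3) by (simp add: vector_2)
qed

section \<open>Extension of sections and Saito's criterion\<close>

lemma two_powi_inject: "(2 :: complex) powi k = 2 powi l \<Longrightarrow> k = l"
proof -
  assume "(2 :: complex) powi k = 2 powi l"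
  then have "norm ((2 :: complex) powi k) = norm ((2 :: complex) powi l)" by (rule arg_cong)
  then have e: "(2 :: real) powi k = 2 powi l" by (simp add: norm_power_int)
  show ?thesis
  proof (rule linorder_cases)
    assume "k < l" then show ?thesis using power_int_strict_increasing[of k l "2 :: real"] e by simp
  next
    assume "l < k" then show ?thesis using power_int_strict_increasing[of l k "2 :: real"] e by simp
  qed
qed

lemma homog_degree_unique:
  assumes "homog k F" "homog l F" "F v \<noteq> 0" shows "k = l"
proof -
  have "F (2 *s v) = 2 powi k * F v" "F (2 *s v) = 2 powi l * F v"
    using assms(1,2) by (auto intro: homog_scale)
  then have "(2 :: complex) powi k * F v = 2 powi l * F v" by (rule trans[OF sym])
  then show ?thesis using assms(3) by (intro two_powi_inject) simp
qed

lemma homog_positive_at_zero: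
  assumes F: "homog k F" and k: "k > 0" shows "F 0 = 0"
proof (rule ccontr)
  assume nz: "F 0 \<noteq> 0"
  have "2 powi k * F 0 = 2 powi 0 * F 0" using homog_scale[OF F, of 2 0] by simp
  then have "(2 :: complex) powi k = 2 powi 0" using nz by simp
  then show False using two_powi_inject k by blast
qed

lemma poly_on_lines_product_nonzero:
  assumes "poly_on_lines F" "poly_on_lines G" "F u \<noteq> 0" "G w \<noteq> 0"
  obtains z where "F z * G z \<noteq> 0"
proof (rule ccontr)
  assume "\<not> thesis"
  then have z: "F z * G z = 0" for z using that by blast
  have "G w = 0"
    by (rule poly_on_lines_mult_eq_zero[OF assms(1,2), where S = UNIV and u = u]) (use z assms(3) in auto)
  then show False using assms(4) by simp
qed

lemma cross_multiply: "x * G = F \<Longrightarrow> x * G' = F' \<Longrightarrow> F * G' = F' * (G :: complex)"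
  by (auto simp: mult_ac)

lemma cross_multiply_unique:
  assumes f: "poly_on_lines f" "f w \<noteq> 0" and pol: "poly_on_lines F" "poly_on_lines G" "poly_on_lines F'" "poly_on_lines G'"
    and nz: "G p \<noteq> 0" "G' p' \<noteq> 0"
    and eq: "\<And>v. v \<noteq> 0 \<Longrightarrow> f v \<noteq> 0 \<Longrightarrow> G v \<noteq> 0 \<Longrightarrow> G' v \<noteq> 0 \<Longrightarrow> F v * G' v = F' v * G v"
  shows "F v * G' v = F' v * G v"
proof -
  obtain z where z: "G z * G' z \<noteq> 0" by (rule poly_on_lines_product_nonzero[OF pol(2,4) nz])
  obtain z' where z': "f z' * (G z' * G' z') \<noteq> 0"
    by (rule poly_on_lines_product_nonzero[OF f(1) poly_on_lines_mult[OF pol(2,4)] f(2) z])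
  have D: "poly_on_lines (\<lambda>v. F v * G' v - F' v * G v)"
    by (intro poly_on_lines_diff poly_on_lines_mult pol)
  have "F v * G' v - F' v * G v = 0"
    by (rule identity_principle[OF poly_on_lines_mult[OF f(1) poly_on_lines_mult[OF pol(2,4)]] z' D])
       (use eq in auto)
  then show ?thesis by simp
qed

text \<open>The plane is irreducible: a section is determined by its values where a nonzero polynomial does not
  vanish.\<close>

lemma regular_unique:
  assumes U: "zopen U" and s: "s \<in> regular UNIV k U" and t: "t \<in> regular UNIV k U"
    and f: "poly_on_lines f" "f w \<noteq> 0" and eq: "\<And>v. v \<in> U \<Longrightarrow> f v \<noteq> 0 \<Longrightarrow> s v = t v"
  shows "s = t"
proof
  fix v
  show "s v = t v"
  proof (cases "v \<in> U")
    case True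
    from regular_local_UNIV[OF U s True] obtain m F G where FG: "homog (m + k) F" "homog m G" "G v \<noteq> 0"
      "\<And>v. v \<noteq> 0 \<Longrightarrow> G v \<noteq> 0 \<Longrightarrow> v \<in> U \<and> s v * G v = F v" by blast
    from regular_local_UNIV[OF U t True] obtain m' F' G' where FG': "homog (m' + k) F'" "homog m' G'" "G' v \<noteq> 0"
      "\<And>v. v \<noteq> 0 \<Longrightarrow> G' v \<noteq> 0 \<Longrightarrow> v \<in> U \<and> t v * G' v = F' v" by blast
    note pol = FG(1,2)[THEN homog_poly_on_lines] FG'(1,2)[THEN homog_poly_on_lines]
    have "F v * G' v = F' v * G v"
    proof (rule cross_multiply_unique[OF f pol FG(3) FG'(3)])
      fix v assume v: "v \<noteq> 0" "f v \<noteq> 0" "G v \<noteq> 0" "G' v \<noteq> 0"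
      have "s v = t v" using eq[of v] FG(4)[of v] v by blast
      then have "t v * G v = F v" "t v * G' v = F' v" using FG(4)[OF v(1,3)] FG'(4)[OF v(1,4)] by auto
      then show "F v * G' v = F' v * G v" by (rule cross_multiply)
    qed
    moreover have "v \<noteq> 0" by (rule zopen_nonzero[OF U True])
    ultimately have "(s v * G v) * G' v = (t v * G' v) * G v" using FG(3,4) FG'(3,4) by simp
    then have "(G v * G' v) * s v = (G v * G' v) * t v" by (simp only: mult_ac)
    then show ?thesis using FG(3) FG'(3) by simp
  next
    case False
    then show ?thesis using regular_zero_outside[OF s, of v] regular_zero_outside[OF t, of v] by simp
  qed
qed

text \<open>A function known only where \<open>f\<close> does not vanish extends to a section if it is locally a quotient
  of forms.\<close>

lemma regular_extension:
  assumes U: "zopen U" and f: "poly_on_lines f" "f w \<noteq> 0"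
    and loc: "\<And>p. p \<in> U \<Longrightarrow> \<exists>m F G. homog (m + k) F \<and> homog m G \<and> G p \<noteq> 0 \<and>
      (\<forall>v. v \<noteq> 0 \<longrightarrow> G v \<noteq> 0 \<longrightarrow> v \<in> U \<and> (f v \<noteq> 0 \<longrightarrow> x v * G v = F v))"
  obtains s where "s \<in> regular UNIV k U" "\<And>v. v \<in> U \<Longrightarrow> f v \<noteq> 0 \<Longrightarrow> s v = x v"
proof -
  define good where "good p m F G \<longleftrightarrow> homog (m + k) F \<and> homog m G \<and> G p \<noteq> 0 \<and>
      (\<forall>v. v \<noteq> 0 \<longrightarrow> G v \<noteq> 0 \<longrightarrow> v \<in> U \<and> (f v \<noteq> 0 \<longrightarrow> x v * G v = F v))" for p m F G
  have "\<forall>p. \<exists>z. p \<in> U \<longrightarrow> good p (fst z) (fst (snd z)) (snd (snd z))"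
    using loc unfolding good_def by (simp add: split_paired_Ex)
  from choice[OF this] obtain z where z: "\<And>p. p \<in> U \<Longrightarrow> good p (fst (z p)) (fst (snd (z p))) (snd (snd (z p)))" by blast
  define m where "m p = fst (z p)" for p
  define F where "F p = fst (snd (z p))" for p
  define G where "G p = snd (snd (z p))" for p
  have g: "homog (m p + k) (F p)" "homog (m p) (G p)" "G p p \<noteq> 0"
    "\<And>v. v \<noteq> 0 \<Longrightarrow> G p v \<noteq> 0 \<Longrightarrow> v \<in> U" "\<And>v. v \<noteq> 0 \<Longrightarrow> G p v \<noteq> 0 \<Longrightarrow> f v \<noteq> 0 \<Longrightarrow> x v * G p v = F p v"
    if "p \<in> U" for p
    using z[OF that] unfolding good_def m_def F_def G_def by auto
  define s where "s v = (if v \<in> U then F v v / G v v else 0)" for v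
  have sG: "s v * G p v = F p v" if p: "p \<in> U" and v: "v \<noteq> 0" "G p v \<noteq> 0" for p v
  proof -
    have vU: "v \<in> U" by (rule g(4)[OF p v])
    have "F v v * G p v = F p v * G v v"
    proof (rule cross_multiply_unique[OF f, where F = "F v" and G = "G v" and F' = "F p" and G' = "G p" and p = v and p' = p])
      show "G v v \<noteq> 0" "G p p \<noteq> 0" using g(3) vU p by auto
      fix u assume u: "u \<noteq> 0" "f u \<noteq> 0" "G v u \<noteq> 0" "G p u \<noteq> 0"
      have "x u * G v u = F v u" "x u * G p u = F p u" using g(5) vU p u by auto
      then show "F v u * G p u = F p u * G v u" by (rule cross_multiply)
    qed (use g(1,2) vU p homog_poly_on_lines in blast)+
    then show ?thesis using g(3)[OF vU] vU by (simp add: s_def field_simps)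
  qed
  show ?thesis
  proof (rule that)
    show "s \<in> regular UNIV k U"
    proof (rule regularI[OF U])
      fix p assume p: "p \<in> U"
      show "\<exists>m F G. homog (m + k) F \<and> homog m G \<and> G p \<noteq> 0 \<and>
        (\<forall>v. v \<noteq> 0 \<longrightarrow> G v \<noteq> 0 \<longrightarrow> v \<in> U \<and> s v * G v = F v)"
        by (intro exI[of _ "m p"] exI[of _ "F p"] exI[of _ "G p"]) (use g[OF p] sG[OF p] in auto)
    qed (simp add: s_def)
    fix v assume v: "v \<in> U" "f v \<noteq> 0"
    have "v \<noteq> 0" by (rule zopen_nonzero[OF U v(1)])
    then show "s v = x v" using g(3,5)[OF v(1)] v by (simp add: s_def field_simps)
  qed
qed

lemma det3_cramer:
  "det3 v u w *s t = det3 t u w *s v + det3 v t w *s u + det3 v u t *s w"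
  unfolding vec3_eq_iff by (simp add: det3_def algebra_simps)

lemma log_pairing_ex:
  "arrangement A \<Longrightarrow> log_field A k \<theta> \<Longrightarrow> log_field A l \<psi> \<Longrightarrow>
    \<exists>G. homog (k + l + 1 - int (card A)) G \<and> (\<forall>v. det3 v (\<theta> v) (\<psi> v) = defining_poly A v * G v)"
  by (erule (2) log_pairing) blast

text \<open>Saito's criterion: by Cramer's rule, the coefficients of a section with respect to the two fields are
  its pairings with them divided by \<open>c * f\<close>, and these quotients are regular, because \<open>f\<close> divides the
  pairing of logarithmic fields.\<close>

lemma free_if_pairing_constant:
  assumes A: "arrangement A" and \<psi>: "vform (int a) \<psi>1" "vform (int b) \<psi>2"
    and kill: "\<And>v. grad_pairing A v (\<psi>1 v) = 0" "\<And>v. grad_pairing A v (\<psi>2 v) = 0"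
    and c: "c \<noteq> 0" and det: "\<And>v. det3 v (\<psi>1 v) (\<psi>2 v) = c * defining_poly A v"
  shows "free_with_exponents A a b"
proof -
  let ?f = "defining_poly A" and ?\<kappa> = "vector [- int a, - int b] :: int ^ 2"
  have \<kappa>: "?\<kappa> $ 1 = - int a" "?\<kappa> $ 2 = - int b" by (simp_all add: vector_2)
  obtain w where w: "?f w \<noteq> 0" using defining_poly_nonzero[OF A] by blast
  have fp: "poly_on_lines ?f" by (rule homog_poly_on_lines[OF homog_defining_poly])
  have log: "log_field A (int a) \<psi>1" "log_field A (int b) \<psi>2"
    using grad_kernel_log_field[OF A \<psi>(1) kill(1)] grad_kernel_log_field[OF A \<psi>(2) kill(2)] by auto
  have n: "int a + int b + 1 = int (card A)"
  proof (rule homog_degree_unique)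
    show "homog (int a + int b + 1) (\<lambda>v. det3 v (\<psi>1 v) (\<psi>2 v))"
      using homog_det3[OF vform_id \<psi>] by (simp add: algebra_simps)
    show "homog (int (card A)) (\<lambda>v. det3 v (\<psi>1 v) (\<psi>2 v))"
      unfolding det by (rule homog_cmult[OF homog_defining_poly])
    show "det3 w (\<psi>1 w) (\<psi>2 w) \<noteq> 0" using det w c by simp
  qed
  define \<Xi> where "\<Xi> (U :: vec3 set) s = (\<lambda>v. s v $ 1 *s \<psi>1 v + s v $ 2 *s \<psi>2 v)" for U and s :: "vec3 \<Rightarrow> complex ^ 2"
  have inT: "\<Xi> U s \<in> derivation_bundle A U" if U: "zopen U" and s: "s \<in> twist UNIV ?\<kappa> U" for U s
  proof -
    have r: "(\<lambda>v. s v $ 1) \<in> regular UNIV (- int a) U" "(\<lambda>v. s v $ 2) \<in> regular UNIV (- int b) U"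
      using s by (simp_all add: twist_def forall_2 vector_2)
    show ?thesis unfolding \<Xi>_def
      by (intro derivation_bundle_add[OF U] kernel_field_section[OF A _ _ U r(1)] kernel_field_section[OF A _ _ U r(2)])
         (simp_all add: \<psi> kill)
  qed
  have mor: "sheaf_morphism (twist UNIV ?\<kappa>) (derivation_bundle A) \<Xi>"
    unfolding sheaf_morphism_def
  proof (intro allI impI conjI ballI)
    show "\<Xi> U s \<in> derivation_bundle A U" if "zopen U" "s \<in> twist UNIV ?\<kappa> U" for U s by (rule inT[OF that])
  qed (auto simp: \<Xi>_def restr_def fun_eq_iff vector_smult_assoc vector_add_ldistrib vec.scale_left_distrib algebra_simps)
  have inj: "inj_on (\<Xi> U) (twist UNIV ?\<kappa> U)" if U: "zopen U" for U
  proof (rule inj_onI)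
    fix s t assume s: "s \<in> twist UNIV ?\<kappa> U" and t: "t \<in> twist UNIV ?\<kappa> U" and eq: "\<Xi> U s = \<Xi> U t"
    have dd: "det3 v (s v $ 1 *s \<psi>1 v + s v $ 2 *s \<psi>2 v) (\<psi>2 v) = det3 v (t v $ 1 *s \<psi>1 v + t v $ 2 *s \<psi>2 v) (\<psi>2 v)"
      "det3 v (\<psi>1 v) (s v $ 1 *s \<psi>1 v + s v $ 2 *s \<psi>2 v) = det3 v (\<psi>1 v) (t v $ 1 *s \<psi>1 v + t v $ 2 *s \<psi>2 v)" for v
      using fun_cong[OF eq, of v] unfolding \<Xi>_def by simp_all
    have e: "s v $ 1 = t v $ 1" "s v $ 2 = t v $ 2" if "?f v \<noteq> 0" for v
      using dd(1)[of v] dd(2)[of v] that c by (simp_all add: det3_lincomb det)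
    have "(\<lambda>v. s v $ j) = (\<lambda>v. t v $ j)" for j
    proof (rule regular_unique[OF U _ _ fp w])
      show "(\<lambda>v. s v $ j) \<in> regular UNIV (?\<kappa> $ j) U" "(\<lambda>v. t v $ j) \<in> regular UNIV (?\<kappa> $ j) U"
        using s t by (auto simp: twist_def)
      show "s v $ j = t v $ j" if "?f v \<noteq> 0" for v using e[OF that] exhaust_2[of j] by auto
    qed
    then show "s = t" by (simp add: fun_eq_iff Finite_Cartesian_Product.vec_eq_iff)
  qed
  have surj: "\<exists>s\<in>twist UNIV ?\<kappa> U. \<Xi> U s = t" if U: "zopen U" and t: "t \<in> derivation_bundle A U" for U t
  proof -
    have tT: "t \<in> twist UNIV 0 U" and tk: "grad_pairing A v (t v) = 0" for v
      using t by (auto simp: derivation_bundle_iff)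
    have dens: "\<exists>M G \<delta>. homog M G \<and> G p \<noteq> 0 \<and> log_field A M \<delta> \<and>
        (\<forall>v. v \<noteq> 0 \<longrightarrow> G v \<noteq> 0 \<longrightarrow> v \<in> U \<and> \<delta> v = G v *s t v)" if p: "p \<in> U" for p
    proof -
      from common_denominator[OF U tT p] obtain M G N where
        G: "homog M G" "G p \<noteq> 0" "\<And>j. homog (M + 0 $ j) (N j)" and
        G': "\<forall>v. v \<noteq> 0 \<longrightarrow> G v \<noteq> 0 \<longrightarrow> v \<in> U \<and> (\<forall>j. t v $ j * G v = N j v)" by (elim exE conjE) metis
      define \<delta> where "\<delta> v = (\<chi> j. N j v)" for v
      have \<delta>: "vform M \<delta>" using G(3) by (simp add: vform_def \<delta>_def)
      have Gt: "\<delta> v = G v *s t v" if "v \<noteq> 0" "G v \<noteq> 0" for v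
        using G' that by (simp add: \<delta>_def Finite_Cartesian_Product.vec_eq_iff mult.commute)
      have "grad_pairing A v (\<delta> v) = 0" for v
        by (rule identity_principle[OF homog_poly_on_lines[OF G(1)] G(2) homog_grad_pairing[OF A \<delta>]])
           (simp add: Gt grad_pairing_scale tk)
      from grad_kernel_log_field[OF A \<delta> this] show ?thesis using G G' Gt by blast
    qed
    obtain x where x: "x \<in> regular UNIV (- int a) U"
      "\<And>v. v \<in> U \<Longrightarrow> ?f v \<noteq> 0 \<Longrightarrow> x v = det3 v (t v) (\<psi>2 v) / (c * ?f v)"
    proof (rule regular_extension[OF U fp w])
      fix p assume p: "p \<in> U"
      from dens[OF p] obtain M G \<delta> where G: "homog M G" "G p \<noteq> 0" "log_field A M \<delta>"
        "\<And>v. v \<noteq> 0 \<Longrightarrow> G v \<noteq> 0 \<Longrightarrow> v \<in> U \<and> \<delta> v = G v *s t v" by blast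
      have e: "M + int b + 1 - int (card A) = M + - int a" using n by simp
      from log_pairing_ex[OF A G(3) log(2)] obtain K where
        K: "homog (M + - int a) K" "\<And>v. det3 v (\<delta> v) (\<psi>2 v) = ?f v * K v" unfolding e by blast
      have "homog (M + - int a) (\<lambda>v. (1 / c) * K v)" by (rule homog_cmult[OF K(1)])
      moreover have "det3 v (t v) (\<psi>2 v) / (c * ?f v) * G v = (1 / c) * K v" if "v \<noteq> 0" "G v \<noteq> 0" "?f v \<noteq> 0" for v
        using K(2)[of v] G(4)[OF that(1,2)] that(3) c by (simp add: field_simps)
      ultimately show "\<exists>m F G. homog (m + - int a) F \<and> homog m G \<and> G p \<noteq> 0 \<and>
        (\<forall>v. v \<noteq> 0 \<longrightarrow> G v \<noteq> 0 \<longrightarrow> v \<in> U \<and> (?f v \<noteq> 0 \<longrightarrow> det3 v (t v) (\<psi>2 v) / (c * ?f v) * G v = F v))"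
        using G by (intro exI[of _ M] exI[of _ "\<lambda>v. (1 / c) * K v"] exI[of _ G]) auto
    qed blast
    obtain y where y: "y \<in> regular UNIV (- int b) U"
      "\<And>v. v \<in> U \<Longrightarrow> ?f v \<noteq> 0 \<Longrightarrow> y v = det3 v (\<psi>1 v) (t v) / (c * ?f v)"
    proof (rule regular_extension[OF U fp w])
      fix p assume p: "p \<in> U"
      from dens[OF p] obtain M G \<delta> where G: "homog M G" "G p \<noteq> 0" "log_field A M \<delta>"
        "\<And>v. v \<noteq> 0 \<Longrightarrow> G v \<noteq> 0 \<Longrightarrow> v \<in> U \<and> \<delta> v = G v *s t v" by blast
      have e: "int a + M + 1 - int (card A) = M + - int b" using n by simp
      from log_pairing_ex[OF A log(1) G(3)] obtain K where
        K: "homog (M + - int b) K" "\<And>v. det3 v (\<psi>1 v) (\<delta> v) = ?f v * K v" unfolding e by blast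
      have "homog (M + - int b) (\<lambda>v. (1 / c) * K v)" by (rule homog_cmult[OF K(1)])
      moreover have "det3 v (\<psi>1 v) (t v) / (c * ?f v) * G v = (1 / c) * K v" if "v \<noteq> 0" "G v \<noteq> 0" "?f v \<noteq> 0" for v
        using K(2)[of v] G(4)[OF that(1,2)] that(3) c by (simp add: field_simps)
      ultimately show "\<exists>m F G. homog (m + - int b) F \<and> homog m G \<and> G p \<noteq> 0 \<and>
        (\<forall>v. v \<noteq> 0 \<longrightarrow> G v \<noteq> 0 \<longrightarrow> v \<in> U \<and> (?f v \<noteq> 0 \<longrightarrow> det3 v (\<psi>1 v) (t v) / (c * ?f v) * G v = F v))"
        using G by (intro exI[of _ M] exI[of _ "\<lambda>v. (1 / c) * K v"] exI[of _ G]) auto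
    qed blast
    define s where "s v = (vector [x v, y v] :: complex ^ 2)" for v
    have s12: "s v $ 1 = x v" "s v $ 2 = y v" for v by (simp_all add: s_def vector_2)
    have sT: "s \<in> twist UNIV ?\<kappa> U"
      unfolding twist_def using x(1) y(1) \<kappa> by (simp add: forall_2 s12)
    have agree: "\<Xi> U s v = t v" if v: "v \<in> U" "?f v \<noteq> 0" for v
    proof -
      have cr: "(c * ?f v) *s t v = det3 (t v) (\<psi>1 v) (\<psi>2 v) *s v + det3 v (t v) (\<psi>2 v) *s \<psi>1 v + det3 v (\<psi>1 v) (t v) *s \<psi>2 v"
        using det3_cramer[of v "\<psi>1 v" "\<psi>2 v" "t v"] det[of v] by simp
      from arg_cong[OF cr, of "grad_pairing A v"]
      have "det3 (t v) (\<psi>1 v) (\<psi>2 v) * (of_nat (card A) * ?f v) = 0"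
        by (simp add: grad_pairing_add grad_pairing_scale tk kill euler_identity[OF arrangementD(1)[OF A]])
      moreover have "card A \<noteq> 0" using n by linarith
      ultimately have "det3 (t v) (\<psi>1 v) (\<psi>2 v) = 0" using v(2) by simp
      then have "(c * ?f v) *s t v = (c * ?f v) *s (x v *s \<psi>1 v + y v *s \<psi>2 v)"
        using cr x(2)[OF v] y(2)[OF v] c v(2) by (simp add: vector_add_ldistrib vector_smult_assoc)
      then have "c * ?f v = 0 \<or> t v = x v *s \<psi>1 v + y v *s \<psi>2 v" by (simp only: vector_mul_lcancel)
      then have "t v = x v *s \<psi>1 v + y v *s \<psi>2 v" using c v(2) by simp
      then show ?thesis by (simp only: \<Xi>_def s12)
    qed
    have "(\<lambda>v. \<Xi> U s v $ i) = (\<lambda>v. t v $ i)" for i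
    proof (rule regular_unique[OF U _ _ fp w])
      show "(\<lambda>v. \<Xi> U s v $ i) \<in> regular UNIV (0 $ i) U" "(\<lambda>v. t v $ i) \<in> regular UNIV (0 $ i) U"
        using inT[OF U sT] tT by (auto simp: derivation_bundle_iff twist_def)
    qed (simp add: agree)
    then have "\<Xi> U s = t" by (simp add: fun_eq_iff Finite_Cartesian_Product.vec_eq_iff)
    then show ?thesis using sT by blast
  qed
  have bij: "bij_betw (\<Xi> U) (twist UNIV ?\<kappa> U) (derivation_bundle A U)" if "zopen U" for U
    unfolding bij_betw_def using inj[OF that] surj[OF that] inT[OF that] by blast
  have "sheaf_morphism (derivation_bundle A) (twist UNIV ?\<kappa>) (\<lambda>U. inv_into (twist UNIV ?\<kappa> U) (\<Xi> U))"
    by (rule sheaf_isomorphic_inverse[OF mor bij twist_add twist_structure_mult twist_restrict])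
  then show ?thesis unfolding free_with_exponents_def sheaf_isomorphic_def
    using bij_betw_inv_into[OF bij] by blast
qed

section \<open>Plus-one generated arrangements and the distinguished line\<close>

lemma sheaf_imageI:
  assumes "zopen U" "s \<in> E U" "\<Phi> U s = t" "restr U t = t"
  shows "sheaf_image E \<Phi> U t"
  unfolding sheaf_image_def locally_on_def
  by (intro ballI exI[of _ U] conjI bexI[of _ s]) (use assms in auto)

lemma vform_sum_zero_at_zero:
  assumes "\<And>j. poly_on_lines (r j)" "\<And>j. vform (k j) (\<theta> j)"
    "\<And>v. v \<noteq> 0 \<Longrightarrow> (\<Sum>j\<in>UNIV. r j v *s \<theta> j v) = 0"
  shows "(\<Sum>j\<in>(UNIV :: ('n::finite) set). r j v *s \<theta> j v) = 0"
proof -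
  have "(\<Sum>j\<in>UNIV. r j v * \<theta> j v $ i) = 0" for i
  proof (rule poly_on_lines_at_zero)
    show "poly_on_lines (\<lambda>v. \<Sum>j\<in>UNIV. r j v * \<theta> j v $ i)"
      by (intro poly_on_lines_sum poly_on_lines_mult assms(1) vform_poly_on_lines[OF assms(2)])
    fix v :: vec3 assume "v \<noteq> 0"
    from arg_cong[OF assms(3)[OF this], of "\<lambda>x. x $ i"]
    show "(\<Sum>j\<in>UNIV. r j v * \<theta> j v $ i) = 0" by simp
  qed
  then show ?thesis by (simp add: Finite_Cartesian_Product.vec_eq_iff)
qed

text \<open>Exactness in the middle of the presentation in terms of forms, for relations of total degree \<open>d\<close>: up
  to a factor that does not vanish at \<open>p\<close>, they are multiples of \<open>\<rho>\<close>.\<close>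

definition relation_generated :: "(('n::finite) \<Rightarrow> vec3 \<Rightarrow> vec3) \<Rightarrow> ('n \<Rightarrow> vec3 \<Rightarrow> complex) \<Rightarrow> int ^ 'n \<Rightarrow> int \<Rightarrow> bool" where
  "relation_generated \<theta> \<rho> \<kappa> d \<longleftrightarrow>
     (\<forall>R p. (\<forall>j. homog (\<kappa> $ j + d) (R j)) \<longrightarrow> (\<forall>v. (\<Sum>j\<in>UNIV. R j v *s \<theta> j v) = 0) \<longrightarrow> p \<noteq> 0 \<longrightarrow>
       (\<exists>Q W. poly_on_lines Q \<and> poly_on_lines W \<and> Q p \<noteq> 0 \<and> (\<forall>j v. Q v * R j v = W v * \<rho> j v)))"

text \<open>The exact sequence in terms of vector fields: the generators \<open>\<theta>\<close> are the images of the coordinate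
  vectors, and the coefficients \<open>\<rho>\<close> of their relation are the image of the generator of the kernel.\<close>

lemma plus_one_generated_presentation:
  fixes a b d :: nat
  defines "\<kappa> \<equiv> vector [- int d, - int b, - int a] :: int ^ 3"
  assumes A: "arrangement A" and pog: "plus_one_generated A a b d"
  obtains \<theta> \<rho> where "\<And>j. vform (- \<kappa> $ j) (\<theta> j)" "\<And>j v. grad_pairing A v (\<theta> j v) = 0" "generates A \<theta> \<kappa>"
    "\<And>j. homog (\<kappa> $ j + (1 + int d)) (\<rho> j)" "\<And>v. (\<Sum>j\<in>UNIV. \<rho> j v *s \<theta> j v) = 0"
    "relation_generated \<theta> \<rho> \<kappa> (int d)" "\<exists>j v. \<rho> j v \<noteq> 0"
proof -
  let ?\<mu> = "vector [- 1 - int d] :: int ^ 1"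
  have \<mu>: "?\<mu> $ 1 = - 1 - int d" by (simp add: vector_def)
  from pog obtain \<phi> \<psi> where ex: "short_exact (twist UNIV ?\<mu>) \<phi> (twist UNIV \<kappa>) \<psi> (derivation_bundle A)"
    unfolding plus_one_generated_def \<kappa>_def by blast
  then have \<phi>: "sheaf_morphism (twist UNIV ?\<mu>) (twist UNIV \<kappa>) \<phi>"
    and \<psi>: "sheaf_morphism (twist UNIV \<kappa>) (derivation_bundle A) \<psi>"
    and inj: "\<And>U. zopen U \<Longrightarrow> inj_on (\<phi> U) (twist UNIV ?\<mu> U)"
    and ker: "\<And>U t. zopen U \<Longrightarrow> t \<in> twist UNIV \<kappa> U \<Longrightarrow>
      \<psi> U t = (\<lambda>v. 0) \<longleftrightarrow> sheaf_image (twist UNIV ?\<mu>) \<phi> U t"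
    and sur: "sheaf_surjective (twist UNIV \<kappa>) (derivation_bundle A) \<psi>"
    unfolding short_exact_def by blast+
  from presentation_by_fields[OF A \<psi> sur] obtain \<theta> where \<theta>: "\<And>j. vform (- \<kappa> $ j) (\<theta> j)"
    "\<And>j v. grad_pairing A v (\<theta> j v) = 0"
    "\<And>U s. zopen U \<Longrightarrow> s \<in> twist UNIV \<kappa> U \<Longrightarrow> \<psi> U s = (\<lambda>v. \<Sum>j\<in>UNIV. s v $ j *s \<theta> j v)"
    "generates A \<theta> \<kappa>" by blast
  have ax: "(\<lambda>v. g v *s axis 1 1) \<in> twist UNIV ?\<mu> U" if "zopen U" "g \<in> regular UNIV (- 1 - int d) U" for U g
    using regular_axis[of U g ?\<mu> 1] that \<mu> by simp
  from twisted_section_image[OF \<phi> subset_refl ax] obtain \<eta> where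
    \<eta>: "\<And>U g. zopen U \<Longrightarrow> g \<in> regular UNIV (- 1 - int d) U \<Longrightarrow>
      \<phi> U (\<lambda>v. g v *s axis 1 1) = (\<lambda>v. g v *s \<eta> v)"
    "\<And>j. locally_quotient UNIV (\<kappa> $ j - (- 1 - int d)) (\<lambda>v. \<eta> v $ j)" by blast
  have "\<forall>j. \<exists>F. homog (\<kappa> $ j + (1 + int d)) F \<and> (\<forall>v. v \<noteq> 0 \<longrightarrow> F v = \<eta> v $ j)"
  proof
    fix j
    have "\<kappa> $ j - (- 1 - int d) = \<kappa> $ j + (1 + int d)" by simp
    then show "\<exists>F. homog (\<kappa> $ j + (1 + int d)) F \<and> (\<forall>v. v \<noteq> 0 \<longrightarrow> F v = \<eta> v $ j)"
      using locally_quotient_global[OF \<eta>(2)[of j]] by metis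
  qed
  from choice[OF this] obtain \<rho> where \<rho>: "\<And>j. homog (\<kappa> $ j + (1 + int d)) (\<rho> j)"
    "\<And>j v. v \<noteq> 0 \<Longrightarrow> \<rho> j v = \<eta> v $ j" by blast
  have rel0: "(\<Sum>j\<in>UNIV. \<rho> j v *s \<theta> j v) = 0" if v: "v \<noteq> 0" for v
  proof -
    obtain U g where U: "zopen U" "v \<in> U" and g: "g \<in> regular UNIV (- 1 - int d) U" "\<And>v. v \<in> U \<Longrightarrow> g v \<noteq> 0"
      using coord_unit_section[OF v] by metis
    let ?s = "\<lambda>v. g v *s \<eta> v"
    have sT: "?s \<in> twist UNIV \<kappa> U" using morphismD(1)[OF \<phi> U(1) ax[OF U(1) g(1)]] \<eta>(1)[OF U(1) g(1)] by simp
    have "restr U ?s = ?s" using twist_zero_outside[OF sT] by (auto simp: restr_def)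
    then have "sheaf_image (twist UNIV ?\<mu>) \<phi> U ?s"
      by (intro sheaf_imageI[where s = "\<lambda>v. g v *s axis 1 1"] U(1) ax[OF U(1) g(1)] \<eta>(1)[OF U(1) g(1)])
    then have "\<psi> U ?s = (\<lambda>v. 0)" using ker[OF U(1) sT] by simp
    from fun_cong[OF trans[OF \<theta>(3)[OF U(1) sT, symmetric] this], of v]
    have "(\<Sum>j\<in>UNIV. (g v *s \<eta> v) $ j *s \<theta> j v) = 0" .
    then have "g v *s (\<Sum>j\<in>UNIV. \<eta> v $ j *s \<theta> j v) = 0" by (simp add: vec.scale_sum_right vector_smult_assoc)
    then show ?thesis using g(2)[OF U(2)] \<rho>(2)[OF v] by simp
  qed
  have rel: "(\<Sum>j\<in>UNIV. \<rho> j v *s \<theta> j v) = 0" for v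
    by (rule vform_sum_zero_at_zero[OF homog_poly_on_lines[OF \<rho>(1)] \<theta>(1) rel0])
  have gen: "relation_generated \<theta> \<rho> \<kappa> (int d)" unfolding relation_generated_def
  proof (intro allI impI)
    fix R and p :: vec3
    assume R: "\<forall>j. homog (\<kappa> $ j + int d) (R j)" and z: "\<forall>v. (\<Sum>j\<in>UNIV. R j v *s \<theta> j v) = 0" and p: "p \<noteq> 0"
    obtain U g where U: "zopen U" "p \<in> U" and g: "g \<in> regular UNIV (- int d) U" "\<And>v. v \<in> U \<Longrightarrow> g v \<noteq> 0"
      using coord_unit_section[OF p] by metis
    let ?s = "\<lambda>v. g v *s (\<chi> j. R j v)"
    have "(\<lambda>v. g v * R j v) \<in> regular UNIV (\<kappa> $ j) U" for j
      using regular_mult_homog[OF U(1) g(1), of "\<kappa> $ j + int d" "R j"] R by simp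
    then have sT: "?s \<in> twist UNIV \<kappa> U" by (simp add: twist_def)
    have "\<psi> U ?s = (\<lambda>v. g v *s (\<Sum>j\<in>UNIV. R j v *s \<theta> j v))"
      unfolding \<theta>(3)[OF U(1) sT] by (simp add: vec.scale_sum_right vector_smult_assoc)
    then have "\<psi> U ?s = (\<lambda>v. 0)" using z by simp
    then have "sheaf_image (twist UNIV ?\<mu>) \<phi> U ?s" using ker[OF U(1) sT] by simp
    then obtain V t where V: "zopen V" "p \<in> V" "V \<subseteq> U" and t: "t \<in> twist UNIV ?\<mu> V" "\<phi> V t = restr V ?s"
      using U(2) unfolding sheaf_image_def locally_on_def by blast
    have tr: "(\<lambda>v. t v $ 1) \<in> regular UNIV (- 1 - int d) V" using t(1) \<mu> by (auto simp: twist_def)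
    have "t = (\<lambda>v. t v $ 1 *s axis 1 1)" by (simp add: fun_eq_iff Finite_Cartesian_Product.vec_eq_iff axis_def)
    then have "\<phi> V t = (\<lambda>v. t v $ 1 *s \<eta> v)" using \<eta>(1)[OF V(1) tr] by simp
    then have eq: "t v $ 1 * \<rho> j v = g v * R j v" if "v \<in> V" for v j
      using fun_cong[OF t(2), of v] that \<rho>(2)[OF zopen_nonzero[OF V(1) that], of j]
      by (simp add: restr_def Finite_Cartesian_Product.vec_eq_iff)
    from regular_local_UNIV[OF V(1) tr V(2)] obtain m F G where FG: "homog (m + (- 1 - int d)) F" "homog m G" "G p \<noteq> 0"
      "\<And>v. v \<noteq> 0 \<Longrightarrow> G v \<noteq> 0 \<Longrightarrow> v \<in> V \<and> t v $ 1 * G v = F v" by blast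
    from regular_local_UNIV[OF U(1) g(1) U(2)] obtain m' F' G' where FG': "homog (m' + - int d) F'" "homog m' G'" "G' p \<noteq> 0"
      "\<And>v. v \<noteq> 0 \<Longrightarrow> G' v \<noteq> 0 \<Longrightarrow> v \<in> U \<and> g v * G' v = F' v" by blast
    note pol = FG(1,2)[THEN homog_poly_on_lines] FG'(1,2)[THEN homog_poly_on_lines]
    have pR: "poly_on_lines (R j)" "poly_on_lines (\<rho> j)" for j using R \<rho>(1) homog_poly_on_lines by blast+
    show "\<exists>Q W. poly_on_lines Q \<and> poly_on_lines W \<and> Q p \<noteq> 0 \<and> (\<forall>j v. Q v * R j v = W v * \<rho> j v)"
    proof (rule exI[of _ "\<lambda>v. F' v * G v"], rule exI[of _ "\<lambda>v. F v * G' v"], intro conjI allI)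
      show "poly_on_lines (\<lambda>v. F' v * G v)" "poly_on_lines (\<lambda>v. F v * G' v)"
        by (intro poly_on_lines_mult pol)+
      have "F' p = g p * G' p" using FG'(4)[OF p FG'(3)] by simp
      then show "F' p * G p \<noteq> 0" using g(2)[OF U(2)] FG(3) FG'(3) by simp
      fix j v
      have nz: "G p * G' p \<noteq> 0" using FG(3) FG'(3) by simp
      have D: "poly_on_lines (\<lambda>v. F' v * G v * R j v - F v * G' v * \<rho> j v)"
        by (intro poly_on_lines_diff poly_on_lines_mult pol pR)
      have "F' v * G v * R j v - F v * G' v * \<rho> j v = 0"
      proof (rule identity_principle[OF poly_on_lines_mult[OF pol(2,4)] nz D])
        fix v :: vec3 assume v: "v \<noteq> 0" "G v * G' v \<noteq> 0"
        then have "G v \<noteq> 0" "G' v \<noteq> 0" by auto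
        with FG(4)[OF v(1)] FG'(4)[OF v(1)] have h: "v \<in> V" "t v $ 1 * G v = F v" "g v * G' v = F' v" by auto
        have "F' v * G v * R j v = (g v * R j v) * (G v * G' v)" unfolding h(3)[symmetric] by (simp add: mult_ac)
        also have "\<dots> = F v * G' v * \<rho> j v" unfolding eq[OF h(1), symmetric] h(2)[symmetric] by (simp add: mult_ac)
        finally show "F' v * G v * R j v - F v * G' v * \<rho> j v = 0" by simp
      qed
      then show "F' v * G v * R j v = F v * G' v * \<rho> j v" by simp
    qed
  qed
  have nz: "\<exists>j v. \<rho> j v \<noteq> 0"
  proof (rule ccontr)
    assume c: "\<not> ?thesis"
    have p: "pt 1 0 0 \<noteq> 0" by (simp add: vec3_eq_iff)
    obtain U g where U: "zopen U" "pt 1 0 0 \<in> U" and g: "g \<in> regular UNIV (- 1 - int d) U" "\<And>v. v \<in> U \<Longrightarrow> g v \<noteq> 0"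
      using coord_unit_section[OF p] by metis
    have "g v *s \<eta> v = 0" for v
    proof (cases "v \<in> U")
      case True
      then have "\<eta> v $ j = 0" for j using \<rho>(2)[OF zopen_nonzero[OF U(1) True], of j] c by simp
      then show ?thesis by (simp add: Finite_Cartesian_Product.vec_eq_iff)
    next
      case False
      then show ?thesis using regular_zero_outside[OF g(1), of v] by simp
    qed
    then have "(\<lambda>v. g v *s \<eta> v) = (\<lambda>v. 0)" by (rule ext)
    with \<eta>(1)[OF U(1) g(1)] have "\<phi> U (\<lambda>v. g v *s axis 1 1) = (\<lambda>v. 0)" by (rule trans)
    also have "\<dots> = \<phi> U (\<lambda>v. 0)" by (rule morphism_zero[OF \<phi> U(1) twist_zero[OF U(1)], symmetric])
    finally have "(\<lambda>v. g v *s axis 1 1 :: complex ^ 1) = (\<lambda>v. 0)"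
      by (rule inj_onD[OF inj[OF U(1)] _ ax[OF U(1) g(1)] twist_zero[OF U(1)]])
    then have "(g (pt 1 0 0) *s axis 1 1 :: complex ^ 1) $ 1 = 0" by (metis zero_index)
    then show False using g(2)[OF U(2)] by (simp add: axis_def)
  qed
  show ?thesis by (rule that[OF \<theta>(1,2,4) \<rho>(1) rel gen nz])
qed

lemma coordinates:
  fixes \<eta> :: "3 \<Rightarrow> complex ^ 'n"
  assumes "(\<Sum>j\<in>UNIV. x j *s \<eta> j) = y"
  shows "x 1 * \<eta> 1 $ i + x 2 * \<eta> 2 $ i + x 3 * \<eta> 3 $ i = y $ i"
  unfolding assms[symmetric] sum_3 by simp

text \<open>The map onto the split bundle on \<open>l\<close> sends the three generators to pairs of forms on \<open>l\<close>. The components of the last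
  two generators in \<open>O(- d)\<close> have negative degree and vanish; as the map is onto, the component of the
  first generator vanishes nowhere. Hence the coefficient of the first generator in the relation is zero
  on \<open>l\<close>, and the second components \<open>u2\<close> and \<open>u3\<close> of the other generators, which have to generate the
  second summand, have no common zero.\<close>

lemma distinguished_line_sections:
  fixes a b d :: nat
  defines "\<kappa> \<equiv> vector [- int d, - int b, - int a] :: int ^ 3"
  assumes A: "arrangement A" and dl: "distinguished_line A a b d l" and ab: "a \<le> b" "b < d"
    and \<theta>: "\<And>j. vform (- \<kappa> $ j) (\<theta> j)" "\<And>j v. grad_pairing A v (\<theta> j v) = 0" "generates A \<theta> \<kappa>"
    and \<rho>: "\<And>j. homog (\<kappa> $ j + (1 + int d)) (\<rho> j)" "\<And>v. (\<Sum>j\<in>UNIV. \<rho> j v *s \<theta> j v) = 0"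
  obtains u2 u3 where "homog (int d + 1 - int a) u2" "homog (int d + 1 - int b) u3"
    "\<And>v. v \<in> l \<Longrightarrow> \<rho> 1 v = 0" "\<And>v. v \<in> l \<Longrightarrow> \<rho> 2 v * u2 v + \<rho> 3 v * u3 v = 0"
    "\<And>v. v \<in> l \<Longrightarrow> v \<noteq> 0 \<Longrightarrow> u2 v \<noteq> 0 \<or> u3 v \<noteq> 0"
proof -
  let ?\<tau> = "vector [- int d, int d + 1 - int a - int b] :: int ^ 2" and ?T = "derivation_bundle A"
  have \<kappa>: "\<kappa> $ 1 = - int d" "\<kappa> $ 2 = - int b" "\<kappa> $ 3 = - int a" by (simp_all add: \<kappa>_def vector_3)
  have l: "is_line l" using dl by (simp add: distinguished_line_def)
  note lc = line_coeffs_props[OF l]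
  have l_eq: "l = {v. lin (line_coeffs l) v = 0}" using lc(2) by blast
  from dl obtain \<Phi> where \<Phi>: "sheaf_morphism ?T (twist l ?\<tau>) \<Phi>" and sur: "sheaf_surjective ?T (twist l ?\<tau>) \<Phi>"
    unfolding distinguished_line_def restricts_to_def by blast
  have "\<forall>j. \<exists>\<eta>. (\<forall>U g. zopen U \<longrightarrow> g \<in> regular UNIV (\<kappa> $ j) U \<longrightarrow>
      \<Phi> U (\<lambda>v. g v *s \<theta> j v) = (\<lambda>v. g v *s \<eta> v)) \<and> (\<forall>i. locally_quotient l (?\<tau> $ i - \<kappa> $ j) (\<lambda>v. \<eta> v $ i))"
  proof
    fix j
    show "\<exists>\<eta>. (\<forall>U g. zopen U \<longrightarrow> g \<in> regular UNIV (\<kappa> $ j) U \<longrightarrow>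
      \<Phi> U (\<lambda>v. g v *s \<theta> j v) = (\<lambda>v. g v *s \<eta> v)) \<and> (\<forall>i. locally_quotient l (?\<tau> $ i - \<kappa> $ j) (\<lambda>v. \<eta> v $ i))"
      by (rule twisted_section_image[OF \<Phi> subset_refl kernel_field_section[OF A \<theta>(1,2)]])
  qed
  from choice[OF this] obtain \<eta> where \<eta>: "\<And>j U g. zopen U \<Longrightarrow> g \<in> regular UNIV (\<kappa> $ j) U \<Longrightarrow>
      \<Phi> U (\<lambda>v. g v *s \<theta> j v) = (\<lambda>v. g v *s \<eta> j v)"
    "\<And>j i. locally_quotient l (?\<tau> $ i - \<kappa> $ j) (\<lambda>v. \<eta> j v $ i)" by blast
  have lq: "\<exists>F. homog (?\<tau> $ i - \<kappa> $ j) F \<and> (\<forall>v. v \<noteq> 0 \<longrightarrow> v \<in> l \<longrightarrow> F v = \<eta> j v $ i)" for i j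
  proof -
    have "locally_quotient {v. lin (line_coeffs l) v = 0} (?\<tau> $ i - \<kappa> $ j) (\<lambda>v. \<eta> j v $ i)"
      using \<eta>(2)[of i j] l_eq by simp
    from locally_quotient_global_on_plane[OF lc(1) this] show ?thesis unfolding lc(2) by metis
  qed
  have neg: "\<eta> j v $ 1 = 0" if j: "j = 2 \<or> j = 3" and v: "v \<noteq> 0" "v \<in> l" for j v
  proof -
    obtain F where F: "homog (?\<tau> $ 1 - \<kappa> $ j) F" "F v = \<eta> j v $ 1" using lq[of 1 j] v by blast
    have "?\<tau> $ 1 - \<kappa> $ j < 0" using j ab by (auto simp: \<kappa> vector_2)
    then show ?thesis using homog_cases(2)[OF F(1)] F(2) by simp
  qed
  have neg2: "\<eta> 2 v $ 1 = 0" and neg3: "\<eta> 3 v $ 1 = 0" if "v \<noteq> 0" "v \<in> l" for v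
    using neg[OF _ that] by blast+
  have e: "?\<tau> $ 2 - \<kappa> $ 2 = int d + 1 - int a" "?\<tau> $ 2 - \<kappa> $ 3 = int d + 1 - int b"
    by (simp_all add: \<kappa> vector_2)
  obtain u2 where u2: "homog (int d + 1 - int a) u2" "\<And>v. v \<noteq> 0 \<Longrightarrow> v \<in> l \<Longrightarrow> u2 v = \<eta> 2 v $ 2"
    using lq[of 2 2] unfolding e by blast
  obtain u3 where u3: "homog (int d + 1 - int b) u3" "\<And>v. v \<noteq> 0 \<Longrightarrow> v \<in> l \<Longrightarrow> u3 v = \<eta> 3 v $ 2"
    using lq[of 2 3] unfolding e by blast
  have rel: "(\<Sum>j\<in>UNIV. \<rho> j v *s \<eta> j v) = 0" if v: "v \<noteq> 0" for v
  proof -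
    obtain U g where U: "zopen U" "v \<in> U" and g: "g \<in> regular UNIV (- 1 - int d) U" "\<And>v. v \<in> U \<Longrightarrow> g v \<noteq> 0"
      using coord_unit_section[OF v] by metis
    have gr: "(\<lambda>v. g v * \<rho> j v) \<in> regular UNIV (\<kappa> $ j) U" for j
      using regular_mult_homog[OF U(1) g(1) \<rho>(1)[of j]] by (simp add: algebra_simps)
    have zT: "(\<lambda>v. 0) \<in> ?T U" by (simp add: derivation_bundle_iff twist_zero[OF U(1)])
    have "(\<lambda>v. \<Sum>j\<in>UNIV. (g v * \<rho> j v) *s \<theta> j v) = (\<lambda>v. g v *s (\<Sum>j\<in>UNIV. \<rho> j v *s \<theta> j v))"
      by (simp add: vec.scale_sum_right vector_smult_assoc)
    then have z: "(\<lambda>v. \<Sum>j\<in>UNIV. (g v * \<rho> j v) *s \<theta> j v) = (\<lambda>v. 0)" using \<rho>(2) by simp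
    have "\<Phi> U (\<lambda>v. \<Sum>j\<in>UNIV. (g v * \<rho> j v) *s \<theta> j v) = (\<lambda>v. \<Sum>j\<in>UNIV. \<Phi> U (\<lambda>v. (g v * \<rho> j v) *s \<theta> j v) v)"
      by (rule conjunct1[OF morphism_sum[OF \<Phi> U(1) zT derivation_bundle_add[OF U(1)]]])
         (auto intro: kernel_field_section[OF A \<theta>(1,2) U(1) gr])
    also have "\<dots> = (\<lambda>v. \<Sum>j\<in>UNIV. (g v * \<rho> j v) *s \<eta> j v)" by (simp add: \<eta>(1)[OF U(1) gr])
    finally have "(\<lambda>v. \<Sum>j\<in>UNIV. (g v * \<rho> j v) *s \<eta> j v) = (\<lambda>v. 0)"
      unfolding z morphism_zero[OF \<Phi> U(1) zT] by simp
    then have "(\<Sum>j\<in>UNIV. (g v * \<rho> j v) *s \<eta> j v) = 0" by (rule fun_cong)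
    then have "g v *s (\<Sum>j\<in>UNIV. \<rho> j v *s \<eta> j v) = 0" by (simp add: vec.scale_sum_right vector_smult_assoc)
    then show ?thesis using g(2)[OF U(2)] by simp
  qed
  have onto: "\<exists>x c. c \<noteq> 0 \<and> (\<Sum>j\<in>UNIV. x j *s \<eta> j p) = c *s axis i 1" if p: "p \<noteq> 0" "p \<in> l" for p and i :: 2
  proof -
    obtain U g where U: "zopen U" "p \<in> U" and g: "g \<in> regular UNIV (?\<tau> $ i) U" "\<And>v. v \<in> U \<Longrightarrow> g v \<noteq> 0"
      using coord_unit_section[OF p(1)] by metis
    let ?t = "\<lambda>v. if v \<in> l then g v *s axis i 1 else 0 :: complex ^ 2"
    have "?t \<in> twist l ?\<tau> U" unfolding twist_def
    proof (intro CollectI allI)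
      fix j
      have "(\<lambda>v. (g v *s axis i 1 :: complex ^ 2) $ j) \<in> regular UNIV (?\<tau> $ j) U"
        using regular_axis[OF U(1) g(1)] unfolding twist_def by blast
      from regular_to_subvariety[OF this, of l]
      show "(\<lambda>v. ?t v $ j) \<in> regular l (?\<tau> $ j) U" by (simp add: if_distrib[of "\<lambda>x. x $ j"] cong: if_cong)
    qed
    then have "sheaf_image ?T \<Phi> U ?t" using sur U(1) unfolding sheaf_surjective_def by blast
    then obtain V s where V: "zopen V" "p \<in> V" "V \<subseteq> U" and s: "s \<in> ?T V" "\<Phi> V s = restr V ?t"
      using U(2) unfolding sheaf_image_def locally_on_def by blast
    obtain W r where W: "zopen W" "p \<in> W" "W \<subseteq> V" and r: "\<And>j. r j \<in> regular UNIV (\<kappa> $ j) W"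
      "restr W s = (\<lambda>v. \<Sum>j\<in>UNIV. r j v *s \<theta> j v)"
      by (rule section_in_generators[OF A \<theta>(3) V(1) s(1) V(2)]) blast
    have zT: "(\<lambda>v. 0) \<in> ?T W" by (simp add: derivation_bundle_iff twist_zero[OF W(1)])
    have "restr W (\<Phi> V s) = \<Phi> W (restr W s)" by (rule morphismD(4)[OF \<Phi> V(1) W(1,3) s(1), symmetric])
    also have "\<dots> = (\<lambda>v. \<Sum>j\<in>UNIV. \<Phi> W (\<lambda>v. r j v *s \<theta> j v) v)" unfolding r(2)
      by (rule conjunct1[OF morphism_sum[OF \<Phi> W(1) zT derivation_bundle_add[OF W(1)]]])
         (auto intro: kernel_field_section[OF A \<theta>(1,2) W(1) r(1)])
    also have "\<dots> = (\<lambda>v. \<Sum>j\<in>UNIV. r j v *s \<eta> j v)" by (simp add: \<eta>(1)[OF W(1) r(1)])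
    finally have "restr W (\<Phi> V s) = (\<lambda>v. \<Sum>j\<in>UNIV. r j v *s \<eta> j v)" .
    from fun_cong[OF this, of p] have "(\<Sum>j\<in>UNIV. r j p *s \<eta> j p) = restr W (\<Phi> V s) p" by (rule sym)
    also have "\<dots> = g p *s axis i 1" unfolding s(2) restr_def if_P[OF W(2)] if_P[OF V(2)] if_P[OF p(2)] ..
    finally have "(\<Sum>j\<in>UNIV. r j p *s \<eta> j p) = g p *s axis i 1" .
    then show ?thesis using g(2)[OF U(2)] by (intro exI[of _ "\<lambda>j. r j p"] exI[of _ "g p"]) simp
  qed
  have \<eta>1: "\<eta> 1 p $ 1 \<noteq> 0" if p: "p \<noteq> 0" "p \<in> l" for p
  proof -
    from onto[OF p, of 1] obtain x c where c: "c \<noteq> 0" and e: "(\<Sum>j\<in>UNIV. x j *s \<eta> j p) = c *s axis 1 1" by blast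
    have "x 1 * \<eta> 1 p $ 1 + x 2 * \<eta> 2 p $ 1 + x 3 * \<eta> 3 p $ 1 = c"
      using coordinates[OF e, of 1] by (simp add: axis_def)
    then have "x 1 * \<eta> 1 p $ 1 = c" using neg2[OF p] neg3[OF p] by simp
    then show ?thesis using c by auto
  qed
  have r1: "\<rho> 1 v = 0" if "v \<noteq> 0" "v \<in> l" for v
    using coordinates[OF rel[OF that(1)], of 1] neg2[OF that] neg3[OF that] \<eta>1[OF that] by simp
  show ?thesis
  proof (rule that[OF u2(1) u3(1)])
    fix v assume v: "v \<in> l"
    show "\<rho> 1 v = 0"
    proof (cases "v = 0")
      case True
      have "homog 1 (\<rho> 1)" using \<rho>(1)[of 1] by (simp add: \<kappa>)
      then show ?thesis using homog_positive_at_zero True by simp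
    qed (use r1 v in blast)
    show "\<rho> 2 v * u2 v + \<rho> 3 v * u3 v = 0"
    proof (cases "v = 0")
      case True
      have "u2 0 = 0" "u3 0 = 0" using homog_positive_at_zero[OF u2(1)] homog_positive_at_zero[OF u3(1)] ab by auto
      then show ?thesis using True by simp
    next
      case False
      show ?thesis
        using coordinates[OF rel[OF False], of 2] r1[OF False v] u2(2)[OF False v] u3(2)[OF False v] by simp
    qed
    assume v0: "v \<noteq> 0"
    from onto[OF v0 v, of 2] obtain x c where c: "c \<noteq> 0" and e: "(\<Sum>j\<in>UNIV. x j *s \<eta> j v) = c *s axis 2 1" by blast
    have "x 1 * \<eta> 1 v $ 1 + x 2 * \<eta> 2 v $ 1 + x 3 * \<eta> 3 v $ 1 = 0"
      using coordinates[OF e, of 1] by (simp add: axis_def)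
    then have "x 1 = 0" using neg2[OF v0 v] neg3[OF v0 v] \<eta>1[OF v0 v] by simp
    then have "x 2 * u2 v + x 3 * u3 v = c"
      using coordinates[OF e, of 2] u2(2)[OF v0 v] u3(2)[OF v0 v] by (simp add: axis_def)
    then show "u2 v \<noteq> 0 \<or> u3 v \<noteq> 0" using c by auto
  qed
qed

section \<open>Two plane curves meet\<close>

lemma nonvanishing_poly_constant:
  fixes P :: "complex poly"
  assumes "\<And>t. poly P t \<noteq> 0" shows "poly P t = poly P s"
proof -
  have "constant (poly P)" using fundamental_theorem_of_algebra[of P] assms by blast
  then show ?thesis by (simp add: constant_def)
qed

lemma resultant_zero_iff_common_root:
  fixes f g :: "complex poly"
  assumes "f \<noteq> 0"
  shows "resultant f g = 0 \<longleftrightarrow> (\<exists>z. poly f z = 0 \<and> poly g z = 0)"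
proof -
  have "degree (gcd f g) \<noteq> 0 \<longleftrightarrow> (\<exists>z. poly (gcd f g) z = 0)"
  proof
    assume "degree (gcd f g) \<noteq> 0"
    then show "\<exists>z. poly (gcd f g) z = 0" using fundamental_theorem_of_algebra by (simp add: constant_degree)
  next
    assume "\<exists>z. poly (gcd f g) z = 0"
    then obtain z where z: "poly (gcd f g) z = 0" by blast
    show "degree (gcd f g) \<noteq> 0"
    proof
      assume "degree (gcd f g) = 0"
      then obtain a where a: "gcd f g = [:a:]" using degree_eq_zeroE by blast
      then have "a = 0" using z by simp
      then show False using a assms by simp
    qed
  qed
  moreover have "poly (gcd f g) z = 0 \<longleftrightarrow> poly f z = 0 \<and> poly g z = 0" for z
    unfolding poly_eq_0_iff_dvd by simp
  ultimately show ?thesis unfolding resultant_0_gcd by simp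
qed

text \<open>A form of degree \<open>k\<close> in \<open>x, y, z\<close> with coefficients \<open>c\<close> as a polynomial in \<open>z\<close>, the
  coordinates \<open>x\<close> and \<open>y\<close> being elements of an arbitrary algebra.\<close>

definition form_in_z :: "(complex \<Rightarrow> 'a) \<Rightarrow> (nat \<Rightarrow> nat \<Rightarrow> complex) \<Rightarrow> nat \<Rightarrow> 'a \<Rightarrow> 'a \<Rightarrow> 'a :: comm_ring_1 poly" where
  "form_in_z h c k x y = (\<Sum>i\<le>k. \<Sum>j\<le>k - i. monom (h (c i j) * x ^ i * y ^ j) (k - i - j))"

lemma poly_form_in_z:
  "poly (form_in_z h c k x y) z = (\<Sum>i\<le>k. \<Sum>j\<le>k - i. h (c i j) * x ^ i * y ^ j * z ^ (k - i - j))"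
  by (simp add: form_in_z_def poly_sum poly_monom)

lemma degree_form_in_z:
  assumes "h (c 0 0) \<noteq> 0"
  shows "degree (form_in_z h c k x y) = k"
proof (rule antisym)
  show "degree (form_in_z h c k x y) \<le> k"
    unfolding form_in_z_def
    by (intro degree_sum_le finite_atMost) (rule order.trans[OF degree_monom_le], simp)
  have "coeff (form_in_z h c k x y) k = (\<Sum>i\<le>k. \<Sum>j\<le>k - i. if i = 0 \<and> j = 0 then h (c 0 0) else 0)"
    unfolding form_in_z_def coeff_sum by (intro sum.cong refl) auto
  also have "\<dots> = (\<Sum>i\<le>k. if i = 0 then h (c 0 0) else 0)"
  proof (intro sum.cong refl)
    fix i
    show "(\<Sum>j\<le>k - i. if i = 0 \<and> j = 0 then h (c 0 0) else 0) = (if i = 0 then h (c 0 0) else 0)"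
      by (cases "i = 0") simp_all
  qed
  also have "\<dots> = h (c 0 0)" by simp
  finally show "k \<le> degree (form_in_z h c k x y)" using assms by (intro le_degree) simp
qed

lemma map_poly_form_in_z:
  "map_poly (\<lambda>r. poly r t) (form_in_z (\<lambda>a. [:a:]) c k X Y) = form_in_z (\<lambda>a. a) c k (poly X t) (poly Y t)"
proof (rule poly_eqI)
  fix l
  have "poly (coeff (monom r n) l) t = coeff (monom (poly r t) n) l" for r :: "complex poly" and n
    by simp
  then show "coeff (map_poly (\<lambda>r. poly r t) (form_in_z (\<lambda>a. [:a:]) c k X Y)) l =
      coeff (form_in_z (\<lambda>a. a) c k (poly X t) (poly Y t)) l"
    unfolding form_in_z_def poly_hom.coeff_map_poly_hom coeff_sum poly_sum by (simp add: mult.assoc cong: if_cong)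
qed

lemma resultant_polynomial_on_lines:
  assumes "c 0 0 \<noteq> 0" "c' 0 0 \<noteq> 0"
  shows "\<exists>N. \<forall>t. resultant (form_in_z (\<lambda>a. a) c k (x0 + t * x1) (y0 + t * y1))
      (form_in_z (\<lambda>a. a) c' k' (x0 + t * x1) (y0 + t * y1)) = poly N t"
proof -
  let ?B = "form_in_z (\<lambda>a. [:a:]) c k [:x0, x1:] [:y0, y1:]"
  let ?G = "form_in_z (\<lambda>a. [:a:]) c' k' [:x0, x1:] [:y0, y1:]"
  have "resultant (map_poly (\<lambda>r. poly r t) ?B) (map_poly (\<lambda>r. poly r t) ?G) = poly (resultant ?B ?G) t" for t
    using poly_hom.resultant_map_poly[of t ?B ?G] by (simp add: map_poly_form_in_z degree_form_in_z assms)
  then show ?thesis unfolding map_poly_form_in_z by (intro exI[of _ "resultant ?B ?G"]) simp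
qed

text \<open>The resultant of two forms with respect to \<open>z\<close> is a polynomial in \<open>x, y\<close> that vanishes at the
  origin; a polynomial in two variables has no isolated zero.\<close>

lemma forms_common_zero_aux:
  assumes F: "form k F" and G: "form k' G" and k: "k > 0" "k' > 0"
    and e: "F (pt 0 0 1) \<noteq> 0" "G (pt 0 0 1) \<noteq> 0"
  shows "\<exists>v. v \<noteq> 0 \<and> F v = 0 \<and> G v = 0"
proof (rule ccontr)
  assume none: "\<not> ?thesis"
  from F obtain c where c: "\<And>v. F v = (\<Sum>i\<le>k. \<Sum>j\<le>k - i. c i j * (v $ 1) ^ i * (v $ 2) ^ j * (v $ 3) ^ (k - i - j))"
    unfolding form_def by blast
  from G obtain c' where c': "\<And>v. G v = (\<Sum>i\<le>k'. \<Sum>j\<le>k' - i. c' i j * (v $ 1) ^ i * (v $ 2) ^ j * (v $ 3) ^ (k' - i - j))"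
    unfolding form_def by blast
  let ?b = "\<lambda>x y. form_in_z (\<lambda>a. a) c k x y" and ?g = "\<lambda>x y. form_in_z (\<lambda>a. a) c' k' x y"
  have pF: "poly (?b x y) z = F (pt x y z)" and pG: "poly (?g x y) z = G (pt x y z)" for x y z
    by (simp_all add: poly_form_in_z c c')
  have val: "(\<Sum>i\<le>k. \<Sum>j\<le>k - i. c i j * (0 :: complex) ^ i * 0 ^ j * 1 ^ (k - i - j)) = c 0 0" for k c
  proof -
    have "(\<Sum>i\<le>k. \<Sum>j\<le>k - i. c i j * (0 :: complex) ^ i * 0 ^ j * 1 ^ (k - i - j)) =
      (\<Sum>i\<le>k. if i = 0 then c 0 0 else 0)"
    proof (intro sum.cong refl)
      fix i
      have "(\<Sum>j\<le>k - i. c i j * (0 :: complex) ^ i * 0 ^ j * 1 ^ (k - i - j)) =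
        (\<Sum>j\<le>k - i. if j = 0 then c i 0 * 0 ^ i else 0)"
        by (intro sum.cong refl) auto
      then show "(\<Sum>j\<le>k - i. c i j * (0 :: complex) ^ i * 0 ^ j * 1 ^ (k - i - j)) = (if i = 0 then c 0 0 else 0)"
        by simp
    qed
    then show ?thesis by simp
  qed
  have c0: "c 0 0 \<noteq> 0" "c' 0 0 \<noteq> 0" using e unfolding c c' pt_nth val by auto
  define R where "R x y = resultant (?b x y) (?g x y)" for x y
  have b0: "?b x y \<noteq> 0" for x y using degree_form_in_z[of "\<lambda>a. a" c k x y] c0(1) k(1) by auto
  have R_iff: "R x y = 0 \<longleftrightarrow> (\<exists>z. F (pt x y z) = 0 \<and> G (pt x y z) = 0)" for x y
    by (simp add: R_def resultant_zero_iff_common_root[OF b0] pF pG)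
  have Rnz: "R x y \<noteq> 0" if "x \<noteq> 0 \<or> y \<noteq> 0" for x y
  proof -
    have "pt x y z \<noteq> 0" for z using that by (auto simp: vec3_eq_iff)
    then show ?thesis unfolding R_iff using none by blast
  qed
  have "pt 0 0 0 = 0" by (simp add: vec3_eq_iff)
  then have R0: "R 0 0 = 0" unfolding R_iff
    using homog_positive_at_zero[of "int k" F] homog_positive_at_zero[of "int k'" G] F G k
    by (intro exI[of _ 0]) (simp add: form_iff_homog)
  have line: "\<exists>N. \<forall>t. R (x0 + t * x1) (y0 + t * y1) = poly N t" for x0 x1 y0 y1
    unfolding R_def by (rule resultant_polynomial_on_lines[where c = c and c' = c', OF c0])
  have vert: "R x u = R x 0" if "x \<noteq> 0" for x u
  proof -
    obtain N where N: "\<And>t. R (x + t * 0) (0 + t * 1) = poly N t" using line[of x 0 0 1] by blast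
    have "poly N t \<noteq> 0" for t using N[of t] Rnz[of x t] that by simp
    from nonvanishing_poly_constant[OF this, of u 0] show ?thesis using N[of u] N[of 0] by simp
  qed
  have hor: "R u 1 = R 0 1" for u
  proof -
    obtain N where N: "\<And>t. R (0 + t * 1) (1 + t * 0) = poly N t" using line[of 0 1 1 0] by blast
    have "poly N t \<noteq> 0" for t using N[of t] Rnz[of t 1] by simp
    from nonvanishing_poly_constant[OF this, of u 0] show ?thesis using N[of u] N[of 0] by simp
  qed
  obtain N where N: "\<And>t. R (0 + t * 1) (0 + t * 0) = poly N t" using line[of 0 1 0 0] by blast
  have "N = [:R 0 1:]"
  proof (rule poly_eq_if_cofinitely_equal[of "{0}"])
    fix t :: complex assume "t \<notin> {0}"
    then show "poly N t = poly [:R 0 1:] t" using N[of t] vert[of t 1] hor[of t] by simp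
  qed simp
  then show False using N[of 0] R0 Rnz[of 0 1] by simp
qed

text \<open>A linear change of coordinates moves a point where neither form vanishes to \<open>(0, 0, 1)\<close>; then both
  forms have full degree in \<open>z\<close>, as the resultant argument requires.\<close>

lemma forms_common_zero:
  assumes F: "homog k F" and G: "homog l G" and k: "k > 0" "l > 0"
  shows "\<exists>v. v \<noteq> 0 \<and> F v = 0 \<and> G v = 0"
proof (cases "(\<exists>u. F u \<noteq> 0) \<and> (\<exists>w. G w \<noteq> 0)")
  case False
  have p: "pt 1 0 0 \<noteq> 0" by (simp add: vec3_eq_iff)
  show ?thesis
    using False homog_has_zero_on_plane[OF F k(1) p] homog_has_zero_on_plane[OF G k(2) p] by metis
next
  case True
  then obtain e where e: "F e * G e \<noteq> 0"
    using poly_on_lines_product_nonzero[OF homog_poly_on_lines[OF F] homog_poly_on_lines[OF G]] by metis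
  have e0: "e \<noteq> 0" using e homog_positive_at_zero[OF F k(1)] by auto
  obtain \<alpha> where \<alpha>: "\<alpha> \<noteq> 0" "lin \<alpha> e = 0"
  proof (cases "e $ 1 = 0 \<and> e $ 2 = 0")
    case True
    then show ?thesis by (intro that[of "pt 1 0 0"]) (simp_all add: vec3_eq_iff lin_vec3)
  next
    case False
    then show ?thesis by (intro that[of "pt (e $ 2) (- e $ 1) 0"]) (auto simp: vec3_eq_iff lin_vec3)
  qed
  obtain \<nu> p x y where f: "frame \<alpha> \<nu> p e x y" using frame_exists[OF \<alpha> e0] by metis
  define M :: "vec3 \<Rightarrow> vec3" where "M v = v $ 1 *s \<nu> + v $ 2 *s p + v $ 3 *s e" for v
  have M: "M (u + v) = M u + M v" "M (a *s v) = a *s M v" for u v a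
    by (auto simp: M_def Finite_Cartesian_Product.vec_eq_iff algebra_simps)
  have "form (nat k) (\<lambda>v. F (M v))" "form (nat l) (\<lambda>v. G (M v))"
    using homog_linear_comp[OF F M] homog_linear_comp[OF G M] k by (simp_all add: form_iff_homog)
  moreover have "M (pt 0 0 1) = e" by (simp add: M_def)
  ultimately obtain v where v: "v \<noteq> 0" "F (M v) = 0" "G (M v) = 0"
    using forms_common_zero_aux[of "nat k" "\<lambda>v. F (M v)" "nat l" "\<lambda>v. G (M v)"] e k by auto
  have "M v \<noteq> 0"
  proof
    assume "M v = 0"
    moreover have "lin \<alpha> (M v) = v $ 1" "lin x (M v) = v $ 2" "lin y (M v) = v $ 3"
      using f by (simp_all add: M_def frame_def lin_simps)
    ultimately have "v $ 1 = 0" "v $ 2 = 0" "v $ 3 = 0" by simp_all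
    then have "v = 0" unfolding vec3_eq_iff by simp
    then show False using v(1) by simp
  qed
  then show ?thesis using v by (intro exI[of _ "M v"]) simp
qed

section \<open>The pairing on a plus-one generated arrangement\<close>

lemma det3_matrix:
  "det3 (u1 *s x + v1 *s y + w1 *s z) (u2 *s x + v2 *s y + w2 *s z) (u3 *s x + v3 *s y + w3 *s z) =
    (u1 * (v2 * w3 - w2 * v3) - v1 * (u2 * w3 - w2 * u3) + w1 * (u2 * v3 - v2 * u3)) * det3 x y z"
  by (simp add: det3_def algebra_simps)

lemma det3_mod_euler: "det3 v (x + m *s v) (y + n *s v) = det3 v x y"
  by (simp add: det3_def algebra_simps)

lemma det3_expand:
  "det3 v (u1 *s x + v1 *s y + w1 *s z) (u2 *s x + v2 *s y + w2 *s z) =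
    (v1 * w2 - w1 * v2) * det3 v y z + (w1 * u2 - u1 * w2) * det3 v z x + (u1 * v2 - v1 * u2) * det3 v x y"
  by (simp add: det3_def algebra_simps)

lemma factor_out: "0 = x * (f * g) - y * (f * h) \<Longrightarrow> f * (x * g - y * h) = (0 :: complex)"
proof -
  have "f * (x * g - y * h) = x * (f * g) - y * (f * h)" by (simp add: algebra_simps)
  then show "0 = x * (f * g) - y * (f * h) \<Longrightarrow> f * (x * g - y * h) = 0" by simp
qed

text \<open>What the presentation and the splitting on the line \<open>l\<close> say in terms of forms. The relation has degree
  \<open>d + 1\<close>; \<open>relgen\<close> concerns the relations of degree one less.\<close>

locale plus_one_data =
  fixes A :: "vec3 set set" and a b d :: nat and l :: "vec3 set"
    and td tb ta :: "vec3 \<Rightarrow> vec3" and \<alpha> \<beta> \<gamma> u2 u3 :: "vec3 \<Rightarrow> complex"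
  assumes arr: "arrangement A" and line: "is_line l" and ab: "a \<le> b" and bd: "b < d"
    and vf: "vform (int d) td" "vform (int b) tb" "vform (int a) ta"
    and kill: "\<And>v. grad_pairing A v (td v) = 0" "\<And>v. grad_pairing A v (tb v) = 0" "\<And>v. grad_pairing A v (ta v) = 0"
    and gen: "\<And>\<delta> k p. vform k \<delta> \<Longrightarrow> (\<And>v. grad_pairing A v (\<delta> v) = 0) \<Longrightarrow> p \<noteq> 0 \<Longrightarrow>
      \<exists>Q u v w. poly_on_lines Q \<and> poly_on_lines u \<and> poly_on_lines v \<and> poly_on_lines w \<and> Q p \<noteq> 0 \<and>
        (\<forall>x. Q x *s \<delta> x = u x *s td x + v x *s tb x + w x *s ta x)"
    and coeffs: "homog 1 \<alpha>" "homog (int d + 1 - int b) \<beta>" "homog (int d + 1 - int a) \<gamma>"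
    and rel: "\<And>v. \<alpha> v *s td v + \<beta> v *s tb v + \<gamma> v *s ta v = 0"
    and relgen: "\<And>\<alpha>' \<beta>' \<gamma>' p. homog 0 \<alpha>' \<Longrightarrow> homog (int d - int b) \<beta>' \<Longrightarrow> homog (int d - int a) \<gamma>' \<Longrightarrow>
      (\<And>v. \<alpha>' v *s td v + \<beta>' v *s tb v + \<gamma>' v *s ta v = 0) \<Longrightarrow> p \<noteq> 0 \<Longrightarrow>
      \<exists>Q W. poly_on_lines Q \<and> poly_on_lines W \<and> Q p \<noteq> 0 \<and>
        (\<forall>v. Q v * \<alpha>' v = W v * \<alpha> v \<and> Q v * \<beta>' v = W v * \<beta> v \<and> Q v * \<gamma>' v = W v * \<gamma> v)"
    and nonzero: "\<exists>v. \<alpha> v \<noteq> 0 \<or> \<beta> v \<noteq> 0 \<or> \<gamma> v \<noteq> 0"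
    and us: "homog (int d + 1 - int a) u2" "homog (int d + 1 - int b) u3"
      "\<And>v. v \<in> l \<Longrightarrow> \<alpha> v = 0" "\<And>v. v \<in> l \<Longrightarrow> \<beta> v * u2 v + \<gamma> v * u3 v = 0"
      "\<And>v. v \<in> l \<Longrightarrow> v \<noteq> 0 \<Longrightarrow> u2 v \<noteq> 0 \<or> u3 v \<noteq> 0"
begin

abbreviation "f \<equiv> defining_poly A"
abbreviation "L \<equiv> lin (line_coeffs l)"

lemma lc: "line_coeffs l \<noteq> 0" "v \<in> l \<longleftrightarrow> L v = 0"
  using line_coeffs_props[OF line] by auto

lemma L_nonzero: "\<exists>w. L w \<noteq> 0"
  by (rule line_form_nonzero[OF line])

lemma cancel_L: "poly_on_lines D \<Longrightarrow> (\<And>v. L v * D v = 0) \<Longrightarrow> D v = 0"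
proof -
  assume D: "poly_on_lines D" and z: "\<And>v. L v * D v = 0"
  obtain w where w: "L w \<noteq> 0" using L_nonzero by blast
  show ?thesis by (rule poly_on_lines_mult_eq_zero[OF poly_on_lines_lin D, where S = UNIV and u = w]) (use z w in auto)
qed

text \<open>Both the relation and \<open>(u3, - u2)\<close> are orthogonal to \<open>(u2, u3)\<close> on \<open>l\<close>, so \<open>(\<beta>, \<gamma>)\<close> is a constant
  multiple of \<open>(u3, - u2)\<close> there. If the constant were zero, \<open>L\<close> would divide the relation, and the
  quotient would be a relation of degree \<open>d\<close>; this is a local multiple of the original one, which is
  impossible because the original one is \<open>L\<close> times the quotient.\<close>

lemma \<beta>\<gamma>_no_common_zero: "v \<in> l \<Longrightarrow> v \<noteq> 0 \<Longrightarrow> \<beta> v \<noteq> 0 \<or> \<gamma> v \<noteq> 0"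
proof -
  obtain u where u: "homog (int d + 1 - int b - (int d + 1 - int b)) u"
    "\<And>v. L v = 0 \<Longrightarrow> \<beta> v = u3 v * u v" "\<And>v. L v = 0 \<Longrightarrow> \<gamma> v = - u2 v * u v"
  proof (rule coprime_division_on_plane[OF lc(1) us(2) us(1) coeffs(2) coeffs(3)])
    show "u3 v * \<gamma> v + u2 v * \<beta> v = 0" if "L v = 0" for v
      using us(4)[of v] that lc(2) by (simp add: mult.commute add.commute)
    show "u3 v \<noteq> 0 \<or> u2 v \<noteq> 0" if "v \<noteq> 0" "L v = 0" for v using us(5)[of v] that lc(2) by blast
  qed auto
  have uc: "u v = u 0" for v using homog_0_const[of u v] u(1) by simp
  have "u 0 \<noteq> 0"
  proof
    assume "u 0 = 0"
    then have z: "\<alpha> v = 0" "\<beta> v = 0" "\<gamma> v = 0" if "L v = 0" for v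
      using u(2,3)[OF that] us(3)[of v] that lc(2) uc[of v] by auto
    obtain \<alpha>' where \<alpha>': "homog (1 - 1) \<alpha>'" "\<And>v. \<alpha> v = L v * \<alpha>' v"
      using linear_form_division[OF lc(1) coeffs(1) z(1)] by metis
    obtain \<beta>' where \<beta>': "homog (int d + 1 - int b - 1) \<beta>'" "\<And>v. \<beta> v = L v * \<beta>' v"
      using linear_form_division[OF lc(1) coeffs(2) z(2)] by metis
    obtain \<gamma>' where \<gamma>': "homog (int d + 1 - int a - 1) \<gamma>'" "\<And>v. \<gamma> v = L v * \<gamma>' v"
      using linear_form_division[OF lc(1) coeffs(3) z(3)] by metis
    note pol = \<alpha>'(1)[THEN homog_poly_on_lines] \<beta>'(1)[THEN homog_poly_on_lines] \<gamma>'(1)[THEN homog_poly_on_lines]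
    have rel': "\<alpha>' v *s td v + \<beta>' v *s tb v + \<gamma>' v *s ta v = 0" for v
    proof -
      have "\<alpha>' v * td v $ i + \<beta>' v * tb v $ i + \<gamma>' v * ta v $ i = 0" for i
      proof (rule cancel_L[of "\<lambda>v. \<alpha>' v * td v $ i + \<beta>' v * tb v $ i + \<gamma>' v * ta v $ i"])
        show "poly_on_lines (\<lambda>v. \<alpha>' v * td v $ i + \<beta>' v * tb v $ i + \<gamma>' v * ta v $ i)"
          by (intro poly_on_lines_add poly_on_lines_mult pol vform_poly_on_lines[OF vf(1)]
              vform_poly_on_lines[OF vf(2)] vform_poly_on_lines[OF vf(3)])
        show "L v * (\<alpha>' v * td v $ i + \<beta>' v * tb v $ i + \<gamma>' v * ta v $ i) = 0" for v
          using arg_cong[OF rel[of v], of "\<lambda>x. x $ i"] by (simp add: \<alpha>'(2) \<beta>'(2) \<gamma>'(2) algebra_simps)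
      qed
      then show ?thesis by (simp add: Finite_Cartesian_Product.vec_eq_iff)
    qed
    obtain \<nu> p q x y where fr: "frame (line_coeffs l) \<nu> p q x y" using frame_exists_some[OF lc(1)] by blast
    have q: "q \<noteq> 0" "L q = 0" using frame_q_nz[OF fr] fr by (auto simp: frame_def)
    obtain Q W where Q: "poly_on_lines Q" "poly_on_lines W" "Q q \<noteq> 0"
      "\<And>v. Q v * \<alpha>' v = W v * \<alpha> v \<and> Q v * \<beta>' v = W v * \<beta> v \<and> Q v * \<gamma>' v = W v * \<gamma> v"
    proof -
      have "homog 0 \<alpha>'" "homog (int d - int b) \<beta>'" "homog (int d - int a) \<gamma>'"
        using \<alpha>'(1) \<beta>'(1) \<gamma>'(1) by (simp_all add: algebra_simps)
      from relgen[OF this rel' q(1)] show ?thesis using that by blast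
    qed
    have K: "poly_on_lines (\<lambda>v. Q v - W v * L v)"
      by (intro poly_on_lines_diff poly_on_lines_mult Q(1,2) poly_on_lines_lin)
    have Kq: "Q q - W q * L q \<noteq> 0" using Q(3) q(2) by simp
    have D: "D v = 0" if "poly_on_lines D" "\<And>v. Q v * D v = W v * (L v * D v)" for D v
      by (rule poly_on_lines_mult_eq_zero[OF K that(1), where S = UNIV and u = q])
         (use Kq that(2) in \<open>auto simp: algebra_simps\<close>)
    have "\<alpha>' v = 0" "\<beta>' v = 0" "\<gamma>' v = 0" for v
      using D[OF pol(1)] D[OF pol(2)] D[OF pol(3)] Q(4) unfolding \<alpha>'(2) \<beta>'(2) \<gamma>'(2) by auto
    then show False using nonzero \<alpha>'(2) \<beta>'(2) \<gamma>'(2) by simp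
  qed
  then show "v \<in> l \<Longrightarrow> v \<noteq> 0 \<Longrightarrow> \<beta> v \<noteq> 0 \<or> \<gamma> v \<noteq> 0"
    using us(5)[of v] u(2,3)[of v] uc[of v] lc(2) by auto
qed

text \<open>For the empty arrangement every field is killed by the gradient, whereas three generators with a
  nontrivial relation span a plane at most.\<close>

lemma arr_nonempty: "A \<noteq> {}"
proof
  assume A: "A = {}"
  have k: "grad_pairing A v s = 0" for v s using grad_pairing_eq[of A v s] A by simp
  have p: "pt 1 0 0 \<noteq> 0" by (simp add: vec3_eq_iff)
  let ?p = "pt 1 0 0"
  have g: "\<exists>Q u v w. Q ?p \<noteq> 0 \<and> Q ?p *s e = u ?p *s td ?p + v ?p *s tb ?p + w ?p *s ta ?p" for e :: vec3
    using gen[OF vform_const[of e] k p] by metis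
  obtain Q1 u1 v1 w1 :: "vec3 \<Rightarrow> complex" where 1: "Q1 ?p \<noteq> 0" "Q1 ?p *s pt 1 0 0 = u1 ?p *s td ?p + v1 ?p *s tb ?p + w1 ?p *s ta ?p"
    using g[of "pt 1 0 0"] by metis
  obtain Q2 u2 v2 w2 :: "vec3 \<Rightarrow> complex" where 2: "Q2 ?p \<noteq> 0" "Q2 ?p *s pt 0 1 0 = u2 ?p *s td ?p + v2 ?p *s tb ?p + w2 ?p *s ta ?p"
    using g[of "pt 0 1 0"] by metis
  obtain Q3 u3 v3 w3 :: "vec3 \<Rightarrow> complex" where 3: "Q3 ?p \<noteq> 0" "Q3 ?p *s pt 0 0 1 = u3 ?p *s td ?p + v3 ?p *s tb ?p + w3 ?p *s ta ?p"
    using g[of "pt 0 0 1"] by metis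
  have "det3 (Q1 ?p *s pt 1 0 0) (Q2 ?p *s pt 0 1 0) (Q3 ?p *s pt 0 0 1) \<noteq> 0"
    using 1(1) 2(1) 3(1) by (simp add: det3_def)
  then have D: "det3 (td ?p) (tb ?p) (ta ?p) \<noteq> 0" unfolding 1(2) 2(2) 3(2) det3_matrix by auto
  let ?D = "\<lambda>v. det3 (td v) (tb v) (ta v)"
  have pD: "poly_on_lines ?D" by (rule homog_poly_on_lines[OF homog_det3[OF vf]])
  have c: "F v = 0" if F: "poly_on_lines F" "\<And>v. ?D v * F v = 0" for F v
    by (rule poly_on_lines_mult_eq_zero[OF pD F(1), where S = UNIV and u = ?p]) (use F(2) D in auto)
  have "?D v * \<alpha> v = det3 (\<alpha> v *s td v + \<beta> v *s tb v + \<gamma> v *s ta v) (tb v) (ta v)"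
    "?D v * \<beta> v = det3 (td v) (\<alpha> v *s td v + \<beta> v *s tb v + \<gamma> v *s ta v) (ta v)"
    "?D v * \<gamma> v = det3 (td v) (tb v) (\<alpha> v *s td v + \<beta> v *s tb v + \<gamma> v *s ta v)" for v
    by (simp_all add: det3_def algebra_simps)
  then have "?D v * \<alpha> v = 0" "?D v * \<beta> v = 0" "?D v * \<gamma> v = 0" for v unfolding rel by simp_all
  then have "\<alpha> v = 0" "\<beta> v = 0" "\<gamma> v = 0" for v
    using c[OF homog_poly_on_lines[OF coeffs(1)]] c[OF homog_poly_on_lines[OF coeffs(2)]]
      c[OF homog_poly_on_lines[OF coeffs(3)]] by blast+
  then show False using nonzero by simp
qed

lemma logs: "log_field A (int d) td" "log_field A (int b) tb" "log_field A (int a) ta"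
  using grad_kernel_log_field[OF arr] vf kill by auto

lemma cancel_f: "poly_on_lines D \<Longrightarrow> (\<And>v. f v * D v = 0) \<Longrightarrow> D v = 0"
  by (rule poly_on_lines_cancel[OF arr])

text \<open>The pairings of the generators, divided by \<open>f\<close>, have no common zero, because there are logarithmic
  fields with nonvanishing pairing at any given point. By Cramer's rule they are proportional to \<open>\<alpha>\<close>,
  \<open>\<beta>\<close>, \<open>\<gamma>\<close>. If \<open>\<alpha>\<close> were zero, only two of them would remain, and two forms without a common zero
  cannot both have positive degree. So \<open>\<alpha>\<close> is a multiple of \<open>L\<close>. As \<open>\<beta>\<close> and \<open>\<gamma>\<close> have no common zero
  on \<open>l\<close>, the first pairing vanishes there, and the factor of proportionality is a form. It vanishes
  nowhere and hence is constant.\<close>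

lemma pairings_proportional:
  "\<exists>g. g \<noteq> 0 \<and> int a + int b = int (card A) \<and> (\<exists>c. c \<noteq> 0 \<and> (\<forall>v. \<alpha> v = c * L v)) \<and>
    (\<forall>v. det3 v (tb v) (ta v) = f v * (g * \<alpha> v)) \<and> (\<forall>v. det3 v (ta v) (td v) = f v * (g * \<beta> v)) \<and>
    (\<forall>v. det3 v (td v) (tb v) = f v * (g * \<gamma> v))"
proof -
  let ?n = "int (card A)"
  obtain G1 where G1: "homog (int b + int a + 1 - ?n) G1" "\<And>v. det3 v (tb v) (ta v) = f v * G1 v"
    using log_pairing_ex[OF arr logs(2,3)] by blast
  obtain G2 where G2: "homog (int a + int d + 1 - ?n) G2" "\<And>v. det3 v (ta v) (td v) = f v * G2 v"
    using log_pairing_ex[OF arr logs(3,1)] by blast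
  obtain G3 where G3: "homog (int d + int b + 1 - ?n) G3" "\<And>v. det3 v (td v) (tb v) = f v * G3 v"
    using log_pairing_ex[OF arr logs(1,2)] by blast
  note pG = G1(1)[THEN homog_poly_on_lines] G2(1)[THEN homog_poly_on_lines] G3(1)[THEN homog_poly_on_lines]
  note pc = coeffs[THEN homog_poly_on_lines]
  have e1: "\<beta> v * G1 v - \<alpha> v * G2 v = 0" for v
  proof (rule cancel_f[of "\<lambda>v. \<beta> v * G1 v - \<alpha> v * G2 v"])
    show "poly_on_lines (\<lambda>v. \<beta> v * G1 v - \<alpha> v * G2 v)" by (intro poly_on_lines_diff poly_on_lines_mult pG pc)
    fix v
    have "0 = det3 v (\<alpha> v *s td v + \<beta> v *s tb v + \<gamma> v *s ta v) (ta v)" unfolding rel by simp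
    also have "\<dots> = \<beta> v * det3 v (tb v) (ta v) - \<alpha> v * det3 v (ta v) (td v)"
      by (simp add: det3_def algebra_simps)
    finally show "f v * (\<beta> v * G1 v - \<alpha> v * G2 v) = 0" unfolding G1(2) G2(2) by (rule factor_out)
  qed
  have e2: "\<gamma> v * G1 v - \<alpha> v * G3 v = 0" for v
  proof (rule cancel_f[of "\<lambda>v. \<gamma> v * G1 v - \<alpha> v * G3 v"])
    show "poly_on_lines (\<lambda>v. \<gamma> v * G1 v - \<alpha> v * G3 v)" by (intro poly_on_lines_diff poly_on_lines_mult pG pc)
    fix v
    have "0 = det3 v (\<alpha> v *s td v + \<beta> v *s tb v + \<gamma> v *s ta v) (tb v)" unfolding rel by simp
    also have "\<dots> = - (\<gamma> v * det3 v (tb v) (ta v) - \<alpha> v * det3 v (td v) (tb v))"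
      by (simp add: det3_def algebra_simps)
    finally have "0 = \<gamma> v * det3 v (tb v) (ta v) - \<alpha> v * det3 v (td v) (tb v)" by simp
    then show "f v * (\<gamma> v * G1 v - \<alpha> v * G3 v) = 0" unfolding G1(2) G3(2) by (rule factor_out)
  qed
  have e3: "\<beta> v * G3 v - \<gamma> v * G2 v = 0" for v
  proof (rule cancel_f[of "\<lambda>v. \<beta> v * G3 v - \<gamma> v * G2 v"])
    show "poly_on_lines (\<lambda>v. \<beta> v * G3 v - \<gamma> v * G2 v)" by (intro poly_on_lines_diff poly_on_lines_mult pG pc)
    fix v
    have "0 = det3 v (td v) (\<alpha> v *s td v + \<beta> v *s tb v + \<gamma> v *s ta v)" unfolding rel by simp
    also have "\<dots> = \<beta> v * det3 v (td v) (tb v) - \<gamma> v * det3 v (ta v) (td v)"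
      by (simp add: det3_def algebra_simps)
    finally show "f v * (\<beta> v * G3 v - \<gamma> v * G2 v) = 0" unfolding G2(2) G3(2) by (rule factor_out)
  qed
  have nz: "G1 p \<noteq> 0 \<or> G2 p \<noteq> 0 \<or> G3 p \<noteq> 0" if p: "p \<noteq> 0" for p
  proof -
    obtain k k' m \<delta> \<epsilon> G where loc: "log_field A k \<delta>" "log_field A k' \<epsilon>" "homog m G"
      "\<And>v. det3 v (\<delta> v) (\<epsilon> v) = f v * G v" "G p \<noteq> 0"
      by (rule log_fields_independent_at[OF arr p]) blast
    obtain \<mu> where \<mu>: "homog (k - 1) \<mu>" "\<And>v. grad_pairing A v (\<delta> v + \<mu> v *s v) = 0"
      using log_field_mod_euler[OF arr arr_nonempty loc(1)] by metis
    obtain \<mu>' where \<mu>': "homog (k' - 1) \<mu>'" "\<And>v. grad_pairing A v (\<epsilon> v + \<mu>' v *s v) = 0"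
      using log_field_mod_euler[OF arr arr_nonempty loc(2)] by metis
    have "vform k (\<lambda>v. \<delta> v + \<mu> v *s v)"
      using loc(1) by (intro vform_add vform_mult[OF \<mu>(1) vform_id]) (auto simp: log_field_def)
    from gen[OF this \<mu>(2) p] obtain Q u v w where Q: "poly_on_lines Q" "poly_on_lines u" "poly_on_lines v" "poly_on_lines w"
      "Q p \<noteq> 0" "\<And>x. Q x *s (\<delta> x + \<mu> x *s x) = u x *s td x + v x *s tb x + w x *s ta x" by blast
    have "vform k' (\<lambda>v. \<epsilon> v + \<mu>' v *s v)"
      using loc(2) by (intro vform_add vform_mult[OF \<mu>'(1) vform_id]) (auto simp: log_field_def)
    from gen[OF this \<mu>'(2) p] obtain Q' u' v' w' where Q': "poly_on_lines Q'" "poly_on_lines u'" "poly_on_lines v'" "poly_on_lines w'"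
      "Q' p \<noteq> 0" "\<And>x. Q' x *s (\<epsilon> x + \<mu>' x *s x) = u' x *s td x + v' x *s tb x + w' x *s ta x" by blast
    let ?R = "\<lambda>x. (v x * w' x - w x * v' x) * G1 x + (w x * u' x - u x * w' x) * G2 x + (u x * v' x - v x * u' x) * G3 x"
    have "Q x * Q' x * G x - ?R x = 0" for x
    proof (rule cancel_f[of "\<lambda>x. Q x * Q' x * G x - ?R x"])
      show "poly_on_lines (\<lambda>x. Q x * Q' x * G x - ?R x)"
        by (intro poly_on_lines_diff poly_on_lines_mult poly_on_lines_add pG Q(1-4) Q'(1-4) homog_poly_on_lines[OF loc(3)])
      fix x
      have "Q x * Q' x * (f x * G x) = det3 x (Q x *s (\<delta> x + \<mu> x *s x)) (Q' x *s (\<epsilon> x + \<mu>' x *s x))"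
        by (simp add: det3_mod_euler loc(4))
      also have "\<dots> = f x * ?R x" unfolding Q(6) Q'(6) det3_expand G1(2) G2(2) G3(2) by (simp add: algebra_simps)
      finally show "f x * (Q x * Q' x * G x - ?R x) = 0" by (simp add: algebra_simps)
    qed
    from this[of p] have "?R p \<noteq> 0" using Q(5) Q'(5) loc(5) by auto
    then show ?thesis by auto
  qed
  obtain \<nu> p0 q0 x0 y0 where fr: "frame (line_coeffs l) \<nu> p0 q0 x0 y0" using frame_exists_some[OF lc(1)] by blast
  have G1l: "G1 v = 0" if "L v = 0" for v
  proof -
    have z: "G1 w = 0" if "w \<noteq> 0" "L w = 0" for w
      using e1[of w] e2[of w] us(3)[of w] \<beta>\<gamma>_no_common_zero[of w] that lc(2) by auto
    have "G1 0 = 0"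
      by (rule homog_at_zero[OF G1(1), of q0]) (rule z, use frame_q_nz[OF fr] fr in \<open>auto simp: frame_def lin_simps\<close>)
    then show ?thesis using z[of v] that by (cases "v = 0") auto
  qed
  have \<alpha>nz: "\<exists>v. \<alpha> v \<noteq> 0"
  proof (rule ccontr)
    assume "\<not> ?thesis"
    then have \<alpha>0: "\<alpha> v = 0" for v by simp
    have deg: "int d + 1 - int b > 0" "int d + 1 - int a > 0" using ab bd by auto
    have not\<beta>: "\<exists>v. \<beta> v \<noteq> 0"
    proof (rule ccontr)
      assume none: "\<not> ?thesis"
      obtain v where "v \<noteq> 0" "L v = 0" "\<gamma> v = 0" by (rule homog_has_zero_on_plane[OF coeffs(3) deg(2) lc(1)])
      then show False using \<beta>\<gamma>_no_common_zero[of v] none lc(2)[of v] by auto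
    qed
    have not\<gamma>: "\<exists>v. \<gamma> v \<noteq> 0"
    proof (rule ccontr)
      assume none: "\<not> ?thesis"
      obtain v where "v \<noteq> 0" "L v = 0" "\<beta> v = 0" by (rule homog_has_zero_on_plane[OF coeffs(2) deg(1) lc(1)])
      then show False using \<beta>\<gamma>_no_common_zero[of v] none lc(2)[of v] by auto
    qed
    have G1z: "G1 v = 0" for v
    proof -
      obtain w where w: "\<beta> w \<noteq> 0" using not\<beta> by blast
      show ?thesis
        by (rule poly_on_lines_mult_eq_zero[OF pc(2) pG(1), where S = UNIV and u = w]) (use e1 \<alpha>0 w in auto)
    qed
    have nz': "G2 p \<noteq> 0 \<or> G3 p \<noteq> 0" if "p \<noteq> 0" for p using nz[OF that] G1z by auto
    \<comment> \<open>A constant pairing would make \<open>F\<close> divide \<open>F'\<close>, and then both would vanish at a zero of \<open>F\<close> on \<open>l\<close>.\<close>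
    have const: "False" if G: "homog k G" "k \<le> 0" and G': "homog k' G'" and F: "homog e F" "e > 0" and F': "poly_on_lines F'" "\<exists>v. F' v \<noteq> 0"
      and eq: "\<And>v. F v * G' v = F' v * G v" and n: "\<And>p. p \<noteq> 0 \<Longrightarrow> G p \<noteq> 0 \<or> G' p \<noteq> 0"
      and ncz: "\<And>v. v \<noteq> 0 \<Longrightarrow> L v = 0 \<Longrightarrow> F v \<noteq> 0 \<or> F' v \<noteq> 0" and F0: "\<exists>v. F v \<noteq> 0" for k G k' G' e F F'
    proof -
      have c: "G v = G 0" for v
        using G homog_0_const[of G v] homog_cases(2)[of k G] by (cases "k = 0") auto
      show False
      proof (cases "G 0 = 0")
        case True
        then have z: "F v * G' v = 0" for v using eq c by simp
        obtain w where w: "F w \<noteq> 0" using F0 by blast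
        have "G' v = 0" for v
          by (rule poly_on_lines_mult_eq_zero[OF homog_poly_on_lines[OF F(1)] homog_poly_on_lines[OF G'], where S = UNIV and u = w])
             (use z w in auto)
        moreover have "pt 1 0 0 \<noteq> 0" by (simp add: vec3_eq_iff)
        ultimately show False using n[of "pt 1 0 0"] c[of "pt 1 0 0"] True by simp
      next
        case False
        obtain v where v: "v \<noteq> 0" "L v = 0" "F v = 0" by (rule homog_has_zero_on_plane[OF F lc(1)])
        have "F' v * G v = 0" using eq[of v] v(3) by simp
        then have "F' v = 0" using False c[of v] by simp
        then show False using ncz[OF v(1,2)] v(3) by simp
      qed
    qed
    have eq3: "\<beta> v * G3 v = \<gamma> v * G2 v" for v using e3[of v] by simp
    have ncz: "\<beta> v \<noteq> 0 \<or> \<gamma> v \<noteq> 0" if "v \<noteq> 0" "L v = 0" for v using \<beta>\<gamma>_no_common_zero[of v] that lc(2) by blast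
    show False
    proof (cases "int a + int d + 1 - ?n \<le> 0")
      case True
      show False
        by (rule const[OF G2(1) True G3(1) coeffs(2) deg(1) pc(3) not\<gamma> eq3 nz' ncz not\<beta>])
    next
      case False
      show False
      proof (cases "int d + int b + 1 - ?n \<le> 0")
        case True
        show False
          by (rule const[OF G3(1) True G2(1) coeffs(3) deg(2) pc(2) not\<beta> eq3[symmetric] _ _ not\<gamma>]) (use nz' ncz in blast)+
      next
        case False
        then show False using forms_common_zero[OF G2(1) G3(1)] \<open>\<not> int a + int d + 1 - ?n \<le> 0\<close> nz' by fastforce
      qed
    qed
  qed
  obtain c0 where c0: "homog (1 - 1) c0" "\<And>v. \<alpha> v = L v * c0 v"
    using linear_form_division[OF lc(1) coeffs(1)] us(3) lc(2) by metis
  define c where "c = c0 0"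
  have \<alpha>c: "\<alpha> v = c * L v" for v using c0(2)[of v] homog_0_const[of c0 v] c0(1) by (simp add: c_def mult.commute)
  have cnz: "c \<noteq> 0" using \<alpha>nz \<alpha>c by auto
  obtain g where g: "homog (int b + int a + 1 - ?n - 1) g" "\<And>v. G1 v = L v * g v"
    using linear_form_division[OF lc(1) G1(1) G1l] by metis
  note pg = homog_poly_on_lines[OF g(1)]
  have g2: "\<beta> v * g v - c * G2 v = 0" for v
  proof (rule cancel_L[of "\<lambda>v. \<beta> v * g v - c * G2 v"])
    show "poly_on_lines (\<lambda>v. \<beta> v * g v - c * G2 v)" by (intro poly_on_lines_diff poly_on_lines_mult pG pc pg poly_on_lines_const)
    show "L v * (\<beta> v * g v - c * G2 v) = 0" for v using e1[of v] by (simp add: g(2) \<alpha>c algebra_simps)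
  qed
  have g3: "\<gamma> v * g v - c * G3 v = 0" for v
  proof (rule cancel_L[of "\<lambda>v. \<gamma> v * g v - c * G3 v"])
    show "poly_on_lines (\<lambda>v. \<gamma> v * g v - c * G3 v)" by (intro poly_on_lines_diff poly_on_lines_mult pG pc pg poly_on_lines_const)
    show "L v * (\<gamma> v * g v - c * G3 v) = 0" for v using e2[of v] by (simp add: g(2) \<alpha>c algebra_simps)
  qed
  have gnz: "g v \<noteq> 0" if "v \<noteq> 0" for v
  proof
    assume "g v = 0"
    then have "G1 v = 0" "G2 v = 0" "G3 v = 0" using g(2)[of v] g2[of v] g3[of v] cnz by auto
    then show False using nz[OF that] by simp
  qed
  from nonvanishing_constant[OF g(1) gnz] obtain k where k: "int b + int a + 1 - ?n - 1 = 0" "k \<noteq> 0" "\<And>v. g v = k" by blast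
  show ?thesis
  proof (rule exI[of _ "k / c"], intro conjI allI)
    show "k / c \<noteq> 0" using k cnz by simp
    show "int a + int b = ?n" using k(1) by simp
    show "\<exists>c. c \<noteq> 0 \<and> (\<forall>v. \<alpha> v = c * L v)" using cnz \<alpha>c by blast
    fix v
    have "G1 v = k / c * \<alpha> v" using g(2)[of v] cnz by (simp add: k(3) \<alpha>c)
    then show "det3 v (tb v) (ta v) = f v * (k / c * \<alpha> v)" using G1(2) by simp
    have "G2 v = k / c * \<beta> v" using g2[of v] cnz by (simp add: k(3) field_simps)
    then show "det3 v (ta v) (td v) = f v * (k / c * \<beta> v)" using G2(2) by simp
    have "G3 v = k / c * \<gamma> v" using g3[of v] cnz by (simp add: k(3) field_simps)
    then show "det3 v (td v) (tb v) = f v * (k / c * \<gamma> v)" using G3(2) by simp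
  qed
qed

text \<open>A field is determined modulo the Euler field by its pairings \<open>P\<close> and \<open>R\<close> with \<open>ta\<close> and \<open>tb\<close>. On \<open>l\<close>
  the relation says that \<open>(P, R)\<close> is a multiple of \<open>(\<beta>, - \<gamma>)\<close>, so a multiple of \<open>td\<close> can be
  subtracted such that \<open>L\<close> divides both pairings; what remains is a combination of \<open>tb\<close> and \<open>ta\<close>, whose
  pairing is a multiple of \<open>L\<close>.\<close>

lemma generation_mod_euler:
  assumes \<psi>: "log_field A k \<psi>"
  shows "\<exists>U V W. homog (k - int d) U \<and> homog (k - int b) V \<and> homog (k - int a) W \<and>
    (\<forall>v z. det3 v (\<psi> v) z = det3 v (U v *s td v + V v *s tb v + W v *s ta v) z)"
proof -
  let ?n = "int (card A)"
  obtain g c where g: "g \<noteq> 0" and n: "int a + int b = ?n" and c: "c \<noteq> 0" "\<And>v. \<alpha> v = c * L v"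
    and ba: "\<And>v. det3 v (tb v) (ta v) = f v * (g * \<alpha> v)" and ad: "\<And>v. det3 v (ta v) (td v) = f v * (g * \<beta> v)"
    and db: "\<And>v. det3 v (td v) (tb v) = f v * (g * \<gamma> v)" using pairings_proportional by blast
  obtain P where P: "homog (k + int a + 1 - ?n) P" "\<And>v. det3 v (\<psi> v) (ta v) = f v * P v"
    using log_pairing_ex[OF arr \<psi> logs(3)] by blast
  obtain R where R: "homog (k + int b + 1 - ?n) R" "\<And>v. det3 v (\<psi> v) (tb v) = f v * R v"
    using log_pairing_ex[OF arr \<psi> logs(2)] by blast
  obtain S where S: "homog (k + int d + 1 - ?n) S" "\<And>v. det3 v (\<psi> v) (td v) = f v * S v"
    using log_pairing_ex[OF arr \<psi> logs(1)] by blast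
  note pol = P(1)[THEN homog_poly_on_lines] R(1)[THEN homog_poly_on_lines] S(1)[THEN homog_poly_on_lines]
    coeffs[THEN homog_poly_on_lines]
  have r: "\<alpha> v * S v + \<beta> v * R v + \<gamma> v * P v = 0" for v
  proof (rule cancel_f[of "\<lambda>v. \<alpha> v * S v + \<beta> v * R v + \<gamma> v * P v"])
    show "poly_on_lines (\<lambda>v. \<alpha> v * S v + \<beta> v * R v + \<gamma> v * P v)" by (intro poly_on_lines_add poly_on_lines_mult pol)
    fix v
    have "f v * (\<alpha> v * S v + \<beta> v * R v + \<gamma> v * P v) = \<alpha> v * det3 v (\<psi> v) (td v) + \<beta> v * det3 v (\<psi> v) (tb v) + \<gamma> v * det3 v (\<psi> v) (ta v)"
      unfolding P(2) R(2) S(2) by (simp add: algebra_simps)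
    also have "\<dots> = det3 v (\<psi> v) (\<alpha> v *s td v + \<beta> v *s tb v + \<gamma> v *s ta v)" by (simp add: det3_add)
    finally show "f v * (\<alpha> v * S v + \<beta> v * R v + \<gamma> v * P v) = 0" unfolding rel by simp
  qed
  \<comment> \<open>Restricted to \<open>l\<close>, the relation \<open>r\<close> loses its first term.\<close>
  obtain u where u: "homog (k + int a + 1 - ?n - (int d + 1 - int b)) u" "\<And>v. L v = 0 \<Longrightarrow> P v = \<beta> v * u v"
    "\<And>v. L v = 0 \<Longrightarrow> R v = - \<gamma> v * u v"
  proof (rule coprime_division_on_plane[OF lc(1) coeffs(2,3) P(1) R(1)])
    show "\<beta> v \<noteq> 0 \<or> \<gamma> v \<noteq> 0" if "v \<noteq> 0" "L v = 0" for v using \<beta>\<gamma>_no_common_zero[of v] that lc(2) by blast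
    show "\<beta> v * R v + \<gamma> v * P v = 0" if "L v = 0" for v using r[of v] c(2)[of v] that by simp
  qed auto
  have eu: "k + int a + 1 - ?n - (int d + 1 - int b) = k - int d" using n by simp
  note hu = u(1)[unfolded eu]
  have "homog (k + int a + 1 - ?n) (\<lambda>v. P v - \<beta> v * u v)"
    by (intro homog_diff P(1) homog_mult'[OF coeffs(2) hu]) (use n in simp)
  then obtain V' where V': "homog (k + int a + 1 - ?n - 1) V'" "\<And>v. P v - \<beta> v * u v = L v * V' v"
    using linear_form_division[OF lc(1), of _ "\<lambda>v. P v - \<beta> v * u v"] u(2) by (metis (no_types, lifting) diff_self)
  have "homog (k + int b + 1 - ?n) (\<lambda>v. R v + \<gamma> v * u v)"
    by (intro homog_add R(1) homog_mult'[OF coeffs(3) hu]) (use n in simp)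
  then obtain W' where W': "homog (k + int b + 1 - ?n - 1) W'" "\<And>v. R v + \<gamma> v * u v = L v * W' v"
    using linear_form_division[OF lc(1), of _ "\<lambda>v. R v + \<gamma> v * u v"] u(3)
    by (metis (no_types, lifting) add.left_inverse mult_minus_left)
  \<comment> \<open>The constants come from the pairings \<open>g * \<alpha>\<close>, \<open>g * \<beta>\<close>, \<open>g * \<gamma>\<close> of the generators, with \<open>\<alpha> = c * L\<close>.\<close>
  define U where "U = (\<lambda>v. (- 1 / g) * u v)"
  define V where "V = (\<lambda>v. (1 / (g * c)) * V' v)"
  define W where "W = (\<lambda>v. (- 1 / (g * c)) * W' v)"
  have e: "k + int a + 1 - ?n - 1 = k - int b" "k + int b + 1 - ?n - 1 = k - int a" using n by simp_all
  have deg: "homog (k - int d) U" "homog (k - int b) V" "homog (k - int a) W"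
    unfolding U_def V_def W_def
    by (rule homog_cmult[OF hu], rule homog_cmult[OF V'(1)[unfolded e(1)]], rule homog_cmult[OF W'(1)[unfolded e(2)]])
  let ?x = "\<lambda>v. U v *s td v + V v *s tb v + W v *s ta v"
  have p1: "det3 v (?x v) (ta v) = f v * P v" for v
  proof -
    have "det3 v (?x v) (ta v) = - U v * det3 v (ta v) (td v) + V v * det3 v (tb v) (ta v)"
      by (simp add: det3_def algebra_simps)
    also have "\<dots> = f v * (g * (- U v * \<beta> v + V v * \<alpha> v))" unfolding ba ad by (simp add: algebra_simps)
    also have "g * (- U v * \<beta> v + V v * \<alpha> v) = \<beta> v * u v + L v * V' v"
      using g c(1) by (simp add: U_def V_def c(2) field_simps)
    also have "\<dots> = P v" using V'(2)[of v] by (simp add: algebra_simps)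
    finally show ?thesis .
  qed
  have p2: "det3 v (?x v) (tb v) = f v * R v" for v
  proof -
    have "det3 v (?x v) (tb v) = U v * det3 v (td v) (tb v) - W v * det3 v (tb v) (ta v)"
      by (simp add: det3_def algebra_simps)
    also have "\<dots> = f v * (g * (U v * \<gamma> v - W v * \<alpha> v))" unfolding ba db by (simp add: algebra_simps)
    also have "g * (U v * \<gamma> v - W v * \<alpha> v) = - (\<gamma> v * u v) + L v * W' v"
      using g c(1) by (simp add: U_def W_def c(2) field_simps)
    also have "\<dots> = R v" using W'(2)[of v] by (simp add: algebra_simps)
    finally show ?thesis .
  qed
  have "det3 v (\<psi> v) z - det3 v (?x v) z = 0" for v z
  proof (rule cancel_L[of "\<lambda>v. det3 v (\<psi> v) z - det3 v (?x v) z"])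
    have vx: "vform k ?x"
      by (intro vform_add vform_mult[OF deg(1) vf(1)] vform_mult[OF deg(2) vf(2)] vform_mult[OF deg(3) vf(3)]) simp_all
    have v\<psi>: "vform k \<psi>" using \<psi> by (simp add: log_field_def)
    show pD: "poly_on_lines (\<lambda>v. det3 v (\<psi> v) z - det3 v (?x v) z)"
      by (intro poly_on_lines_diff homog_poly_on_lines[OF homog_det3[OF vform_id v\<psi> vform_const]]
          homog_poly_on_lines[OF homog_det3[OF vform_id vx vform_const]])
    have "L v * (det3 v (\<psi> v) z - det3 v (?x v) z) = 0" for v
    proof (rule cancel_f[of "\<lambda>v. L v * (det3 v (\<psi> v) z - det3 v (?x v) z)"])
      show "poly_on_lines (\<lambda>v. L v * (det3 v (\<psi> v) z - det3 v (?x v) z))"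
        by (intro poly_on_lines_mult poly_on_lines_lin pD)
      fix v
      let ?y = "\<psi> v - ?x v"
      have y: "det3 v ?y (ta v) = 0" "det3 v ?y (tb v) = 0"
      proof -
        have "det3 v ?y (ta v) = det3 v (\<psi> v) (ta v) - det3 v (?x v) (ta v)" by (simp add: det3_def algebra_simps)
        then show "det3 v ?y (ta v) = 0" unfolding P(2) p1 by simp
        have "det3 v ?y (tb v) = det3 v (\<psi> v) (tb v) - det3 v (?x v) (tb v)" by (simp add: det3_def algebra_simps)
        then show "det3 v ?y (tb v) = 0" unfolding R(2) p2 by simp
      qed
      have "det3 v (tb v) (ta v) *s ?y = det3 ?y (tb v) (ta v) *s v"
        using det3_cramer[of v "tb v" "ta v" ?y] y det3_swap(1)[of v ?y "tb v"] by simp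
      from arg_cong[OF this, of "\<lambda>y. det3 v y z"]
      have "det3 v (tb v) (ta v) * det3 v ?y z = 0" by (simp only: det3_scale det3_repeat mult_zero_right)
      then have "f v * (g * (c * L v)) * det3 v ?y z = 0" unfolding ba c(2) .
      moreover have "det3 v ?y z = det3 v (\<psi> v) z - det3 v (?x v) z" by (simp add: det3_def algebra_simps)
      ultimately show "f v * (L v * (det3 v (\<psi> v) z - det3 v (?x v) z)) = 0" using g c(1) by simp
    qed
    then show "L v * (det3 v (\<psi> v) z - det3 v (?x v) z) = 0" for v .
  qed
  then have "\<forall>v z. det3 v (\<psi> v) z = det3 v (?x v) z" by simp
  then show ?thesis using deg by blast
qed

text \<open>Express both fields by the generators. The minors of the coefficient matrix that involve \<open>td\<close> are
  homogeneous of negative degree and vanish, because \<open>d\<close> is larger than \<open>a\<close> and \<open>b\<close>. So the pairing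
  is the remaining minor times the pairing of \<open>tb\<close> and \<open>ta\<close>, a multiple of \<open>L * f\<close>. For \<open>e = 1\<close> that
  minor is a nonzero constant; then \<open>td\<close> does not occur, and the coefficient matrix can be inverted.\<close>

lemma small_pairing:
  assumes \<psi>: "log_field A k1 \<psi>1" "log_field A k2 \<psi>2" and M: "homog e M" "e \<le> 1" "M w \<noteq> 0"
    and det: "\<And>v. det3 v (\<psi>1 v) (\<psi>2 v) = f v * M v"
  shows "e = 1 \<and> (\<exists>t. t \<noteq> 0 \<and> (\<forall>v. M v = t * L v)) \<and>
    (\<exists>t X Y. t \<noteq> 0 \<and> (\<forall>v z. t * det3 v (tb v) z = X v * det3 v (\<psi>1 v) z + Y v * det3 v (\<psi>2 v) z)) \<and>
    (\<exists>t X Y. t \<noteq> 0 \<and> (\<forall>v z. t * det3 v (ta v) z = X v * det3 v (\<psi>1 v) z + Y v * det3 v (\<psi>2 v) z))"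
proof -
  let ?n = "int (card A)"
  obtain g c where g: "g \<noteq> 0" and n: "int a + int b = ?n" and c: "c \<noteq> 0" "\<And>v. \<alpha> v = c * L v"
    and ba: "\<And>v. det3 v (tb v) (ta v) = f v * (g * \<alpha> v)" and ad: "\<And>v. det3 v (ta v) (td v) = f v * (g * \<beta> v)"
    and db: "\<And>v. det3 v (td v) (tb v) = f v * (g * \<gamma> v)" using pairings_proportional by blast
  obtain w0 where w0: "f w0 \<noteq> 0" using defining_poly_nonzero[OF arr] by blast
  obtain w1 where w1: "f w1 * M w1 \<noteq> 0"
    by (rule poly_on_lines_product_nonzero[OF homog_poly_on_lines[OF homog_defining_poly[of A]] homog_poly_on_lines[OF M(1)] w0 M(3)])
  have e: "k1 + k2 + 1 = ?n + e"
  proof (rule homog_degree_unique)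
    show "homog (k1 + k2 + 1) (\<lambda>v. det3 v (\<psi>1 v) (\<psi>2 v))"
      using homog_det3[OF vform_id, of k1 \<psi>1 k2 \<psi>2] \<psi> by (simp add: log_field_def algebra_simps)
    show "homog (?n + e) (\<lambda>v. det3 v (\<psi>1 v) (\<psi>2 v))"
      unfolding det by (rule homog_mult[OF homog_defining_poly M(1)])
    show "det3 w1 (\<psi>1 w1) (\<psi>2 w1) \<noteq> 0" unfolding det by (rule w1)
  qed
  obtain U1 V1 W1 where 1: "homog (k1 - int d) U1" "homog (k1 - int b) V1" "homog (k1 - int a) W1"
    "\<And>v z. det3 v (\<psi>1 v) z = det3 v (U1 v *s td v + V1 v *s tb v + W1 v *s ta v) z"
    using generation_mod_euler[OF \<psi>(1)] by blast
  obtain U2 V2 W2 where 2: "homog (k2 - int d) U2" "homog (k2 - int b) V2" "homog (k2 - int a) W2"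
    "\<And>v z. det3 v (\<psi>2 v) z = det3 v (U2 v *s td v + V2 v *s tb v + W2 v *s ta v) z"
    using generation_mod_euler[OF \<psi>(2)] by blast
  \<comment> \<open>The minor of the coefficients of \<open>tb\<close> and \<open>ta\<close>; the other two minors vanish for reasons of degree.\<close>
  define T where "T v = V1 v * W2 v - W1 v * V2 v" for v
  have T: "homog (e - 1) T" unfolding T_def
    by (intro homog_diff homog_mult'[OF 1(2) 2(3)] homog_mult'[OF 1(3) 2(2)]) (use e n in auto)
  have "homog (e - 1 + int b - int d) (\<lambda>v. W1 v * U2 v - U1 v * W2 v)"
    by (intro homog_diff homog_mult'[OF 1(3) 2(1)] homog_mult'[OF 1(1) 2(3)]) (use e n in auto)
  from homog_cases(2)[OF this] have K1: "W1 v * U2 v - U1 v * W2 v = 0" for v using M(2) bd by (simp add: fun_eq_iff)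
  have "homog (e - 1 + int a - int d) (\<lambda>v. U1 v * V2 v - V1 v * U2 v)"
    by (intro homog_diff homog_mult'[OF 1(1) 2(2)] homog_mult'[OF 1(2) 2(1)]) (use e n in auto)
  from homog_cases(2)[OF this] have K2: "U1 v * V2 v - V1 v * U2 v = 0" for v using M(2) ab bd by (simp add: fun_eq_iff)
  have MT: "M v - T v * (g * \<alpha> v) = 0" for v
  proof (rule cancel_f[of "\<lambda>v. M v - T v * (g * \<alpha> v)"])
    show "poly_on_lines (\<lambda>v. M v - T v * (g * \<alpha> v))"
      by (intro poly_on_lines_diff poly_on_lines_mult poly_on_lines_const homog_poly_on_lines[OF M(1)]
          homog_poly_on_lines[OF T] homog_poly_on_lines[OF coeffs(1)])
    fix v
    let ?x1 = "U1 v *s td v + V1 v *s tb v + W1 v *s ta v" and ?x2 = "U2 v *s td v + V2 v *s tb v + W2 v *s ta v"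
    have "f v * M v = det3 v ?x1 (\<psi>2 v)" by (simp only: det[symmetric] 1(4))
    also have "\<dots> = - det3 v (\<psi>2 v) ?x1" by (rule det3_swap(1))
    also have "\<dots> = - det3 v ?x2 ?x1" by (simp only: 2(4))
    also have "\<dots> = det3 v ?x1 ?x2" by (rule det3_swap(1)[symmetric])
    also have "\<dots> = f v * (T v * (g * \<alpha> v))" unfolding det3_expand K1 K2 ba T_def by simp
    finally show "f v * (M v - T v * (g * \<alpha> v)) = 0" by (simp add: algebra_simps)
  qed
  have e1: "e = 1"
  proof (rule ccontr)
    assume "e \<noteq> 1"
    then have "T = (\<lambda>v. 0)" using homog_cases(2)[OF T] M(2) by simp
    then show False using MT[of w] M(3) by simp
  qed
  have Tc: "T v = T 0" for v using homog_0_const[of T v] T e1 by simp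
  have T0: "T 0 \<noteq> 0" using MT[of w] M(3) Tc[of w] by auto
  have U1: "U1 v = 0" for v
  proof -
    have "T v * U1 v = V1 v * (U1 v * W2 v - W1 v * U2 v) - W1 v * (U1 v * V2 v - V1 v * U2 v)"
      by (simp add: T_def algebra_simps)
    also have "\<dots> = 0" using K1[of v] K2[of v] by simp
    finally show ?thesis using T0 Tc[of v] by simp
  qed
  have U2: "U2 v = 0" for v
  proof -
    have "T v * U2 v = V2 v * (U1 v * W2 v - W1 v * U2 v) - W2 v * (U1 v * V2 v - V1 v * U2 v)"
      by (simp add: T_def algebra_simps)
    also have "\<dots> = 0" using K1[of v] K2[of v] by simp
    finally show ?thesis using T0 Tc[of v] by simp
  qed
  have x1: "det3 v (\<psi>1 v) z = V1 v * det3 v (tb v) z + W1 v * det3 v (ta v) z" for v z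
    unfolding 1(4) by (simp add: U1 det3_add)
  have x2: "det3 v (\<psi>2 v) z = V2 v * det3 v (tb v) z + W2 v * det3 v (ta v) z" for v z
    unfolding 2(4) by (simp add: U2 det3_add)
  have "\<exists>t. t \<noteq> 0 \<and> (\<forall>v. M v = t * L v)"
  proof (intro exI[of _ "T 0 * g * c"] conjI allI)
    show "T 0 * g * c \<noteq> 0" using T0 g c(1) by simp
    show "M v = T 0 * g * c * L v" for v using MT[of v] Tc[of v] by (simp add: c(2))
  qed
  moreover have comb: "T 0 * det3 v (tb v) z = W2 v * det3 v (\<psi>1 v) z + (- W1 v) * det3 v (\<psi>2 v) z"
    "T 0 * det3 v (ta v) z = (- V2 v) * det3 v (\<psi>1 v) z + V1 v * det3 v (\<psi>2 v) z" for v z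
    unfolding x1 x2 Tc[of v, symmetric] by (simp_all add: T_def algebra_simps)
  moreover have "\<exists>t X Y. t \<noteq> 0 \<and> (\<forall>v z. t * det3 v (tb v) z = X v * det3 v (\<psi>1 v) z + Y v * det3 v (\<psi>2 v) z)"
    by (rule exI[of _ "T 0"], rule exI[of _ W2], rule exI[of _ "\<lambda>v. - W1 v"]) (intro conjI allI T0 comb(1))
  moreover have "\<exists>t X Y. t \<noteq> 0 \<and> (\<forall>v z. t * det3 v (ta v) z = X v * det3 v (\<psi>1 v) z + Y v * det3 v (\<psi>2 v) z)"
    by (rule exI[of _ "T 0"], rule exI[of _ "\<lambda>v. - V2 v"], rule exI[of _ V1]) (intro conjI allI T0 comb(2))
  ultimately show ?thesis using e1 by (intro conjI)
qed

end

section \<open>Freeness in terms of logarithmic fields\<close>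

lemma log_field_mod_euler_ex:
  "arrangement A \<Longrightarrow> A \<noteq> {} \<Longrightarrow> log_field A k \<theta> \<Longrightarrow>
    \<exists>\<mu>. homog (k - 1) \<mu> \<and> (\<forall>v. grad_pairing A v (\<theta> v + \<mu> v *s v) = 0)"
  by (erule (2) log_field_mod_euler) blast

lemma log_fields_independent_at_ex:
  "arrangement A \<Longrightarrow> p \<noteq> 0 \<Longrightarrow> \<exists>k l m \<delta> \<epsilon> G. log_field A k \<delta> \<and> log_field A l \<epsilon> \<and> homog m G \<and>
    (\<forall>v. det3 v (\<delta> v) (\<epsilon> v) = defining_poly A v * G v) \<and> G p \<noteq> 0"
  by (erule (1) log_fields_independent_at) blast

text \<open>The converse of Saito's criterion. Near every point there are logarithmic fields whose pairing, divided
  by \<open>f\<close>, does not vanish; they are combinations of the generators, so the pairing of the generators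
  does not vanish either.\<close>

lemma free_imp_log_pairing:
  assumes A: "arrangement A" and ne: "A \<noteq> {}" and free: "free_arrangement A"
  shows "\<exists>k1 k2 \<psi>1 \<psi>2 c. log_field A k1 \<psi>1 \<and> log_field A k2 \<psi>2 \<and> c \<noteq> 0 \<and>
    (\<forall>v. det3 v (\<psi>1 v) (\<psi>2 v) = c * defining_poly A v)"
proof -
  let ?f = "defining_poly A"
  obtain a b where "free_with_exponents A a b" using free by (auto simp: free_arrangement_def)
  from free_generators[OF A this] obtain \<theta> :: "2 \<Rightarrow> vec3 \<Rightarrow> vec3"
    where \<theta>: "vform (int a) (\<theta> 1)" "vform (int b) (\<theta> 2)" "\<And>j v. grad_pairing A v (\<theta> j v) = 0"
      and gen: "generates A \<theta> (vector [- int a, - int b])" by blast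
  have log: "log_field A (int a) (\<theta> 1)" "log_field A (int b) (\<theta> 2)"
    using grad_kernel_log_field[OF A \<theta>(1) \<theta>(3)] grad_kernel_log_field[OF A \<theta>(2) \<theta>(3)] by auto
  obtain G where G: "homog (int a + int b + 1 - int (card A)) G" "\<And>v. det3 v (\<theta> 1 v) (\<theta> 2 v) = ?f v * G v"
    using log_pairing_ex[OF A log] by blast
  have span: "\<exists>Q u w. poly_on_lines Q \<and> poly_on_lines u \<and> poly_on_lines w \<and> Q p \<noteq> 0 \<and>
      (\<forall>v z. Q v * det3 v (\<delta> v) z = u v * det3 v (\<theta> 1 v) z + w v * det3 v (\<theta> 2 v) z)"
    if \<delta>: "log_field A k \<delta>" and p: "p \<noteq> 0" for k \<delta> p
  proof -
    obtain \<mu> where \<mu>: "homog (k - 1) \<mu>" "\<And>v. grad_pairing A v (\<delta> v + \<mu> v *s v) = 0"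
      using log_field_mod_euler_ex[OF A ne \<delta>] by blast
    have vf: "vform k (\<lambda>v. \<delta> v + \<mu> v *s v)"
      using \<delta> by (intro vform_add vform_mult[OF \<mu>(1) vform_id]) (auto simp: log_field_def)
    obtain m Q u where Q: "homog m Q" "Q p \<noteq> 0" "\<And>j. homog (m + k + vector [- int a, - int b] $ j) (u j)"
      "\<And>v. Q v *s (\<delta> v + \<mu> v *s v) = (\<Sum>j\<in>UNIV. u j v *s \<theta> j v)"
      using gen[unfolded generates_def, rule_format, OF vf \<mu>(2) p] by blast
    have "Q v * det3 v (\<delta> v) z = u 1 v * det3 v (\<theta> 1 v) z + u 2 v * det3 v (\<theta> 2 v) z" for v z
      using arg_cong[OF Q(4)[of v], of "\<lambda>y. det3 v y z"] by (simp add: sum_2 det3_add)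
    moreover have "poly_on_lines Q" "poly_on_lines (u 1)" "poly_on_lines (u 2)"
      using Q(1,3) homog_poly_on_lines by blast+
    ultimately have "poly_on_lines Q \<and> poly_on_lines (u 1) \<and> poly_on_lines (u 2) \<and> Q p \<noteq> 0 \<and>
      (\<forall>v z. Q v * det3 v (\<delta> v) z = u 1 v * det3 v (\<theta> 1 v) z + u 2 v * det3 v (\<theta> 2 v) z)"
      using Q(2) by simp
    then show ?thesis by (rule_tac exI[of _ Q], rule_tac exI[of _ "u 1"], rule_tac exI[of _ "u 2"])
  qed
  have "G p \<noteq> 0" if p: "p \<noteq> 0" for p
  proof
    assume Gp: "G p = 0"
    obtain k l m \<delta> \<epsilon> D where d: "log_field A k \<delta>" "log_field A l \<epsilon>" "homog m D"
      "\<And>v. det3 v (\<delta> v) (\<epsilon> v) = ?f v * D v" "D p \<noteq> 0"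
      using log_fields_independent_at_ex[OF A p] by blast
    obtain Q u w where 1: "poly_on_lines Q" "poly_on_lines u" "poly_on_lines w" "Q p \<noteq> 0"
      "\<And>v z. Q v * det3 v (\<delta> v) z = u v * det3 v (\<theta> 1 v) z + w v * det3 v (\<theta> 2 v) z"
      using span[OF d(1) p] by blast
    obtain Q' u' w' where 2: "poly_on_lines Q'" "poly_on_lines u'" "poly_on_lines w'" "Q' p \<noteq> 0"
      "\<And>v z. Q' v * det3 v (\<epsilon> v) z = u' v * det3 v (\<theta> 1 v) z + w' v * det3 v (\<theta> 2 v) z"
      using span[OF d(2) p] by blast
    have "Q v * Q' v * D v - (u v * w' v - w v * u' v) * G v = 0" for v
    proof (rule poly_on_lines_cancel[OF A, of "\<lambda>v. Q v * Q' v * D v - (u v * w' v - w v * u' v) * G v"])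
      show "poly_on_lines (\<lambda>v. Q v * Q' v * D v - (u v * w' v - w v * u' v) * G v)"
        by (intro poly_on_lines_diff poly_on_lines_mult 1 2 homog_poly_on_lines[OF d(3)] homog_poly_on_lines[OF G(1)])
      fix v
      have "det3 v (\<theta> 1 v) (\<epsilon> v) * Q' v = w' v * (?f v * G v)"
        using 2(5)[of v "\<theta> 1 v"] det3_swap(1)[of v "\<theta> 1 v" "\<epsilon> v"] G(2)[of v]
          det3_swap(1)[of v "\<theta> 2 v" "\<theta> 1 v"] by (simp add: algebra_simps)
      moreover have "det3 v (\<theta> 2 v) (\<epsilon> v) * Q' v = - u' v * (?f v * G v)"
        using 2(5)[of v "\<theta> 2 v"] det3_swap(1)[of v "\<theta> 2 v" "\<epsilon> v"] G(2)[of v] by (simp add: algebra_simps)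
      moreover have "Q v * (?f v * D v) * Q' v =
          u v * (det3 v (\<theta> 1 v) (\<epsilon> v) * Q' v) + w v * (det3 v (\<theta> 2 v) (\<epsilon> v) * Q' v)"
        unfolding d(4)[symmetric] 1(5) by (simp add: algebra_simps)
      ultimately show "?f v * (Q v * Q' v * D v - (u v * w' v - w v * u' v) * G v) = 0"
        by (simp add: algebra_simps)
    qed
    from this[of p] show False using Gp d(5) 1(4) 2(4) by simp
  qed
  from nonvanishing_constant[OF G(1) this] obtain c where c: "c \<noteq> 0" "\<And>v. G v = c" by blast
  have "det3 v (\<theta> 1 v) (\<theta> 2 v) = c * ?f v" for v using G(2)[of v] c(2)[of v] by (simp add: mult.commute)
  with log c(1) have "log_field A (int a) (\<theta> 1) \<and> log_field A (int b) (\<theta> 2) \<and> c \<noteq> 0 \<and>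
    (\<forall>v. det3 v (\<theta> 1 v) (\<theta> 2 v) = c * ?f v)" by blast
  then show ?thesis by (rule_tac exI, rule_tac exI, rule_tac exI, rule_tac exI, rule_tac exI)
qed

text \<open>Subtracting multiples of the Euler field makes the gradient kill both fields and does not change their
  pairing.\<close>

lemma free_if_log_pairing:
  assumes A: "arrangement A" and ne: "A \<noteq> {}" and \<psi>: "log_field A k1 \<psi>1" "log_field A k2 \<psi>2"
    and c: "c \<noteq> 0" and det: "\<And>v. det3 v (\<psi>1 v) (\<psi>2 v) = c * defining_poly A v"
  shows "free_arrangement A"
proof -
  obtain \<mu>1 where \<mu>1: "homog (k1 - 1) \<mu>1" "\<And>v. grad_pairing A v (\<psi>1 v + \<mu>1 v *s v) = 0"
    using log_field_mod_euler_ex[OF A ne \<psi>(1)] by blast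
  obtain \<mu>2 where \<mu>2: "homog (k2 - 1) \<mu>2" "\<And>v. grad_pairing A v (\<psi>2 v + \<mu>2 v *s v) = 0"
    using log_field_mod_euler_ex[OF A ne \<psi>(2)] by blast
  obtain w where w: "defining_poly A w \<noteq> 0" using defining_poly_nonzero[OF A] by blast
  have nonneg: "k \<ge> 0" if "log_field A k \<psi>" "\<psi> w \<noteq> 0" for k \<psi>
  proof (rule ccontr)
    assume "\<not> k \<ge> 0"
    then have "(\<lambda>v. \<psi> v $ i) = (\<lambda>v. 0)" for i
      using that(1) homog_cases(2)[of k "\<lambda>v. \<psi> v $ i"] by (simp add: log_field_def vform_def)
    then have "\<psi> w $ i = 0" for i by (rule fun_cong)
    then show False using that(2) by (simp add: Finite_Cartesian_Product.vec_eq_iff)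
  qed
  have "det3 w (\<psi>1 w) (\<psi>2 w) \<noteq> 0" unfolding det using c w by simp
  then have "\<psi>1 w \<noteq> 0" "\<psi>2 w \<noteq> 0" by auto
  then have k: "int (nat k1) = k1" "int (nat k2) = k2" using nonneg[OF \<psi>(1)] nonneg[OF \<psi>(2)] by simp_all
  have "free_with_exponents A (nat k1) (nat k2)"
  proof (rule free_if_pairing_constant[OF A _ _ \<mu>1(2) \<mu>2(2) c])
    show "vform (int (nat k1)) (\<lambda>v. \<psi>1 v + \<mu>1 v *s v)" "vform (int (nat k2)) (\<lambda>v. \<psi>2 v + \<mu>2 v *s v)"
      unfolding k using \<psi> by (auto simp: log_field_def intro!: vform_add vform_mult[OF \<mu>1(1) vform_id] vform_mult[OF \<mu>2(1) vform_id])
    show "det3 v (\<psi>1 v + \<mu>1 v *s v) (\<psi>2 v + \<mu>2 v *s v) = c * defining_poly A v" for v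
      unfolding det3_mod_euler by (rule det)
  qed
  then show ?thesis by (auto simp: free_arrangement_def)
qed

section \<open>The points of an arrangement on a line\<close>

lemma sum_order_le_degree_subset:
  fixes P :: "complex poly"
  assumes "P \<noteq> 0" "finite T"
  shows "(\<Sum>t\<in>T. order t P) \<le> degree P"
proof -
  have "(\<Sum>t\<in>T. order t P) = (\<Sum>t | t \<in> T \<and> poly P t = 0. order t P)"
    using assms by (intro sum.mono_neutral_right) (auto simp: order_root)
  also have "\<dots> \<le> (\<Sum>t | poly P t = 0. order t P)"
    using assms by (intro sum_mono2) (auto simp: poly_roots_finite)
  finally show ?thesis using sum_order_le_degree[OF assms(1)] by linarith
qed

lemma sum_order_eq_degree:
  fixes P :: "complex poly"
  assumes "P \<noteq> 0" "finite T" "\<And>t. poly P t = 0 \<Longrightarrow> t \<in> T"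
  shows "(\<Sum>t\<in>T. order t P) = degree P"
proof -
  have "degree P = (\<Sum>t\<in>set_mset (proots P). count (proots P) t)"
    by (simp add: size_proots_complex[symmetric] size_multiset_overloaded_eq)
  also have "\<dots> = (\<Sum>t | poly P t = 0. order t P)" using assms(1) by (simp add: count_proots)
  also have "\<dots> = (\<Sum>t\<in>T. order t P)"
    using assms by (intro sum.mono_neutral_left) (auto simp: order_root)
  finally show ?thesis by simp
qed

lemma order_prod_linear:
  assumes "finite C"
  shows "order t (\<Prod>H\<in>C. [:- g H, 1:] :: complex poly) = card {H\<in>C. g H = t}"
proof -
  have "proots (pCons (- z) 1) = {#z#}" for z :: complex
    using proots_linear_factor[of "- z"] by simp
  then have "proots (\<Prod>H\<in>C. [:- g H, 1:] :: complex poly) = (\<Sum>H\<in>C. {# g H #})" by (subst proots_prod) simp_all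
  then have "count (proots (\<Prod>H\<in>C. [:- g H, 1:])) t = (\<Sum>H\<in>C. if g H = t then 1 else (0 :: nat))"
    by (auto simp: count_sum intro!: sum.cong)
  also have "\<dots> = card {H\<in>C. g H = t}" using assms by (simp add: sum.If_cases Int_def)
  finally have "count (proots (\<Prod>H\<in>C. [:- g H, 1:])) t = card {H\<in>C. g H = t}" .
  moreover have "(\<Prod>H\<in>C. [:- g H, 1:]) \<noteq> 0" using assms by simp
  ultimately show ?thesis by (simp add: count_proots)
qed

lemma tangent_if_pairing_zero:
  assumes \<alpha>: "\<alpha> \<noteq> 0" and v: "lin \<alpha> v = 0" "v \<noteq> 0" and z: "\<And>z. lin \<alpha> z = 0 \<Longrightarrow> det3 v u z = 0"
  shows "lin \<alpha> u = 0"
proof -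
  obtain \<nu> p q x y where f: "frame \<alpha> \<nu> p q x y" using frame_exists_some[OF \<alpha>] by blast
  have *: "lin \<alpha> u * (lin x v * lin y z - lin y v * lin x z) * det3 \<nu> p q = 0" if "lin \<alpha> z = 0" for z
    using frame_det3_plane[OF f v(1) that, of u] z[OF that] det3_swap(2)[of u v z] by simp
  have D: "det3 \<nu> p q \<noteq> 0" by (rule frame_det3[OF f])
  have "lin x v \<noteq> 0 \<or> lin y v \<noteq> 0"
  proof (rule ccontr)
    assume "\<not> ?thesis"
    then show False using frame_plane[OF f v(1)] v(2) by simp
  qed
  then show ?thesis using *[of q] *[of p] D f by (auto simp: frame_def)
qed

text \<open>The line \<open>l\<close> with an affine coordinate whose point at infinity \<open>q\<close> lies on no line of \<open>B\<close>, so that all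
  points in which \<open>l\<close> meets \<open>B\<close> have a finite parameter.\<close>

locale line_trace =
  fixes B :: "vec3 set set" and l :: "vec3 set" and \<nu> p q x y :: vec3
  assumes arrB: "arrangement B" and is_l: "is_line l" and frame: "frame (line_coeffs l) \<nu> p q x y"
    and q_off: "defining_poly B q \<noteq> 0"
begin

definition "parameter H = - lin (line_coeffs H) p / lin (line_coeffs H) q"

text \<open>The restriction of the equation of \<open>C\<close> to \<open>l\<close>, up to a nonzero factor.\<close>

definition "local_poly C = (\<Prod>H\<in>C. [:- parameter H, 1:])"

lemma finB: "finite B" using arrB by (simp add: arrangement_def)

lemma mem_l: "v \<in> l \<longleftrightarrow> lin (line_coeffs l) v = 0" using line_coeffs_props[OF is_l] by auto

lemma mem: "H \<in> B \<Longrightarrow> v \<in> H \<longleftrightarrow> lin (line_coeffs H) v = 0"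
  using line_coeffs_props[OF arrangementD(2)[OF arrB]] by blast

lemma point_in_l: "p + s *s q \<in> l" "q \<in> l" "p \<in> l"
  using frame_line[OF frame] frame by (auto simp: mem_l frame_def)

lemma lin_q: "H \<in> B \<Longrightarrow> lin (line_coeffs H) q \<noteq> 0"
  using q_off finB by (auto simp: defining_poly_lin)

lemma lin_on_l: 
  assumes "H \<in> B" "v \<in> l"
  shows "lin (line_coeffs H) v = lin (line_coeffs H) q * (lin y v - parameter H * lin x v)"
proof -
  have "v = lin x v *s p + lin y v *s q" using frame_plane[OF frame] assms(2) mem_l by blast
  from arg_cong[OF this, of "lin (line_coeffs H)"]
  have "lin (line_coeffs H) v = lin x v * lin (line_coeffs H) p + lin y v * lin (line_coeffs H) q"
    unfolding lin_simps .
  moreover have "lin (line_coeffs H) q * parameter H = - lin (line_coeffs H) p"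
    using lin_q[OF assms(1)] by (simp add: parameter_def)
  ultimately show ?thesis by (simp add: right_diff_distrib mult.assoc[symmetric])
qed

lemma coords_point: "lin x (p + s *s q) = 1" "lin y (p + s *s q) = s" "lin x q = 0" "lin y q = 1"
  using frame by (auto simp: frame_def lin_simps)

lemma mem_point: "H \<in> B \<Longrightarrow> p + s *s q \<in> H \<longleftrightarrow> parameter H = s"
  using lin_on_l[OF _ point_in_l(1), of H s] lin_q[of H] mem[of H] by (auto simp: coords_point)

lemma card_points: "card ((\<lambda>H. H \<inter> l) ` B) = card (parameter ` B)"
proof -
  define g where "g t = {v \<in> l. lin y v = t * lin x v}" for t
  have "H \<inter> l = g (parameter H)" if "H \<in> B" for H
    using lin_on_l[OF that] mem[OF that] lin_q[OF that] by (auto simp: g_def)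
  then have "(\<lambda>H. H \<inter> l) ` B = g ` (parameter ` B)" by (auto simp: image_image)
  moreover have "inj g"
  proof (rule injI)
    fix s t assume "g s = g t"
    moreover have "p + s *s q \<in> g s" using point_in_l coords_point by (simp add: g_def)
    ultimately have "p + s *s q \<in> g t" by simp
    then show "s = t" using coords_point by (simp add: g_def)
  qed
  ultimately show ?thesis by (simp add: card_image inj_on_subset)
qed

lemma defining_poly_on_l:
  assumes "C \<subseteq> B"
  shows "defining_poly C (p + s *s q) = defining_poly C q * poly (local_poly C) s"
    and "defining_poly C q \<noteq> 0" and "local_poly C \<noteq> 0"
proof -
  have fin: "finite C" using assms finB finite_subset by blast
  have "defining_poly C (p + s *s q) = (\<Prod>H\<in>C. lin (line_coeffs H) q * (s - parameter H))"
    unfolding defining_poly_lin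
    by (rule prod.cong) (use assms lin_on_l[OF _ point_in_l(1)] in \<open>auto simp: coords_point\<close>)
  then show "defining_poly C (p + s *s q) = defining_poly C q * poly (local_poly C) s"
    by (simp add: prod.distrib defining_poly_lin local_poly_def poly_prod)
  show "defining_poly C q \<noteq> 0" using fin assms lin_q by (auto simp: defining_poly_lin)
  show "local_poly C \<noteq> 0" using fin by (simp add: local_poly_def)
qed

lemma order_local_poly: "C \<subseteq> B \<Longrightarrow> order t (local_poly C) = card {H\<in>C. parameter H = t}"
  unfolding local_poly_def using finB finite_subset by (intro order_prod_linear) blast

lemma sum_multiplicities: "(\<Sum>t\<in>parameter ` B. card {H\<in>B. parameter H = t}) = card B"
  using sum.image_gen[OF finB, of "\<lambda>_. 1 :: nat" parameter] by simp

lemma sum_multiplicities_minus_one: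
  "(\<Sum>t\<in>parameter ` B. card {H\<in>B. parameter H = t} - 1) + card (parameter ` B) = card B"
proof -
  have "card {H\<in>B. parameter H = t} \<ge> 1" if "t \<in> parameter ` B" for t
    using that finB by (auto simp: Suc_le_eq card_gt_0_iff)
  then have "card {H\<in>B. parameter H = t} - 1 + 1 = card {H\<in>B. parameter H = t}" if "t \<in> parameter ` B" for t
    using le_add_diff_inverse2 that by blast
  then have "(\<Sum>t\<in>parameter ` B. card {H\<in>B. parameter H = t} - 1 + 1) = card B"
    unfolding sum_multiplicities[symmetric] by (rule sum.cong[OF refl])
  then show ?thesis by (simp add: sum.distrib del: One_nat_def)
qed

lemma points_proportional:
  assumes "v \<in> l" "w \<in> l" "H \<in> B" "v \<in> H" "w \<in> H"
  shows "det3 u v w = 0"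
proof -
  have "lin y v = parameter H * lin x v" "lin y w = parameter H * lin x w"
    using lin_on_l[OF assms(3,1)] lin_on_l[OF assms(3,2)] mem[OF assms(3)] assms(4,5) lin_q[OF assms(3)] by auto
  then show ?thesis using frame_det3_plane[OF frame, of v w u] assms(1,2) mem_l by simp
qed

text \<open>Let \<open>p\<^sub>t\<close> be the point with parameter \<open>t\<close>. The determinant of \<open>p\<^sub>t\<close>, \<open>z\<close> and \<open>\<theta> z\<close> vanishes when
  \<open>z\<close> is on one of the \<open>m\<close> lines through \<open>p\<^sub>t\<close>, so their equations divide it. On \<open>l\<close> it equals the
  normal component of \<open>\<theta>\<close> up to one factor vanishing at \<open>p\<^sub>t\<close>, which leaves order \<open>m - 1\<close>.\<close>

lemma order_normal_component:
  assumes \<theta>: "log_field B k \<theta>" and P: "\<And>s. lin (line_coeffs l) (\<theta> (p + s *s q)) = poly P s" "P \<noteq> 0"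
  shows "card {H\<in>B. parameter H = t} - 1 \<le> order t P"
proof -
  let ?C = "{H\<in>B. parameter H = t}" and ?pt = "p + t *s q"
  have C: "?C \<subseteq> B" "arrangement ?C" using arrB by (auto simp: arrangement_def)
  have h: "homog (0 + 1 + k) (\<lambda>z. det3 ?pt z (\<theta> z))"
    using \<theta> by (intro homog_det3 vform_const vform_id) (simp add: log_field_def)
  have van: "det3 ?pt z (\<theta> z) = 0" if "H \<in> ?C" "z \<in> H" for H z
  proof (rule det3_plane_zero)
    have H: "H \<in> B" using that by simp
    show "line_coeffs H \<noteq> 0" by (rule line_coeffs_props[OF arrangementD(2)[OF arrB H]])
    show "lin (line_coeffs H) ?pt = 0" "lin (line_coeffs H) z = 0" "lin (line_coeffs H) (\<theta> z) = 0"
      using that mem_point[OF H, of t] \<theta> by (auto simp: mem[OF H, symmetric] log_field_def)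
  qed
  have "\<exists>G. homog (0 + 1 + k - int (card ?C)) G \<and> (\<forall>z. det3 ?pt z (\<theta> z) = defining_poly ?C z * G z)"
    by (rule defining_poly_dvd[OF C(2) h van]) blast+
  then obtain G where G: "homog (0 + 1 + k - int (card ?C)) G" "\<And>z. det3 ?pt z (\<theta> z) = defining_poly ?C z * G z" by blast
  obtain g where g: "\<And>s. G (p + s *s q) = poly g s"
    using homog_poly_on_lines[OF G(1)] unfolding poly_on_lines_def by blast
  let ?D = "det3 \<nu> p q" and ?e = "defining_poly ?C q"
  have D: "?D \<noteq> 0" by (rule frame_det3[OF frame])
  have eq: "Polynomial.smult ?D ([:- t, 1:] * P) = Polynomial.smult ?e (local_poly ?C * g)"
  proof (rule poly_eqI_all)
    fix s
    let ?z = "p + s *s q"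
    have "det3 ?pt ?z (\<theta> ?z) = det3 (\<theta> ?z) ?pt ?z" by (simp add: det3_def algebra_simps)
    also have "\<dots> = poly P s * (s - t) * ?D"
      using frame_det3_plane[OF frame, of ?pt ?z "\<theta> ?z"] point_in_l(1) mem_l by (simp add: coords_point P(1))
    finally have "poly P s * (s - t) * ?D = ?e * poly (local_poly ?C) s * poly g s"
      unfolding G(2) defining_poly_on_l(1)[OF C(1)] g by simp
    then show "poly (Polynomial.smult ?D ([:- t, 1:] * P)) s = poly (Polynomial.smult ?e (local_poly ?C * g)) s"
      by (simp add: algebra_simps)
  qed
  have nz: "[:- t, 1:] * P \<noteq> 0" using P(2) by (simp del: mult_pCons_left)
  have e: "?e \<noteq> 0" by (rule defining_poly_on_l(2)[OF C(1)])
  have nz': "local_poly ?C * g \<noteq> 0" 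
  proof
    assume "local_poly ?C * g = 0"
    with eq have "Polynomial.smult ?D ([:- t, 1:] * P) = 0" by (simp only: smult_0_right)
    with nz D show False by (simp only: smult_eq_0_iff simp_thms)
  qed
  have "order t ([:- t, 1:] * P) = order t (local_poly ?C * g)"
    using arg_cong[OF eq, of "order t"] unfolding Polynomial.order_smult[OF D] Polynomial.order_smult[OF e] .
  then have "1 + order t P = order t (local_poly ?C) + order t g"
    unfolding order_mult[OF nz] order_mult[OF nz'] using order_power_n_n[of t 1] by simp
  moreover have "order t (local_poly ?C) = card ?C" unfolding order_local_poly[OF C(1)] by simp
  ultimately show ?thesis by linarith
qed

text \<open>The orders \<open>m - 1\<close> at the points of \<open>B\<close> on \<open>l\<close> add up to the number of lines minus the number of
  points.\<close>

lemma tangent_if_low_degree: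
  assumes \<theta>: "log_field B k \<theta>" and k: "k + int (card (parameter ` B)) < int (card B)" and v: "v \<in> l"
  shows "lin (line_coeffs l) (\<theta> v) = 0"
proof -
  let ?F = "\<lambda>v. lin (line_coeffs l) (\<theta> v)"
  have F: "homog k ?F" using \<theta> by (intro homog_lin_vform) (simp add: log_field_def)
  obtain P where P: "\<And>s. ?F (p + s *s q) = poly P s" "k \<ge> 0 \<Longrightarrow> degree P \<le> nat k" "k < 0 \<Longrightarrow> P = 0"
    using homog_line_poly_int[OF F, of p q] by blast
  have "P = 0"
  proof (rule ccontr)
    assume nz: "P \<noteq> 0"
    have "(\<Sum>t\<in>parameter ` B. card {H\<in>B. parameter H = t} - 1) \<le> (\<Sum>t\<in>parameter ` B. order t P)"
      by (intro sum_mono order_normal_component[OF \<theta> P(1) nz])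
    also have "\<dots> \<le> degree P" using finB by (intro sum_order_le_degree_subset[OF nz]) simp
    finally show False using sum_multiplicities_minus_one P(2,3) nz k by linarith
  qed
  then have "?F (p + s *s q) = 0" for s using P(1) by simp
  from homog_zero_on_plane[OF frame F this] v show ?thesis by (simp add: mem_l)
qed

text \<open>At a point of \<open>l\<close> on another line, a field tangent to both lines is radial. The determinant of \<open>\<theta>\<close> and
  the Euler field along \<open>l\<close> thus has more zeros than its degree, \<open>\<theta>\<close> is radial on all of \<open>l\<close>, and \<open>L\<close>
  divides its difference with a multiple of the Euler field. The quotient is still tangent to the other
  lines.\<close>

lemma radial_if_low_degree:
  assumes \<theta>: "log_field (insert l B) k \<theta>" and k: "k + 1 < int (card (parameter ` B))" and lB: "l \<notin> B"
  shows "\<exists>\<mu> \<theta>'. log_field B (k - 1) \<theta>' \<and> (\<forall>v. \<theta> v = \<mu> v *s v + lin (line_coeffs l) v *s \<theta>' v)"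
proof -
  let ?L = "lin (line_coeffs l)"
  have vf: "vform k \<theta>" and tan: "\<And>v. v \<in> l \<Longrightarrow> \<theta> v \<in> l" "\<And>v H. H \<in> B \<Longrightarrow> v \<in> H \<Longrightarrow> \<theta> v \<in> H"
    using \<theta> by (auto simp: log_field_def)
  let ?F = "\<lambda>v. det3 \<nu> v (\<theta> v)"
  have F: "homog (0 + 1 + k) ?F" by (intro homog_det3 vform_const vform_id vf)
  obtain P where P: "\<And>s. ?F (p + s *s q) = poly P s" "0 + 1 + k \<ge> 0 \<Longrightarrow> degree P \<le> nat (0 + 1 + k)" "0 + 1 + k < 0 \<Longrightarrow> P = 0"
    using homog_line_poly_int[OF F, of p q] by blast
  have roots: "poly P t = 0" if "t \<in> parameter ` B" for t
  proof -
    from that obtain H where H: "H \<in> B" "parameter H = t" by blast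
    then have "p + t *s q \<in> H" using mem_point by blast
    from points_proportional[OF point_in_l(1) tan(1)[OF point_in_l(1)] H(1) this tan(2)[OF H(1) this]]
    show ?thesis using P(1) by metis
  qed
  have "P = 0"
  proof (rule ccontr)
    assume nz: "P \<noteq> 0"
    have "card (parameter ` B) \<le> card {t. poly P t = 0}"
      using roots poly_roots_finite[OF nz] by (intro card_mono) auto
    also have "\<dots> \<le> degree P" by (rule card_poly_roots_bound[OF nz])
    finally show False using P(2,3) nz k by linarith
  qed
  then have z: "?F (p + s *s q) = 0" for s using P(1) by simp
  have \<alpha>: "line_coeffs l \<noteq> 0" by (rule line_coeffs_props[OF is_l])
  have rel: "lin x v * lin y (\<theta> v) + - lin y v * lin x (\<theta> v) = 0" if v: "?L v = 0" for v
  proof -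
    have "?L (\<theta> v) = 0" using tan(1)[of v] v mem_l by blast
    from frame_det3_plane[OF frame v this, of \<nu>] homog_zero_on_plane[OF frame F z v]
    show ?thesis using frame_det3[OF frame] frame by (simp add: frame_def)
  qed
  have "\<exists>u. homog (k - 1) u \<and> (\<forall>v. ?L v = 0 \<longrightarrow> lin x (\<theta> v) = lin x v * u v) \<and>
      (\<forall>v. ?L v = 0 \<longrightarrow> lin y (\<theta> v) = - (- lin y v) * u v)"
  proof (rule coprime_division_on_plane[OF \<alpha> homog_lin homog_minus[OF homog_lin] homog_lin_vform[OF vf] homog_lin_vform[OF vf] _ _ rel])
    show "lin x v \<noteq> 0 \<or> - lin y v \<noteq> 0" if "v \<noteq> 0" "?L v = 0" for v
    proof (rule ccontr)
      assume "\<not> ?thesis"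
      then show False using frame_plane[OF frame that(2)] that(1) by simp
    qed
  qed (auto 0 3)
  then obtain u where u: "homog (k - 1) u" "\<And>v. ?L v = 0 \<Longrightarrow> lin x (\<theta> v) = lin x v * u v"
    "\<And>v. ?L v = 0 \<Longrightarrow> lin y (\<theta> v) = lin y v * u v" by auto
  have rad: "\<theta> v = u v *s v" if v: "?L v = 0" for v
  proof -
    have "?L (\<theta> v) = 0" using tan(1)[of v] v mem_l by blast
    from frame_plane[OF frame this] have "\<theta> v = u v *s (lin x v *s p + lin y v *s q)"
      by (simp add: u(2,3)[OF v] vector_add_ldistrib vector_smult_assoc mult.commute)
    then show ?thesis using frame_plane[OF frame v] by simp
  qed
  have "\<exists>g. homog (k - 1) g \<and> (\<forall>v. (\<theta> v - u v *s v) $ i = ?L v * g v)" for i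
  proof -
    have "homog k (\<lambda>v. (\<theta> v - u v *s v) $ i)"
      using vform_diff[OF vf vform_mult[OF u(1) vform_id]] by (simp add: vform_def)
    then show ?thesis by (rule linear_form_division[OF \<alpha>]) (use rad in auto)
  qed
  then have "\<forall>i. \<exists>g. homog (k - 1) g \<and> (\<forall>v. (\<theta> v - u v *s v) $ i = ?L v * g v)" by blast
  from choice[OF this] obtain g where g: "\<And>i. homog (k - 1) (g i)" "\<And>i v. (\<theta> v - u v *s v) $ i = ?L v * g i v" by blast
  define \<theta>' where "\<theta>' v = (\<chi> i. g i v)" for v
  have v': "vform (k - 1) \<theta>'" using g(1) by (simp add: vform_def \<theta>'_def)
  have d: "\<theta> v - u v *s v = ?L v *s \<theta>' v" for v
    using g(2) by (simp add: Finite_Cartesian_Product.vec_eq_iff \<theta>'_def)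
  have "\<theta>' v \<in> H" if H: "H \<in> B" and v: "v \<in> H" for H v
  proof -
    note lH = arrangementD(2)[OF arrB H]
    have "lin (line_coeffs H) (\<theta>' v) = 0"
    proof (rule zero_on_line_cancel[of "{l}" H "\<lambda>v. lin (line_coeffs H) (\<theta>' v)" v])
      show "finite {l}" "is_line H" "v \<in> H" using lH v by simp_all
      show "is_line K" if "K \<in> {l}" for K using that is_l by simp
      show "H \<notin> {l}" using H lB by blast
      show "poly_on_lines (\<lambda>v. lin (line_coeffs H) (\<theta>' v))" by (rule homog_poly_on_lines[OF homog_lin_vform[OF v']])
      fix w assume w: "w \<in> H"
      have "\<theta> w - u w *s w \<in> H" using line_closed(3)[OF lH tan(2)[OF H w] line_closed(4)[OF lH w w]] .
      then have "?L w *s \<theta>' w \<in> H" by (simp only: d)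
      then have "lin (line_coeffs H) (?L w *s \<theta>' w) = 0" by (simp only: mem[OF H])
      then have "?L w * lin (line_coeffs H) (\<theta>' w) = 0" unfolding lin_scale .
      then show "defining_poly {l} w * lin (line_coeffs H) (\<theta>' w) = 0" unfolding defining_poly_lin by simp
    qed
    then show ?thesis using mem[OF H] by blast
  qed
  then have "log_field B (k - 1) \<theta>'" using v' by (simp add: log_field_def)
  moreover have "\<theta> v = u v *s v + ?L v *s \<theta>' v" for v using d[of v] by (simp add: algebra_simps)
  ultimately show ?thesis by blast
qed

end

section \<open>Adding and deleting a line\<close>

lemma line_trace_exists:
  assumes B: "arrangement B" and l: "is_line l" "l \<notin> B"
  shows "\<exists>\<nu> p q x y. line_trace B l \<nu> p q x y"
proof -
  note lc = line_coeffs_props[OF l(1)]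
  obtain v where v: "v \<in> l" "defining_poly B v \<noteq> 0"
    using defining_poly_nonzero_on_line[OF arrangementD(1)[OF B] arrangementD(2)[OF B] l] by blast
  obtain q where q: "q \<noteq> 0" "lin (line_coeffs l) q = 0" "defining_poly B q \<noteq> 0"
    using nonvanishing_direction[OF homog_defining_poly lc(1) _ v(2)] v(1) lc(2) by blast
  obtain \<nu> p x y where "frame (line_coeffs l) \<nu> p q x y" by (rule frame_exists[OF lc(1) q(2,1)])
  then have "line_trace B l \<nu> p q x y" using B l(1) q(3) by (unfold_locales)
  then show ?thesis by blast
qed

text \<open>Used for the combinations provided by \<open>small_pairing\<close>.\<close>

lemma multiple_zero:
  fixes D E F :: "'a \<Rightarrow> 'b \<Rightarrow> complex"
  assumes "\<exists>t X Y. t \<noteq> 0 \<and> (\<forall>v z. t * D v z = X v * E v z + Y v * F v z)" "E v z = 0" "F v z = 0"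
  shows "D v z = 0"
proof -
  obtain t X Y where t: "t \<noteq> 0" "\<And>v z. t * D v z = X v * E v z + Y v * F v z" using assms(1) by blast
  show ?thesis using t(2)[of v z] t(1) assms(2,3) by simp
qed

lemma points_on_image: "points_on A l = (\<lambda>H. H \<inter> l) ` (A - {l})"
  by (auto simp: points_on_def)

context plus_one_data
begin

lemma finA: "finite A" using arr by (simp add: arrangement_def)

text \<open>Generators of the larger arrangement are logarithmic fields of \<open>A\<close> whose pairing is \<open>f\<close> times the
  equation of \<open>H\<close>, and they are tangent to \<open>H\<close>.\<close>

lemma adding_line:
  assumes H: "is_line H" "H \<notin> A" and free: "free_arrangement (insert H A)"
  shows "H = l" and "v \<in> l \<Longrightarrow> v \<noteq> 0 \<Longrightarrow> L (ta v) = 0 \<and> L (tb v) = 0"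
proof -
  have A': "arrangement (insert H A)" using arr H(1) by (simp add: arrangement_def)
  obtain k1 k2 \<psi>1 \<psi>2 c where \<psi>: "log_field (insert H A) k1 \<psi>1" "log_field (insert H A) k2 \<psi>2" and c: "c \<noteq> 0"
    and det: "\<And>v. det3 v (\<psi>1 v) (\<psi>2 v) = c * defining_poly (insert H A) v"
    using free_imp_log_pairing[OF A' _ free] by blast
  have log: "log_field A k1 \<psi>1" "log_field A k2 \<psi>2" using \<psi> by (auto simp: log_field_def)
  let ?M = "\<lambda>v. c * lin (line_coeffs H) v"
  obtain w where w: "lin (line_coeffs H) w \<noteq> 0"
    using line_form_nonzero[OF H(1)] by blast
  have detM: "det3 v (\<psi>1 v) (\<psi>2 v) = f v * ?M v" for v
    unfolding det defining_poly_insert[OF finA H(2)] by (simp add: algebra_simps)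
  have "?M w \<noteq> 0" using w c by simp
  from small_pairing[OF log homog_cmult[OF homog_lin] _ this detM]
  obtain t where t: "t \<noteq> 0" "\<And>v. ?M v = t * L v"
    and tb: "\<exists>t X Y. t \<noteq> 0 \<and> (\<forall>v z. t * det3 v (tb v) z = X v * det3 v (\<psi>1 v) z + Y v * det3 v (\<psi>2 v) z)"
    and ta: "\<exists>t X Y. t \<noteq> 0 \<and> (\<forall>v z. t * det3 v (ta v) z = X v * det3 v (\<psi>1 v) z + Y v * det3 v (\<psi>2 v) z)"
    by auto
  have "lin (line_coeffs H) w = 0 \<longleftrightarrow> L w = 0" for w using t(2)[of w] t(1) c by (metis mult_eq_0_iff)
  then have "w \<in> H \<longleftrightarrow> w \<in> l" for w using line_coeffs_props(2)[OF H(1), of w] lc(2)[of w] by simp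
  then show Hl: "H = l" by blast
  assume v: "v \<in> l" "v \<noteq> 0"
  have z: "det3 v (\<psi>1 v) z = 0" "det3 v (\<psi>2 v) z = 0" if "L z = 0" for z
    using det3_plane_zero[OF lc(1), of v _ z] \<psi> v(1) that Hl lc(2) by (auto simp: log_field_def)
  have "L (ta v) = 0"
  proof (rule tangent_if_pairing_zero[OF lc(1) _ v(2)])
    show "det3 v (ta v) z = 0" if "L z = 0" for z by (rule multiple_zero[OF ta z[OF that]])
  qed (use v lc in blast)
  moreover have "L (tb v) = 0"
  proof (rule tangent_if_pairing_zero[OF lc(1) _ v(2)])
    show "det3 v (tb v) z = 0" if "L z = 0" for z by (rule multiple_zero[OF tb z[OF that]])
  qed (use v lc in blast)
  ultimately show "L (ta v) = 0 \<and> L (tb v) = 0" ..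
qed

text \<open>For a single line two constant fields along it have a pairing that is a constant multiple of \<open>f\<close>, which
  \<open>small_pairing\<close> excludes.\<close>

lemma two_lines: "H \<in> A \<Longrightarrow> A - {H} \<noteq> {}"
proof
  assume H: "H \<in> A" and "A - {H} = {}"
  then have A: "A = {H}" by blast
  note lcH = line_coeffs_props[OF arrangementD(2)[OF arr H]]
  obtain \<nu> p q x y where fr: "frame (line_coeffs H) \<nu> p q x y" using frame_exists_some[OF lcH(1)] by blast
  have log: "log_field A 0 (\<lambda>v. p)" "log_field A 0 (\<lambda>v. q)"
    using fr lcH(2) vform_const by (auto simp: log_field_def A frame_def)
  have "det3 v p q = f v * det3 \<nu> p q" for v
    using frame_det3_plane[OF fr, of p q v] fr by (simp add: A defining_poly_lin frame_def)
  from small_pairing[OF log homog_const _ frame_det3[OF fr] this] show False by simp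
qed

text \<open>Generators of the smaller arrangement multiplied by the equation of \<open>H\<close> are logarithmic fields of \<open>A\<close>
  that vanish on \<open>H\<close>, and their pairing is again \<open>f\<close> times that equation.\<close>

lemma deleting_line:
  assumes H: "H \<in> A" and free: "free_arrangement (A - {H})"
  shows "H = l" and "v \<in> l \<Longrightarrow> det3 v (ta v) z = 0 \<and> det3 v (tb v) z = 0"
proof -
  have A': "arrangement (A - {H})" using arr by (simp add: arrangement_def)
  note H_line = arrangementD(2)[OF arr H]
  let ?K = "lin (line_coeffs H)"
  obtain k1 k2 \<psi>1 \<psi>2 c where \<psi>: "log_field (A - {H}) k1 \<psi>1" "log_field (A - {H}) k2 \<psi>2" and c: "c \<noteq> 0"
    and det: "\<And>v. det3 v (\<psi>1 v) (\<psi>2 v) = c * defining_poly (A - {H}) v"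
    using free_imp_log_pairing[OF A' two_lines[OF H] free] by blast
  have log: "log_field A (1 + k) (\<lambda>v. ?K v *s \<psi> v)" if \<psi>: "log_field (A - {H}) k \<psi>" for k \<psi>
    unfolding log_field_def
  proof (intro conjI ballI)
    show "vform (1 + k) (\<lambda>v. ?K v *s \<psi> v)"
      using \<psi> by (intro vform_mult[OF homog_lin]) (simp_all add: log_field_def)
    fix K v assume K: "K \<in> A" and v: "v \<in> K"
    note kc = line_coeffs_props(2)[OF arrangementD(2)[OF arr K]]
    show "?K v *s \<psi> v \<in> K"
    proof (cases "K = H")
      case True
      then show ?thesis using v kc by (simp add: lin_simps)
    next
      case False
      then have "\<psi> v \<in> K" using \<psi> K v by (simp add: log_field_def)
      then show ?thesis using kc by (simp add: lin_simps)
    qed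
  qed
  let ?M = "\<lambda>v. c * ?K v"
  obtain w where w: "?K w \<noteq> 0"
    using line_form_nonzero[OF H_line] by blast
  have detM: "det3 v (?K v *s \<psi>1 v) (?K v *s \<psi>2 v) = f v * ?M v" for v
    unfolding det3_scale det defining_poly_remove[OF finA H, of v] by (simp add: algebra_simps)
  have "?M w \<noteq> 0" using w c by simp
  from small_pairing[OF log[OF \<psi>(1)] log[OF \<psi>(2)] homog_cmult[OF homog_lin] _ this detM]
  obtain t where t: "t \<noteq> 0" "\<And>v. ?M v = t * L v"
    and tb: "\<exists>t X Y. t \<noteq> 0 \<and> (\<forall>v z. t * det3 v (tb v) z = X v * det3 v (?K v *s \<psi>1 v) z + Y v * det3 v (?K v *s \<psi>2 v) z)"
    and ta: "\<exists>t X Y. t \<noteq> 0 \<and> (\<forall>v z. t * det3 v (ta v) z = X v * det3 v (?K v *s \<psi>1 v) z + Y v * det3 v (?K v *s \<psi>2 v) z)"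
    by auto
  have "lin (line_coeffs H) w = 0 \<longleftrightarrow> L w = 0" for w using t(2)[of w] t(1) c by (metis mult_eq_0_iff)
  then have "w \<in> H \<longleftrightarrow> w \<in> l" for w using line_coeffs_props(2)[OF H_line, of w] lc(2)[of w] by simp
  then show Hl: "H = l" by blast
  assume "v \<in> l"
  then have "?K v = 0" using Hl lc(2) by simp
  then show "det3 v (ta v) z = 0 \<and> det3 v (tb v) z = 0"
    by (intro conjI multiple_zero[OF ta] multiple_zero[OF tb]) simp_all
qed

text \<open>Both \<open>ta\<close> and \<open>tb\<close> have degree less than \<open>d\<close> and are therefore tangent to \<open>l\<close>.\<close>

lemma added_line_free:
  assumes l: "l \<notin> A" and level: "int d = int (card A) - int (card (points_on A l))"
  shows "free_arrangement (insert l A)"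
proof -
  obtain \<nu> p q x y where "line_trace A l \<nu> p q x y" using line_trace_exists[OF arr line l] by blast
  then interpret line_trace A l \<nu> p q x y .
  have h: "int d + int (card (parameter ` A)) = int (card A)"
    using level l card_points by (simp add: points_on_image)
  have tan: "log_field (insert l A) k \<theta>" if \<theta>: "log_field A k \<theta>" and k: "k < int d" for k \<theta>
    using \<theta> tangent_if_low_degree[OF \<theta>] k h lc(2) by (auto simp: log_field_def)
  have A': "arrangement (insert l A)" using arr line by (simp add: arrangement_def)
  obtain g c where g: "g \<noteq> 0" and c: "c \<noteq> 0" "\<And>v. \<alpha> v = c * L v"
    and ba: "\<And>v. det3 v (tb v) (ta v) = f v * (g * \<alpha> v)" using pairings_proportional by blast
  show ?thesis
  proof (rule free_if_log_pairing[OF A'])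
    show "log_field (insert l A) (int b) tb" "log_field (insert l A) (int a) ta"
      using ab bd by (auto intro!: tan logs)
    show "g * c \<noteq> 0" using g c by simp
    show "det3 v (tb v) (ta v) = g * c * defining_poly (insert l A) v" for v
      unfolding ba c(2) defining_poly_insert[OF finA l] by (simp add: algebra_simps)
  qed simp
qed

text \<open>Both \<open>ta\<close> and \<open>tb\<close> have degree less than \<open>d\<close> and can therefore be divided by \<open>L\<close> modulo the Euler
  field.\<close>

lemma deleted_line_free:
  assumes l: "l \<in> A" and level: "d + 1 = card (points_on A l)"
  shows "free_arrangement (A - {l})"
proof -
  have B: "arrangement (A - {l})" "insert l (A - {l}) = A" "l \<notin> A - {l}" using arr l by (auto simp: arrangement_def)
  obtain \<nu> p q x y where "line_trace (A - {l}) l \<nu> p q x y" using line_trace_exists[OF B(1) line B(3)] by blast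
  then interpret line_trace "A - {l}" l \<nu> p q x y .
  have h: "card (parameter ` (A - {l})) = d + 1"
    using level card_points by (simp add: points_on_image)
  have rad: "\<exists>\<mu> \<theta>'. log_field (A - {l}) (k - 1) \<theta>' \<and> (\<forall>v. \<theta> v = \<mu> v *s v + L v *s \<theta>' v)"
    if \<theta>: "log_field A k \<theta>" and k: "k < int d" for k \<theta>
    by (rule radial_if_low_degree) (use \<theta> k h B in auto)
  obtain \<mu>b tb' where tb': "log_field (A - {l}) (int b - 1) tb'" "\<And>v. tb v = \<mu>b v *s v + L v *s tb' v"
    using rad[OF logs(2)] bd by auto
  obtain \<mu>a ta' where ta': "log_field (A - {l}) (int a - 1) ta'" "\<And>v. ta v = \<mu>a v *s v + L v *s ta' v"
    using rad[OF logs(3)] ab bd by auto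
  obtain g c where g: "g \<noteq> 0" and c: "c \<noteq> 0" "\<And>v. \<alpha> v = c * L v"
    and ba: "\<And>v. det3 v (tb v) (ta v) = f v * (g * \<alpha> v)" using pairings_proportional by blast
  let ?D = "\<lambda>v. det3 v (tb' v) (ta' v) - g * c * defining_poly (A - {l}) v"
  have pol: "poly_on_lines ?D"
    using tb'(1) ta'(1) unfolding log_field_def
    by (intro poly_on_lines_diff poly_on_lines_mult poly_on_lines_const homog_poly_on_lines[OF homog_defining_poly]
        homog_poly_on_lines[OF homog_det3[OF vform_id]]) auto
  have LL: "L v * (L v * ?D v) = 0" for v
  proof -
    have "L v * (L v * det3 v (tb' v) (ta' v)) = det3 v (L v *s tb' v + \<mu>b v *s v) (L v *s ta' v + \<mu>a v *s v)"
      unfolding det3_mod_euler by simp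
    also have "\<dots> = det3 v (tb v) (ta v)" unfolding tb'(2) ta'(2) by (simp only: add.commute)
    also have "\<dots> = L v * (L v * (g * c * defining_poly (A - {l}) v))"
      unfolding ba c(2) defining_poly_remove[OF finA l, of v] by (simp add: algebra_simps)
    finally show ?thesis by (simp add: right_diff_distrib)
  qed
  have "L v * ?D v = 0" for v
    by (rule cancel_L[of "\<lambda>v. L v * ?D v"]) (intro poly_on_lines_mult poly_on_lines_lin pol, rule LL)
  then have D: "?D v = 0" for v by (rule cancel_L[OF pol])
  show ?thesis
  proof (rule free_if_log_pairing[OF B(1) two_lines[OF l] tb'(1) ta'(1)])
    show "g * c \<noteq> 0" using g c by simp
    show "det3 v (tb' v) (ta' v) = g * c * defining_poly (A - {l}) v" for v using D[of v] by simp
  qed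
qed

text \<open>On \<open>l\<close> the normal component of every logarithmic field is a multiple of that of \<open>td\<close>. For a line \<open>H\<close> of
  \<open>A\<close> and a constant field along \<open>H\<close>, multiplied by the equations of the other lines, the normal
  component vanishes only at the points of \<open>A\<close> on \<open>l\<close>, and its order at the point on \<open>H\<close> is \<open>m - 1\<close>.
  So the component of \<open>td\<close>, of degree \<open>d\<close>, has exactly the zeros it must have, and none at infinity.\<close>

lemma level_if_tangent:
  assumes l: "l \<notin> A" and tan: "\<And>v. v \<in> l \<Longrightarrow> v \<noteq> 0 \<Longrightarrow> L (ta v) = 0 \<and> L (tb v) = 0"
  shows "int d = int (card A) - int (card (points_on A l))"
proof -
  obtain \<nu> p q x y where "line_trace A l \<nu> p q x y" using line_trace_exists[OF arr line l] by blast
  then interpret line_trace A l \<nu> p q x y .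
  have pnz: "p + s *s q \<noteq> 0" for s by (rule frame_line_nz[OF frame])
  have qnz: "q \<noteq> 0" by (rule frame_q_nz[OF frame])
  have F: "homog (int d) (\<lambda>v. L (td v))" by (rule homog_lin_vform[OF vf(1)])
  obtain P where P: "\<And>s. L (td (p + s *s q)) = poly P s" "degree P \<le> d" "coeff P d = L (td q)"
    using homog_line_poly_int[OF F, of p q] by auto
  \<comment> \<open>The normal component of the field \<open>u\<close> along \<open>H\<close>, times the other equations, is a multiple of that of \<open>td\<close>.\<close>
  have key: "\<exists>g e. e \<noteq> 0 \<and> Polynomial.smult e (local_poly (A - {H})) = g * P" and Pq: "L (td q) \<noteq> 0" if H: "H \<in> A" for H
  proof -
    have "\<not> H \<subseteq> l" using lines_eq_if_subset[OF arrangementD(2)[OF arr H] line] l H by blast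
    then obtain u where u: "u \<in> H" "L u \<noteq> 0" using lc(2) by blast
    obtain U V W where U: "homog (int (card A) - 1 - int d) U"
      and eq: "\<And>v z. det3 v (defining_poly (A - {H}) v *s u) z = det3 v (U v *s td v + V v *s tb v + W v *s ta v) z"
      using generation_mod_euler[OF log_field_translate[OF arr H u(1)]] by blast
    have Lu: "L u * defining_poly (A - {H}) v = U v * L (td v)" if v: "v \<in> l" "v \<noteq> 0" for v
    proof -
      have "L (defining_poly (A - {H}) v *s u - (U v *s td v + V v *s tb v + W v *s ta v)) = 0"
      proof (rule tangent_if_pairing_zero[OF lc(1) _ v(2)])
        show "L v = 0" using v lc by blast
        show "det3 v (defining_poly (A - {H}) v *s u - (U v *s td v + V v *s tb v + W v *s ta v)) z = 0" for z
          using eq[of v z] by (simp add: det3_def algebra_simps)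
      qed
      then show ?thesis using tan[OF v] by (simp add: lin_simps mult.commute)
    qed
    obtain g where g: "\<And>s. U (p + s *s q) = poly g s"
      using homog_poly_on_lines[OF U] unfolding poly_on_lines_def by blast
    have sub: "A - {H} \<subseteq> A" by blast
    have e: "L u * defining_poly (A - {H}) q \<noteq> 0" using u defining_poly_on_l(2)[OF sub] by simp
    then show "L (td q) \<noteq> 0" using Lu[OF point_in_l(2) qnz] by auto
    have "Polynomial.smult (L u * defining_poly (A - {H}) q) (local_poly (A - {H})) = g * P"
    proof (rule poly_eqI_all)
      fix s
      show "poly (Polynomial.smult (L u * defining_poly (A - {H}) q) (local_poly (A - {H}))) s = poly (g * P) s"
        using Lu[OF point_in_l(1) pnz, of s] unfolding defining_poly_on_l(1)[OF sub] g P(1) by (simp add: mult.assoc)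
    qed
    then show "\<exists>g e. e \<noteq> 0 \<and> Polynomial.smult e (local_poly (A - {H})) = g * P" using e by blast
  qed
  obtain H0 where H0: "H0 \<in> A" using arr_nonempty by blast
  have nz: "P \<noteq> 0" using P(3) Pq[OF H0] by auto
  have deg: "degree P = d" using P(2) le_degree[of P d] P(3) Pq[OF H0] by simp
  have upper: "order t P \<le> card {K\<in>A - {H}. parameter K = t}" if H: "H \<in> A" for H t
  proof -
    obtain g e where e: "e \<noteq> 0" "Polynomial.smult e (local_poly (A - {H})) = g * P" using key[OF H] by blast
    have sub: "A - {H} \<subseteq> A" by blast
    have "Polynomial.smult e (local_poly (A - {H})) \<noteq> 0"
      using e(1) defining_poly_on_l(3)[OF sub] by (simp only: smult_eq_0_iff simp_thms)
    then have gP: "g * P \<noteq> 0" using e(2) by (simp only: simp_thms)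
    have "order t P \<le> order t (g * P)" unfolding order_mult[OF gP] by simp
    also have "\<dots> = order t (local_poly (A - {H}))" unfolding e(2)[symmetric] by (rule Polynomial.order_smult[OF e(1)])
    finally show ?thesis unfolding order_local_poly[OF sub] .
  qed
  have roots: "t \<in> parameter ` A" if "poly P t = 0" for t
  proof (rule ccontr)
    assume t: "t \<notin> parameter ` A"
    have "{K\<in>A - {H0}. parameter K = t} = {}" using t by blast
    then have "order t P = 0" using upper[OF H0, of t] by (simp only: card.empty le_zero_eq)
    then show False using that nz by (simp add: order_root)
  qed
  have "order t P = card {H\<in>A. parameter H = t} - 1" if t: "t \<in> parameter ` A" for t
  proof -
    from t obtain H where H: "H \<in> A" "parameter H = t" by blast
    have "{K\<in>A - {H}. parameter K = t} = {K\<in>A. parameter K = t} - {H}" by blast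
    then have "order t P \<le> card ({K\<in>A. parameter K = t} - {H})" using upper[OF H(1), of t] by simp
    also have "\<dots> = card {K\<in>A. parameter K = t} - 1" using H by (intro card_Diff_singleton) simp
    finally show ?thesis using order_normal_component[OF logs(1) P(1) nz, of t] by simp
  qed
  then have "(\<Sum>t\<in>parameter ` A. card {H\<in>A. parameter H = t} - 1) = (\<Sum>t\<in>parameter ` A. order t P)" by simp
  also have "\<dots> = d" using sum_order_eq_degree[OF nz _ roots] finA deg by simp
  finally have "d + card (parameter ` A) = card A" using sum_multiplicities_minus_one by simp
  then show ?thesis using card_points l by (simp add: points_on_image)
qed

text \<open>On \<open>l\<close> the determinant of a logarithmic field with the Euler field is a multiple of that of \<open>td\<close>, a form
  of degree \<open>d + 1\<close>. The constant fields \<open>p\<close> and \<open>q\<close> along \<open>l\<close>, multiplied by the equations of the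
  other lines, show that the determinant of \<open>td\<close> vanishes neither at infinity nor off the points of
  \<open>A\<close> on \<open>l\<close>; the constant field given by one of these points, multiplied by the equations of the
  lines not through it, shows that the zero there is simple.\<close>

lemma level_if_radial:
  assumes l: "l \<in> A" and rad: "\<And>v z. v \<in> l \<Longrightarrow> det3 v (ta v) z = 0 \<and> det3 v (tb v) z = 0"
  shows "d + 1 = card (points_on A l)"
proof -
  have B: "arrangement (A - {l})" "insert l (A - {l}) = A" "l \<notin> A - {l}" using arr l by (auto simp: arrangement_def)
  obtain \<nu> p q x y where "line_trace (A - {l}) l \<nu> p q x y" using line_trace_exists[OF B(1) line B(3)] by blast
  then interpret line_trace "A - {l}" l \<nu> p q x y .
  let ?T = "parameter ` (A - {l})" and ?D = "det3 \<nu> p q"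
  have D: "?D \<noteq> 0" by (rule frame_det3[OF frame])
  have F: "homog (0 + 1 + int d) (\<lambda>v. det3 \<nu> v (td v))" by (intro homog_det3 vform_const vform_id vf)
  obtain P where P: "\<And>s. det3 \<nu> (p + s *s q) (td (p + s *s q)) = poly P s" "degree P \<le> d + 1"
    "coeff P (d + 1) = det3 \<nu> q (td q)"
    using homog_line_poly_int[OF F, of p q] by (auto simp: nat_add_distrib)
  have mult: "\<exists>U. poly_on_lines U \<and> (\<forall>v\<in>l. det3 \<nu> v (\<psi> v) = U v * det3 \<nu> v (td v))" if \<psi>: "log_field A k \<psi>" for k \<psi>
  proof -
    obtain U V W where U: "homog (k - int d) U"
      and eq: "\<And>v z. det3 v (\<psi> v) z = det3 v (U v *s td v + V v *s tb v + W v *s ta v) z"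
      using generation_mod_euler[OF \<psi>] by blast
    have "det3 \<nu> v (\<psi> v) = U v * det3 \<nu> v (td v)" if v: "v \<in> l" for v
    proof -
      have cyc: "det3 \<nu> v w = det3 v w \<nu>" for w by (simp add: det3_def algebra_simps)
      show ?thesis unfolding cyc eq using rad[OF v] by (simp add: det3_add)
    qed
    then show ?thesis using homog_poly_on_lines[OF U] by blast
  qed
  have on_point: "det3 \<nu> (p + s *s q) (a *s p + b *s q) = (b - s * a) * ?D" for a b s
    by (simp add: det3_def algebra_simps)
  \<comment> \<open>At infinity the field \<open>p\<close> is not radial.\<close>
  have "det3 \<nu> q (td q) \<noteq> 0"
  proof -
    obtain U where "\<forall>v\<in>l. det3 \<nu> v (defining_poly (A - {l}) v *s p) = U v * det3 \<nu> v (td v)"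
      using mult[OF log_field_translate[OF arr l point_in_l(3)]] by blast
    from this[rule_format, OF point_in_l(2)]
    show ?thesis using D q_off det3_swap(1)[of \<nu> q p] by auto
  qed
  then have nz: "P \<noteq> 0" and deg: "degree P = d + 1" using P(2,3) le_degree[of P "d + 1"] by auto
  have roots: "t \<in> ?T" if t: "poly P t = 0" for t
  proof (rule ccontr)
    assume nt: "t \<notin> ?T"
    have "p + t *s q \<notin> H" if "H \<in> A - {l}" for H
      using mem_point[OF that, of t] imageI[OF that, of parameter] nt by metis
    then have off: "defining_poly (A - {l}) (p + t *s q) \<noteq> 0" by (rule defining_poly_nonzero_at[OF B(1)])
    obtain U where "\<forall>v\<in>l. det3 \<nu> v (defining_poly (A - {l}) v *s q) = U v * det3 \<nu> v (td v)"
      using mult[OF log_field_translate[OF arr l point_in_l(2)]] by blast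
    from this[rule_format, OF point_in_l(1), of t] have "defining_poly (A - {l}) (p + t *s q) * ?D = 0"
      using on_point[of t 0 1] by (simp add: P(1) t)
    then show False using off D by simp
  qed
  have "order t P = 1" if t: "t \<in> ?T" for t
  proof -
    let ?pt = "p + t *s q"
    let ?C = "{H\<in>A. ?pt \<notin> H}"
    have C: "arrangement ?C" using arr by (simp add: arrangement_def)
    have Cpt: "defining_poly ?C ?pt \<noteq> 0" by (rule defining_poly_nonzero_at[OF C]) simp
    obtain c where c: "\<And>s. defining_poly ?C (p + s *s q) = poly c s"
      using homog_poly_on_lines[OF homog_defining_poly] unfolding poly_on_lines_def by blast
    obtain U where U: "poly_on_lines U" "\<forall>v\<in>l. det3 \<nu> v (defining_poly ?C v *s ?pt) = U v * det3 \<nu> v (td v)"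
      using mult[OF log_field_point[OF arr]] by blast
    obtain g where g: "\<And>s. U (p + s *s q) = poly g s" using U(1) unfolding poly_on_lines_def by blast
    have eq: "[:- t, 1:] * Polynomial.smult (- ?D) c = g * P"
    proof (rule poly_eqI_all)
      fix s
      have "det3 \<nu> (p + s *s q) ?pt = (t - s) * ?D" using on_point[of s 1 t] by simp
      then have "poly c s * ((t - s) * ?D) = poly g s * poly P s"
        using U(2)[rule_format, OF point_in_l(1), of s] unfolding det3_scale c g P(1) by simp
      then show "poly ([:- t, 1:] * Polynomial.smult (- ?D) c) s = poly (g * P) s" by (simp add: algebra_simps)
    qed
    have "\<not> 2 \<le> order t P"
    proof
      assume "2 \<le> order t P"
      then have "[:- t, 1:] ^ 2 dvd P" by (simp only: order_divides simp_thms)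
      then have "[:- t, 1:] * [:- t, 1:] dvd [:- t, 1:] * Polynomial.smult (- ?D) c"
        unfolding eq power2_eq_square by (rule dvd_mult)
      then have "[:- t, 1:] dvd Polynomial.smult (- ?D) c" by (subst (asm) dvd_times_left_cancel_iff) auto
      then have "poly (Polynomial.smult (- ?D) c) t = 0" by (simp only: poly_eq_0_iff_dvd)
      then show False using Cpt c D by simp
    qed
    moreover have "poly P t = 0"
    proof -
      from t obtain H where H: "H \<in> A - {l}" "parameter H = t" by blast
      then have pt: "?pt \<in> H" using mem_point by blast
      have "td ?pt \<in> l" "td ?pt \<in> H" using logs(1) l H pt point_in_l(1) by (auto simp: log_field_def)
      from points_proportional[OF point_in_l(1) this(1) H(1) pt this(2)] show ?thesis using P(1) by metis
    qed
    then have "order t P \<noteq> 0" using nz by (simp add: order_root)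
    ultimately show ?thesis by linarith
  qed
  then have "card ?T = (\<Sum>t\<in>?T. order t P)" by simp
  also have "\<dots> = d + 1" using sum_order_eq_degree[OF nz _ roots] finA deg by simp
  finally show ?thesis using card_points by (simp add: points_on_image)
qed

end

lemma plus_one_data_exists:
  assumes A: "arrangement A" and pog: "plus_one_generated A a b d" and bd: "d > b"
    and dl: "distinguished_line A a b d l"
  shows "\<exists>td tb ta \<alpha> \<beta> \<gamma> u2 u3. plus_one_data A a b d l td tb ta \<alpha> \<beta> \<gamma> u2 u3"
proof -
  let ?\<kappa> = "vector [- int d, - int b, - int a] :: int ^ 3"
  have \<kappa>: "?\<kappa> $ 1 = - int d" "?\<kappa> $ 2 = - int b" "?\<kappa> $ 3 = - int a" by (simp_all add: vector_3)
  have ab: "a \<le> b" using pog by (simp add: plus_one_generated_def)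
  have "\<exists>\<theta> \<rho>. (\<forall>j. vform (- ?\<kappa> $ j) (\<theta> j)) \<and> (\<forall>j v. grad_pairing A v (\<theta> j v) = 0) \<and> generates A \<theta> ?\<kappa> \<and>
    (\<forall>j. homog (?\<kappa> $ j + (1 + int d)) (\<rho> j)) \<and> (\<forall>v. (\<Sum>j\<in>UNIV. \<rho> j v *s \<theta> j v) = 0) \<and>
    relation_generated \<theta> \<rho> ?\<kappa> (int d) \<and> (\<exists>j v. \<rho> j v \<noteq> 0)"
    by (rule plus_one_generated_presentation[OF A pog]) blast
  then obtain \<theta> \<rho> where \<theta>: "\<And>j. vform (- ?\<kappa> $ j) (\<theta> j)" "\<And>j v. grad_pairing A v (\<theta> j v) = 0" "generates A \<theta> ?\<kappa>"
    and \<rho>: "\<And>j. homog (?\<kappa> $ j + (1 + int d)) (\<rho> j)" "\<And>v. (\<Sum>j\<in>UNIV. \<rho> j v *s \<theta> j v) = 0"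
    and rg: "relation_generated \<theta> \<rho> ?\<kappa> (int d)" and nz: "\<exists>j v. \<rho> j v \<noteq> 0" by blast
  have "\<exists>u2 u3. homog (int d + 1 - int a) u2 \<and> homog (int d + 1 - int b) u3 \<and>
    (\<forall>v\<in>l. \<rho> 1 v = 0) \<and> (\<forall>v\<in>l. \<rho> 2 v * u2 v + \<rho> 3 v * u3 v = 0) \<and> (\<forall>v\<in>l. v \<noteq> 0 \<longrightarrow> u2 v \<noteq> 0 \<or> u3 v \<noteq> 0)"
    by (rule distinguished_line_sections[OF A dl ab bd \<theta> \<rho>]) blast
  then obtain u2 u3 where us: "homog (int d + 1 - int a) u2" "homog (int d + 1 - int b) u3"
    "\<forall>v\<in>l. \<rho> 1 v = 0" "\<forall>v\<in>l. \<rho> 2 v * u2 v + \<rho> 3 v * u3 v = 0" "\<forall>v\<in>l. v \<noteq> 0 \<longrightarrow> u2 v \<noteq> 0 \<or> u3 v \<noteq> 0" by blast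
  have "plus_one_data A a b d l (\<theta> 1) (\<theta> 2) (\<theta> 3) (\<rho> 1) (\<rho> 2) (\<rho> 3) u2 u3"
  proof
    show "arrangement A" "a \<le> b" "b < d" by fact+
    show "is_line l" using dl by (simp add: distinguished_line_def)
    show "vform (int d) (\<theta> 1)" "vform (int b) (\<theta> 2)" "vform (int a) (\<theta> 3)"
      using \<theta>(1)[of 1] \<theta>(1)[of 2] \<theta>(1)[of 3] by (simp_all add: \<kappa>)
    show "grad_pairing A v (\<theta> 1 v) = 0" "grad_pairing A v (\<theta> 2 v) = 0" "grad_pairing A v (\<theta> 3 v) = 0" for v
      by (rule \<theta>(2))+
    show "\<exists>Q u v w. poly_on_lines Q \<and> poly_on_lines u \<and> poly_on_lines v \<and> poly_on_lines w \<and> Q p \<noteq> 0 \<and>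
        (\<forall>x. Q x *s \<delta> x = u x *s \<theta> 1 x + v x *s \<theta> 2 x + w x *s \<theta> 3 x)"
      if \<delta>: "vform k \<delta>" "\<And>v. grad_pairing A v (\<delta> v) = 0" "p \<noteq> 0" for \<delta> k p
    proof -
      obtain m Q u where Q: "homog m Q" "Q p \<noteq> 0" "\<And>j. homog (m + k + ?\<kappa> $ j) (u j)"
        "\<And>v. Q v *s \<delta> v = (\<Sum>j\<in>UNIV. u j v *s \<theta> j v)"
        using \<theta>(3)[unfolded generates_def, rule_format, OF \<delta>] by blast
      show ?thesis
        by (rule exI[of _ Q], rule exI[of _ "u 1"], rule exI[of _ "u 2"], rule exI[of _ "u 3"])
           (use Q(2,4) homog_poly_on_lines[OF Q(1)] homog_poly_on_lines[OF Q(3)] in \<open>auto simp: sum_3\<close>)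
    qed
    show "homog 1 (\<rho> 1)" "homog (int d + 1 - int b) (\<rho> 2)" "homog (int d + 1 - int a) (\<rho> 3)"
      using \<rho>(1)[of 1] \<rho>(1)[of 2] \<rho>(1)[of 3] by (simp_all add: \<kappa> algebra_simps)
    show "\<rho> 1 v *s \<theta> 1 v + \<rho> 2 v *s \<theta> 2 v + \<rho> 3 v *s \<theta> 3 v = 0" for v using \<rho>(2)[of v] by (simp add: sum_3)
    show "\<exists>v. \<rho> 1 v \<noteq> 0 \<or> \<rho> 2 v \<noteq> 0 \<or> \<rho> 3 v \<noteq> 0" using nz by (metis exhaust_3)
    show "homog (int d + 1 - int a) u2" "homog (int d + 1 - int b) u3" by fact+
    show "\<rho> 1 v = 0" "\<rho> 2 v * u2 v + \<rho> 3 v * u3 v = 0" if "v \<in> l" for v using us that by auto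
    show "u2 v \<noteq> 0 \<or> u3 v \<noteq> 0" if "v \<in> l" "v \<noteq> 0" for v using us that by auto
    show "\<exists>Q W. poly_on_lines Q \<and> poly_on_lines W \<and> Q p \<noteq> 0 \<and>
        (\<forall>v. Q v * \<alpha>' v = W v * \<rho> 1 v \<and> Q v * \<beta>' v = W v * \<rho> 2 v \<and> Q v * \<gamma>' v = W v * \<rho> 3 v)"
      if h: "homog 0 \<alpha>'" "homog (int d - int b) \<beta>'" "homog (int d - int a) \<gamma>'"
        and r: "\<And>v. \<alpha>' v *s \<theta> 1 v + \<beta>' v *s \<theta> 2 v + \<gamma>' v *s \<theta> 3 v = 0" and p: "p \<noteq> 0" for \<alpha>' \<beta>' \<gamma>' p
    proof -
      let ?R = "\<lambda>j. if j = 1 then \<alpha>' else if j = (2 :: 3) then \<beta>' else \<gamma>'"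
      have "homog (?\<kappa> $ j + int d) (?R j)" for j using exhaust_3[of j] h by (auto simp: \<kappa> add.commute)
      moreover have "(\<Sum>j\<in>UNIV. ?R j v *s \<theta> j v) = 0" for v using r[of v] by (simp add: sum_3)
      ultimately obtain Q W where Q: "poly_on_lines Q" "poly_on_lines W" "Q p \<noteq> 0" "\<And>j v. Q v * ?R j v = W v * \<rho> j v"
        using rg[unfolded relation_generated_def, rule_format, of ?R, OF _ _ p] by blast
      have "Q v * \<alpha>' v = W v * \<rho> 1 v \<and> Q v * \<beta>' v = W v * \<rho> 2 v \<and> Q v * \<gamma>' v = W v * \<rho> 3 v" for v
        using Q(4)[of v 1] Q(4)[of v 2] Q(4)[of v 3] by simp
      then show ?thesis using Q(1,2,3) by (rule_tac exI[of _ Q], rule_tac exI[of _ W]) (intro conjI allI; blast)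
    qed
  qed
  then show ?thesis by blast
qed

theorem theorem3p5:
  fixes A :: "(complex ^ 3) set set" and l0 :: "(complex ^ 3) set" and a b d :: nat
  assumes "arrangement A"
    and "plus_one_generated A a b d"
    and "d > b"
    and "distinguished_line A a b d l0"
  shows "(l0 \<notin> A \<longrightarrow>
            (nt_free A \<longleftrightarrow> nt_free_minus A) \<and>
            (nt_free_minus A \<longleftrightarrow> int d = int (card A) - int (card (points_on A l0))) \<and>
            (int d = int (card A) - int (card (points_on A l0)) \<longleftrightarrow> free_arrangement (A \<union> {l0}))) \<and>
         (l0 \<in> A \<longrightarrow>
            (nt_free A \<longleftrightarrow> nt_free_plus A) \<and>
            (nt_free_plus A \<longleftrightarrow> d + 1 = card (points_on A l0)) \<and>
            (d + 1 = card (points_on A l0) \<longleftrightarrow> free_arrangement (A - {l0})))"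
proof -
  obtain td tb ta \<alpha> \<beta> \<gamma> u2 u3 where "plus_one_data A a b d l0 td tb ta \<alpha> \<beta> \<gamma> u2 u3"
    using plus_one_data_exists[OF assms] by blast
  then interpret plus_one_data A a b d l0 td tb ta \<alpha> \<beta> \<gamma> u2 u3 .
  have minus: "H = l0" if "is_line H" "H \<notin> A" "free_arrangement (A \<union> {H})" for H
    using adding_line(1)[of H] that by simp
  have plus: "H = l0" if "H \<in> A" "free_arrangement (A - {H})" for H by (rule deleting_line(1)[OF that])
  have minus_iff: "nt_free_minus A \<longleftrightarrow> l0 \<notin> A \<and> free_arrangement (A \<union> {l0})"
    unfolding nt_free_minus_def using minus line by blast
  have plus_iff: "nt_free_plus A \<longleftrightarrow> l0 \<in> A \<and> free_arrangement (A - {l0})"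
    unfolding nt_free_plus_def using plus by blast
  have off: "free_arrangement (A \<union> {l0}) \<longleftrightarrow> int d = int (card A) - int (card (points_on A l0))" if l: "l0 \<notin> A"
  proof
    assume "free_arrangement (A \<union> {l0})"
    then have "free_arrangement (insert l0 A)" by simp
    from adding_line(2)[OF line l this] level_if_tangent[OF l]
    show "int d = int (card A) - int (card (points_on A l0))" by blast
  next
    assume "int d = int (card A) - int (card (points_on A l0))"
    then show "free_arrangement (A \<union> {l0})" using added_line_free[OF l] by simp
  qed
  have on: "free_arrangement (A - {l0}) \<longleftrightarrow> d + 1 = card (points_on A l0)" if l: "l0 \<in> A"
    using deleting_line(2)[OF l] level_if_radial[OF l] deleted_line_free[OF l] by blast
  show ?thesis unfolding nt_free_def minus_iff plus_iff using off on by blast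
qed

end
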